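(* Let $m=n+1$ be the dimension of a homogeneous CR model $M\subset\mathbb C^n$ with nonholonomic (bracket-generating) CR structure $(D,J)$ of CR dimension $1$, with the symbol $\mathfrak m=\mathfrak g_-$ of $D$ of depth $\nu\ge3$. Then $M=M_\nu$ allows a tower of symmetry reductions to CR manifolds $(M_i,D_i,J_i)$ of CR dimension $1$, successively decreasing in depth $i$. This tower ends (at depth $3$) either with the Engel CR structure, of reduced growth $(2,1,1)$, or with the Hilbert–Cartan CR structure, of reduced growth $(2,1,2)$. Both of these reduce (by a symmetry reduction) to the CR quadric $\operatorname{Im}(u)=|z|^2$ in $\mathbb C^2$. Conversely, any such homogeneous CR model $(M,D,J)$ is obtained from the reduced one $(\bar M,\bar D,\bar J)$ by a sequence of integrable extensions.
   Context: A CR structure of CR dimension $1$ on a real manifold $M$ is a rank $2$ distribution $D\subset TM$ with $J:D\to D$, $J^2=-\mathrm{id}$; for $M\subset\mathbb C^n$ it is the induced one. The weak derived flag is $D^1=D$, $D^{k+1}=[D,D^k]$, of constant ranks $d_k$; $D$ is bracket-generating if $D^s=TM$ for some $s$; the reduced growth vector is $(r_1,r_2,\dots)$, $r_k=d_k-d_{k-1}$, $d_0=0$. The symbol of $D$ at $x$ is the graded nilpotent Lie algebra (GNLA) $\mathfrak m=\mathfrak g_{-\nu}\oplus\dots\oplus\mathfrak g_{-1}$, $\mathfrak g_{-k}=D^k_x/D^{k-1}_x$, with bracket induced by commutators of vector fields; $\nu$ is its depth. The depth of a CR structure is the depth of its symbol. Homogeneous CR model: a homogeneous polynomial model (given by weighted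 homogeneous polynomial equations in $\mathbb C^n$, with transitive local symmetries); up to local CR equivalence this is a standard model $M=\exp(\mathfrak m)$, the simply connected nilpotent Lie group of a GNLA $\mathfrak m$ generated by $\mathfrak g_{-1}$, $\dim\mathfrak g_{-1}=2$, with left-invariant $D=\mathfrak g_{-1}$ and left-invariant $J$ given by a complex structure on $\mathfrak g_{-1}$. All statements are local. Symmetry reduction: if $(\tilde M,\tilde D,\tilde J)$ is a CR manifold and $\mathfrak h$ is an Abelian Lie algebra of its infinitesimal symmetries transversal to $\tilde D^{\nu}$ (where $\tilde M$ has depth $\nu+1$ and $T\tilde M=\tilde D^\nu\oplus\mathfrak h$ pointwise), then the local leaf space $M$ of the orbits of $\mathfrak h$ carries the induced CR structure $(D,J)$; the passage $(\tilde M,\tilde D,\tilde J)\to(M,D,J)$ is called symmetry reduction. For standard models it corresponds to the projection $\tilde{\mathfrak m}\to\mathfrak m=\tilde{\mathfrak m}/\mathfrak g_{-\nu-1}$ of GNLAs, with unchanged $\mathfrak g_{-1}$ and $J$. Integrable extension (the opposite operation): from $(M,D,J)$ with symbol $\mathfrak m$ of depth $\nu$ one takes a principal bundle $\tilde M\to M$ with Abelian fibre $\exp\mathfrak g_{-\nu-1}$ and a principal connection, and lifts $(D,J)$ to $(\tilde D,\tilde J)$ on $\tilde M$ by horizontal lift, so that the symbol $\tilde{\mathfrak m}$ of $\tilde D$ is a graded central extension $0\to\mathfrak g_{-\nu-1}\to\tilde{\mathfrak m}\to\mathfrak m\to0$. Engel CR structure: the standard model on the GNLA with basis $e_1',e_1''\in\mathfrak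 g_{-1}$, $e_2\in\mathfrak g_{-2}$, $e_3\in\mathfrak g_{-3}$ and nontrivial brackets $[e_1',e_1'']=e_2$, $[e_1',e_2]=e_3$. Hilbert–Cartan CR structure: the standard model on the GNLA with basis $e_1',e_1''\in\mathfrak g_{-1}$, $e_2\in\mathfrak g_{-2}$, $e_3',e_3''\in\mathfrak g_{-3}$ and nontrivial brackets $[e_1',e_1'']=e_2$, $[e_1',e_2]=e_3'$, $[e_1'',e_2]=e_3''$. In both cases $\mathfrak g_{-1}$ carries a complex structure $J$. *)

theory Defs
  imports "HOL-Analysis.Analysis"
begin

section \<open>Smooth maps and embedded submanifolds\<close>

primrec C_k_on :: "nat \<Rightarrow> 'a::euclidean_space set \<Rightarrow> ('a \<Rightarrow> 'b::euclidean_space) \<Rightarrow> bool" where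
  "C_k_on 0 W f \<longleftrightarrow> continuous_on W f"
| "C_k_on (Suc k) W f \<longleftrightarrow>
     (\<forall>x\<in>W. f differentiable (at x)) \<and> (\<forall>v. C_k_on k W (\<lambda>x. frechet_derivative f (at x) v))"

definition smooth_on :: "'a::euclidean_space set \<Rightarrow> ('a \<Rightarrow> 'b::euclidean_space) \<Rightarrow> bool" where
  "smooth_on S f \<longleftrightarrow>
     (\<forall>p\<in>S. \<exists>W F. open W \<and> p \<in> W \<and> (\<forall>k. C_k_on k W F) \<and> (\<forall>x\<in>W \<inter> S. F x = f x))"

definition embedded_submanifold :: "nat \<Rightarrow> 'a::euclidean_space set \<Rightarrow> bool" where
  "embedded_submanifold d S \<longleftrightarrow>
     (\<forall>p\<in>S. \<exists>W W' L. \<exists>\<Phi> \<Psi> :: 'a \<Rightarrow> 'a.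
        open W \<and> p \<in> W \<and> open W' \<and> \<Phi> ` W = W' \<and> (\<forall>x\<in>W. \<Psi> (\<Phi> x) = x) \<and>
        smooth_on W \<Phi> \<and> smooth_on W' \<Psi> \<and>
        subspace L \<and> dim L = d \<and> \<Phi> ` (W \<inter> S) = W' \<inter> L)"

definition tangent_space :: "'a::euclidean_space set \<Rightarrow> 'a \<Rightarrow> 'a set" where
  "tangent_space S p =
     {v. \<exists>\<gamma> :: real \<Rightarrow> 'a. \<gamma> 0 = p \<and> (\<forall>t. \<gamma> t \<in> S) \<and> (\<gamma> has_vector_derivative v) (at 0)}"

text \<open>
  On an embedded submanifold the derivative within S is determined only on vectors tangent
  to S. Below it is applied to such vectors only.
\<close>

definition differential ::
  "'a::euclidean_space set \<Rightarrow> ('a \<Rightarrow> 'b::euclidean_space) \<Rightarrow> 'a \<Rightarrow> 'a \<Rightarrow> 'b" where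
  "differential S f x = frechet_derivative f (at x within S)"

definition lie_bracket ::
  "'a::euclidean_space set \<Rightarrow> ('a \<Rightarrow> 'a) \<Rightarrow> ('a \<Rightarrow> 'a) \<Rightarrow> 'a \<Rightarrow> 'a" where
  "lie_bracket S A B x = differential S B x (A x) - differential S A x (B x)"

abbreviation open_in :: "'a::topological_space set \<Rightarrow> 'a set \<Rightarrow> bool" where
  "open_in S U \<equiv> openin (top_of_set S) U"

definition sections ::
  "'a::euclidean_space set \<Rightarrow> ('a \<Rightarrow> 'a set) \<Rightarrow> ('a \<Rightarrow> 'a) set" where
  "sections U E = {A. smooth_on U A \<and> (\<forall>x\<in>U. A x \<in> E x)}"

definition smooth_distribution :: "'a::euclidean_space set \<Rightarrow> ('a \<Rightarrow> 'a set) \<Rightarrow> bool" where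
  "smooth_distribution S E \<longleftrightarrow>
     (\<forall>x\<in>S. subspace (E x) \<and> E x \<subseteq> tangent_space S x) \<and>
     (\<forall>x\<in>S. \<forall>v\<in>E x. \<exists>U A. open_in S U \<and> x \<in> U \<and> A \<in> sections U E \<and> A x = v)"


section \<open>CR structures\<close>

record 'a cr =
  points :: "'a set"
  distr :: "'a \<Rightarrow> 'a set"
  cplx :: "'a \<Rightarrow> 'a \<Rightarrow> 'a"

text \<open>The union with the previous step is implied by the Leibniz rule.\<close>

fun weak_flag :: "'a::euclidean_space cr \<Rightarrow> nat \<Rightarrow> 'a \<Rightarrow> 'a set" where
  "weak_flag X 0 x = {0}"
| "weak_flag X (Suc 0) x = distr X x"
| "weak_flag X (Suc (Suc k)) x =
     span (weak_flag X (Suc k) x \<union>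
       {lie_bracket (points X) A B x | A B U.
          open_in (points X) U \<and> x \<in> U \<and>
          A \<in> sections U (distr X) \<and> B \<in> sections U (weak_flag X (Suc k))})"

definition cr_manifold :: "'a::euclidean_space cr \<Rightarrow> bool" where
  "cr_manifold X \<longleftrightarrow>
     (\<exists>d. embedded_submanifold d (points X)) \<and>
     smooth_distribution (points X) (distr X) \<and>
     (\<forall>x\<in>points X. dim (distr X x) = 2) \<and>
     (\<forall>x\<in>points X. \<forall>v\<in>distr X x. cplx X x v \<in> distr X x \<and> cplx X x (cplx X x v) = - v) \<and>
     (\<forall>x\<in>points X. \<forall>v\<in>distr X x. \<forall>w\<in>distr X x. \<forall>a b.
        cplx X x (a *\<^sub>R v + b *\<^sub>R w) = a *\<^sub>R cplx X x v + b *\<^sub>R cplx X x w) \<and>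
     (\<forall>U A. open_in (points X) U \<and> A \<in> sections U (distr X) \<longrightarrow>
        smooth_on U (\<lambda>x. cplx X x (A x))) \<and>
     (\<forall>k. \<forall>x\<in>points X. \<forall>y\<in>points X. dim (weak_flag X k x) = dim (weak_flag X k y))"

definition bracket_generating :: "'a::euclidean_space cr \<Rightarrow> bool" where
  "bracket_generating X \<longleftrightarrow>
     (\<exists>s. \<forall>x\<in>points X. weak_flag X s x = tangent_space (points X) x)"

definition has_reduced_growth :: "'a::euclidean_space cr \<Rightarrow> nat list \<Rightarrow> bool" where
  "has_reduced_growth X rs \<longleftrightarrow>
     (\<forall>x\<in>points X. \<forall>k. dim (weak_flag X (Suc k) x) - dim (weak_flag X k x) =
        (if k < length rs then rs ! k else 0))"

definition induced_cr :: "(complex ^ 'n) set \<Rightarrow> (complex ^ 'n) cr" where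
  "induced_cr M =
     \<lparr>points = M,
      distr = (\<lambda>x. {v \<in> tangent_space M x. \<i> *s v \<in> tangent_space M x}),
      cplx = (\<lambda>x v. \<i> *s v)\<rparr>"

definition cr_equivalence_at ::
  "'a::euclidean_space cr \<Rightarrow> 'b::euclidean_space cr \<Rightarrow> 'a \<Rightarrow> 'b \<Rightarrow> bool" where
  "cr_equivalence_at X Y p q \<longleftrightarrow>
     (\<exists>U V f g. open_in (points X) U \<and> p \<in> U \<and> open_in (points Y) V \<and> q \<in> V \<and>
        f ` U = V \<and> (\<forall>x\<in>U. g (f x) = x) \<and> f p = q \<and> smooth_on U f \<and> smooth_on V g \<and>
        (\<forall>x\<in>U. differential (points X) f x ` distr X x = distr Y (f x)) \<and>
        (\<forall>x\<in>U. \<forall>v\<in>distr X x.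
           differential (points X) f x (cplx X x v) =
           cplx Y (f x) (differential (points X) f x v)))"

definition locally_cr_equivalent ::
  "'a::euclidean_space cr \<Rightarrow> 'b::euclidean_space cr \<Rightarrow> bool" where
  "locally_cr_equivalent X Y \<longleftrightarrow> rel_set (cr_equivalence_at X Y) (points X) (points Y)"

definition infinitesimal_symmetry ::
  "'a::euclidean_space cr \<Rightarrow> 'a set \<Rightarrow> ('a \<Rightarrow> 'a) \<Rightarrow> bool" where
  "infinitesimal_symmetry X U \<xi> \<longleftrightarrow>
     \<xi> \<in> sections U (tangent_space (points X)) \<and>
     (\<forall>U' A. open_in (points X) U' \<and> U' \<subseteq> U \<and> A \<in> sections U' (distr X) \<longrightarrow>
        (\<forall>x\<in>U'. lie_bracket (points X) \<xi> A x \<in> distr X x \<and>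
           lie_bracket (points X) \<xi> (\<lambda>y. cplx X y (A y)) x =
             cplx X x (lie_bracket (points X) \<xi> A x)))"


section \<open>Graded nilpotent Lie algebras and symbols\<close>

text \<open>
  A GNLA is given by its homogeneous components inside a Euclidean space, the component
  \<open>gr k\<close> having degree \<open>-k\<close>, and by a bilinear bracket of which only the restriction
  to \<open>gnla_carrier gr\<close> matters. Nilpotency follows from finite dimension.
\<close>

definition gnla_carrier :: "(nat \<Rightarrow> 'a::euclidean_space set) \<Rightarrow> 'a set" where
  "gnla_carrier gr = span (\<Union>k. gr k)"

definition gnla ::
  "(nat \<Rightarrow> 'a::euclidean_space set) \<Rightarrow> ('a \<Rightarrow> 'a \<Rightarrow> 'a) \<Rightarrow> bool" where
  "gnla gr br \<longleftrightarrow>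
     (\<forall>k. subspace (gr k)) \<and> gr 0 = {0} \<and>
     (\<forall>f n. (\<forall>k. f k \<in> gr k) \<and> (\<Sum>k\<le>n. f k) = 0 \<longrightarrow> (\<forall>k\<le>n. f k = 0)) \<and>
     bilinear br \<and>
     (\<forall>i j. \<forall>x\<in>gr i. \<forall>y\<in>gr j. br x y \<in> gr (i + j)) \<and>
     (\<forall>x\<in>gnla_carrier gr. br x x = 0) \<and>
     (\<forall>x\<in>gnla_carrier gr. \<forall>y\<in>gnla_carrier gr. \<forall>z\<in>gnla_carrier gr.
        br x (br y z) + br y (br z x) + br z (br x y) = 0)"

definition generated_in_degree_one ::
  "(nat \<Rightarrow> 'a::euclidean_space set) \<Rightarrow> ('a \<Rightarrow> 'a \<Rightarrow> 'a) \<Rightarrow> bool" where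
  "generated_in_degree_one gr br \<longleftrightarrow>
     (\<forall>W. subspace W \<and> gr 1 \<subseteq> W \<and> (\<forall>x\<in>W. \<forall>y\<in>W. br x y \<in> W) \<longrightarrow> gnla_carrier gr \<subseteq> W)"

definition gnla_depth :: "(nat \<Rightarrow> 'a::euclidean_space set) \<Rightarrow> nat \<Rightarrow> bool" where
  "gnla_depth gr \<nu> \<longleftrightarrow> gr \<nu> \<noteq> {0} \<and> (\<forall>k>\<nu>. gr k = {0})"

text \<open>
  The maps \<open>\<sigma> k\<close> identify the quotient of the flag at x by its previous step with \<open>gr k\<close>;
  thus the GNLA is the symbol at x, up to isomorphism.
\<close>

definition is_symbol ::
  "'a::euclidean_space cr \<Rightarrow> 'a \<Rightarrow> (nat \<Rightarrow> 'b::euclidean_space set) \<Rightarrow> ('b \<Rightarrow> 'b \<Rightarrow> 'b) \<Rightarrow> bool" where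
  "is_symbol X x gr br \<longleftrightarrow> gnla gr br \<and>
     (\<exists>\<sigma> :: nat \<Rightarrow> 'a \<Rightarrow> 'b.
        (\<forall>k. linear (\<sigma> k)) \<and>
        (\<forall>k. \<sigma> (Suc k) ` weak_flag X (Suc k) x = gr (Suc k)) \<and>
        (\<forall>k. {v \<in> weak_flag X (Suc k) x. \<sigma> (Suc k) v = 0} = weak_flag X k x) \<and>
        (\<forall>i\<ge>1. \<forall>j\<ge>1. \<forall>U A B. open_in (points X) U \<and> x \<in> U \<and>
           A \<in> sections U (weak_flag X i) \<and> B \<in> sections U (weak_flag X j) \<longrightarrow>
             lie_bracket (points X) A B x \<in> weak_flag X (i + j) x \<and>
             \<sigma> (i + j) (lie_bracket (points X) A B x) = br (\<sigma> i (A x)) (\<sigma> j (B x))))"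

definition has_depth :: "'a::euclidean_space cr \<Rightarrow> nat \<Rightarrow> bool" where
  "has_depth X \<nu> \<longleftrightarrow>
     (\<forall>x\<in>points X. \<exists>(gr :: nat \<Rightarrow> 'a set) br. is_symbol X x gr br \<and> gnla_depth gr \<nu>)"

definition graded_central_extension ::
  "nat \<Rightarrow> (nat \<Rightarrow> 'a::euclidean_space set) \<Rightarrow> ('a \<Rightarrow> 'a \<Rightarrow> 'a) \<Rightarrow>
   (nat \<Rightarrow> 'b::euclidean_space set) \<Rightarrow> ('b \<Rightarrow> 'b \<Rightarrow> 'b) \<Rightarrow> bool" where
  "graded_central_extension k gr br gr' br' \<longleftrightarrow>
     (\<exists>\<phi>. linear \<phi> \<and> (\<forall>i. \<phi> ` gr i = gr' i) \<and>
        (\<forall>x\<in>gnla_carrier gr. \<forall>y\<in>gnla_carrier gr. \<phi> (br x y) = br' (\<phi> x) (\<phi> y)) \<and>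
        {x \<in> gnla_carrier gr. \<phi> x = 0} = gr k \<and>
        (\<forall>x\<in>gr k. \<forall>y\<in>gnla_carrier gr. br x y = 0))"


section \<open>Standard models\<close>

definition left_inv_field ::
  "('a::euclidean_space \<Rightarrow> 'a \<Rightarrow> 'a) \<Rightarrow> 'a \<Rightarrow> 'a \<Rightarrow> 'a" where
  "left_inv_field mul u x = vector_derivative (\<lambda>t. mul x (t *\<^sub>R u)) (at 0)"

text \<open>
  The simply connected nilpotent Lie group of a GNLA in exponential coordinates: the manifold
  is the vector space of the Lie algebra, lines through 0 are the one-parameter subgroups, and
  the left-invariant fields realise the given bracket. This determines \<open>mul\<close> uniquely
  (Baker-Campbell-Hausdorff).
\<close>

definition exp_group ::
  "(nat \<Rightarrow> 'a::euclidean_space set) \<Rightarrow> ('a \<Rightarrow> 'a \<Rightarrow> 'a) \<Rightarrow> ('a \<Rightarrow> 'a \<Rightarrow> 'a) \<Rightarrow> bool" where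
  "exp_group gr br mul \<longleftrightarrow> (let V = gnla_carrier gr in
     (\<forall>x\<in>V. \<forall>y\<in>V. mul x y \<in> V) \<and>
     (\<forall>x\<in>V. \<forall>y\<in>V. \<forall>z\<in>V. mul (mul x y) z = mul x (mul y z)) \<and>
     (\<forall>x\<in>V. mul 0 x = x \<and> mul x 0 = x) \<and>
     (\<forall>x\<in>V. \<forall>s t. mul (s *\<^sub>R x) (t *\<^sub>R x) = (s + t) *\<^sub>R x) \<and>
     smooth_on (V \<times> V) (\<lambda>(x, y). mul x y) \<and>
     (\<forall>u\<in>V. \<forall>v\<in>V. \<forall>x\<in>V.
        lie_bracket V (left_inv_field mul u) (left_inv_field mul v) x =
          left_inv_field mul (br u v) x))"

definition complex_structure_on :: "'a::euclidean_space set \<Rightarrow> ('a \<Rightarrow> 'a) \<Rightarrow> bool" where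
  "complex_structure_on W J \<longleftrightarrow> linear J \<and> (\<forall>v\<in>W. J v \<in> W \<and> J (J v) = - v)"

definition standard_model ::
  "(nat \<Rightarrow> 'a::euclidean_space set) \<Rightarrow> ('a \<Rightarrow> 'a \<Rightarrow> 'a) \<Rightarrow> ('a \<Rightarrow> 'a) \<Rightarrow> 'a cr \<Rightarrow> bool" where
  "standard_model gr br J X \<longleftrightarrow>
     gnla gr br \<and> generated_in_degree_one gr br \<and> dim (gr 1) = 2 \<and>
     complex_structure_on (gr 1) J \<and>
     points X = gnla_carrier gr \<and>
     (\<exists>mul. exp_group gr br mul \<and>
        (\<forall>x\<in>points X. distr X x = (\<lambda>u. left_inv_field mul u x) ` gr 1) \<and>
        (\<forall>x\<in>points X. \<forall>u\<in>gr 1.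
           cplx X x (left_inv_field mul u x) = left_inv_field mul (J u) x))"

text \<open>
  Basis \<open>e\<^sub>1', e\<^sub>1'', e\<^sub>2, e\<^sub>3\<close>, respectively \<open>e\<^sub>1', e\<^sub>1'', e\<^sub>2, e\<^sub>3', e\<^sub>3''\<close>, in this order.
\<close>

definition engel_grading :: "nat \<Rightarrow> (real ^ 4) set" where
  "engel_grading k =
     (if k = 1 then span {axis 1 1, axis 2 1}
      else if k = 2 then span {axis 3 1}
      else if k = 3 then span {axis 4 1} else {0})"

definition engel_bracket :: "real ^ 4 \<Rightarrow> real ^ 4 \<Rightarrow> real ^ 4" where
  "engel_bracket x y =
     (x $ 1 * y $ 2 - x $ 2 * y $ 1) *\<^sub>R axis 3 1 +
     (x $ 1 * y $ 3 - x $ 3 * y $ 1) *\<^sub>R axis 4 1"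

definition engel_cr :: "(real ^ 4) cr \<Rightarrow> bool" where
  "engel_cr X \<longleftrightarrow> (\<exists>J. standard_model engel_grading engel_bracket J X)"

definition hilbert_cartan_grading :: "nat \<Rightarrow> (real ^ 5) set" where
  "hilbert_cartan_grading k =
     (if k = 1 then span {axis 1 1, axis 2 1}
      else if k = 2 then span {axis 3 1}
      else if k = 3 then span {axis 4 1, axis 5 1} else {0})"

definition hilbert_cartan_bracket :: "real ^ 5 \<Rightarrow> real ^ 5 \<Rightarrow> real ^ 5" where
  "hilbert_cartan_bracket x y =
     (x $ 1 * y $ 2 - x $ 2 * y $ 1) *\<^sub>R axis 3 1 +
     (x $ 1 * y $ 3 - x $ 3 * y $ 1) *\<^sub>R axis 4 1 +
     (x $ 2 * y $ 3 - x $ 3 * y $ 2) *\<^sub>R axis 5 1"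

definition hilbert_cartan_cr :: "(real ^ 5) cr \<Rightarrow> bool" where
  "hilbert_cartan_cr X \<longleftrightarrow>
     (\<exists>J. standard_model hilbert_cartan_grading hilbert_cartan_bracket J X)"

text \<open>The coordinates \<open>(z, u)\<close> are the components 1 and 2.\<close>

definition cr_quadric :: "(complex ^ 2) cr" where
  "cr_quadric = induced_cr {p. Im (p $ 2) = (cmod (p $ 1))\<^sup>2}"


section \<open>Homogeneous CR models\<close>

definition weighted_homogeneous ::
  "('n::finite \<Rightarrow> nat) \<Rightarrow> nat \<Rightarrow> (complex ^ 'n \<Rightarrow> real) \<Rightarrow> bool" where
  "weighted_homogeneous w k \<rho> \<longleftrightarrow>
     (\<forall>(t::real) x. \<rho> (\<chi> j. of_real (t ^ w j) * x $ j) = t ^ k * \<rho> x)"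

definition homogeneous_cr_model ::
  "(complex ^ 'n::finite) set \<Rightarrow> (nat \<Rightarrow> 'a::euclidean_space set) \<Rightarrow> ('a \<Rightarrow> 'a \<Rightarrow> 'a) \<Rightarrow>
   ('a \<Rightarrow> 'a) \<Rightarrow> bool" where
  "homogeneous_cr_model M gr br J \<longleftrightarrow>
     (\<exists>w R. (\<forall>j. w j > 0) \<and> finite R \<and>
        (\<forall>\<rho>\<in>R. real_polynomial_function \<rho> \<and> (\<exists>k>0. weighted_homogeneous w k \<rho>)) \<and>
        M = {x. \<forall>\<rho>\<in>R. \<rho> x = 0}) \<and>
     (\<forall>x\<in>M. \<forall>v\<in>tangent_space M x. \<exists>U \<xi>. open_in M U \<and> x \<in> U \<and>
        infinitesimal_symmetry (induced_cr M) U \<xi> \<and> \<xi> x = v) \<and>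
     (\<exists>N. standard_model gr br J N \<and> locally_cr_equivalent (induced_cr M) N)"


section \<open>Symmetry reductions and integrable extensions\<close>

text \<open>
  \<open>\<pi> : U \<rightarrow> V\<close> is the projection to the local leaf space of the orbits of \<open>\<hh>\<close>.
\<close>

definition symmetry_reduction_at ::
  "nat \<Rightarrow> 'a::euclidean_space cr \<Rightarrow> 'b::euclidean_space cr \<Rightarrow> 'a \<Rightarrow> 'b \<Rightarrow> bool" where
  "symmetry_reduction_at \<nu> X Y p q \<longleftrightarrow>
     (\<exists>U V \<hh> \<pi>. open_in (points X) U \<and> p \<in> U \<and> open_in (points Y) V \<and> q \<in> V \<and>
        (\<lambda>x. 0) \<in> \<hh> \<and>
        (\<forall>\<xi>\<in>\<hh>. \<forall>\<eta>\<in>\<hh>. \<forall>a b. (\<lambda>x. a *\<^sub>R \<xi> x + b *\<^sub>R \<eta> x) \<in> \<hh>) \<and>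
        (\<forall>\<xi>\<in>\<hh>. infinitesimal_symmetry X U \<xi>) \<and>
        (\<forall>\<xi>\<in>\<hh>. \<forall>\<eta>\<in>\<hh>. \<forall>x\<in>U. lie_bracket (points X) \<xi> \<eta> x = 0) \<and>
        (\<forall>x\<in>U. tangent_space (points X) x = {v + \<xi> x | v \<xi>. v \<in> weak_flag X \<nu> x \<and> \<xi> \<in> \<hh>}) \<and>
        (\<forall>x\<in>U. \<forall>\<xi>\<in>\<hh>. \<xi> x \<in> weak_flag X \<nu> x \<longrightarrow> (\<forall>y\<in>U. \<xi> y = 0)) \<and>
        smooth_on U \<pi> \<and> \<pi> ` U = V \<and> \<pi> p = q \<and>
        (\<forall>y\<in>V. connected {x \<in> U. \<pi> x = y}) \<and>
        (\<forall>x\<in>U. differential (points X) \<pi> x ` tangent_space (points X) x =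
            tangent_space (points Y) (\<pi> x)) \<and>
        (\<forall>x\<in>U. {v \<in> tangent_space (points X) x. differential (points X) \<pi> x v = 0} =
            {\<xi> x | \<xi>. \<xi> \<in> \<hh>}) \<and>
        (\<forall>x\<in>U. differential (points X) \<pi> x ` distr X x = distr Y (\<pi> x)) \<and>
        (\<forall>x\<in>U. \<forall>v\<in>distr X x. differential (points X) \<pi> x (cplx X x v) =
            cplx Y (\<pi> x) (differential (points X) \<pi> x v)))"

definition symmetry_reduction ::
  "'a::euclidean_space cr \<Rightarrow> 'b::euclidean_space cr \<Rightarrow> bool" where
  "symmetry_reduction X Y \<longleftrightarrow> cr_manifold X \<and> cr_manifold Y \<and>
     (\<exists>\<nu>. has_depth X (Suc \<nu>) \<and> rel_set (symmetry_reduction_at \<nu> X Y) (points X) (points Y))"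

text \<open>
  \<open>\<aa>\<close> is the Abelian Lie algebra of the structure group, identified with the group by the
  exponential map, so that the group law is addition; \<open>H\<close> is the horizontal distribution of the
  principal connection.
\<close>

definition horizontal_lift ::
  "'b::euclidean_space cr \<Rightarrow> 'a::euclidean_space cr \<Rightarrow> bool" where
  "horizontal_lift Y Z \<longleftrightarrow> cr_manifold Y \<and> cr_manifold Z \<and>
     (\<exists>\<nu> \<pi>. \<exists>(\<aa> :: 'a set) act H.
        has_depth Y \<nu> \<and>
        smooth_on (points Z) \<pi> \<and> \<pi> ` points Z = points Y \<and>
        (\<forall>z\<in>points Z. differential (points Z) \<pi> z ` tangent_space (points Z) z =
            tangent_space (points Y) (\<pi> z)) \<and>
        subspace \<aa> \<and> smooth_on (\<aa> \<times> points Z) (\<lambda>(a, z). act a z) \<and>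
        (\<forall>z\<in>points Z. act 0 z = z) \<and>
        (\<forall>a\<in>\<aa>. \<forall>b\<in>\<aa>. \<forall>z\<in>points Z. act (a + b) z = act a (act b z)) \<and>
        (\<forall>a\<in>\<aa>. \<forall>z\<in>points Z. act a z \<in> points Z \<and> (act a z = z \<longrightarrow> a = 0)) \<and>
        (\<forall>z\<in>points Z. \<forall>z'\<in>points Z. \<pi> z = \<pi> z' \<longleftrightarrow> (\<exists>a\<in>\<aa>. z' = act a z)) \<and>
        smooth_distribution (points Z) H \<and>
        (\<forall>z\<in>points Z. bij_betw (differential (points Z) \<pi> z) (H z)
            (tangent_space (points Y) (\<pi> z))) \<and>
        (\<forall>a\<in>\<aa>. \<forall>z\<in>points Z. differential (points Z) (act a) z ` H z = H (act a z)) \<and>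
        (\<forall>z\<in>points Z. distr Z z = {v \<in> H z. differential (points Z) \<pi> z v \<in> distr Y (\<pi> z)}) \<and>
        (\<forall>z\<in>points Z. \<forall>v\<in>distr Z z. differential (points Z) \<pi> z (cplx Z z v) =
            cplx Y (\<pi> z) (differential (points Z) \<pi> z v)) \<and>
        (\<forall>z\<in>points Z. \<exists>(gr :: nat \<Rightarrow> 'a set) br (gr' :: nat \<Rightarrow> 'b set) br'.
            is_symbol Z z gr br \<and> is_symbol Y (\<pi> z) gr' br' \<and>
            gnla_depth gr (Suc \<nu>) \<and> dim (gr (Suc \<nu>)) = dim \<aa> \<and>
            graded_central_extension (Suc \<nu>) gr br gr' br'))"

definition integrable_extension ::
  "'b::euclidean_space cr \<Rightarrow> 'a::euclidean_space cr \<Rightarrow> bool" where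
  "integrable_extension Y X \<longleftrightarrow> (\<exists>Z :: 'a cr. horizontal_lift Y Z \<and> locally_cr_equivalent X Z)"

end

theory Submission
  imports Defs
begin

text \<open>
  In exponential coordinates the left-invariant fields of a GNLA are \<open>x \<mapsto> Lam x u\<close>, where \<open>Lam x\<close>
  is the differential of left translation. The Maurer-Cartan equation along one-parameter subgroups is
  a linear ODE with nilpotent coefficient, so its solutions are unique; hence \<open>Lam x z = z\<close> for
  central \<open>z\<close>, and central elements act by translations. Consequently the weak flag of a standard
  model is \<open>Lam x ` Fil k\<close> with \<open>Fil k\<close> the sum of the components of degree at most \<open>k\<close>, the symbol is
  the GNLA itself, constant fields in the top component are symmetries, and the linear projection
  killing the top component is at the same time a symmetry reduction and a principal bundle with
  connection \<open>Lam x ` Fil i\<close>. Iterating it and transporting along local equivalences gives the tower.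
  In depth 3 the two brackets of degree 3 are either independent (Hilbert-Cartan) or not (Engel), and
  the depth 2 quotient is the quadric via \<open>(z, c) \<mapsto> (z, - 4 c + \<i> \<bar>z\<bar>\<^sup>2)\<close>.
\<close>

section \<open>Smooth maps\<close>

text \<open>\<open>exp_group\<close> characterises the product instead of giving it by a series, so
  every fact about left translations has to be extracted from the brackets of the left-invariant
  fields. Three further obstacles shape the proof. The manifold \<open>M\<close> is only locally
  equivalent to a standard model; reductions and extensions are therefore proved for any
  \<open>W\<close> locally equivalent to the model, with the quotient kept a standard model. Symbols
  in \<open>has_depth\<close> and all levels of the tower must live in one Euclidean space; hence
  the models are moved linearly into \<open>complex ^ 'n\<close>, where they fit because a local
  equivalence bounds their dimension. The differential within a set is determined on tangent vectors
  only, so brackets of tangent fields must be known to be tangent; this is clear on subspaces and is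
  carried to \<open>M\<close> and to the quadric by local diffeomorphisms. The factor -4 in the map
  to the quadric equals -2, the coefficient that makes its differential complex linear on the
  distribution, divided by the 1/2 in the second-order term of \<open>Lam\<close>.\<close>

lemma frechet_derivative_eqI:
  "(f has_derivative f') (at x) \<Longrightarrow> frechet_derivative f (at x) v = f' v"
  using frechet_derivative_at by metis

lemma C_k_on_continuous: "C_k_on k W f \<Longrightarrow> continuous_on W f"
  by (cases k) (auto intro!: continuous_at_imp_continuous_on differentiable_imp_continuous_within)

lemma C_k_on_subset: "C_k_on k W f \<Longrightarrow> V \<subseteq> W \<Longrightarrow> C_k_on k V f"
  by (induction k arbitrary: f) (auto intro: continuous_on_subset)

lemma frechet_derivative_cong_open:
  assumes "open W" "x \<in> W" "\<And>y. y \<in> W \<Longrightarrow> f y = g y"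
  shows "frechet_derivative f (at x) = frechet_derivative g (at x)"
proof -
  have "(f has_derivative D) (at x) \<longleftrightarrow> (g has_derivative D) (at x)" for D
    using has_derivative_transform_within_open[OF _ assms(1,2)] assms(3) by metis
  then show ?thesis by (simp add: frechet_derivative_def)
qed

lemma C_k_on_cong:
  assumes "open W" "\<And>x. x \<in> W \<Longrightarrow> f x = g x"
  shows "C_k_on k W f \<Longrightarrow> C_k_on k W g"
  using assms(2)
proof (induction k arbitrary: f g)
  case 0
  then show ?case by (metis C_k_on.simps(1) continuous_on_cong)
next
  case (Suc k)
  have "g differentiable at x" if "x \<in> W" for x
  proof -
    have "f differentiable at x" using Suc.prems(1) that by simp
    then obtain D where "(f has_derivative D) (at x)" unfolding differentiable_def by blast
    then have "(g has_derivative D) (at x)"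
      by (rule has_derivative_transform_within_open[OF _ assms(1) that Suc.prems(2)])
    then show ?thesis by (rule differentiableI)
  qed
  moreover have "C_k_on k W (\<lambda>x. frechet_derivative g (at x) v)" for v
  proof (rule Suc.IH)
    show "C_k_on k W (\<lambda>x. frechet_derivative f (at x) v)" using Suc.prems(1) by simp
    show "frechet_derivative f (at x) v = frechet_derivative g (at x) v" if "x \<in> W" for x
      by (rule fun_cong[OF frechet_derivative_cong_open[OF assms(1) that Suc.prems(2)]])
  qed
  ultimately show ?case by simp
qed

lemma C_k_on_SucD: "C_k_on (Suc k) W f \<Longrightarrow> C_k_on k W f"
proof (induction k arbitrary: f)
  case 0
  then show ?case using C_k_on_continuous by fastforce
next
  case (Suc k)
  then show ?case by (metis C_k_on.simps(2))
qed

lemma C_k_on_has_derivative: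
  assumes "C_k_on (Suc k) W f" "x \<in> W"
  shows "(f has_derivative frechet_derivative f (at x)) (at x)"
  using assms by (simp add: frechet_derivative_works)

lemma C_k_on_const: "C_k_on k W (\<lambda>x. c)"
  by (induction k arbitrary: c) (auto)

lemma C_k_on_bounded_linear:
  assumes "bounded_linear h" shows "C_k_on k W h"
proof (cases k)
  case 0
  then show ?thesis using assms by (simp add: linear_continuous_on)
next
  case (Suc k)
  have "frechet_derivative h (at x) = h" for x
    using assms by (metis bounded_linear_imp_has_derivative frechet_derivative_at)
  then show ?thesis using Suc assms
    by (auto simp: C_k_on_const bounded_linear_imp_differentiable)
qed

lemma C_k_on_add:
  assumes "open W"
  shows "C_k_on k W f \<Longrightarrow> C_k_on k W g \<Longrightarrow> C_k_on k W (\<lambda>x. f x + g x)"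
proof (induction k arbitrary: f g)
  case 0
  then show ?case by (auto intro: continuous_on_add)
next
  case (Suc k)
  have eq: "frechet_derivative (\<lambda>x. f x + g x) (at x) v =
      frechet_derivative f (at x) v + frechet_derivative g (at x) v" if "x \<in> W" for x v
    by (intro frechet_derivative_eqI has_derivative_add C_k_on_has_derivative[OF Suc.prems(1) that]
        C_k_on_has_derivative[OF Suc.prems(2) that])
  have "C_k_on k W (\<lambda>x. frechet_derivative f (at x) v + frechet_derivative g (at x) v)" for v
    using Suc.prems by (intro Suc.IH) simp_all
  then have "C_k_on k W (\<lambda>x. frechet_derivative (\<lambda>x. f x + g x) (at x) v)" for v
    by (rule C_k_on_cong[OF assms, rotated]) (simp add: eq)
  then show ?case using Suc.prems by auto
qed

lemma C_k_on_sum: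
  assumes "open W" "finite I" "\<And>i. i \<in> I \<Longrightarrow> C_k_on k W (f i)"
  shows "C_k_on k W (\<lambda>x. \<Sum>i\<in>I. f i x)"
  using assms(2,3) by (induction I) (auto simp: C_k_on_const intro!: C_k_on_add assms(1))

lemma C_k_on_bounded_bilinear:
  assumes "open W" "bounded_bilinear bl"
  shows "C_k_on k W f \<Longrightarrow> C_k_on k W g \<Longrightarrow> C_k_on k W (\<lambda>x. bl (f x) (g x))"
proof (induction k arbitrary: f g)
  case 0
  then show ?case by (auto intro: bounded_bilinear.continuous_on[OF assms(2)])
next
  case (Suc k)
  have der: "((\<lambda>x. bl (f x) (g x)) has_derivative (\<lambda>v. bl (f x) (frechet_derivative g (at x) v) +
      bl (frechet_derivative f (at x) v) (g x))) (at x)" if "x \<in> W" for x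
    using bounded_bilinear.FDERIV[OF assms(2) C_k_on_has_derivative[OF Suc.prems(1) that]
        C_k_on_has_derivative[OF Suc.prems(2) that]] .
  then have eq: "frechet_derivative (\<lambda>x. bl (f x) (g x)) (at x) v =
      bl (f x) (frechet_derivative g (at x) v) + bl (frechet_derivative f (at x) v) (g x)"
    if "x \<in> W" for x v
    using that by (intro frechet_derivative_eqI der)
  have "C_k_on k W (\<lambda>x. bl (f x) (frechet_derivative g (at x) v))"
    "C_k_on k W (\<lambda>x. bl (frechet_derivative f (at x) v) (g x))" for v
    using Suc.prems C_k_on_SucD[OF Suc.prems(1)] C_k_on_SucD[OF Suc.prems(2)]
    by (intro Suc.IH; simp)+
  from C_k_on_add[OF assms(1) this]
  have "C_k_on k W (\<lambda>x. frechet_derivative (\<lambda>x. bl (f x) (g x)) (at x) v)" for v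
    by (rule C_k_on_cong[OF assms(1), rotated]) (simp add: eq)
  moreover have "(\<lambda>x. bl (f x) (g x)) differentiable (at x)" if "x \<in> W" for x
    using der[OF that] by (auto simp: differentiable_def)
  ultimately show ?case by simp
qed

lemma linear_sum_Basis:
  fixes h :: "'a::euclidean_space \<Rightarrow> 'b::real_vector"
  assumes "linear h" shows "h v = (\<Sum>b\<in>Basis. (v \<bullet> b) *\<^sub>R h b)"
proof -
  have "h v = h (\<Sum>b\<in>Basis. (v \<bullet> b) *\<^sub>R b)" by (simp add: euclidean_representation)
  also have "\<dots> = (\<Sum>b\<in>Basis. (v \<bullet> b) *\<^sub>R h b)"
    using assms by (simp add: linear_sum linear_scale)
  finally show ?thesis .
qed

text \<open>In the chain rule the direction fed to the derivative of \<open>g\<close> depends on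
  \<open>x\<close>. Expanding it in \<open>Basis\<close> turns the derivative into a sum of products
  of scalar functions with derivatives of \<open>g\<close> in fixed directions, to which the
  induction hypothesis applies.\<close>

lemma C_k_on_compose:
  assumes "open W" "open W'"
  shows "C_k_on k W f \<Longrightarrow> C_k_on k W' g \<Longrightarrow> f ` W \<subseteq> W' \<Longrightarrow> C_k_on k W (\<lambda>x. g (f x))"
proof (induction k arbitrary: g)
  case 0
  then show ?case by (auto intro: continuous_on_compose2)
next
  case (Suc k)
  have der: "((\<lambda>x. g (f x)) has_derivative (\<lambda>v. frechet_derivative g (at (f x)) (frechet_derivative f (at x) v))) (at x)"
    if "x \<in> W" for x
    using has_derivative_compose[OF C_k_on_has_derivative[OF Suc.prems(1) that]
        C_k_on_has_derivative[OF Suc.prems(2)]] that Suc.prems(3) by auto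
  have eq: "frechet_derivative (\<lambda>x. g (f x)) (at x) v =
      (\<Sum>b\<in>Basis. (frechet_derivative f (at x) v \<bullet> b) *\<^sub>R frechet_derivative g (at (f x)) b)"
    if "x \<in> W" for x v
  proof -
    have "linear (frechet_derivative g (at (f x)))"
      using Suc.prems(2,3) that by (intro linear_frechet_derivative) auto
    then show ?thesis
      by (subst frechet_derivative_eqI[OF der[OF that]]) (rule linear_sum_Basis)
  qed
  have 1: "C_k_on k W (\<lambda>x. frechet_derivative f (at x) v \<bullet> b)" for v b
    using Suc.prems(1) by (intro C_k_on_bounded_bilinear[OF assms(1) bounded_bilinear_inner] C_k_on_const) simp
  have 2: "C_k_on k W (\<lambda>x. frechet_derivative g (at (f x)) b)" for b
    by (rule Suc.IH[of "\<lambda>y. frechet_derivative g (at y) b"])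
      (use Suc.prems C_k_on_SucD[OF Suc.prems(1)] in simp_all)
  have "C_k_on k W (\<lambda>x. \<Sum>b\<in>Basis. (frechet_derivative f (at x) v \<bullet> b) *\<^sub>R frechet_derivative g (at (f x)) b)" for v
    by (rule C_k_on_sum[OF assms(1)])
      (auto intro: C_k_on_bounded_bilinear[OF assms(1) bounded_bilinear_scaleR 1 2])
  then have "C_k_on k W (\<lambda>x. frechet_derivative (\<lambda>x. g (f x)) (at x) v)" for v
    by (rule C_k_on_cong[OF assms(1), rotated]) (simp add: eq)
  moreover have "(\<lambda>x. g (f x)) differentiable (at x)" if "x \<in> W" for x
    using der[OF that] by (auto simp: differentiable_def)
  ultimately show ?case by simp
qed

section \<open>Symmetry of second derivatives\<close>

lemma second_difference_MVT:
  fixes f :: "'a::euclidean_space \<Rightarrow> real"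
  assumes "C_k_on 2 W f" "h > 0"
    and W: "\<And>s t. 0 \<le> s \<Longrightarrow> s \<le> h \<Longrightarrow> 0 \<le> t \<Longrightarrow> t \<le> h \<Longrightarrow> x + s *\<^sub>R v + t *\<^sub>R w \<in> W"
  obtains s t where "0 < s" "s < h" "0 < t" "t < h"
    "f (x + h *\<^sub>R v + h *\<^sub>R w) - f (x + h *\<^sub>R v) - f (x + h *\<^sub>R w) + f x =
      h * h * frechet_derivative (\<lambda>y. frechet_derivative f (at y) v) (at (x + s *\<^sub>R v + t *\<^sub>R w)) w"
proof -
  have C2: "C_k_on (Suc (Suc 0)) W f" using assms(1) by (simp add: numeral_2_eq_2)
  let ?Df = "\<lambda>y. frechet_derivative f (at y) v"
  have d1: "((\<lambda>s. f (c + s *\<^sub>R v)) has_real_derivative ?Df (c + s *\<^sub>R v)) (at s)"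
    if "c + s *\<^sub>R v \<in> W" for c s
  proof -
    have "((\<lambda>s. c + s *\<^sub>R v) has_derivative (\<lambda>s. s *\<^sub>R v)) (at s)"
      by (auto intro!: derivative_eq_intros)
    from has_derivative_compose[OF this C_k_on_has_derivative[OF C2 that]]
    have "((\<lambda>s. f (c + s *\<^sub>R v)) has_derivative (\<lambda>s'. frechet_derivative f (at (c + s *\<^sub>R v)) (s' *\<^sub>R v))) (at s)" .
    moreover have "linear (frechet_derivative f (at (c + s *\<^sub>R v)))"
      using C2 that by (intro linear_frechet_derivative) auto
    ultimately show ?thesis
      by (auto simp: has_field_derivative_def linear_scale mult.commute[of _ "frechet_derivative _ _ _"])
  qed
  have d2: "((\<lambda>t. ?Df (c + t *\<^sub>R w)) has_real_derivative
      frechet_derivative ?Df (at (c + t *\<^sub>R w)) w) (at t)"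
    if "c + t *\<^sub>R w \<in> W" for c t
  proof -
    have C1: "C_k_on (Suc 0) W ?Df" using C2 by (metis C_k_on.simps(2))
    have "((\<lambda>t. c + t *\<^sub>R w) has_derivative (\<lambda>s. s *\<^sub>R w)) (at t)"
      by (auto intro!: derivative_eq_intros)
    from has_derivative_compose[OF this C_k_on_has_derivative[OF C1 that]]
    have "((\<lambda>t. ?Df (c + t *\<^sub>R w)) has_derivative (\<lambda>s'. frechet_derivative ?Df (at (c + t *\<^sub>R w)) (s' *\<^sub>R w))) (at t)" .
    moreover have "linear (frechet_derivative ?Df (at (c + t *\<^sub>R w)))"
      using C1 that by (intro linear_frechet_derivative) auto
    ultimately show ?thesis
      by (auto simp: has_field_derivative_def linear_scale mult.commute[of _ "frechet_derivative _ _ _"])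
  qed
  \<comment> \<open>The second difference is the increment over \<open>[0, h]\<close> of the
    difference of \<open>f\<close> along two parallel segments. The mean value theorem along
    \<open>v\<close> produces \<open>s\<close>, and a second application along \<open>w\<close>
    produces \<open>t\<close>.\<close>
  let ?g = "\<lambda>s. f ((x + h *\<^sub>R w) + s *\<^sub>R v) - f (x + s *\<^sub>R v)"
  have in1: "(x + h *\<^sub>R w) + s *\<^sub>R v \<in> W" "x + s *\<^sub>R v \<in> W" if "0 \<le> s" "s \<le> h" for s
    using W[of s h] W[of s 0] that assms(2) by (simp_all add: algebra_simps)
  have "\<exists>z. 0 < z \<and> z < h \<and> ?g h - ?g 0 = (h - 0) * (?Df ((x + h *\<^sub>R w) + z *\<^sub>R v) - ?Df (x + z *\<^sub>R v))"
    using assms(2) in1 by (intro MVT2 DERIV_diff d1) auto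
  then obtain s where s: "0 < s" "s < h"
    "?g h - ?g 0 = h * (?Df ((x + s *\<^sub>R v) + h *\<^sub>R w) - ?Df ((x + s *\<^sub>R v) + 0 *\<^sub>R w))"
    by (auto simp: algebra_simps)
  have "\<exists>z. 0 < z \<and> z < h \<and> ?Df ((x + s *\<^sub>R v) + h *\<^sub>R w) - ?Df ((x + s *\<^sub>R v) + 0 *\<^sub>R w) =
      (h - 0) * frechet_derivative ?Df (at ((x + s *\<^sub>R v) + z *\<^sub>R w)) w"
    using assms(2) s W[of s] by (intro MVT2 d2) auto
  then obtain t where "0 < t" "t < h" "?Df ((x + s *\<^sub>R v) + h *\<^sub>R w) - ?Df ((x + s *\<^sub>R v) + 0 *\<^sub>R w) =
      h * frechet_derivative ?Df (at ((x + s *\<^sub>R v) + t *\<^sub>R w)) w" by auto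
  with s that[of s t] show ?thesis by (simp add: algebra_simps)
qed

text \<open>The second difference over a parallelogram is symmetric in \<open>v\<close> and
  \<open>w\<close>, while each order of the mean value theorem expresses it through one of the two
  mixed derivatives near \<open>x\<close>. Continuity of both at \<open>x\<close> closes the gap up
  to any \<open>e\<close>.\<close>

lemma symmetric_second_derivative_real:
  fixes f :: "'a::euclidean_space \<Rightarrow> real"
  assumes "open W" "C_k_on 2 W f" "x \<in> W"
  shows "frechet_derivative (\<lambda>y. frechet_derivative f (at y) v) (at x) w =
         frechet_derivative (\<lambda>y. frechet_derivative f (at y) w) (at x) v"
proof -
  define A where "A v w y = frechet_derivative (\<lambda>y. frechet_derivative f (at y) v) (at y) w" for v w y
  have cont: "continuous_on W (A v w)" for v w
    using assms(2) by (simp add: numeral_2_eq_2 A_def[abs_def])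
  have "\<bar>A v w x - A w v x\<bar> \<le> e" if "e > 0" for e
  proof -
    have "\<forall>\<^sub>F y in at x. \<bar>A v w y - A v w x\<bar> < e / 2" for v w
    proof -
      have "(A v w \<longlongrightarrow> A v w x) (at x)"
        using cont[of v w] assms(1,3) by (simp add: continuous_on_eq_continuous_at isCont_def)
      from tendstoD[OF this half_gt_zero[OF that]] show ?thesis by (simp only: dist_real_def)
    qed
    then have "\<forall>\<^sub>F y in nhds x. \<bar>A v w y - A v w x\<bar> < e / 2" for v w
      using that by (simp add: eventually_nhds_conv_at)
    then have "\<forall>\<^sub>F y in nhds x. \<bar>A v w y - A v w x\<bar> < e / 2 \<and> \<bar>A w v y - A w v x\<bar> < e / 2 \<and> y \<in> W"
      using assms(1,3) by (intro eventually_conj eventually_nhds_in_open) auto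
    then obtain d where d: "d > 0" "\<And>y. dist y x < d \<Longrightarrow>
        \<bar>A v w y - A v w x\<bar> < e / 2 \<and> \<bar>A w v y - A w v x\<bar> < e / 2 \<and> y \<in> W"
      by (auto simp: eventually_nhds_metric)
    \<comment> \<open>Small enough to keep the whole parallelogram within distance \<open>d\<close>
      of \<open>x\<close>; the summand 1 keeps the denominator positive when \<open>v\<close> and
      \<open>w\<close> vanish.\<close>
    define h where "h = d / (2 * (norm v + norm w + 1))"
    have pos: "2 * (norm v + norm w + 1) > 0" by (smt (verit) norm_ge_zero)
    then have h: "h > 0" using d(1) by (simp add: h_def)
    have near: "dist (x + s *\<^sub>R v + t *\<^sub>R w) x < d" if "0 \<le> s" "s \<le> h" "0 \<le> t" "t \<le> h" for s t
    proof -
      have "norm (s *\<^sub>R v + t *\<^sub>R w) \<le> s * norm v + t * norm w"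
        using that by (metis abs_of_nonneg norm_scaleR norm_triangle_ineq)
      also have "\<dots> \<le> h * norm v + h * norm w"
        using that by (intro add_mono mult_right_mono) auto
      also have "\<dots> \<le> h * (norm v + norm w + 1)" using h by (simp add: algebra_simps)
      also have "\<dots> = d / 2" using pos by (simp add: h_def field_simps)
      also have "\<dots> < d" using d(1) by simp
      finally show ?thesis by (simp add: dist_norm add.assoc)
    qed
    have near': "dist (x + s *\<^sub>R w + t *\<^sub>R v) x < d" if "0 \<le> s" "s \<le> h" "0 \<le> t" "t \<le> h" for s t
      using near[of t s] that by (simp add: algebra_simps)
    obtain s t where st: "0 < s" "s < h" "0 < t" "t < h"
      "f (x + h *\<^sub>R v + h *\<^sub>R w) - f (x + h *\<^sub>R v) - f (x + h *\<^sub>R w) + f x =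
       h * h * A v w (x + s *\<^sub>R v + t *\<^sub>R w)"
      using second_difference_MVT[OF assms(2) h, of x v w] near d(2) unfolding A_def by metis
    obtain s' t' where st': "0 < s'" "s' < h" "0 < t'" "t' < h"
      "f (x + h *\<^sub>R w + h *\<^sub>R v) - f (x + h *\<^sub>R w) - f (x + h *\<^sub>R v) + f x =
       h * h * A w v (x + s' *\<^sub>R w + t' *\<^sub>R v)"
      using second_difference_MVT[OF assms(2) h, of x w v] near' d(2) unfolding A_def by metis
    have "h * h * A v w (x + s *\<^sub>R v + t *\<^sub>R w) = h * h * A w v (x + s' *\<^sub>R w + t' *\<^sub>R v)"
      using st(5) st'(5) by (simp add: algebra_simps)
    then have "A v w (x + s *\<^sub>R v + t *\<^sub>R w) = A w v (x + s' *\<^sub>R w + t' *\<^sub>R v)" using h by simp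
    then show ?thesis
      using d(2)[OF near[of s t]] d(2)[OF near'[of s' t']] st st' by (smt (verit) field_sum_of_halves)
  qed
  then have "\<bar>A v w x - A w v x\<bar> \<le> 0" by (rule field_le_epsilon) auto
  then show ?thesis by (simp add: A_def)
qed

lemma symmetric_second_derivative:
  fixes f :: "'a::euclidean_space \<Rightarrow> 'b::euclidean_space"
  assumes "open W" "C_k_on 2 W f" "x \<in> W"
  shows "frechet_derivative (\<lambda>y. frechet_derivative f (at y) v) (at x) w =
         frechet_derivative (\<lambda>y. frechet_derivative f (at y) w) (at x) v"
proof (rule euclidean_eqI)
  fix b :: 'b
  have C2: "C_k_on (Suc (Suc 0)) W f" using assms(2) by (simp add: numeral_2_eq_2)
  have inner: "frechet_derivative (\<lambda>y. g y \<bullet> b) (at y) u = frechet_derivative g (at y) u \<bullet> b"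
    if "g differentiable at y" for g :: "'a \<Rightarrow> 'b" and y u
  proof -
    have "((\<lambda>y. g y \<bullet> b) has_derivative (\<lambda>u. frechet_derivative g (at y) u \<bullet> b)) (at y)"
      using that by (intro has_derivative_inner_left) (simp add: frechet_derivative_works)
    then show ?thesis by (rule frechet_derivative_eqI)
  qed
  have eq: "frechet_derivative (\<lambda>y. frechet_derivative (\<lambda>y. f y \<bullet> b) (at y) u) (at x) u' =
      frechet_derivative (\<lambda>y. frechet_derivative f (at y) u) (at x) u' \<bullet> b" for u u'
  proof -
    have "frechet_derivative (\<lambda>y. frechet_derivative (\<lambda>y. f y \<bullet> b) (at y) u) (at x) =
        frechet_derivative (\<lambda>y. frechet_derivative f (at y) u \<bullet> b) (at x)"
      using C2 by (intro frechet_derivative_cong_open[OF assms(1,3)]) (simp add: inner)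
    then show ?thesis using C2 assms(3) by (simp add: inner)
  qed
  have "C_k_on 2 W (\<lambda>y. f y \<bullet> b)"
    using C_k_on_bounded_bilinear[OF assms(1) bounded_bilinear_inner assms(2) C_k_on_const] .
  from symmetric_second_derivative_real[OF assms(1) this assms(3), of v w]
  show "frechet_derivative (\<lambda>y. frechet_derivative f (at y) v) (at x) w \<bullet> b =
         frechet_derivative (\<lambda>y. frechet_derivative f (at y) w) (at x) v \<bullet> b"
    by (simp add: eq)
qed

section \<open>Smooth maps on arbitrary sets, through local extensions\<close>

lemma smooth_on_openI:
  assumes "open W" "\<And>k. C_k_on k W F" "S \<subseteq> W" shows "smooth_on S F"
  unfolding smooth_on_def
  by (intro ballI exI[of _ W] exI[of _ F]) (use assms in auto)

lemma smooth_onE: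
  assumes "smooth_on S f" "p \<in> S"
  obtains W F where "open W" "p \<in> W" "\<And>k. C_k_on k W F" "\<And>x. x \<in> W \<Longrightarrow> x \<in> S \<Longrightarrow> F x = f x"
proof -
  from bspec[OF assms(1)[unfolded smooth_on_def] assms(2)]
  obtain W F where "open W \<and> p \<in> W \<and> (\<forall>k. C_k_on k W F) \<and> (\<forall>x\<in>W \<inter> S. F x = f x)"
    by (elim exE)
  then show ?thesis by (intro that[of W F]) auto
qed

lemma smooth_on_cong:
  assumes "smooth_on S f" "\<And>x. x \<in> S \<Longrightarrow> f x = g x" shows "smooth_on S g"
  unfolding smooth_on_def
proof
  fix p assume "p \<in> S"
  from smooth_onE[OF assms(1) this] obtain W F
    where "open W" "p \<in> W" "\<And>k. C_k_on k W F" "\<And>x. x \<in> W \<Longrightarrow> x \<in> S \<Longrightarrow> F x = f x" by blast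
  then show "\<exists>W F. open W \<and> p \<in> W \<and> (\<forall>k. C_k_on k W F) \<and> (\<forall>x\<in>W \<inter> S. F x = g x)"
    using assms(2) by (intro exI[of _ W] exI[of _ F]) auto
qed

lemma smooth_on_subset:
  assumes "smooth_on S f" "T \<subseteq> S" shows "smooth_on T f"
  unfolding smooth_on_def
proof
  fix p assume "p \<in> T"
  with assms(2) have "p \<in> S" by blast
  from smooth_onE[OF assms(1) this] obtain W F
    where "open W" "p \<in> W" "\<And>k. C_k_on k W F" "\<And>x. x \<in> W \<Longrightarrow> x \<in> S \<Longrightarrow> F x = f x" by blast
  then show "\<exists>W F. open W \<and> p \<in> W \<and> (\<forall>k. C_k_on k W F) \<and> (\<forall>x\<in>W \<inter> T. F x = f x)"
    using assms(2) by (intro exI[of _ W] exI[of _ F]) auto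
qed

lemma smooth_on_local:
  assumes "\<And>p. p \<in> S \<Longrightarrow> \<exists>Q. open Q \<and> p \<in> Q \<and> smooth_on (S \<inter> Q) f"
  shows "smooth_on S f"
  unfolding smooth_on_def
proof
  fix p assume p: "p \<in> S"
  then obtain Q where Q: "open Q" "p \<in> Q" "smooth_on (S \<inter> Q) f" using assms by blast
  have "p \<in> S \<inter> Q" using p Q(2) by blast
  from smooth_onE[OF Q(3) this] obtain W F where "open W" "p \<in> W" "\<And>k. C_k_on k W F"
    "\<And>x. x \<in> W \<Longrightarrow> x \<in> S \<inter> Q \<Longrightarrow> F x = f x" by blast
  then show "\<exists>W F. open W \<and> p \<in> W \<and> (\<forall>k. C_k_on k W F) \<and> (\<forall>x\<in>W \<inter> S. F x = f x)"
    using Q by (intro exI[of _ "W \<inter> Q"] exI[of _ F]) (auto intro: C_k_on_subset)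
qed

lemma smooth_on_const: "smooth_on S (\<lambda>x. c)"
  by (rule smooth_on_openI[of UNIV]) (auto intro: C_k_on_const)

lemma smooth_on_linear: "linear h \<Longrightarrow> smooth_on S h"
  by (rule smooth_on_openI[of UNIV])
    (auto intro: C_k_on_bounded_linear simp: linear_conv_bounded_linear)

lemma smooth_on_id: "smooth_on S (\<lambda>x. x)"
  by (rule smooth_on_linear) (rule linear_id[unfolded id_def])

lemma smooth_on_bilinear:
  assumes "bounded_bilinear bl" "smooth_on S f" "smooth_on S g"
  shows "smooth_on S (\<lambda>x. bl (f x) (g x))"
  unfolding smooth_on_def
proof
  fix p assume p: "p \<in> S"
  obtain W F where F: "open W" "p \<in> W" "\<And>k. C_k_on k W F" "\<And>x. x \<in> W \<Longrightarrow> x \<in> S \<Longrightarrow> F x = f x"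
    using smooth_onE[OF assms(2) p] by blast
  obtain W' G where G: "open W'" "p \<in> W'" "\<And>k. C_k_on k W' G" "\<And>x. x \<in> W' \<Longrightarrow> x \<in> S \<Longrightarrow> G x = g x"
    using smooth_onE[OF assms(3) p] by blast
  have "C_k_on k (W \<inter> W') (\<lambda>x. bl (F x) (G x))" for k
    by (rule C_k_on_bounded_bilinear[OF open_Int[OF F(1) G(1)] assms(1)
          C_k_on_subset[OF F(3)] C_k_on_subset[OF G(3)]]) auto
  then show "\<exists>W H. open W \<and> p \<in> W \<and> (\<forall>k. C_k_on k W H) \<and> (\<forall>x\<in>W \<inter> S. H x = bl (f x) (g x))"
    using F G by (intro exI[of _ "W \<inter> W'"] exI[of _ "\<lambda>x. bl (F x) (G x)"]) auto
qed

lemma smooth_on_add: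
  assumes "smooth_on S f" "smooth_on S g" shows "smooth_on S (\<lambda>x. f x + g x)"
  unfolding smooth_on_def
proof
  fix p assume p: "p \<in> S"
  obtain W F where F: "open W" "p \<in> W" "\<And>k. C_k_on k W F" "\<And>x. x \<in> W \<Longrightarrow> x \<in> S \<Longrightarrow> F x = f x"
    using smooth_onE[OF assms(1) p] by blast
  obtain W' G where G: "open W'" "p \<in> W'" "\<And>k. C_k_on k W' G" "\<And>x. x \<in> W' \<Longrightarrow> x \<in> S \<Longrightarrow> G x = g x"
    using smooth_onE[OF assms(2) p] by blast
  have "C_k_on k (W \<inter> W') (\<lambda>x. F x + G x)" for k
    by (rule C_k_on_add[OF open_Int[OF F(1) G(1)] C_k_on_subset[OF F(3)] C_k_on_subset[OF G(3)]]) auto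
  then show "\<exists>W H. open W \<and> p \<in> W \<and> (\<forall>k. C_k_on k W H) \<and> (\<forall>x\<in>W \<inter> S. H x = f x + g x)"
    using F G by (intro exI[of _ "W \<inter> W'"] exI[of _ "\<lambda>x. F x + G x"]) auto
qed

lemma smooth_on_sum:
  assumes "finite I" "\<And>i. i \<in> I \<Longrightarrow> smooth_on S (f i)"
  shows "smooth_on S (\<lambda>x. \<Sum>i\<in>I. f i x)"
  using assms by (induction I) (auto simp: smooth_on_const intro!: smooth_on_add)

lemma smooth_on_continuous: "smooth_on S f \<Longrightarrow> continuous_on S f"
  unfolding continuous_on_eq_continuous_within
proof
  fix p assume f: "smooth_on S f" and "p \<in> S"
  from smooth_onE[OF this] obtain W F where F: "open W" "p \<in> W" "\<And>k. C_k_on k W F" "\<And>x. x \<in> W \<Longrightarrow> x \<in> S \<Longrightarrow> F x = f x" by blast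
  have "continuous (at p within S) F"
    using F(1,2) C_k_on_continuous[OF F(3)] continuous_at_imp_continuous_within
      continuous_on_eq_continuous_at by blast
  moreover obtain d where "d > 0" "ball p d \<subseteq> W" using F(1,2) openE by blast
  ultimately show "continuous (at p within S) f"
    using continuous_transform_within[of p S F d f] F(4) \<open>p \<in> S\<close> by (auto simp: dist_commute subset_iff)
qed

lemma smooth_on_compose:
  assumes "smooth_on S f" "smooth_on T g" "f ` S \<subseteq> T"
  shows "smooth_on S (\<lambda>x. g (f x))"
  unfolding smooth_on_def
proof
  fix p assume p: "p \<in> S"
  obtain W F where F: "open W" "p \<in> W" "\<And>k. C_k_on k W F" "\<And>x. x \<in> W \<Longrightarrow> x \<in> S \<Longrightarrow> F x = f x"
    using smooth_onE[OF assms(1) p] by blast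
  have fp: "f p \<in> T" using assms(3) p by blast
  obtain W' G where G: "open W'" "f p \<in> W'" "\<And>k. C_k_on k W' G" "\<And>x. x \<in> W' \<Longrightarrow> x \<in> T \<Longrightarrow> G x = g x"
    using smooth_onE[OF assms(2) fp] by blast
  \<comment> \<open>The extension \<open>F\<close> may carry points outside \<open>S\<close> out of
    \<open>W'\<close>, so its domain is cut down to a preimage.\<close>
  let ?O = "W \<inter> F -` W'"
  have O: "open ?O"
    using continuous_open_preimage[OF C_k_on_continuous[OF F(3)] F(1) G(1)] .
  have "C_k_on k ?O (\<lambda>x. G (F x))" for k
    by (rule C_k_on_compose[OF O G(1) C_k_on_subset[OF F(3)] G(3)]) auto
  then show "\<exists>W H. open W \<and> p \<in> W \<and> (\<forall>k. C_k_on k W H) \<and> (\<forall>x\<in>W \<inter> S. H x = g (f x))"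
    using F G O p assms(3) by (intro exI[of _ ?O] exI[of _ "\<lambda>x. G (F x)"]) auto
qed

lemma smooth_on_linear_compose:
  "linear h \<Longrightarrow> smooth_on S f \<Longrightarrow> smooth_on S (\<lambda>x. h (f x))"
  using smooth_on_compose[OF _ smooth_on_linear[of h UNIV]] by blast

text \<open>A field of linear maps is smooth once its values on fixed vectors are: written in
  \<open>Basis\<close>, \<open>L x (a x)\<close> becomes a sum of products of smooth functions. This
  is how \<open>Lam\<close> and \<open>om\<close> will act on sections.\<close>

lemma smooth_on_family:
  assumes "\<And>x. x \<in> S \<Longrightarrow> linear (L x)" "\<And>u. smooth_on S (\<lambda>x. L x u)" "smooth_on S a"
  shows "smooth_on S (\<lambda>x. L x (a x))"
proof -
  have "smooth_on S (\<lambda>x. \<Sum>b\<in>Basis. (a x \<bullet> b) *\<^sub>R L x b)"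
    by (intro smooth_on_sum smooth_on_bilinear[OF bounded_bilinear_scaleR]
        smooth_on_bilinear[OF bounded_bilinear_inner] assms smooth_on_const) simp
  then show ?thesis by (rule smooth_on_cong) (simp add: linear_sum_Basis[OF assms(1), symmetric])
qed

text \<open>The product rule for a field of linear maps along \<open>f\<close>. The maps
  \<open>DL u\<close> are given separately for each \<open>u\<close>, so their linear dependence on
  \<open>u\<close> has to be recovered from uniqueness of derivatives before the sum over
  \<open>Basis\<close> can be folded back.\<close>

lemma has_derivative_family:
  fixes L :: "'a::euclidean_space \<Rightarrow> 'b::euclidean_space \<Rightarrow> 'c::euclidean_space"
    and f :: "'d::euclidean_space \<Rightarrow> 'a"
  assumes "\<And>y. y \<in> W \<Longrightarrow> linear (L y)" "open W" "f x \<in> W"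
    and L: "\<And>u. ((\<lambda>y. L y u) has_derivative DL u) (at (f x))"
    and f: "(f has_derivative f') (at x within S)" and a: "(a has_derivative a') (at x within S)"
    and x: "x \<in> S"
  shows "((\<lambda>x. L (f x) (a x)) has_derivative (\<lambda>h. DL (a x) (f' h) + L (f x) (a' h))) (at x within S)"
proof -
  have DL: "DL u w = (\<Sum>b\<in>Basis. (u \<bullet> b) *\<^sub>R DL b w)" for u w
  proof -
    have "((\<lambda>y. \<Sum>b\<in>Basis. (u \<bullet> b) *\<^sub>R L y b) has_derivative (\<lambda>w. \<Sum>b\<in>Basis. (u \<bullet> b) *\<^sub>R DL b w)) (at (f x))"
      by (intro has_derivative_sum has_derivative_scaleR_right L)
    moreover have "(\<Sum>b\<in>Basis. (u \<bullet> b) *\<^sub>R L y b) = L y u" if "y \<in> W" for y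
      using linear_sum_Basis[OF assms(1)[OF that]] by metis
    ultimately have "((\<lambda>y. L y u) has_derivative (\<lambda>w. \<Sum>b\<in>Basis. (u \<bullet> b) *\<^sub>R DL b w)) (at (f x))"
      by (rule has_derivative_transform_within_open[OF _ assms(2,3)])
    from fun_cong[OF has_derivative_unique[OF L this]] show ?thesis .
  qed
  have "((\<lambda>x. \<Sum>b\<in>Basis. (a x \<bullet> b) *\<^sub>R L (f x) b) has_derivative
      (\<lambda>h. \<Sum>b\<in>Basis. (a x \<bullet> b) *\<^sub>R DL b (f' h) + (a' h \<bullet> b) *\<^sub>R L (f x) b)) (at x within S)"
    by (intro has_derivative_sum has_derivative_scaleR has_derivative_inner_left a
        has_derivative_compose[OF f L])
  moreover have "(\<lambda>h. \<Sum>b\<in>Basis. (a x \<bullet> b) *\<^sub>R DL b (f' h) + (a' h \<bullet> b) *\<^sub>R L (f x) b) =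
      (\<lambda>h. DL (a x) (f' h) + L (f x) (a' h))"
  proof
    fix h
    show "(\<Sum>b\<in>Basis. (a x \<bullet> b) *\<^sub>R DL b (f' h) + (a' h \<bullet> b) *\<^sub>R L (f x) b) =
      DL (a x) (f' h) + L (f x) (a' h)"
      unfolding sum.distrib DL[of "a x" "f' h", symmetric]
        linear_sum_Basis[OF assms(1)[OF assms(3)], of "a' h", symmetric] ..
  qed
  ultimately have D: "((\<lambda>x. \<Sum>b\<in>Basis. (a x \<bullet> b) *\<^sub>R L (f x) b) has_derivative
      (\<lambda>h. DL (a x) (f' h) + L (f x) (a' h))) (at x within S)" by simp
  have "continuous (at x within S) f" using f by (rule has_derivative_continuous)
  then have "\<forall>\<^sub>F y in at x within S. f y \<in> W"
    using topological_tendstoD[OF _ assms(2,3)] by (simp add: continuous_within)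
  then have "\<forall>\<^sub>F y in at x within S. (\<Sum>b\<in>Basis. (a y \<bullet> b) *\<^sub>R L (f y) b) = L (f y) (a y)"
    by eventually_elim (simp add: linear_sum_Basis[OF assms(1), symmetric])
  from has_derivative_transform_eventually[OF D this _ x] show ?thesis
    by (simp add: linear_sum_Basis[OF assms(1)[OF assms(3)], symmetric])
qed

section \<open>Tangent vectors and differentials\<close>

lemma at_within_openin:
  assumes "open_in S U" "x \<in> U" shows "at x within U = at x within S"
proof -
  obtain Q where "open Q" "U = S \<inter> Q" using assms(1) by (auto simp: openin_open)
  then show ?thesis using assms(2) by (intro at_within_nhd[of x Q]) auto
qed

text \<open>\<open>tangent_space\<close> asks for a curve that lies in \<open>S\<close> at all
  times. Outside a small interval the curve is replaced by the constant \<open>p\<close>; the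
  derivative is taken at 0 alone, so the jump does no harm.\<close>

lemma tangent_spaceI_eventually:
  assumes "\<gamma> 0 = p" "p \<in> S" "\<forall>\<^sub>F t in at 0. \<gamma> t \<in> S" "(\<gamma> has_vector_derivative v) (at 0)"
  shows "v \<in> tangent_space S p"
proof -
  obtain d where d: "d > 0" "\<And>t. t \<noteq> 0 \<Longrightarrow> \<bar>t\<bar> < d \<Longrightarrow> \<gamma> t \<in> S"
    using assms(3) by (auto simp: eventually_at)
  define \<delta> where "\<delta> t = (if \<bar>t\<bar> < d then \<gamma> t else p)" for t
  have "(\<delta> has_vector_derivative v) (at 0)"
    using assms(4) unfolding has_vector_derivative_def
    by (rule has_derivative_transform_within[OF _ d(1)]) (auto simp: \<delta>_def)
  moreover have "\<delta> 0 = p" "\<forall>t. \<delta> t \<in> S" using d assms by (auto simp: \<delta>_def) (metis assms(1,2) d(2))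
  ultimately show ?thesis unfolding tangent_space_def by blast
qed

lemma curve_derivative:
  fixes f :: "'a::euclidean_space \<Rightarrow> 'b::euclidean_space"
  assumes "(f has_derivative D) (at p within S)" "\<gamma> 0 = p" "\<forall>t. \<gamma> t \<in> S"
    "(\<gamma> has_vector_derivative v) (at 0)"
  shows "((\<lambda>t. f (\<gamma> t)) has_vector_derivative D v) (at 0)"
proof -
  have "(f has_derivative D) (at (\<gamma> 0) within range \<gamma>)"
    using assms(1,2,3) by (auto intro: has_derivative_subset)
  from has_derivative_in_compose[OF assms(4)[unfolded has_vector_derivative_def] this]
  have "((\<lambda>t. f (\<gamma> t)) has_derivative (\<lambda>t. D (t *\<^sub>R v))) (at 0)" by simp
  moreover have "linear D" using assms(1) by (rule has_derivative_linear)
  ultimately show ?thesis by (simp add: has_vector_derivative_def linear_scale)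
qed

text \<open>The derivative within \<open>S\<close> is selected by choice and is ambiguous off the
  tangent directions. Every candidate gives the same derivative along a curve in \<open>S\<close>,
  so its value on a tangent vector is determined.\<close>

lemma differential_eqI:
  assumes "(f has_derivative D) (at p within S)" "v \<in> tangent_space S p"
  shows "differential S f p v = D v"
proof -
  obtain \<gamma> where \<gamma>: "\<gamma> 0 = p" "\<forall>t. \<gamma> t \<in> S" "(\<gamma> has_vector_derivative v) (at 0)"
    using assms(2) unfolding tangent_space_def by blast
  have "(f has_derivative differential S f p) (at p within S)"
    using assms(1) unfolding differential_def frechet_derivative_works[symmetric] by (rule differentiableI)
  from vector_derivative_unique_at[OF curve_derivative[OF this \<gamma>] curve_derivative[OF assms(1) \<gamma>]]
  show ?thesis .
qed

lemma smooth_on_extension: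
  assumes "smooth_on U f" "open_in S U" "x \<in> U"
  obtains W F where "open W" "x \<in> W" "\<And>k. C_k_on k W F" "W \<inter> S \<subseteq> U" "\<And>y. y \<in> W \<Longrightarrow> y \<in> S \<Longrightarrow> F y = f y"
proof -
  obtain W F where F: "open W" "x \<in> W" "\<And>k. C_k_on k W F" "\<And>y. y \<in> W \<Longrightarrow> y \<in> U \<Longrightarrow> F y = f y"
    using smooth_onE[OF assms(1,3)] by blast
  obtain Q where "open Q" "U = S \<inter> Q" using assms(2) by (auto simp: openin_open)
  then show ?thesis using F assms(3) by (intro that[of "W \<inter> Q" F]) (auto intro: C_k_on_subset)
qed

lemma has_derivative_extension:
  assumes "open W" "x \<in> W" "x \<in> S" "C_k_on (Suc 0) W F" "\<And>y. y \<in> W \<Longrightarrow> y \<in> S \<Longrightarrow> F y = f y"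
  shows "(f has_derivative frechet_derivative F (at x)) (at x within S)"
proof -
  have D: "(F has_derivative frechet_derivative F (at x)) (at x within S)"
    using C_k_on_has_derivative[OF assms(4,2)] by (rule has_derivative_at_withinI)
  obtain d where d: "d > 0" "ball x d \<subseteq> W" using assms(1,2) openE by blast
  have "F y = f y" if "y \<in> S" "dist y x < d" for y
    using that d(2) assms(5)[of y] by (auto simp: dist_commute subset_iff)
  from has_derivative_transform_within[OF D d(1) assms(3) this] show ?thesis .
qed

lemma has_derivative_differential:
  assumes "smooth_on U f" "open_in S U" "x \<in> U"
  shows "(f has_derivative differential S f x) (at x within S)"
proof -
  have "x \<in> S" using assms(2,3) openin_imp_subset by blast
  moreover obtain W F where "open W" "x \<in> W" "\<And>k. C_k_on k W F" "W \<inter> S \<subseteq> U"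
    "\<And>y. y \<in> W \<Longrightarrow> y \<in> S \<Longrightarrow> F y = f y"
    using smooth_on_extension[OF assms] by blast
  ultimately have "f differentiable (at x within S)"
    by (intro differentiableI[OF has_derivative_extension[of W x S F f]]) auto
  then show ?thesis by (simp add: differential_def frechet_derivative_works)
qed

lemma linear_differential:
  "smooth_on U f \<Longrightarrow> open_in S U \<Longrightarrow> x \<in> U \<Longrightarrow> linear (differential S f x)"
  using has_derivative_differential has_derivative_linear by blast

lemma differential_cong:
  assumes "open_in S U" "x \<in> U" "\<And>y. y \<in> U \<Longrightarrow> f y = g y"
  shows "differential S f x = differential S g x"
proof -
  have "(f has_derivative D) (at x within S) \<longleftrightarrow> (g has_derivative D) (at x within S)" for D
    unfolding at_within_openin[OF assms(1,2), symmetric]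
    using has_derivative_transform[OF assms(2), of f g] has_derivative_transform[OF assms(2), of g f] assms(3)
    by metis
  then show ?thesis by (simp add: differential_def frechet_derivative_def)
qed

lemma differential_in_tangent:
  assumes "smooth_on U f" "open_in S U" "x \<in> U" "f ` U \<subseteq> T" "v \<in> tangent_space S x"
  shows "differential S f x v \<in> tangent_space T (f x)"
proof -
  obtain \<gamma> where \<gamma>: "\<gamma> 0 = x" "\<forall>t. \<gamma> t \<in> S" "(\<gamma> has_vector_derivative v) (at 0)"
    using assms(5) unfolding tangent_space_def by blast
  obtain Q where Q: "open Q" "U = S \<inter> Q" using assms(2) by (auto simp: openin_open)
  have "(\<gamma> \<longlongrightarrow> x) (at 0)" using \<gamma>(1,3) has_vector_derivative_continuous
    by (metis continuous_within)
  then have "\<forall>\<^sub>F t in at 0. \<gamma> t \<in> Q" using Q assms(3) by (intro topological_tendstoD) auto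
  then have "\<forall>\<^sub>F t in at 0. f (\<gamma> t) \<in> T" by eventually_elim (use Q \<gamma>(2) assms(4) in auto)
  then show ?thesis
    using curve_derivative[OF has_derivative_differential[OF assms(1-3)] \<gamma>] \<gamma>(1) assms(3,4)
    by (intro tangent_spaceI_eventually[of "\<lambda>t. f (\<gamma> t)"]) auto
qed

lemma has_derivative_compose_openin:
  assumes "smooth_on U f" "open_in S U" "x \<in> U" "f ` U \<subseteq> V" "smooth_on V g" "open_in T V"
  shows "((\<lambda>x. g (f x)) has_derivative (\<lambda>v. differential T g (f x) (differential S f x v))) (at x within S)"
proof -
  have "(f has_derivative differential S f x) (at x within U)"
    using has_derivative_differential[OF assms(1-3)] by (simp add: at_within_openin[OF assms(2,3)])
  moreover have "(g has_derivative differential T g (f x)) (at (f x) within f ` U)"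
    using has_derivative_differential[OF assms(5,6), of "f x"] assms(3,4,6) openin_imp_subset
    by (blast intro: has_derivative_subset)
  ultimately show ?thesis
    unfolding at_within_openin[OF assms(2,3), symmetric] by (rule has_derivative_in_compose)
qed

lemma differential_compose:
  assumes "smooth_on U f" "open_in S U" "x \<in> U" "f ` U \<subseteq> V" "smooth_on V g" "open_in T V"
    "v \<in> tangent_space S x"
  shows "differential S (\<lambda>x. g (f x)) x v = differential T g (f x) (differential S f x v)"
  by (rule differential_eqI[OF has_derivative_compose_openin[OF assms(1-6)] assms(7)])

lemma differential_ident: "v \<in> tangent_space S x \<Longrightarrow> differential S (\<lambda>x. x) x v = v"
  by (rule differential_eqI[OF has_derivative_ident])

lemma differential_linear: "linear h \<Longrightarrow> v \<in> tangent_space S x \<Longrightarrow> differential S h x v = h v"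
  by (rule differential_eqI[OF linear_imp_has_derivative])

text \<open>The chosen derivatives within \<open>S\<close> at different points are unrelated to each
  other. Near each point a smooth extension \<open>F\<close> has smooth directional derivatives, and
  these agree with the differential of \<open>f\<close> on the tangent vectors
  \<open>A x\<close>.\<close>

lemma smooth_on_differential:
  assumes "smooth_on U f" "open_in S U" "smooth_on U A" "\<And>x. x \<in> U \<Longrightarrow> A x \<in> tangent_space S x"
  shows "smooth_on U (\<lambda>x. differential S f x (A x))"
proof (rule smooth_on_local)
  fix p assume p: "p \<in> U"
  obtain W F where F: "open W" "p \<in> W" "\<And>k. C_k_on k W F" "W \<inter> S \<subseteq> U" "\<And>y. y \<in> W \<Longrightarrow> y \<in> S \<Longrightarrow> F y = f y"
    using smooth_on_extension[OF assms(1,2) p] by blast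
  have "smooth_on W (\<lambda>x. frechet_derivative F (at x) u)" for u
  proof (rule smooth_on_openI[OF F(1) _ order_refl])
    show "C_k_on k W (\<lambda>x. frechet_derivative F (at x) u)" for k using F(3)[of "Suc k"] by simp
  qed
  then have sm: "smooth_on (U \<inter> W) (\<lambda>x. frechet_derivative F (at x) u)" for u
    by (rule smooth_on_subset) simp
  have lin: "linear (frechet_derivative F (at x))" if "x \<in> U \<inter> W" for x
    using that F(3)[of "Suc 0"] by (intro linear_frechet_derivative) simp
  have "smooth_on (U \<inter> W) (\<lambda>x. frechet_derivative F (at x) (A x))"
    by (rule smooth_on_family[OF lin sm smooth_on_subset[OF assms(3)]]) simp_all
  moreover have "frechet_derivative F (at x) (A x) = differential S f x (A x)" if "x \<in> U \<inter> W" for x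
  proof -
    have "x \<in> S" using that assms(2) openin_imp_subset by blast
    then show ?thesis
      using differential_eqI[OF has_derivative_extension[OF F(1) _ _ F(3) F(5)]] that assms(4) by force
  qed
  ultimately have "smooth_on (U \<inter> W) (\<lambda>x. differential S f x (A x))" by (rule smooth_on_cong)
  then show "\<exists>Q. open Q \<and> p \<in> Q \<and> smooth_on (U \<inter> Q) (\<lambda>x. differential S f x (A x))"
    using F by blast
qed

lemma lie_bracket_cong:
  assumes "open_in S U" "x \<in> U" "\<And>y. y \<in> U \<Longrightarrow> A y = A' y" "\<And>y. y \<in> U \<Longrightarrow> B y = B' y"
  shows "lie_bracket S A B x = lie_bracket S A' B' x"
  using differential_cong[OF assms(1,2,3)] differential_cong[OF assms(1,2,4)] assms(2-4)
  by (simp add: lie_bracket_def)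

text \<open>The second derivatives of \<open>f\<close> cancel by symmetry.\<close>

lemma lie_bracket_related:
  assumes f: "smooth_on U f" "open_in S U" "x \<in> U" "f ` U \<subseteq> V" "open_in T V"
    and A: "\<And>i::bool. smooth_on U (A i)" "\<And>i y. y \<in> U \<Longrightarrow> A i y \<in> tangent_space S y"
    and B: "\<And>i. smooth_on V (B i)" "\<And>i y. y \<in> U \<Longrightarrow> B i (f y) = differential S f y (A i y)"
    and tan: "lie_bracket S (A False) (A True) x \<in> tangent_space S x"
  shows "lie_bracket T (B False) (B True) (f x) = differential S f x (lie_bracket S (A False) (A True) x)"
proof -
  obtain W F where F: "open W" "x \<in> W" "\<And>k. C_k_on k W F" "W \<inter> S \<subseteq> U" "\<And>y. y \<in> W \<Longrightarrow> y \<in> S \<Longrightarrow> F y = f y"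
    using smooth_on_extension[OF f(1-3)] by blast
  have xS: "x \<in> S" using f(2,3) openin_imp_subset by blast
  let ?D = "\<lambda>y. frechet_derivative F (at y)"
  have dF: "differential S f y v = ?D y v" if "y \<in> W" "y \<in> S" "v \<in> tangent_space S y" for y v
    using differential_eqI[OF has_derivative_extension[OF F(1) that(1,2) F(3,5)] that(3)] .
  have lin: "linear (?D y)" if "y \<in> W" for y
    using F(3)[of "Suc 0"] that by (intro linear_frechet_derivative) auto
  define D2 where "D2 u = frechet_derivative (\<lambda>y. ?D y u) (at x)" for u
  have D2: "((\<lambda>y. ?D y u) has_derivative D2 u) (at x)" for u
    unfolding D2_def using F(2) F(3)[of "Suc (Suc 0)"] by (intro C_k_on_has_derivative[of 0 W]) auto
  have sym: "D2 u w = D2 w u" for u w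
    unfolding D2_def using symmetric_second_derivative[OF F(1,3,2)] .
  \<comment> \<open>Two expressions for the derivative of \<open>y \<mapsto> B i (f y)\<close> along
    \<open>S\<close>: the chain rule, and the product rule applied to
    \<open>?D y (A i y)\<close>.\<close>
  have key: "differential T (B i) (f x) (differential S f x v) =
      D2 (A i x) v + ?D x (differential S (A i) x v)" if v: "v \<in> tangent_space S x" for i v
  proof -
    have "((\<lambda>y. ?D y (A i y)) has_derivative
        (\<lambda>h. D2 (A i x) h + ?D x (differential S (A i) x h))) (at x within S)"
      by (rule has_derivative_family[where f="\<lambda>x. x", OF lin F(1,2) D2 has_derivative_ident
            has_derivative_differential[OF A(1) f(2,3)] xS])
    moreover obtain d where d: "d > 0" "ball x d \<subseteq> W" using F(1,2) openE by blast
    moreover have "?D y (A i y) = B i (f y)" if "y \<in> S" "dist y x < d" for y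
      using that d F(4) B(2) A(2) dF by (auto simp: dist_commute subset_iff)
    ultimately have "((\<lambda>y. B i (f y)) has_derivative
        (\<lambda>h. D2 (A i x) h + ?D x (differential S (A i) x h))) (at x within S)"
      by - (rule has_derivative_transform_within[OF _ d(1) xS])
    from differential_eqI[OF this v] show ?thesis
      using differential_compose[OF f(1-4) B(1) f(5) v, of i] by simp
  qed
  have "lie_bracket T (B False) (B True) (f x) =
      ?D x (differential S (A True) x (A False x)) - ?D x (differential S (A False) x (A True x))"
    unfolding lie_bracket_def B(2)[OF f(3)] key[OF A(2)[OF f(3)]]
    by (simp add: sym[of "A True x" "A False x"])
  also have "\<dots> = ?D x (lie_bracket S (A False) (A True) x)"
    by (simp add: lie_bracket_def linear_diff[OF lin[OF F(2)]])
  finally show ?thesis using dF[OF F(2) xS tan] by simp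
qed

lemma sections_subset:
  "A \<in> sections U E \<Longrightarrow> U' \<subseteq> U \<Longrightarrow> (\<And>x. x \<in> U' \<Longrightarrow> E x \<subseteq> E' x) \<Longrightarrow> A \<in> sections U' E'"
  unfolding sections_def by (auto intro: smooth_on_subset)

lemma sections_cong:
  "A \<in> sections U E \<Longrightarrow> (\<And>x. x \<in> U \<Longrightarrow> A x = B x) \<Longrightarrow> B \<in> sections U E"
  unfolding sections_def by (auto intro: smooth_on_cong)

lemma linear_projection:
  fixes V :: "'a::euclidean_space set"
  assumes "subspace V"
  obtains P :: "'a \<Rightarrow> 'a" where "linear P" "\<And>x. P x \<in> V" "\<And>x. x \<in> V \<Longrightarrow> P x = x"
proof -
  have "\<exists>g. range g \<subseteq> span V \<and> linear g \<and> (\<forall>x\<in>span V. g (id x) = x)"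
    by (intro linear_inj_on_left_inverse linear_id) simp
  then show ?thesis using assms that by (auto simp: span_eq_iff[THEN iffD2])
qed

section \<open>Manifolds with involutive tangent spaces\<close>

text \<open>Embedded submanifolds have both properties. Here they are established for linear
  subspaces and for whatever is locally diffeomorphic to one, which avoids working in adapted
  charts.\<close>

definition tangent_closed :: "'a::euclidean_space set \<Rightarrow> bool" where
  "tangent_closed S \<longleftrightarrow> (\<forall>x\<in>S. subspace (tangent_space S x)) \<and>
     (\<forall>U A B. open_in S U \<and> A \<in> sections U (tangent_space S) \<and> B \<in> sections U (tangent_space S) \<longrightarrow>
        (\<forall>x\<in>U. lie_bracket S A B x \<in> tangent_space S x))"

lemma tangent_closed_bracket:
  assumes "tangent_closed S" "open_in S U" "x \<in> U"
    "A \<in> sections U (tangent_space S)" "B \<in> sections U (tangent_space S)"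
  shows "lie_bracket S A B x \<in> tangent_space S x"
  using assms by (simp add: tangent_closed_def)

lemma tangent_space_subspace:
  fixes V :: "'a::euclidean_space set"
  assumes "subspace V" "x \<in> V" shows "tangent_space V x = V"
proof
  show "tangent_space V x \<subseteq> V"
  proof
    fix v assume "v \<in> tangent_space V x"
    then obtain \<gamma> where \<gamma>: "\<gamma> 0 = x" "\<forall>t. \<gamma> t \<in> V" "(\<gamma> has_vector_derivative v) (at 0)"
      unfolding tangent_space_def by blast
    obtain P where P: "linear P" "\<And>x. P x \<in> V" "\<And>x. x \<in> V \<Longrightarrow> P x = x"
      using linear_projection[OF assms(1)] by blast
    \<comment> \<open>A projection onto \<open>V\<close> fixes the curve, hence also its
      velocity.\<close>
    have "((\<lambda>t. P (\<gamma> t)) has_vector_derivative P v) (at 0)"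
      by (rule curve_derivative[OF linear_imp_has_derivative[OF P(1)] \<gamma>])
    then have "P v = v" using \<gamma>(2,3) P(3) vector_derivative_unique_at by auto
    then show "v \<in> V" using P(2) by metis
  qed
  show "V \<subseteq> tangent_space V x"
  proof
    fix v assume "v \<in> V"
    then have "\<forall>t. x + t *\<^sub>R v \<in> V" using assms by (simp add: subspace_add subspace_scale)
    moreover have "((\<lambda>t. x + t *\<^sub>R v) has_vector_derivative v) (at 0)"
      by (auto intro!: derivative_eq_intros)
    ultimately show "v \<in> tangent_space V x"
      unfolding tangent_space_def by (intro CollectI exI[of _ "\<lambda>t. x + t *\<^sub>R v"]) simp
  qed
qed

lemma differential_in_subspace:
  fixes V :: "'a::euclidean_space set"
  assumes "smooth_on U f" "open_in S U" "x \<in> U" "subspace W" "\<And>x. x \<in> U \<Longrightarrow> f x \<in> W" "v \<in> tangent_space S x"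
  shows "differential S f x v \<in> W"
  using differential_in_tangent[OF assms(1-3) _ assms(6), of W] tangent_space_subspace[OF assms(4)] assms(3,5)
  by blast

lemma tangent_closed_subspace:
  assumes "subspace V" shows "tangent_closed V"
proof -
  have brk: "lie_bracket V A B x \<in> tangent_space V x"
    if "open_in V U" "A \<in> sections U (tangent_space V)" "B \<in> sections U (tangent_space V)" "x \<in> U" for U A B x
  proof -
    have x: "x \<in> V" and U: "U \<subseteq> V" using that openin_imp_subset by blast+
    have "\<And>y. y \<in> U \<Longrightarrow> A y \<in> V" "\<And>y. y \<in> U \<Longrightarrow> B y \<in> V" "smooth_on U A" "smooth_on U B"
      using that(2,3) U tangent_space_subspace[OF assms] unfolding sections_def by blast+
    then have "differential V B x (A x) \<in> V" "differential V A x (B x) \<in> V"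
      using that(1,4) x tangent_space_subspace[OF assms x]
      by (auto intro!: differential_in_subspace[OF _ that(1,4) assms])
    then show ?thesis
      using assms tangent_space_subspace[OF assms x] by (simp add: lie_bracket_def subspace_diff)
  qed
  have "\<forall>x\<in>V. subspace (tangent_space V x)"
    using tangent_space_subspace[OF assms] assms by simp
  then show ?thesis unfolding tangent_closed_def
    by (intro conjI allI impI ballI brk; (elim conjE)?; assumption?) simp
qed

locale local_diffeo =
  fixes S :: "'a::euclidean_space set" and T :: "'b::euclidean_space set"
    and U V and f :: "'a \<Rightarrow> 'b" and g
  assumes openU: "open_in S U" and openV: "open_in T V" and image: "f ` U = V"
    and inv: "\<And>x. x \<in> U \<Longrightarrow> g (f x) = x" and smf: "smooth_on U f" and smg: "smooth_on V g"
begin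

lemma sym: "local_diffeo T S V U g f"
  using openU openV smf smg by unfold_locales (use image inv in force)+

lemma US: "U \<subseteq> S" and VT: "V \<subseteq> T"
  using openU openV openin_imp_subset by blast+

lemma fV: "x \<in> U \<Longrightarrow> f x \<in> V" using image by blast

lemma openin_sub: "open_in S U' \<Longrightarrow> U' \<subseteq> U \<Longrightarrow> open_in T (f ` U')"
proof -
  assume U': "open_in S U'" "U' \<subseteq> U"
  have "f ` U' = V \<inter> g -` U'" using U'(2) image inv by force
  moreover have "open_in V (V \<inter> g -` U')"
  proof (rule continuous_openin_preimage)
    show "continuous_on V g" using smooth_on_continuous[OF smg] .
    show "g \<in> V \<rightarrow> S" using image inv US by auto
  qed (rule U'(1))
  ultimately show ?thesis using openV openin_trans by metis
qed

lemma sub: "open_in S U' \<Longrightarrow> U' \<subseteq> U \<Longrightarrow> local_diffeo S T U' (f ` U') f g"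
  using openin_sub inv image smooth_on_subset[OF smf, of U'] smooth_on_subset[OF smg, of "f ` U'"]
  by unfold_locales auto

lemma df_tangent: "x \<in> U \<Longrightarrow> v \<in> tangent_space S x \<Longrightarrow> differential S f x v \<in> tangent_space T (f x)"
  using differential_in_tangent[OF smf openU] image VT by blast

lemma linear_df: "x \<in> U \<Longrightarrow> linear (differential S f x)"
  by (rule linear_differential[OF smf openU])

lemma dgdf:
  assumes "x \<in> U" "v \<in> tangent_space S x"
  shows "differential T g (f x) (differential S f x v) = v"
proof -
  have "differential T g (f x) (differential S f x v) = differential S (\<lambda>x. g (f x)) x v"
    using differential_compose[OF smf openU assms(1) _ smg openV assms(2)] image by simp
  also have "\<dots> = differential S (\<lambda>x. x) x v"
    using differential_cong[OF openU assms(1), of "\<lambda>x. g (f x)" "\<lambda>x. x"] inv by simp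
  finally show ?thesis using differential_ident[OF assms(2)] by simp
qed

lemma df_inj: "x \<in> U \<Longrightarrow> inj_on (differential S f x) (tangent_space S x)"
  by (rule inj_on_inverseI[of _ "differential T g (f x)"]) (rule dgdf)

definition push :: "('a \<Rightarrow> 'a) \<Rightarrow> 'b \<Rightarrow> 'b" where
  "push A y = differential S f (g y) (A (g y))"

lemma push_at: "x \<in> U \<Longrightarrow> push A (f x) = differential S f x (A x)"
  by (simp add: push_def inv)

lemma push_smooth:
  assumes "A \<in> sections U' (tangent_space S)" "open_in S U'" "U' \<subseteq> U"
  shows "smooth_on (f ` U') (push A)"
proof -
  interpret s: local_diffeo S T U' "f ` U'" f g by (rule sub[OF assms(2,3)])
  have "smooth_on U' (\<lambda>x. differential S f x (A x))"
    using assms by (intro smooth_on_differential[OF s.smf assms(2)]) (auto simp: sections_def)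
  moreover have "g ` (f ` U') \<subseteq> U'" using s.inv by auto
  ultimately show ?thesis
    unfolding push_def[abs_def] by (rule smooth_on_compose[OF s.smg])
qed

lemma push_sections:
  assumes "A \<in> sections U' E" "open_in S U'" "U' \<subseteq> U" "\<And>x. x \<in> U' \<Longrightarrow> E x \<subseteq> tangent_space S x"
    "\<And>x. x \<in> U' \<Longrightarrow> differential S f x ` E x \<subseteq> E' (f x)"
  shows "push A \<in> sections (f ` U') E'"
proof -
  have "A \<in> sections U' (tangent_space S)" using sections_subset[OF assms(1) order_refl] assms(4) .
  from push_smooth[OF this assms(2,3)] show ?thesis
    using assms(1,3,5) push_at by (force simp: sections_def)
qed

lemma push_push:
  assumes "y \<in> V" "A y \<in> tangent_space T y"
  shows "push (local_diffeo.push T g f A) y = A y"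
proof -
  interpret s: local_diffeo T S V U g f by (rule sym)
  have "push (s.push A) y = differential S f (g y) (differential T g y (A y))"
    using s.inv[OF assms(1)] by (simp add: push_def s.push_def)
  then show ?thesis using s.dgdf assms by simp
qed

lemma bracket_push:
  assumes "tangent_closed S" "A \<in> sections U' (tangent_space S)" "B \<in> sections U' (tangent_space S)"
    "open_in S U'" "U' \<subseteq> U" "x \<in> U'"
  shows "lie_bracket T (push A) (push B) (f x) = differential S f x (lie_bracket S A B x)"
proof -
  \<comment> \<open>\<open>lie_bracket_related\<close> handles both fields by one Boolean index;
    \<open>False\<close> selects the first argument of the bracket.\<close>
  let ?A = "\<lambda>i::bool. if i then B else A"
  have "lie_bracket T (push (?A False)) (push (?A True)) (f x) =
      differential S f x (lie_bracket S (?A False) (?A True) x)"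
  proof (rule lie_bracket_related[where A="?A" and B="\<lambda>i. push (?A i)"])
    show "smooth_on U' f" using smooth_on_subset[OF smf assms(5)] .
    show "open_in S U'" "x \<in> U'" "f ` U' \<subseteq> f ` U'" "open_in T (f ` U')"
      using assms openin_sub by auto
    show "smooth_on U' (?A i)" for i using assms(2,3) by (simp add: sections_def)
    show "?A i y \<in> tangent_space S y" if "y \<in> U'" for i y
      using assms(2,3) that by (simp add: sections_def)
    show "smooth_on (f ` U') (push (?A i))" for i
      using push_smooth assms by simp
    show "push (?A i) (f y) = differential S f y (?A i y)" if "y \<in> U'" for i y
      using push_at that assms(5) by blast
    show "lie_bracket S (?A False) (?A True) x \<in> tangent_space S x"
      using tangent_closed_bracket[OF assms(1,4,6,2,3)] by simp
  qed
  then show ?thesis by simp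
qed

lemma df_onto: "x \<in> U \<Longrightarrow> differential S f x ` tangent_space S x = tangent_space T (f x)"
proof -
  assume x: "x \<in> U"
  interpret s: local_diffeo T S V U g f by (rule sym)
  show ?thesis
  proof
    show "tangent_space T (f x) \<subseteq> differential S f x ` tangent_space S x"
      using s.df_tangent[OF fV[OF x]] s.dgdf[OF fV[OF x]] inv[OF x] by (metis imageI subsetI)
  qed (use df_tangent x in blast)
qed

end

text \<open>\<open>bracket_push\<close> needs involutivity on the side where the fields start, and
  this is known for \<open>T\<close> alone. So the fields are pushed to \<open>T\<close> and back:
  the bracket on \<open>S\<close> is the image under the differential of \<open>g\<close> of a
  bracket computed on \<open>T\<close>.\<close>

lemma tangent_closed_transport:
  assumes T: "tangent_closed T"
    and "\<And>x. x \<in> S \<Longrightarrow> \<exists>U V f g. local_diffeo S T U V f g \<and> x \<in> U"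
  shows "tangent_closed S"
  unfolding tangent_closed_def
proof (intro conjI ballI allI impI)
  fix x assume "x \<in> S"
  then obtain U V f g where d: "local_diffeo S T U V f g" "x \<in> U" using assms(2) by blast
  interpret s: local_diffeo T S V U g f by (rule local_diffeo.sym[OF d(1)])
  have "subspace (tangent_space T (f x))" using T s.US s.image d s.sym
    unfolding tangent_closed_def by (metis imageI local_diffeo.image subsetD)
  then have "subspace (differential T g (f x) ` tangent_space T (f x))"
    using local_diffeo.fV[OF d] by (intro linear_subspace_image s.linear_df)
  then show "subspace (tangent_space S x)"
    using s.df_onto[OF local_diffeo.fV[OF d]] local_diffeo.inv[OF d] by simp
next
  fix Q A B x
  assume Q: "open_in S Q \<and> A \<in> sections Q (tangent_space S) \<and> B \<in> sections Q (tangent_space S)" and x: "x \<in> Q"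
  then have "x \<in> S" using openin_imp_subset by blast
  then obtain U V f g where d: "local_diffeo S T U V f g" "x \<in> U" using assms(2) by blast
  interpret d: local_diffeo S T U V f g by (rule d(1))
  let ?U = "Q \<inter> U"
  have U: "open_in S ?U" "?U \<subseteq> U" "x \<in> ?U" using Q d.openU x d(2) by auto
  interpret e: local_diffeo S T ?U "f ` ?U" f g by (rule d.sub[OF U(1,2)])
  interpret s: local_diffeo T S "f ` ?U" ?U g f by (rule e.sym)
  have AB: "A \<in> sections ?U (tangent_space S)" "B \<in> sections ?U (tangent_space S)"
    using Q by (auto intro: sections_subset)
  have p: "e.push A \<in> sections (f ` ?U) (tangent_space T)" "e.push B \<in> sections (f ` ?U) (tangent_space T)"
    using AB e.df_tangent by (auto intro!: e.push_sections[of _ _ "tangent_space S"] U)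
  have fx: "f x \<in> f ` ?U" using U by blast
  have "lie_bracket S (s.push (e.push A)) (s.push (e.push B)) (g (f x)) =
      differential T g (f x) (lie_bracket T (e.push A) (e.push B) (f x))"
    by (rule s.bracket_push[OF T p s.openU order_refl fx])
  moreover have "lie_bracket T (e.push A) (e.push B) (f x) \<in> tangent_space T (f x)"
    by (rule tangent_closed_bracket[OF T s.openU fx p])
  ultimately have "lie_bracket S (s.push (e.push A)) (s.push (e.push B)) x \<in> tangent_space S x"
    using s.df_tangent[OF fx] e.inv[OF U(3)] by simp
  moreover have "s.push (e.push C) y = C y" if "y \<in> ?U" "C \<in> sections ?U (tangent_space S)" for C y
    using s.push_push[of y C] that by (auto simp: sections_def)
  ultimately show "lie_bracket S A B x \<in> tangent_space S x"
    using lie_bracket_cong[OF U(1,3), of A "s.push (e.push A)" B "s.push (e.push B)"] AB by simp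
qed

section \<open>Transport of CR data along local equivalences\<close>

text \<open>What transport of brackets and flags relies on. Involutivity of the tangent spaces has
  to be added to the conditions of \<open>cr_manifold\<close>, while dimensions are left out because
  \<open>cr_manifold_transport\<close> obtains them for the quadric only afterwards.\<close>

definition cr_regular :: "'a::euclidean_space cr \<Rightarrow> bool" where
  "cr_regular X \<longleftrightarrow> tangent_closed (points X) \<and>
     (\<forall>x\<in>points X. subspace (distr X x) \<and> distr X x \<subseteq> tangent_space (points X) x) \<and>
     (\<forall>x\<in>points X. \<forall>v\<in>distr X x. cplx X x v \<in> distr X x) \<and>
     (\<forall>U A. open_in (points X) U \<and> A \<in> sections U (distr X) \<longrightarrow> smooth_on U (\<lambda>x. cplx X x (A x)))"

lemma cr_regularI: "cr_manifold X \<Longrightarrow> tangent_closed (points X) \<Longrightarrow> cr_regular X"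
  unfolding cr_regular_def cr_manifold_def smooth_distribution_def by (elim conjE, intro conjI) simp_all

lemma cr_regular_closed: "cr_regular X \<Longrightarrow> tangent_closed (points X)"
  by (simp add: cr_regular_def)

text \<open>Induction along the flag: involutivity of the tangent spaces keeps every new bracket
  tangent.\<close>

lemma weak_flag_regular:
  assumes X: "cr_regular X"
  shows "x \<in> points X \<Longrightarrow> subspace (weak_flag X k x) \<and> weak_flag X k x \<subseteq> tangent_space (points X) x"
proof (induction k arbitrary: x)
  case 0
  then show ?case using X by (auto simp: cr_regular_def tangent_closed_def subspace_0)
next
  case (Suc k)
  have sub: "subspace (tangent_space (points X) x)"
    using X Suc.prems by (auto simp: cr_regular_def tangent_closed_def)
  show ?case
  proof (cases k)
    case 0
    then show ?thesis using X Suc.prems by (auto simp: cr_regular_def)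
  next
    case (Suc j)
    have "lie_bracket (points X) A B x \<in> tangent_space (points X) x"
      if "open_in (points X) U" "x \<in> U" "A \<in> sections U (distr X)" "B \<in> sections U (weak_flag X k)" for A B U
    proof -
      have U: "U \<subseteq> points X" using that(1) openin_imp_subset by blast
      have "A \<in> sections U (tangent_space (points X))"
        by (rule sections_subset[OF that(3)]) (use X U in \<open>auto simp: cr_regular_def\<close>)
      moreover have "B \<in> sections U (tangent_space (points X))"
        by (rule sections_subset[OF that(4)]) (use Suc.IH U in auto)
      ultimately show ?thesis
        by (rule tangent_closed_bracket[OF cr_regular_closed[OF X] that(1,2)])
    qed
    then have "{lie_bracket (points X) A B x | A B U. open_in (points X) U \<and> x \<in> U \<and>
        A \<in> sections U (distr X) \<and> B \<in> sections U (weak_flag X k)} \<subseteq> tangent_space (points X) x"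
      by (intro subsetI) (elim CollectE exE conjE, simp only:)
    then have "span (weak_flag X k x \<union> {lie_bracket (points X) A B x | A B U. open_in (points X) U \<and> x \<in> U \<and>
        A \<in> sections U (distr X) \<and> B \<in> sections U (weak_flag X k)}) \<subseteq> tangent_space (points X) x"
      using Suc.IH[OF Suc.prems] sub by (intro span_minimal Un_least) simp_all
    then show ?thesis unfolding Suc weak_flag.simps by (simp add: subspace_span)
  qed
qed

locale cr_iso = local_diffeo "points X" "points Y" U V f g
  for X :: "'a::euclidean_space cr" and Y :: "'b::euclidean_space cr" and U V f g +
  assumes distr: "\<And>x. x \<in> U \<Longrightarrow> differential (points X) f x ` distr X x = distr Y (f x)"
    and cplx: "\<And>x v. x \<in> U \<Longrightarrow> v \<in> distr X x \<Longrightarrow>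
      differential (points X) f x (cplx X x v) = cplx Y (f x) (differential (points X) f x v)"
    and regX: "cr_regular X" and regY: "cr_regular Y"
begin

lemma distr_tangent: "x \<in> U \<Longrightarrow> v \<in> distr X x \<Longrightarrow> v \<in> tangent_space (points X) x"
  using regX US unfolding cr_regular_def by blast

lemma cplx_distr: "x \<in> U \<Longrightarrow> v \<in> distr X x \<Longrightarrow> cplx X x v \<in> distr X x"
  using regX US unfolding cr_regular_def by blast

lemma cr_sym: "cr_iso Y X V U g f"
proof -
  interpret s: local_diffeo "points Y" "points X" V U g f by (rule sym)
  show ?thesis
  proof
    fix y assume y: "y \<in> V"
    then obtain x where x: "x \<in> U" "y = f x" using image by blast
    show "differential (points Y) g y ` distr Y y = distr X (g y)"
      using distr[OF x(1)] dgdf[OF x(1) distr_tangent[OF x(1)]] inv[OF x(1)]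
      unfolding x(2) by (force simp: image_iff)
    fix w assume "w \<in> distr Y y"
    then obtain v where v: "v \<in> distr X x" "w = differential (points X) f x v"
      using distr[OF x(1)] x(2) by blast
    show "differential (points Y) g y (cplx Y y w) = cplx X (g y) (differential (points Y) g y w)"
      using cplx[OF x(1) v(1)] dgdf[OF x(1) distr_tangent[OF x(1)]] v cplx_distr[OF x(1) v(1)] inv[OF x(1)]
      by (simp add: x(2) v(2) flip: cplx[OF x(1) v(1)])
  qed (rule regX regY)+
qed

lemma cr_sub: "open_in (points X) U' \<Longrightarrow> U' \<subseteq> U \<Longrightarrow> cr_iso X Y U' (f ` U') f g"
  using sub[of U'] distr cplx regX regY
  by (auto intro!: cr_iso.intro cr_iso_axioms.intro)

text \<open>A section near \<open>x\<close> is restricted to the domain of \<open>f\<close> and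
  pushed forward; naturality of the bracket carries the generators of one flag to those of the
  other. Equality follows in \<open>weak_flag_image\<close> by applying this to the inverse.\<close>

lemma weak_flag_image_subset:
  "x \<in> U \<Longrightarrow> differential (points X) f x ` weak_flag X k x \<subseteq> weak_flag Y k (f x)"
proof (induction k arbitrary: x)
  case 0
  then show ?case using linear_df by (auto simp: linear_0)
next
  case (Suc k)
  show ?case
  proof (cases k)
    case 0
    then show ?thesis using distr Suc.prems by auto
  next
    case (Suc j)
    let ?d = "differential (points X) f x"
    have "?d (lie_bracket (points X) A B x) \<in> weak_flag Y (Suc k) (f x)"
      if O: "open_in (points X) O'" "x \<in> O'" "A \<in> sections O' (distr X)" "B \<in> sections O' (weak_flag X k)" for A B O'
    proof -
      let ?U = "O' \<inter> U"
      have U: "open_in (points X) ?U" "?U \<subseteq> U" "x \<in> ?U" using O(1,2) openU Suc.prems by auto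
      have A: "A \<in> sections ?U (distr X)" "B \<in> sections ?U (weak_flag X k)"
        using O(3,4) by (auto intro: sections_subset)
      have wf: "weak_flag X k y \<subseteq> tangent_space (points X) y" if "y \<in> ?U" for y
        using weak_flag_regular[OF regX] that US by blast
      have dt: "distr X y \<subseteq> tangent_space (points X) y" if "y \<in> ?U" for y
        using distr_tangent that by blast
      have "push A \<in> sections (f ` ?U) (distr Y)"
        using distr by (intro push_sections[OF A(1) U(1,2) dt]) auto
      moreover have "push B \<in> sections (f ` ?U) (weak_flag Y k)"
        using Suc.IH by (intro push_sections[OF A(2) U(1,2) wf]) auto
      moreover have "open_in (points Y) (f ` ?U)" "f x \<in> f ` ?U" using openin_sub[OF U(1,2)] U(3) by auto
      moreover have "?d (lie_bracket (points X) A B x) = lie_bracket (points Y) (push A) (push B) (f x)"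
        using regX U dt wf unfolding cr_regular_def
        by (intro bracket_push[symmetric, of _ ?U] sections_subset[OF A(1)] sections_subset[OF A(2)]) auto
      ultimately show ?thesis unfolding Suc weak_flag.simps
        by (intro span_base UnI2 CollectI exI[of _ "push A"] exI[of _ "push B"] exI[of _ "f ` ?U"]) (simp add: Suc)
    qed
    moreover have "?d v \<in> weak_flag Y (Suc k) (f x)" if "v \<in> weak_flag X k x" for v
      using Suc.IH[OF Suc.prems] that unfolding Suc weak_flag.simps by (intro span_base) auto
    ultimately have "?d ` (weak_flag X k x \<union> {lie_bracket (points X) A B x | A B U.
        open_in (points X) U \<and> x \<in> U \<and> A \<in> sections U (distr X) \<and> B \<in> sections U (weak_flag X k)})
        \<subseteq> weak_flag Y (Suc k) (f x)"
      by (intro image_subsetI) (elim UnE CollectE exE conjE, simp_all only:)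
    moreover have "subspace (weak_flag Y (Suc k) (f x))"
      using weak_flag_regular[OF regY] fV[OF Suc.prems] VT by blast
    ultimately show ?thesis
      unfolding Suc weak_flag.simps(3)[of X]
      by (subst linear_span_image[OF linear_df[OF Suc.prems], symmetric]) (intro span_minimal; simp only: Suc)
  qed
qed

lemma weak_flag_image:
  assumes x: "x \<in> U" shows "differential (points X) f x ` weak_flag X k x = weak_flag Y k (f x)"
proof
  interpret s: cr_iso Y X V U g f by (rule cr_sym)
  show "weak_flag Y k (f x) \<subseteq> differential (points X) f x ` weak_flag X k x"
  proof
    fix w assume w: "w \<in> weak_flag Y k (f x)"
    then have "differential (points Y) g (f x) w \<in> weak_flag X k x"
      using s.weak_flag_image_subset[OF fV[OF x], of k] inv[OF x] by auto
    moreover have "w \<in> tangent_space (points Y) (f x)"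
      using w weak_flag_regular[OF regY] fV[OF x] VT by blast
    then have "differential (points X) f x (differential (points Y) g (f x) w) = w"
      using s.dgdf[OF fV[OF x], of w] inv[OF x] by simp
    ultimately show "w \<in> differential (points X) f x ` weak_flag X k x" by (metis imageI)
  qed
qed (rule weak_flag_image_subset[OF x])

lemma dim_weak_flag: "x \<in> U \<Longrightarrow> dim (weak_flag Y k (f x)) = dim (weak_flag X k x)"
proof -
  assume x: "x \<in> U"
  have w: "subspace (weak_flag X k x)" "weak_flag X k x \<subseteq> tangent_space (points X) x"
    using weak_flag_regular[OF regX] x US by blast+
  then have "inj_on (differential (points X) f x) (span (weak_flag X k x))"
    using inj_on_subset[OF df_inj[OF x]] by (simp add: span_eq_iff[THEN iffD2])
  then show ?thesis
    using dim_image_eq[OF linear_df[OF x]] weak_flag_image[OF x, of k] by metis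
qed

end

lemma cr_regular_distr:
  "cr_regular X \<Longrightarrow> x \<in> points X \<Longrightarrow> subspace (distr X x) \<and> distr X x \<subseteq> tangent_space (points X) x"
  by (simp add: cr_regular_def)

lemma (in cr_iso) section_tangent:
  assumes "B \<in> sections Q (weak_flag X k)" "Q \<subseteq> points X"
  shows "B \<in> sections Q (tangent_space (points X))"
  by (rule sections_subset[OF assms(1) order_refl]) (use weak_flag_regular[OF regX] assms(2) in blast)

text \<open>The quotient maps of the symbol at \<open>x\<close> are precomposed with the
  differential of the inverse at \<open>f x\<close>, so the very same \<open>gr\<close> and
  \<open>br\<close> serve as symbol at the image point.\<close>

lemma (in cr_iso) is_symbol_transport:
  assumes x: "x \<in> U" and "is_symbol X x gr br"
  shows "is_symbol Y (f x) gr br"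
proof -
  interpret s: cr_iso Y X V U g f by (rule cr_sym)
  let ?d = "differential (points Y) g (f x)" and ?e = "differential (points X) f x"
  have y: "f x \<in> V" "f x \<in> points Y" "x \<in> points X" using fV[OF x] VT US x by blast+
  have flag: "?d ` weak_flag Y k (f x) = weak_flag X k x" for k
    using s.weak_flag_image[OF y(1)] inv[OF x] by simp
  have ed: "?e (?d v) = v" if "v \<in> tangent_space (points Y) (f x)" for v
    using s.dgdf[OF y(1) that] inv[OF x] by simp
  have wt: "weak_flag Y k (f x) \<subseteq> tangent_space (points Y) (f x)" for k
    using weak_flag_regular[OF regY y(2)] by blast
  \<comment> \<open>Membership in the flag can be tested after applying the differential of
    \<open>g\<close>, since the differential of \<open>f\<close> undoes it on tangent
    vectors.\<close>
  have flag_iff: "?d v \<in> weak_flag X k x \<longleftrightarrow> v \<in> weak_flag Y k (f x)" if "v \<in> tangent_space (points Y) (f x)" for v k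
    using ed[OF that] weak_flag_image[OF x, of k] flag[of k] by (metis imageI)
  obtain \<sigma> where lin: "\<And>k. linear (\<sigma> k)"
    and im: "\<And>k. \<sigma> (Suc k) ` weak_flag X (Suc k) x = gr (Suc k)"
    and ker: "\<And>k. {v \<in> weak_flag X (Suc k) x. \<sigma> (Suc k) v = 0} = weak_flag X k x"
    and brk: "\<And>i j Q A B. i \<ge> 1 \<Longrightarrow> j \<ge> 1 \<Longrightarrow> open_in (points X) Q \<Longrightarrow> x \<in> Q \<Longrightarrow>
        A \<in> sections Q (weak_flag X i) \<Longrightarrow> B \<in> sections Q (weak_flag X j) \<Longrightarrow>
        lie_bracket (points X) A B x \<in> weak_flag X (i + j) x \<and>
        \<sigma> (i + j) (lie_bracket (points X) A B x) = br (\<sigma> i (A x)) (\<sigma> j (B x))"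
    using assms(2) unfolding is_symbol_def by (elim conjE exE) blast
  define \<tau> where "\<tau> k v = \<sigma> k (?d v)" for k v
  have 1: "linear (\<tau> k)" for k
    unfolding \<tau>_def[abs_def] using linear_compose[OF s.linear_df[OF y(1)] lin] by (simp add: o_def)
  have 2: "\<tau> (Suc k) ` weak_flag Y (Suc k) (f x) = gr (Suc k)" for k
    unfolding \<tau>_def im[symmetric] flag[symmetric, of "Suc k"] by (simp add: image_image)
  have 3: "{v \<in> weak_flag Y (Suc k) (f x). \<tau> (Suc k) v = 0} = weak_flag Y k (f x)" for k
  proof -
    have "v \<in> weak_flag Y (Suc k) (f x) \<and> \<tau> (Suc k) v = 0 \<longleftrightarrow> v \<in> weak_flag Y k (f x)"
      if "v \<in> tangent_space (points Y) (f x)" for v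
      unfolding flag_iff[OF that, symmetric] ker[symmetric, of k] \<tau>_def by simp
    then show ?thesis using wt by blast
  qed
  have 4: "lie_bracket (points Y) A B (f x) \<in> weak_flag Y (i + j) (f x) \<and>
      \<tau> (i + j) (lie_bracket (points Y) A B (f x)) = br (\<tau> i (A (f x))) (\<tau> j (B (f x)))"
    if ij: "i \<ge> 1" "j \<ge> 1" and Q: "open_in (points Y) Q" "f x \<in> Q"
      and A: "A \<in> sections Q (weak_flag Y i)" and B: "B \<in> sections Q (weak_flag Y j)" for i j Q A B
  proof -
    let ?Q = "Q \<inter> V"
    have Q': "open_in (points Y) ?Q" "?Q \<subseteq> V" "f x \<in> ?Q" "?Q \<subseteq> points Y" using Q openV y VT by auto
    have A': "A \<in> sections ?Q (weak_flag Y i)" and B': "B \<in> sections ?Q (weak_flag Y j)"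
      using A B by (auto intro: sections_subset)
    have wt': "weak_flag Y k z \<subseteq> tangent_space (points Y) z" if "z \<in> ?Q" for z k
      using weak_flag_regular[OF regY] that Q'(4) by blast
    have pA: "s.push A \<in> sections (g ` ?Q) (weak_flag X i)"
      by (rule s.push_sections[OF A' Q'(1,2) wt']) (use s.weak_flag_image in auto)
    have pB: "s.push B \<in> sections (g ` ?Q) (weak_flag X j)"
      by (rule s.push_sections[OF B' Q'(1,2) wt']) (use s.weak_flag_image in auto)
    have At: "A \<in> sections ?Q (tangent_space (points Y))" and Bt: "B \<in> sections ?Q (tangent_space (points Y))"
      using s.section_tangent A' B' Q'(4) by auto
    have lb: "lie_bracket (points X) (s.push A) (s.push B) x = ?d (lie_bracket (points Y) A B (f x))"
      using s.bracket_push[OF cr_regular_closed[OF regY] At Bt Q'(1-3)] inv[OF x] by simp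
    have "x \<in> g ` ?Q" using Q'(3) inv[OF x] by (metis imageI)
    from brk[OF ij s.openin_sub[OF Q'(1,2)] this pA pB]
    have "?d (lie_bracket (points Y) A B (f x)) \<in> weak_flag X (i + j) x"
      "\<sigma> (i + j) (?d (lie_bracket (points Y) A B (f x))) = br (\<sigma> i (s.push A x)) (\<sigma> j (s.push B x))"
      unfolding lb by auto
    moreover have "s.push C x = ?d (C (f x))" for C using s.push_at[OF y(1)] inv[OF x] by simp
    moreover have "lie_bracket (points Y) A B (f x) \<in> tangent_space (points Y) (f x)"
      by (rule tangent_closed_bracket[OF cr_regular_closed[OF regY] Q'(1,3) At Bt])
    ultimately show ?thesis by (simp add: flag_iff \<tau>_def)
  qed
  have "gnla gr br" using assms(2) by (simp add: is_symbol_def)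
  then show ?thesis unfolding is_symbol_def
    by (intro conjI exI[of _ \<tau>] allI impI; (elim conjE)?) (use 1 2 3 4 in blast)+
qed

lemma (in cr_iso) cr_equivalence_at: "x \<in> U \<Longrightarrow> cr_equivalence_at X Y x (f x)"
  unfolding cr_equivalence_at_def
  by (intro exI[of _ U] exI[of _ V] exI[of _ f] exI[of _ g] conjI ballI)
    (use openU openV image inv smf smg distr cplx in auto)

lemma cr_equivalence_atE:
  assumes "cr_equivalence_at X Y p q" "cr_regular X" "cr_regular Y"
  obtains U V f g where "cr_iso X Y U V f g" "p \<in> U" "f p = q"
proof -
  from assms(1)[unfolded cr_equivalence_at_def] obtain U V f g where
    "open_in (points X) U" "p \<in> U" "open_in (points Y) V" "q \<in> V" "f ` U = V" "\<forall>x\<in>U. g (f x) = x"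
    "f p = q" "smooth_on U f" "smooth_on V g"
    "\<forall>x\<in>U. differential (points X) f x ` distr X x = distr Y (f x)"
    "\<forall>x\<in>U. \<forall>v\<in>distr X x. differential (points X) f x (cplx X x v) =
           cplx Y (f x) (differential (points X) f x v)" by (elim exE conjE)
  with assms(2,3) show ?thesis
    by (intro that[of U V f g] cr_iso.intro local_diffeo.intro cr_iso_axioms.intro) auto
qed

lemma cr_equivalence_at_sym:
  assumes "cr_regular X" "cr_regular Y" "cr_equivalence_at X Y p q"
  shows "cr_equivalence_at Y X q p"
proof -
  obtain U V f g where i: "cr_iso X Y U V f g" "p \<in> U" "f p = q"
    using cr_equivalence_atE[OF assms(3,1,2)] .
  interpret cr_iso X Y U V f g by (rule i(1))
  interpret s: cr_iso Y X V U g f by (rule cr_sym)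
  show ?thesis using s.cr_equivalence_at[OF fV[OF i(2)]] inv[OF i(2)] i(3) by simp
qed

lemma cr_equivalence_at_trans:
  assumes reg: "cr_regular X" "cr_regular Y" "cr_regular Z"
    and "cr_equivalence_at X Y p q" "cr_equivalence_at Y Z q r"
  shows "cr_equivalence_at X Z p r"
proof -
  obtain U V f g where i: "cr_iso X Y U V f g" "p \<in> U" "f p = q"
    using cr_equivalence_atE[OF assms(4) reg(1,2)] .
  obtain U' V' f' g' where i': "cr_iso Y Z U' V' f' g'" "q \<in> U'" "f' q = r"
    using cr_equivalence_atE[OF assms(5) reg(2,3)] .
  interpret a: cr_iso X Y U V f g by (rule i(1))
  interpret as: cr_iso Y X V U g f by (rule a.cr_sym)
  interpret b: cr_iso Y Z U' V' f' g' by (rule i'(1))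
  interpret bs: cr_iso Z Y V' U' g' f' by (rule b.cr_sym)
  \<comment> \<open>Both maps are restricted to the overlap inside \<open>Y\<close>, where the
    composite and its inverse are defined.\<close>
  let ?M = "V \<inter> U'"
  have M: "open_in (points Y) ?M" "?M \<subseteq> V" "?M \<subseteq> U'" "q \<in> ?M"
    using a.openV b.openU a.fV[OF i(2)] i i' by auto
  interpret c: cr_iso Y X ?M "g ` ?M" g f by (rule as.cr_sub[OF M(1,2)])
  interpret c': cr_iso X Y "g ` ?M" ?M f g by (rule c.cr_sym)
  interpret e: cr_iso Y Z ?M "f' ` ?M" f' g' by (rule b.cr_sub[OF M(1,3)])
  interpret e': cr_iso Z Y "f' ` ?M" ?M g' f' by (rule e.cr_sym)
  have dc: "differential (points X) (\<lambda>x. f' (f x)) x v = differential (points Y) f' (f x) (differential (points X) f x v)"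
    if "x \<in> g ` ?M" "v \<in> tangent_space (points X) x" for x v
    using differential_compose[OF c'.smf c'.openU that(1) _ e.smf e.openU that(2)] c'.image by blast
  have "cr_iso X Z (g ` ?M) (f' ` ?M) (\<lambda>x. f' (f x)) (\<lambda>z. g (g' z))"
  proof
    show "open_in (points X) (g ` ?M)" "open_in (points Z) (f' ` ?M)" using c'.openU e.openV .
    show "(\<lambda>x. f' (f x)) ` g ` ?M = f' ` ?M"
      unfolding image_image[of f' f, symmetric] c'.image ..
    show "g (g' (f' (f x))) = x" if "x \<in> g ` ?M" for x
      using e.inv[OF c'.fV[OF that]] c'.inv[OF that] by simp
    show "smooth_on (g ` ?M) (\<lambda>x. f' (f x))"
      using smooth_on_compose[OF c'.smf e.smf] c'.image by blast
    show "smooth_on (f' ` ?M) (\<lambda>z. g (g' z))"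
      using smooth_on_compose[OF e'.smf c.smf] e'.image by blast
    fix x assume x: "x \<in> g ` ?M"
    have "differential (points X) (\<lambda>x. f' (f x)) x ` distr X x =
        differential (points Y) f' (f x) ` differential (points X) f x ` distr X x"
      unfolding image_image by (rule image_cong[OF refl dc[OF x c'.distr_tangent[OF x]]])
    then show "differential (points X) (\<lambda>x. f' (f x)) x ` distr X x = distr Z (f' (f x))"
      using c'.distr[OF x] e.distr[OF c'.fV[OF x]] by simp
    fix v assume v: "v \<in> distr X x"
    have dv: "differential (points X) f x v \<in> distr Y (f x)" using c'.distr[OF x] v by blast
    show "differential (points X) (\<lambda>x. f' (f x)) x (cplx X x v) =
        cplx Z (f' (f x)) (differential (points X) (\<lambda>x. f' (f x)) x v)"
      unfolding dc[OF x c'.distr_tangent[OF x v]] dc[OF x c'.distr_tangent[OF x c'.cplx_distr[OF x v]]]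
        c'.cplx[OF x v] by (rule e.cplx[OF c'.fV[OF x] dv])
  qed (rule reg)+
  moreover have "p \<in> g ` ?M" using M(4) a.inv[OF i(2)] i(3) by (metis imageI)
  ultimately show ?thesis using cr_iso.cr_equivalence_at i(3) i'(3) by metis
qed

lemma cr_iso_refl: "cr_regular X \<Longrightarrow> cr_iso X X (points X) (points X) (\<lambda>x. x) (\<lambda>x. x)"
proof
  assume X: "cr_regular X"
  fix x assume x: "x \<in> points X"
  have t: "v \<in> tangent_space (points X) x" if "v \<in> distr X x" for v
    using cr_regular_distr[OF X x] that by blast
  show "differential (points X) (\<lambda>x. x) x ` distr X x = distr X x"
    using differential_ident t by (force simp: image_iff)
  fix v assume v: "v \<in> distr X x"
  then have "cplx X x v \<in> distr X x" using X x by (simp add: cr_regular_def)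
  then show "differential (points X) (\<lambda>x. x) x (cplx X x v) = cplx X x (differential (points X) (\<lambda>x. x) x v)"
    using differential_ident t v by metis
qed (auto simp: smooth_on_id)

lemma cr_equivalence_at_refl: "cr_regular X \<Longrightarrow> p \<in> points X \<Longrightarrow> cr_equivalence_at X X p p"
  using cr_iso.cr_equivalence_at[OF cr_iso_refl] by blast

lemma locally_cr_equivalentI:
  assumes "\<And>p. p \<in> points X \<Longrightarrow> \<exists>q\<in>points Y. cr_equivalence_at X Y p q"
    "\<And>q. q \<in> points Y \<Longrightarrow> \<exists>p\<in>points X. cr_equivalence_at X Y p q"
  shows "locally_cr_equivalent X Y"
  using assms unfolding locally_cr_equivalent_def rel_set_def by blast

lemma locally_cr_equivalentD:
  assumes "locally_cr_equivalent X Y"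
  shows "p \<in> points X \<Longrightarrow> \<exists>q\<in>points Y. cr_equivalence_at X Y p q"
    "q \<in> points Y \<Longrightarrow> \<exists>p\<in>points X. cr_equivalence_at X Y p q"
  using assms unfolding locally_cr_equivalent_def rel_set_def by blast+

lemma locally_cr_equivalent_trans:
  assumes reg: "cr_regular X" "cr_regular Y" "cr_regular Z"
    and "locally_cr_equivalent X Y" "locally_cr_equivalent Y Z"
  shows "locally_cr_equivalent X Z"
proof (rule locally_cr_equivalentI)
  note D = locally_cr_equivalentD[OF assms(4)] and D' = locally_cr_equivalentD[OF assms(5)]
  show "\<exists>r\<in>points Z. cr_equivalence_at X Z p r" if "p \<in> points X" for p
    using D(1)[OF that] D'(1) cr_equivalence_at_trans[OF reg] by meson
  show "\<exists>p\<in>points X. cr_equivalence_at X Z p r" if "r \<in> points Z" for r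
    using D'(2)[OF that] D(2) cr_equivalence_at_trans[OF reg] by meson
qed

lemma locally_cr_equivalent_refl: "cr_regular X \<Longrightarrow> locally_cr_equivalent X X"
  using cr_equivalence_at_refl by (intro locally_cr_equivalentI) blast+

text \<open>\<open>cr_equivalence_atE\<close> presupposes regularity of both sides. Here just the
  underlying diffeomorphisms are extracted, since this lemma is what makes \<open>X\<close> regular
  in the first place.\<close>

lemma tangent_closed_locally_cr_equivalent:
  assumes "tangent_closed (points Y)" "locally_cr_equivalent X Y"
  shows "tangent_closed (points X)"
proof (rule tangent_closed_transport[OF assms(1)])
  fix p assume "p \<in> points X"
  then obtain q where "cr_equivalence_at X Y p q"
    using locally_cr_equivalentD(1)[OF assms(2)] by blast
  then obtain U V f g where
    "open_in (points X) U" "p \<in> U" "open_in (points Y) V" "f ` U = V" "\<forall>x\<in>U. g (f x) = x"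
    "smooth_on U f" "smooth_on V g" unfolding cr_equivalence_at_def by (elim exE conjE)
  then show "\<exists>U V f g. local_diffeo (points X) (points Y) U V f g \<and> p \<in> U"
    by (intro exI[of _ U] exI[of _ V] exI[of _ f] exI[of _ g] conjI local_diffeo.intro) auto
qed

text \<open>Serves to recognise the quadric as a CR manifold. Different points of \<open>Y\<close>
  may be reached by different isomorphisms, so ranks at two points are compared through points of
  \<open>X\<close>, where they are constant.\<close>

lemma cr_manifold_transport:
  assumes X: "cr_manifold X" and Y: "cr_regular Y" "embedded_submanifold d (points Y)"
    and J: "\<And>x v. x \<in> points Y \<Longrightarrow> v \<in> distr Y x \<Longrightarrow> cplx Y x (cplx Y x v) = - v"
      "\<And>x v w a b. x \<in> points Y \<Longrightarrow> v \<in> distr Y x \<Longrightarrow> w \<in> distr Y x \<Longrightarrow>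
        cplx Y x (a *\<^sub>R v + b *\<^sub>R w) = a *\<^sub>R cplx Y x v + b *\<^sub>R cplx Y x w"
    and cover: "\<And>q. q \<in> points Y \<Longrightarrow> \<exists>p U V f g. cr_iso X Y U V f g \<and> p \<in> U \<and> f p = q"
  shows "cr_manifold Y"
proof -
  have dims: "\<exists>p\<in>points X. \<forall>k. dim (weak_flag Y k q) = dim (weak_flag X k p)" if q: "q \<in> points Y" for q
  proof -
    obtain p U V f g where i: "cr_iso X Y U V f g" "p \<in> U" "f p = q" using cover[OF q] by blast
    interpret cr_iso X Y U V f g by (rule i(1))
    show ?thesis using dim_weak_flag[OF i(2)] i US by blast
  qed
  have Xdim: "\<forall>k. \<forall>x\<in>points X. \<forall>y\<in>points X. dim (weak_flag X k x) = dim (weak_flag X k y)"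
    using X unfolding cr_manifold_def by (elim conjE)
  have wdim: "dim (weak_flag Y k x) = dim (weak_flag Y k y)" if xy: "x \<in> points Y" "y \<in> points Y" for k x y
  proof -
    obtain p where p: "p \<in> points X" "\<And>k. dim (weak_flag Y k x) = dim (weak_flag X k p)"
      using dims[OF xy(1)] by blast
    obtain q where q: "q \<in> points X" "\<And>k. dim (weak_flag Y k y) = dim (weak_flag X k q)"
      using dims[OF xy(2)] by blast
    show ?thesis unfolding p(2) q(2) using Xdim p(1) q(1) by blast
  qed
  have X2: "\<forall>x\<in>points X. dim (distr X x) = 2"
    using X unfolding cr_manifold_def by (elim conjE)
  have dim2: "dim (distr Y x) = 2" if y: "x \<in> points Y" for x
  proof -
    obtain p where "p \<in> points X" "\<And>k. dim (weak_flag Y k x) = dim (weak_flag X k p)"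
      using dims[OF y] by blast
    with this(2)[of "Suc 0"] X2 show ?thesis by simp
  qed
  have sec: "\<exists>Q A. open_in (points Y) Q \<and> x \<in> Q \<and> A \<in> sections Q (distr Y) \<and> A x = v"
    if x: "x \<in> points Y" and v: "v \<in> distr Y x" for x v
  proof -
    obtain p U V f g where i: "cr_iso X Y U V f g" "p \<in> U" "f p = x" using cover[OF x] by blast
    interpret cr_iso X Y U V f g by (rule i(1))
    obtain w where w: "w \<in> distr X p" "v = differential (points X) f p w"
      using v distr[OF i(2)] i(3) by blast
    have "smooth_distribution (points X) (distr X)" using X unfolding cr_manifold_def by (elim conjE)
    moreover have "p \<in> points X" using i(2) US by blast
    ultimately have "\<exists>Q A. open_in (points X) Q \<and> p \<in> Q \<and> A \<in> sections Q (distr X) \<and> A p = w"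
      using w(1) unfolding smooth_distribution_def by simp
    then obtain Q A where Q: "open_in (points X) Q" "p \<in> Q" "A \<in> sections Q (distr X)" "A p = w"
      by (elim exE conjE)
    have Q': "open_in (points X) (Q \<inter> U)" "Q \<inter> U \<subseteq> U" using Q(1) openU by auto
    have "push A \<in> sections (f ` (Q \<inter> U)) (distr Y)"
      by (rule push_sections[OF sections_subset[OF Q(3)] Q'])
        (use distr distr_tangent in auto)
    moreover have "push A x = v" using push_at[OF i(2)] i(3) Q(4) w(2) by metis
    moreover have "x \<in> f ` (Q \<inter> U)" using Q(2) i(2,3) by blast
    ultimately show ?thesis
      using openin_sub[OF Q'] by (intro exI[of _ "f ` (Q \<inter> U)"] exI[of _ "push A"]) simp
  qed
  show ?thesis
    unfolding cr_manifold_def smooth_distribution_def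
  proof (intro conjI)
    show "\<exists>d. embedded_submanifold d (points Y)" using Y(2) by (rule exI)
    show "\<forall>x\<in>points Y. subspace (distr Y x) \<and> distr Y x \<subseteq> tangent_space (points Y) x"
      using cr_regular_distr[OF Y(1)] by (rule ballI)
    show "\<forall>x\<in>points Y. \<forall>v\<in>distr Y x. \<exists>U A. open_in (points Y) U \<and> x \<in> U \<and> A \<in> sections U (distr Y) \<and> A x = v"
      using sec by (intro ballI)
    show "\<forall>x\<in>points Y. dim (distr Y x) = 2" using dim2 by (rule ballI)
    show "\<forall>x\<in>points Y. \<forall>v\<in>distr Y x. cplx Y x v \<in> distr Y x \<and> cplx Y x (cplx Y x v) = - v"
      using J(1) Y(1) by (simp add: cr_regular_def)
    show "\<forall>x\<in>points Y. \<forall>v\<in>distr Y x. \<forall>w\<in>distr Y x. \<forall>a b.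
        cplx Y x (a *\<^sub>R v + b *\<^sub>R w) = a *\<^sub>R cplx Y x v + b *\<^sub>R cplx Y x w"
      using J(2) by (intro ballI allI)
    show "\<forall>U A. open_in (points Y) U \<and> A \<in> sections U (distr Y) \<longrightarrow> smooth_on U (\<lambda>x. cplx Y x (A x))"
      using Y(1) unfolding cr_regular_def by (elim conjE)
    show "\<forall>k. \<forall>x\<in>points Y. \<forall>y\<in>points Y. dim (weak_flag Y k x) = dim (weak_flag Y k y)"
      using wdim by (intro allI ballI)
  qed
qed

section \<open>Graded nilpotent Lie algebras\<close>

lemma bilinear_span_mem:
  assumes "bilinear b" "subspace W" "\<And>x y. x \<in> S \<Longrightarrow> y \<in> T \<Longrightarrow> b x y \<in> W" "x \<in> span S" "y \<in> span T"
  shows "b x y \<in> W"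
proof -
  have "linear (\<lambda>x. b x y)" for y using assms(1) by (simp add: bilinear_def)
  moreover have "linear (b x)" for x using assms(1) by (simp add: bilinear_def)
  ultimately have sub: "subspace {x. b x y \<in> W}" "subspace {y. b x y \<in> W}" for x y
    using linear_subspace_vimage[OF _ assms(2)] unfolding vimage_def by blast+
  have "span T \<subseteq> {y. b x y \<in> W}" if "x \<in> S" for x
    by (rule span_minimal[OF _ sub(2)]) (use assms(3) that in blast)
  then have "span S \<subseteq> {x. b x y \<in> W}"
    using assms(5) by (intro span_minimal[OF _ sub(1)]) blast
  then show ?thesis using assms(4) by blast
qed

locale graded_algebra =
  fixes gr :: "nat \<Rightarrow> 'a::euclidean_space set" and br :: "'a \<Rightarrow> 'a \<Rightarrow> 'a" and \<nu> :: nat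
  assumes gnla: "gnla gr br" and depth: "gnla_depth gr \<nu>"
begin

abbreviation V where "V \<equiv> gnla_carrier gr"

lemma subV: "subspace V" by (simp add: gnla_carrier_def)
lemma sub_gr: "subspace (gr k)" and gr0: "gr 0 = {0}" and bil: "bilinear br"
  and br_gr: "x \<in> gr i \<Longrightarrow> y \<in> gr j \<Longrightarrow> br x y \<in> gr (i + j)"
  and br_self: "x \<in> V \<Longrightarrow> br x x = 0"
  and jacobi: "x \<in> V \<Longrightarrow> y \<in> V \<Longrightarrow> z \<in> V \<Longrightarrow> br x (br y z) + br y (br z x) + br z (br x y) = 0"
  using gnla unfolding gnla_def by (elim conjE; simp)+

lemma gr_indep: "(\<And>k. f k \<in> gr k) \<Longrightarrow> (\<Sum>k\<le>n. f k) = 0 \<Longrightarrow> k \<le> n \<Longrightarrow> f k = 0"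
  using gnla unfolding gnla_def by (elim conjE) simp

lemma gr_top: "k > \<nu> \<Longrightarrow> gr k = {0}" and gr_nu: "gr \<nu> \<noteq> {0}"
  using depth by (auto simp: gnla_depth_def)

lemma grV: "gr k \<subseteq> V" unfolding gnla_carrier_def by (meson UNIV_I UN_I span_base subsetI)

lemma lin_br: "linear (br x)" "linear (\<lambda>x. br x y)" using bil by (auto simp: bilinear_def)

lemma br_V: "x \<in> V \<Longrightarrow> y \<in> V \<Longrightarrow> br x y \<in> V"
  unfolding gnla_carrier_def
  by (rule bilinear_span_mem[OF bil subspace_span, of "\<Union>k. gr k" "\<Union>k. gr k"])
    (use br_gr in \<open>blast intro: span_base\<close>)+

lemma br_0: "br 0 y = 0" "br x 0 = 0"
  using bilinear_lzero[OF bil] bilinear_rzero[OF bil] by auto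

lemma br_anti: "x \<in> V \<Longrightarrow> y \<in> V \<Longrightarrow> br x y = - br y x"
  using br_self[of "x + y"] br_self[of x] br_self[of y] subspace_add[OF subV, of x y] bil
  by (simp add: bilinear_ladd bilinear_radd eq_neg_iff_add_eq_0 add.commute)

lemma decomp:
  assumes "x \<in> V" shows "\<exists>f. (\<forall>k. f k \<in> gr k) \<and> x = (\<Sum>k\<le>\<nu>. f k)"
proof -
  let ?S = "{x. \<exists>f. (\<forall>k. f k \<in> gr k) \<and> x = (\<Sum>k\<le>\<nu>. f k)}"
  have "subspace ?S"
  proof (rule subspaceI)
    show "0 \<in> ?S" using sub_gr by (auto intro!: exI[of _ "\<lambda>_. 0"] simp: subspace_0)
  next
    fix x y assume "x \<in> ?S" "y \<in> ?S"
    then obtain f f' where "\<forall>k. f k \<in> gr k" "x = (\<Sum>k\<le>\<nu>. f k)" "\<forall>k. f' k \<in> gr k" "y = (\<Sum>k\<le>\<nu>. f' k)"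
      by blast
    then show "x + y \<in> ?S"
      using sub_gr by (auto intro!: exI[of _ "\<lambda>k. f k + f' k"] simp: subspace_add sum.distrib)
  next
    fix c x assume "x \<in> ?S"
    then obtain f where "\<forall>k. f k \<in> gr k" "x = (\<Sum>k\<le>\<nu>. f k)" by blast
    then show "c *\<^sub>R x \<in> ?S"
      using sub_gr by (auto intro!: exI[of _ "\<lambda>k. c *\<^sub>R f k"] simp: subspace_scale scaleR_sum_right)
  qed
  moreover have "gr k \<subseteq> ?S" for k
  proof
    fix y assume y: "y \<in> gr k"
    show "y \<in> ?S"
    proof (cases "k \<le> \<nu>")
      case True
      then have "(\<Sum>j\<le>\<nu>. if j = k then y else 0) = y" by (simp add: sum.delta)
      then show ?thesis using y sub_gr
        by (intro CollectI exI[of _ "\<lambda>j. if j = k then y else 0"]) (simp add: subspace_0)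
    next
      case False
      then have "y = 0" using y gr_top[of k] by simp
      then show ?thesis using sub_gr by (auto intro!: exI[of _ "\<lambda>_. 0"] simp: subspace_0)
    qed
  qed
  ultimately have "V \<subseteq> ?S" unfolding gnla_carrier_def by (intro span_minimal) auto
  then show ?thesis using assms by blast
qed

text \<open>A chosen projection of the ambient space onto \<open>V\<close>. Precomposing with it
  makes \<open>pr\<close>, and later the group product, total maps on the Euclidean space, so that
  linearity and ordinary derivatives are available everywhere.\<close>

definition P where "P = (SOME P. linear P \<and> (\<forall>x. P x \<in> V) \<and> (\<forall>x\<in>V. P x = x))"

lemma P: "linear P" "P x \<in> V" "x \<in> V \<Longrightarrow> P x = x"
proof -
  obtain Q :: "'a \<Rightarrow> 'a" where "linear Q" "\<And>x. Q x \<in> V" "\<And>x. x \<in> V \<Longrightarrow> Q x = x"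
    using linear_projection[OF subV] by blast
  then have "\<exists>P. linear P \<and> (\<forall>x. P x \<in> V) \<and> (\<forall>x\<in>V. P x = x)"
    by (intro exI[of _ Q]) simp
  from someI_ex[OF this] have "linear P \<and> (\<forall>x. P x \<in> V) \<and> (\<forall>x\<in>V. P x = x)"
    unfolding P_def[symmetric] .
  then show "linear P" "P x \<in> V" "x \<in> V \<Longrightarrow> P x = x" by auto
qed

definition pr where "pr k x = (SOME f. (\<forall>k. f k \<in> gr k) \<and> P x = (\<Sum>k\<le>\<nu>. f k)) k"

lemma pr_in: "pr k x \<in> gr k" and P_sum: "P x = (\<Sum>k\<le>\<nu>. pr k x)"
proof -
  define f where "f = (SOME f. (\<forall>k. f k \<in> gr k) \<and> P x = (\<Sum>k\<le>\<nu>. f k))"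
  have "(\<forall>k. f k \<in> gr k) \<and> P x = (\<Sum>k\<le>\<nu>. f k)"
    using someI_ex[OF decomp[OF P(2)[of x]]] unfolding f_def[symmetric] .
  moreover have "pr k x = f k" for k by (simp add: pr_def f_def)
  ultimately show "pr k x \<in> gr k" "P x = (\<Sum>k\<le>\<nu>. pr k x)" by auto
qed

lemma pr_sum: "x \<in> V \<Longrightarrow> (\<Sum>k\<le>\<nu>. pr k x) = x" using P_sum P(3) by simp

lemma pr_unique: assumes "\<And>k. f k \<in> gr k" "P x = (\<Sum>k\<le>\<nu>. f k)" shows "pr k x = f k"
proof (cases "k \<le> \<nu>")
  case True
  have "(\<Sum>k\<le>\<nu>. pr k x - f k) = 0" using assms(2) P_sum[of x] by (simp add: sum_subtractf)
  from gr_indep[OF _ this True] show ?thesis using pr_in assms(1) sub_gr by (simp add: subspace_diff)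
next
  case False
  then show ?thesis using gr_top[of k] pr_in[of k x] assms(1)[of k] by simp
qed

lemma linear_pr: "linear (pr k)"
proof (rule linearI)
  show "pr k (x + y) = pr k x + pr k y" for x y
    by (rule pr_unique, simp add: pr_in sub_gr subspace_add, subst linear_add[OF P(1)])
      (simp add: P_sum sum.distrib)
  show "pr k (c *\<^sub>R x) = c *\<^sub>R pr k x" for c x
    by (rule pr_unique, simp add: pr_in sub_gr subspace_scale, subst linear_scale[OF P(1)])
      (simp add: P_sum scaleR_sum_right)
qed

lemma pr_gr: assumes "x \<in> gr j" shows "pr k x = (if k = j then x else 0)"
proof (rule pr_unique)
  show "(if k = j then x else 0) \<in> gr k" for k using assms sub_gr by (simp add: subspace_0)
  show "P x = (\<Sum>k\<le>\<nu>. if k = j then x else 0)"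
    using assms grV P(3) gr_top[of j] by (cases "j \<le> \<nu>") (auto simp: subset_iff)
qed

definition Fil where "Fil k = span (\<Union>j\<le>k. gr j)"

lemma sub_Fil: "subspace (Fil k)" by (simp add: Fil_def)
lemma gr_Fil: "j \<le> k \<Longrightarrow> gr j \<subseteq> Fil k" unfolding Fil_def by (auto intro: span_base)
lemma Fil_mono: "j \<le> k \<Longrightarrow> Fil j \<subseteq> Fil k" unfolding Fil_def by (rule span_mono) force
lemma Fil_V: "Fil k \<subseteq> V" unfolding Fil_def gnla_carrier_def by (rule span_mono) blast
lemma Fil_0: "Fil 0 = {0}" by (simp add: Fil_def gr0)
lemma Fil_1: "Fil 1 = gr 1"
proof -
  have "{..1::nat} = {0, 1}" by auto
  then have "(\<Union>j\<le>1. gr j) = gr 1" using gr0 subspace_0[OF sub_gr[of 1]] by auto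
  moreover have "span (gr 1) = gr 1" using sub_gr span_eq_iff by blast
  ultimately show ?thesis unfolding Fil_def by simp
qed

lemma pr_Fil: assumes "x \<in> Fil k" "j > k" shows "pr j x = 0"
proof -
  have "Fil k \<subseteq> {x. pr j x = 0}" unfolding Fil_def
    by (rule span_minimal) (use assms(2) pr_gr linear_subspace_kernel[OF linear_pr] in auto)
  then show ?thesis using assms(1) by blast
qed

lemma FilI: assumes "x \<in> V" "\<And>j. j > k \<Longrightarrow> pr j x = 0" shows "x \<in> Fil k"
proof -
  have "pr j x \<in> Fil k" for j
    using assms(2)[of j] pr_in[of j x] gr_Fil[of j k] sub_Fil[of k] by (cases "j \<le> k") (auto simp: subspace_0)
  then have "(\<Sum>j\<le>\<nu>. pr j x) \<in> Fil k" by (intro subspace_sum sub_Fil)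
  then show ?thesis using pr_sum[OF assms(1)] by simp
qed

lemma Fil_top: "\<nu> \<le> k \<Longrightarrow> Fil k = V"
proof
  assume k: "\<nu> \<le> k"
  have "x \<in> Fil k" if "x \<in> V" for x
  proof (rule FilI[OF that])
    show "pr j x = 0" if "k < j" for j using gr_top[of j] pr_in[of j x] k that by simp
  qed
  then show "V \<subseteq> Fil k" by blast
qed (rule Fil_V)

lemma Fil_kernel: "{x \<in> Fil (Suc k). pr (Suc k) x = 0} = Fil k"
proof
  show "{x \<in> Fil (Suc k). pr (Suc k) x = 0} \<subseteq> Fil k"
  proof
    fix x assume x: "x \<in> {x \<in> Fil (Suc k). pr (Suc k) x = 0}"
    show "x \<in> Fil k"
    proof (rule FilI)
      show "x \<in> V" using x Fil_V by blast
      show "pr j x = 0" if "j > k" for j using x pr_Fil[of x "Suc k" j] that by (cases "j = Suc k") auto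
    qed
  qed
qed (use Fil_mono[of k "Suc k"] pr_Fil in auto)

lemma Fil_split: "x \<in> Fil (Suc k) \<Longrightarrow> x - pr (Suc k) x \<in> Fil k"
proof -
  assume x: "x \<in> Fil (Suc k)"
  have "pr (Suc k) x \<in> Fil (Suc k)" using pr_in gr_Fil by blast
  then have "x - pr (Suc k) x \<in> Fil (Suc k)" using x sub_Fil subspace_diff by blast
  moreover have "pr (Suc k) (x - pr (Suc k) x) = 0"
    by (simp add: linear_diff[OF linear_pr] pr_gr[OF pr_in])
  ultimately show ?thesis using Fil_kernel[of k] by blast
qed

lemma pr_Fil_image: "pr k ` Fil k = gr k"
proof
  show "gr k \<subseteq> pr k ` Fil k" using pr_gr[of _ k k] gr_Fil[of k k] by (force simp: image_iff)
qed (use pr_in in blast)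

lemma dim_Fil: "dim (Fil (Suc k)) = dim (Fil k) + dim (gr (Suc k))"
proof -
  have "Fil (Suc k) = {x + y | x y. x \<in> Fil k \<and> y \<in> gr (Suc k)}"
  proof
    show "Fil (Suc k) \<subseteq> {x + y | x y. x \<in> Fil k \<and> y \<in> gr (Suc k)}"
    proof
      fix x assume "x \<in> Fil (Suc k)"
      from Fil_split[OF this] pr_in[of "Suc k" x]
      show "x \<in> {x + y | x y. x \<in> Fil k \<and> y \<in> gr (Suc k)}"
        by (intro CollectI exI[of _ "x - pr (Suc k) x"] exI[of _ "pr (Suc k) x"]) simp
    qed
  qed (use Fil_mono[of k "Suc k"] gr_Fil[of "Suc k" "Suc k"] sub_Fil[of "Suc k"] in \<open>auto intro!: subspace_add\<close>)
  moreover have "x = 0" if "x \<in> Fil k" "x \<in> gr (Suc k)" for x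
    using pr_Fil[OF that(1), of "Suc k"] pr_gr[OF that(2), of "Suc k"] by simp
  then have "Fil k \<inter> gr (Suc k) = {0}"
    using subspace_0[OF sub_Fil] subspace_0[OF sub_gr] by blast
  ultimately show ?thesis
    using dim_sums_Int[OF sub_Fil[of k] sub_gr[of "Suc k"]] by simp
qed

lemma br_Fil: "x \<in> Fil i \<Longrightarrow> y \<in> Fil j \<Longrightarrow> br x y \<in> Fil (i + j)"
  unfolding Fil_def[of i] Fil_def[of j]
proof (rule bilinear_span_mem[OF bil sub_Fil])
  fix x y assume "x \<in> (\<Union>a\<le>i. gr a)" "y \<in> (\<Union>a\<le>j. gr a)"
  then obtain a b where ab: "a \<le> i" "x \<in> gr a" "b \<le> j" "y \<in> gr b" by blast
  then show "br x y \<in> Fil (i + j)" using br_gr[OF ab(2,4)] gr_Fil[of "a + b" "i + j"] by auto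
qed

text \<open>Brackets that involve a term below the leading degrees fall below degree
  \<open>i + j\<close>, so the leading parts alone contribute.\<close>

lemma pr_br: assumes "x \<in> Fil i" "y \<in> Fil j" shows "pr (i + j) (br x y) = br (pr i x) (pr j y)"
proof (rule bilinear_eq[of "\<lambda>x y. pr (i + j) (br x y)" "\<lambda>x y. br (pr i x) (pr j y)"
      "Fil i" "\<Union>a\<le>i. gr a" "Fil j" "\<Union>a\<le>j. gr a"])
  show "bilinear (\<lambda>x y. pr (i + j) (br x y))"
    using linear_compose[OF lin_br(1) linear_pr] linear_compose[OF lin_br(2) linear_pr]
    by (simp add: bilinear_def o_def)
  show "bilinear (\<lambda>x y. br (pr i x) (pr j y))"
    using linear_compose[OF linear_pr lin_br(1)] linear_compose[OF linear_pr lin_br(2)]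
    by (simp add: bilinear_def o_def)
  fix x y assume "x \<in> (\<Union>a\<le>i. gr a)" "y \<in> (\<Union>a\<le>j. gr a)"
  then obtain a b where ab: "a \<le> i" "x \<in> gr a" "b \<le> j" "y \<in> gr b" by blast
  show "pr (i + j) (br x y) = br (pr i x) (pr j y)"
    unfolding pr_gr[OF br_gr[OF ab(2,4)]] pr_gr[OF ab(2)] pr_gr[OF ab(4)]
    using ab(1,3) by (auto simp: br_0)
qed (use assms in \<open>auto simp: Fil_def\<close>)

text \<open>The descending filtration, opposite to \<open>Fil\<close>. Since \<open>gr 0\<close> is
  trivial, every \<open>br x\<close> with \<open>x\<close> in \<open>V\<close> raises it by one
  step; this is the nilpotency on which \<open>ode_unique\<close> rests.\<close>

definition Up where "Up k = span (\<Union>j\<in>{k..}. gr j)"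

lemma br_Up: assumes "x \<in> V" "y \<in> Up k" shows "br x y \<in> Up (Suc k)"
proof (rule bilinear_span_mem[OF bil, of _ "\<Union>a. gr a" "\<Union>j\<in>{k..}. gr j"])
  show "subspace (Up (Suc k))" by (simp add: Up_def)
  show "x \<in> span (\<Union>a. gr a)" "y \<in> span (\<Union>j\<in>{k..}. gr j)"
    using assms by (auto simp: gnla_carrier_def Up_def)
  fix x y assume "x \<in> (\<Union>a. gr a)" "y \<in> (\<Union>j\<in>{k..}. gr j)"
  then obtain a j where a: "x \<in> gr a" "j \<ge> k" "y \<in> gr j" by auto
  show "br x y \<in> Up (Suc k)"
  proof (cases a)
    case 0
    then have "br x y = 0" using a(1) gr0 by (simp add: br_0)
    then show ?thesis by (simp add: Up_def span_zero)
  next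
    case (Suc b)
    then have "Suc k \<le> a + j" using a(2) by simp
    then show ?thesis using br_gr[OF a(1,3)] unfolding Up_def by (intro span_base) auto
  qed
qed

lemma Up_0: "Up 0 = V" by (simp add: Up_def gnla_carrier_def)
lemma Up_top: "Up (Suc \<nu>) = {0}"
proof -
  have "(\<Union>j\<in>{Suc \<nu>..}. gr j) \<subseteq> {0}" using gr_top by auto
  then have "Up (Suc \<nu>) \<subseteq> {0}" unfolding Up_def by (rule span_minimal) simp
  then show ?thesis by (auto simp: Up_def span_zero)
qed

lemma ad_pow: "x \<in> V \<Longrightarrow> y \<in> V \<Longrightarrow> (br x ^^ k) y \<in> Up k"
  by (induction k) (auto simp: Up_0 br_Up)

lemma ad_nilpotent: "x \<in> V \<Longrightarrow> y \<in> V \<Longrightarrow> (br x ^^ Suc \<nu>) y = 0"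
  using ad_pow[of x y "Suc \<nu>"] Up_top by simp

definition central where "central z \<longleftrightarrow> z \<in> V \<and> (\<forall>y\<in>V. br z y = 0)"

text \<open>A bracket with the top component either involves degree 0, which is trivial, or has
  degree above \<nu>.\<close>

lemma central_top: assumes "z \<in> gr \<nu>" shows "central z"
proof -
  have "br z y = 0" if "y \<in> V" for y
  proof -
    have "br z y \<in> {0}"
    proof (rule bilinear_span_mem[OF bil, of "{0}" "{z}" "\<Union>j. gr j"])
      fix x y assume "x \<in> {z}" "y \<in> (\<Union>j. gr j)"
      then obtain j where j: "x = z" "y \<in> gr j" by blast
      show "br x y \<in> {0}"
      proof (cases j)
        case 0
        then show ?thesis using j gr0 by (simp add: br_0)
      next
        case (Suc i)
        then show ?thesis using br_gr[OF assms j(2)] gr_top[of "\<nu> + j"] j(1) by simp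
      qed
    qed (use that in \<open>auto simp: gnla_carrier_def span_base\<close>)
    then show ?thesis by simp
  qed
  then show ?thesis using assms grV by (auto simp: central_def)
qed

lemma central_br: "central z \<Longrightarrow> y \<in> V \<Longrightarrow> br z y = 0" "central z \<Longrightarrow> y \<in> V \<Longrightarrow> br y z = 0"
  using br_anti[of y z] by (auto simp: central_def)

lemma central_V: "central z \<Longrightarrow> z \<in> V" by (simp add: central_def)
lemma central_scale: "central z \<Longrightarrow> central (c *\<^sub>R z)"
  using lin_br(2) subV by (auto simp: central_def subspace_scale linear_scale[OF lin_br(2)])

text \<open>\<open>generated_in_degree_one\<close> speaks of subalgebras, the flag of iterated
  brackets with \<open>gr 1\<close>. The spaces \<open>G k\<close> of such iterated brackets are
  shown to multiply like a grading, so their sum is a subalgebra containing \<open>gr 1\<close> and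
  hence everything; projecting to degree \<open>k\<close> gives \<open>gr k = G k\<close>.\<close>

lemma generated_step:
  assumes "generated_in_degree_one gr br" "k \<ge> 1"
  shows "gr (Suc k) = span {br x y | x y. x \<in> gr 1 \<and> y \<in> gr k}"
proof -
  \<comment> \<open>The case distinction starts the recursion at degree 1, so that
    \<open>G 1 = gr 1\<close> while degree 0 stays trivial.\<close>
  define G where "G = rec_nat {0} (\<lambda>k S. if k = 0 then gr 1 else span {br x y | x y. x \<in> gr 1 \<and> y \<in> S})"
  have G: "G 0 = {0}" "G (Suc 0) = gr 1" "G (Suc (Suc k)) = span {br x y | x y. x \<in> gr 1 \<and> y \<in> G (Suc k)}" for k
    by (simp_all add: G_def)
  have subG: "subspace (G k)" for k
    by (cases k rule: nat.exhaust; cases "k - 1") (auto simp: G sub_gr)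
  have Ggr: "G k \<subseteq> gr k" for k
  proof (induction k)
    case (Suc k)
    show ?case
    proof (cases k)
      case (Suc j)
      have "{br x y | x y. x \<in> gr 1 \<and> y \<in> G (Suc j)} \<subseteq> gr (Suc (Suc j))"
        using br_gr[of _ 1 _ "Suc j"] Suc.IH unfolding Suc by auto
      then show ?thesis unfolding Suc G using sub_gr by (rule span_minimal)
    qed (simp add: G)
  qed (simp add: G gr0)
  have GV: "G k \<subseteq> V" for k using Ggr grV by blast
  have b1: "br x y \<in> G (Suc k)" if "x \<in> gr 1" "y \<in> G k" for x y k
    using that by (cases k) (auto simp: G br_0 subspace_0[OF sub_gr] intro: span_base)
  \<comment> \<open>Induction on the degree of the left factor: for \<open>w = br x y\<close> with
    \<open>x\<close> of degree one, the Jacobi identity moves \<open>x\<close> outside or to the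
    right, leaving brackets with left factor \<open>y\<close> of smaller degree.\<close>
  have bG: "\<forall>k. \<forall>x\<in>G i. \<forall>y\<in>G k. br x y \<in> G (i + k)" for i
  proof (induction i)
    case 0
    then show ?case using subspace_0[OF subG] by (simp add: G br_0)
  next
    case (Suc i)
    show ?case
    proof (cases i)
      case 0
      then show ?thesis using b1 by (auto simp: G)
    next
      case (Suc j)
      have "br w z \<in> G (Suc i + k)" if w: "w \<in> G (Suc i)" and z: "z \<in> G k" for w z k
      proof (rule bilinear_span_mem[OF bil subG, of "{br x y | x y. x \<in> gr 1 \<and> y \<in> G i}" "{z}"])
        fix w z' assume "w \<in> {br x y | x y. x \<in> gr 1 \<and> y \<in> G i}" "z' \<in> {z}"
        then obtain x y where xy: "w = br x y" "x \<in> gr 1" "y \<in> G i" "z' = z" by blast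
        have xV: "x \<in> V" "y \<in> V" "z \<in> V" using xy z grV GV by blast+
        have "br (br x y) z = br x (br y z) - br y (br x z)"
          using jacobi[OF xV] unfolding br_anti[OF xV(3) br_V[OF xV(1,2)]] br_anti[OF xV(3,1)]
          by (simp add: linear_neg[OF lin_br(1)] algebra_simps)
        moreover have "br x (br y z) \<in> G (Suc i + k)" using b1[OF xy(2)] Suc.IH xy(3) z by auto
        moreover have "br y (br x z) \<in> G (Suc i + k)" using b1[OF xy(2) z] Suc.IH xy(3) by force
        ultimately show "br w z' \<in> G (Suc i + k)" using xy subspace_diff[OF subG] by simp
      qed (use w Suc in \<open>auto simp: G intro: span_base\<close>)
      then show ?thesis by blast
    qed
  qed
  define W where "W = span (\<Union>k. G k)"
  have "br x y \<in> W" if "x \<in> W" "y \<in> W" for x y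
    unfolding W_def
    by (rule bilinear_span_mem[OF bil subspace_span _ that[unfolded W_def]])
      (use bG in \<open>blast intro: span_base\<close>)
  moreover have "gr 1 \<subseteq> W" unfolding W_def using G(2) by (metis One_nat_def UNIV_I UN_I span_base subsetI)
  ultimately have VW: "V \<subseteq> W" using assms(1) unfolding generated_in_degree_one_def W_def by (simp add: subspace_span)
  have "gr k \<subseteq> G k" for k
  proof
    fix x assume x: "x \<in> gr k"
    have "W \<subseteq> {x. pr k x \<in> G k}" unfolding W_def
    proof (rule span_minimal)
      show "subspace {x. pr k x \<in> G k}"
        using linear_subspace_vimage[OF linear_pr subG] unfolding vimage_def .
      show "(\<Union>j. G j) \<subseteq> {x. pr k x \<in> G k}" using Ggr pr_gr subG by (fastforce simp: subspace_0)
    qed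
    then have "pr k x \<in> G k" using x VW grV by blast
    then show "x \<in> G k" using pr_gr[OF x] by simp
  qed
  then have "gr k = G k" for k using Ggr by blast
  then show ?thesis using G(3)[of "k - 1"] assms(2) by simp
qed

text \<open>Each component is spanned by brackets with the previous one, so a gap below \<nu> would
  propagate up to \<nu>.\<close>

lemma gr_nonzero:
  assumes "generated_in_degree_one gr br" "1 \<le> k" "k \<le> \<nu>" shows "gr k \<noteq> {0}"
proof
  assume z: "gr k = {0}"
  have "gr j = {0}" if "j \<ge> k" for j
    using that
  proof (induction j rule: dec_induct)
    case (step j)
    have "{br x y | x y. x \<in> gr 1 \<and> y \<in> gr j} \<subseteq> {0}" using step.IH by (auto simp: br_0)
    then have "span {br x y | x y. x \<in> gr 1 \<and> y \<in> gr j} \<subseteq> {0}" by (rule span_minimal) simp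
    then show ?case using generated_step[OF assms(1), of j] step.hyps assms(2) sub_gr[of "Suc j"]
      by (auto simp: subspace_0)
  qed (rule z)
  then show False using gr_nu assms(3) by blast
qed

end

section \<open>The group of a graded nilpotent Lie algebra in exponential coordinates\<close>

lemma tangent_UNIV: "v \<in> tangent_space (UNIV :: 'a::euclidean_space set) x"
  using tangent_space_subspace[OF subspace_UNIV] by blast

lemma has_derivative_differential_UNIV:
  "smooth_on UNIV f \<Longrightarrow> (f has_derivative differential UNIV f x) (at x)"
  using has_derivative_differential[of UNIV f UNIV x] by simp

lemma has_vector_derivative_compose_UNIV:
  fixes f :: "'a::euclidean_space \<Rightarrow> 'b::euclidean_space"
  assumes "smooth_on UNIV f" "(y has_vector_derivative y') (at t)"
  shows "((\<lambda>s. f (y s)) has_vector_derivative differential UNIV f (y t) y') (at t)"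
proof -
  have "((\<lambda>s. f (y s)) has_derivative (\<lambda>s. differential UNIV f (y t) (s *\<^sub>R y'))) (at t)"
    by (rule has_derivative_compose[OF assms(2)[unfolded has_vector_derivative_def]
          has_derivative_differential_UNIV[OF assms(1)]])
  moreover have "linear (differential UNIV f (y t))"
    by (rule has_derivative_linear[OF has_derivative_differential_UNIV[OF assms(1)]])
  ultimately show ?thesis by (simp add: has_vector_derivative_def linear_scale)
qed

locale exp_model = graded_algebra gr br \<nu> for gr :: "nat \<Rightarrow> 'a::euclidean_space set" and br \<nu> +
  fixes mul :: "'a \<Rightarrow> 'a \<Rightarrow> 'a"
  assumes exp: "exp_group gr br mul"
begin

lemma mul_V: "x \<in> V \<Longrightarrow> y \<in> V \<Longrightarrow> mul x y \<in> V"
  and mul_assoc: "x \<in> V \<Longrightarrow> y \<in> V \<Longrightarrow> z \<in> V \<Longrightarrow> mul (mul x y) z = mul x (mul y z)"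
  and mul_0: "x \<in> V \<Longrightarrow> mul 0 x = x" "x \<in> V \<Longrightarrow> mul x 0 = x"
  and mul_line: "x \<in> V \<Longrightarrow> mul (s *\<^sub>R x) (t *\<^sub>R x) = (s + t) *\<^sub>R x"
  and mul_smooth: "smooth_on (V \<times> V) (\<lambda>(x, y). mul x y)"
  and mul_bracket: "u \<in> V \<Longrightarrow> v \<in> V \<Longrightarrow> x \<in> V \<Longrightarrow>
    lie_bracket V (left_inv_field mul u) (left_inv_field mul v) x = left_inv_field mul (br u v) x"
  using exp unfolding exp_group_def Let_def by (elim conjE; simp)+

lemma V_closed: "0 \<in> V" "x \<in> V \<Longrightarrow> c *\<^sub>R x \<in> V" "x \<in> V \<Longrightarrow> - x \<in> V"
  "x \<in> V \<Longrightarrow> y \<in> V \<Longrightarrow> x + y \<in> V" "x \<in> V \<Longrightarrow> y \<in> V \<Longrightarrow> x - y \<in> V"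
  using subV by (auto simp: subspace_0 subspace_scale subspace_neg subspace_add subspace_diff)

text \<open>The group law is controlled on \<open>V\<close> only. Composing with \<open>P\<close> in
  both slots yields a map smooth on the whole product space, whose derivatives need no restriction
  to a subset.\<close>

definition mt where "mt p = mul (P (fst p)) (P (snd p))"

lemma smooth_mt: "smooth_on UNIV mt"
proof -
  have "linear (\<lambda>p::'a \<times> 'a. (P (fst p), P (snd p)))"
    by (rule linearI) (simp_all add: linear_add[OF P(1)] linear_scale[OF P(1)])
  then have "smooth_on UNIV (\<lambda>p::'a \<times> 'a. (P (fst p), P (snd p)))" by (rule smooth_on_linear)
  from smooth_on_compose[OF this mul_smooth] show ?thesis
    using P(2) by (auto simp: mt_def[abs_def])
qed

lemma mt_V: "mt p \<in> V" by (simp add: mt_def mul_V P(2))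
lemma mt_eq: "x \<in> V \<Longrightarrow> y \<in> V \<Longrightarrow> mt (x, y) = mul x y" by (simp add: mt_def P(3))

lemma mt_curve:
  assumes "(y has_vector_derivative y') (at t)"
  shows "((\<lambda>s. mt (c, y s)) has_vector_derivative differential UNIV mt (c, y t) (0, y')) (at t)"
  by (rule has_vector_derivative_compose_UNIV[OF smooth_mt has_vector_derivative_Pair[OF has_vector_derivative_const assms]])

lemma linear_dmt: "linear (differential UNIV mt p)"
  by (rule has_derivative_linear[OF has_derivative_differential_UNIV[OF smooth_mt]])

lemma dmt_V: "differential UNIV mt p v \<in> V"
  by (rule differential_in_subspace[OF smooth_mt _ _ subV mt_V tangent_UNIV]) auto

text \<open>\<open>Lam x\<close> is the differential at the identity of the left translation by \<open>x\<close>; \<open>om x\<close> is the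
  Maurer-Cartan form.\<close>

definition Lam where "Lam x u = differential UNIV mt (x, 0) (0, u)"
definition om where "om x v = differential UNIV mt (- x, x) (0, v)"

lemma linear_Lam: "linear (Lam x)" and linear_om: "linear (om x)"
proof -
  have l: "linear (\<lambda>u::'a. (0::'a, u))" by (rule linearI) auto
  show "linear (Lam x)" "linear (om x)"
    using linear_compose[OF l linear_dmt] by (simp_all add: Lam_def[abs_def] om_def[abs_def] o_def)
qed

lemma Lam_V: "Lam x u \<in> V" and om_V: "om x v \<in> V"
  by (simp_all add: Lam_def om_def dmt_V)

lemma smooth_dmt: "smooth_on UNIV (\<lambda>p. differential UNIV mt p (0, u))"
  by (rule smooth_on_differential[OF smooth_mt _ smooth_on_const tangent_UNIV]) simp

lemma smooth_Lam: "smooth_on S (\<lambda>x. Lam x u)"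
proof -
  have "linear (\<lambda>x::'a. (x, 0::'a))" by (rule linearI) auto
  from smooth_on_compose[OF smooth_on_linear[OF this] smooth_dmt] show ?thesis
    unfolding Lam_def by simp
qed

lemma smooth_om: "smooth_on S (\<lambda>x. om x u)"
proof -
  have "linear (\<lambda>x::'a. (- x, x))" by (rule linearI) auto
  from smooth_on_compose[OF smooth_on_linear[OF this] smooth_dmt] show ?thesis
    unfolding om_def by simp
qed

lemma mul_inverse: "x \<in> V \<Longrightarrow> mul (- x) x = 0" "x \<in> V \<Longrightarrow> mul x (- x) = 0"
  using mul_line[of x "-1" 1] mul_line[of x 1 "-1"] by auto

lemma mul_cancel_left: "x \<in> V \<Longrightarrow> y \<in> V \<Longrightarrow> mul (- x) (mul x y) = y"
  "x \<in> V \<Longrightarrow> y \<in> V \<Longrightarrow> mul x (mul (- x) y) = y"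
  by (simp_all add: mul_assoc[symmetric] V_closed mul_inverse mul_0)

lemma mul_cancel_right: "x \<in> V \<Longrightarrow> y \<in> V \<Longrightarrow> mul (mul x y) (- y) = x"
  by (simp add: mul_assoc V_closed mul_inverse mul_0)

lemma deriv_line: "((\<lambda>s. (s - t) *\<^sub>R u) has_vector_derivative u) (at t)"
  by (auto intro!: derivative_eq_intros)

text \<open>By associativity the product at time \<open>s\<close> is the product at time
  \<open>t\<close> followed by a factor with parameter \<open>s - t\<close>, so the derivative at
  any time reduces to one at the identity.\<close>

lemma mul_deriv:
  assumes "x \<in> V" "u \<in> V"
  shows "((\<lambda>s. mul x (s *\<^sub>R u)) has_vector_derivative Lam (mul x (t *\<^sub>R u)) u) (at t)"
proof -
  have "mt (mul x (t *\<^sub>R u), (s - t) *\<^sub>R u) = mul x (s *\<^sub>R u)" for s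
    using assms by (simp add: mt_eq mul_V V_closed mul_assoc mul_line)
  then show ?thesis
    using mt_curve[OF deriv_line, of "mul x (t *\<^sub>R u)" t u] by (simp add: Lam_def)
qed

lemma Lam_deriv0:
  assumes "x \<in> V" "u \<in> V" shows "((\<lambda>s. mul x (s *\<^sub>R u)) has_vector_derivative Lam x u) (at 0)"
  using mul_deriv[OF assms, of 0] assms by (simp add: mul_0)

lemma left_inv_field_eq: "x \<in> V \<Longrightarrow> u \<in> V \<Longrightarrow> left_inv_field mul u x = Lam x u"
  unfolding left_inv_field_def using Lam_deriv0 by (rule vector_derivative_at)

lemma om_Lam: assumes "x \<in> V" "u \<in> V" shows "om x (Lam x u) = u"
proof -
  have "((\<lambda>s. mt (- x, mul x (s *\<^sub>R u))) has_vector_derivative om x (Lam x u)) (at 0)"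
    using mt_curve[OF Lam_deriv0[OF assms], of "- x"] assms by (simp add: om_def mul_0)
  moreover have "(\<lambda>s. mt (- x, mul x (s *\<^sub>R u))) = (\<lambda>s. (s - 0) *\<^sub>R u)"
    using assms by (simp add: mt_eq V_closed mul_V mul_cancel_left)
  ultimately show ?thesis using deriv_line[of 0 u] vector_derivative_unique_at by metis
qed

lemma Lam_om: assumes "x \<in> V" "v \<in> V" shows "Lam x (om x v) = v"
proof -
  have "((\<lambda>s. x + (s - 0) *\<^sub>R v) has_vector_derivative v) (at 0)"
    by (auto intro!: derivative_eq_intros)
  from mt_curve[OF this, of "- x"]
  have "((\<lambda>s. mt (- x, x + (s - 0) *\<^sub>R v)) has_vector_derivative om x v) (at 0)"
    by (simp add: om_def)
  from mt_curve[OF this, of x]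
  have "((\<lambda>s. mt (x, mt (- x, x + (s - 0) *\<^sub>R v))) has_vector_derivative Lam x (om x v)) (at 0)"
    using assms by (simp add: Lam_def mt_eq V_closed mul_inverse)
  moreover have "(\<lambda>s. mt (x, mt (- x, x + (s - 0) *\<^sub>R v))) = (\<lambda>s. x + (s - 0) *\<^sub>R v)"
    using assms by (simp add: mt_eq V_closed mul_V mul_cancel_left)
  ultimately show ?thesis
    using \<open>((\<lambda>s. x + (s - 0) *\<^sub>R v) has_vector_derivative v) (at 0)\<close> vector_derivative_unique_at by metis
qed

definition DL where "DL x w u = differential UNIV (\<lambda>y. Lam y u) x w"

lemma DL: "((\<lambda>y. Lam y u) has_derivative (\<lambda>w. DL x w u)) (at x)"
  using has_derivative_differential_UNIV[OF smooth_Lam, of u x] by (simp add: DL_def)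

lemma DL_scale: "DL x (c *\<^sub>R w) u = c *\<^sub>R DL x w u"
  using has_derivative_linear[OF DL[of u x]] by (rule linear_scale)

lemma Lam_family:
  assumes "(y has_vector_derivative y') (at t)" "(a has_vector_derivative a') (at t)"
  shows "((\<lambda>s. Lam (y s) (a s)) has_vector_derivative DL (y t) y' (a t) + Lam (y t) a') (at t)"
proof -
  have "((\<lambda>s. Lam (y s) (a s)) has_derivative
      (\<lambda>h. DL (y t) (h *\<^sub>R y') (a t) + Lam (y t) (h *\<^sub>R a'))) (at t within UNIV)"
    by (rule has_derivative_family[OF linear_Lam open_UNIV UNIV_I DL
          assms(1)[unfolded has_vector_derivative_def] assms(2)[unfolded has_vector_derivative_def] UNIV_I])
  then show ?thesis
    by (simp add: has_vector_derivative_def DL_scale linear_scale[OF linear_Lam] scaleR_add_right)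
qed

text \<open>The bracket axiom of \<open>exp_group\<close>, spelled out with the derivative
  \<open>DL\<close> of \<open>Lam\<close> in its base point. It is the structure equation of the
  group in the form that will be restricted to one-parameter subgroups.\<close>

lemma Lam_bracket_rel:
  assumes "u \<in> V" "v \<in> V" "x \<in> V"
  shows "DL x (Lam x u) v - DL x (Lam x v) u = Lam x (br u v)"
proof -
  have d: "differential V (\<lambda>y. Lam y w) x h = DL x h w" if "h \<in> V" for w h
    by (rule differential_eqI[OF has_derivative_at_withinI[OF DL]])
      (use that tangent_space_subspace[OF subV assms(3)] in simp)
  have "lie_bracket V (left_inv_field mul u) (left_inv_field mul v) x =
      lie_bracket V (\<lambda>y. Lam y u) (\<lambda>y. Lam y v) x"
    by (rule lie_bracket_cong[OF openin_subtopology_self assms(3)])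
      (use assms left_inv_field_eq in auto)
  also have "\<dots> = DL x (Lam x u) v - DL x (Lam x v) u"
    by (simp add: lie_bracket_def d Lam_V)
  finally show ?thesis using mul_bracket[OF assms] left_inv_field_eq[OF assms(3) br_V[OF assms(1,2)]] by simp
qed

text \<open>A line through 0 is a one-parameter subgroup, so its velocity is both \<open>y\<close>
  and the value of the left-invariant field of \<open>y\<close>.\<close>

lemma Lam_line: assumes "y \<in> V" shows "Lam (t *\<^sub>R y) y = y"
proof -
  have "((\<lambda>s. t *\<^sub>R y + (s - 0) *\<^sub>R y) has_vector_derivative y) (at 0)"
    by (auto intro!: derivative_eq_intros)
  moreover have "(\<lambda>s. mul (t *\<^sub>R y) (s *\<^sub>R y)) = (\<lambda>s. t *\<^sub>R y + (s - 0) *\<^sub>R y)"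
    using assms by (simp add: mul_line scaleR_add_left)
  ultimately show ?thesis
    using Lam_deriv0[OF V_closed(2)[OF assms, of t] assms] vector_derivative_unique_at by metis
qed

text \<open>Differentiation of \<open>Lam (t *\<^sub>R y) y = y\<close> in \<open>y\<close>, at the
  point \<open>x\<close> and in direction \<open>w\<close>.\<close>

lemma Lam_line_diff: assumes "x \<in> V" "w \<in> V" shows "t *\<^sub>R DL (t *\<^sub>R x) w x + Lam (t *\<^sub>R x) w = w"
proof -
  have a: "((\<lambda>s. x + s *\<^sub>R w) has_vector_derivative w) (at 0)"
    and y: "((\<lambda>s. t *\<^sub>R (x + s *\<^sub>R w)) has_vector_derivative t *\<^sub>R w) (at 0)"
    by (auto intro!: derivative_eq_intros)
  have "(\<lambda>s. Lam (t *\<^sub>R (x + s *\<^sub>R w)) (x + s *\<^sub>R w)) = (\<lambda>s. x + s *\<^sub>R w)"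
    using assms by (simp add: Lam_line V_closed)
  with Lam_family[OF y a] have "((\<lambda>s. x + s *\<^sub>R w) has_vector_derivative
      (t *\<^sub>R DL (t *\<^sub>R x) w x + Lam (t *\<^sub>R x) w)) (at 0)" by (simp add: DL_scale)
  then show ?thesis using a vector_derivative_unique_at by metis
qed

text \<open>The Maurer-Cartan equation along the one-parameter subgroup of \<open>x\<close>.\<close>

lemma om_ode:
  assumes "x \<in> V" "u \<in> V"
  shows "((\<lambda>t. t *\<^sub>R om (t *\<^sub>R x) u) has_vector_derivative u - br x (t *\<^sub>R om (t *\<^sub>R x) u)) (at t)"
proof -
  \<comment> \<open>The factor \<open>t\<close> makes the curve vanish at 0, which supplies the
    initial value for \<open>ode_unique\<close>, and turns \<open>Lam_om\<close> into a relation
    with the linear function \<open>s *\<^sub>R u\<close>.\<close>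
  define A where "A t = t *\<^sub>R om (t *\<^sub>R x) u" for t
  have "((\<lambda>s. s *\<^sub>R x) has_vector_derivative x) (at t)"
    by (auto intro!: derivative_eq_intros)
  from has_vector_derivative_compose_UNIV[OF smooth_om this, of u]
  have "(A has_vector_derivative t *\<^sub>R differential UNIV (\<lambda>y. om y u) (t *\<^sub>R x) x + 1 *\<^sub>R om (t *\<^sub>R x) u) (at t)"
    unfolding A_def[abs_def] by (intro has_vector_derivative_scaleR DERIV_ident)
  then obtain a where a: "(A has_vector_derivative a) (at t)" by blast
  have AV: "A s \<in> V" for s using om_V V_closed by (simp add: A_def)
  \<comment> \<open>The curve stays in \<open>V\<close>, where \<open>P\<close> is the identity, so
    its derivative is fixed by \<open>P\<close> as well.\<close>
  have "((\<lambda>s. P (A s)) has_vector_derivative P a) (at t)"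
    using has_vector_derivative_compose_UNIV[OF smooth_on_linear[OF P(1)] a]
    by (simp add: differential_linear[OF P(1) tangent_UNIV])
  then have "P a = a" using a AV P(3) vector_derivative_unique_at by auto
  then have aV: "a \<in> V" using P(2) by metis
  have tx: "t *\<^sub>R x \<in> V" for t using assms V_closed by blast
  have LA: "Lam (s *\<^sub>R x) (A s) = s *\<^sub>R u" for s
    using Lam_om[OF tx assms(2)] by (simp add: A_def linear_scale[OF linear_Lam])
  have y: "((\<lambda>s. s *\<^sub>R x) has_vector_derivative x) (at t)" by (auto intro!: derivative_eq_intros)
  have "((\<lambda>s. s *\<^sub>R u) has_vector_derivative (DL (t *\<^sub>R x) x (A t) + Lam (t *\<^sub>R x) a)) (at t)"
    using Lam_family[OF y a] by (simp add: LA)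
  moreover have "((\<lambda>s. s *\<^sub>R u) has_vector_derivative u) (at t)" by (auto intro!: derivative_eq_intros)
  ultimately have 1: "DL (t *\<^sub>R x) x (A t) + Lam (t *\<^sub>R x) a = u"
    using vector_derivative_unique_at by metis
  have 2: "DL (t *\<^sub>R x) x (A t) - t *\<^sub>R DL (t *\<^sub>R x) u x = Lam (t *\<^sub>R x) (br x (A t))"
    using Lam_bracket_rel[OF assms(1) AV tx, of t t] Lam_line[OF assms(1)] by (simp add: LA DL_scale)
  \<comment> \<open>Relations \<open>1\<close> and \<open>2\<close> together with
    \<open>Lam_line_diff\<close> eliminate both derivatives of \<open>Lam\<close>; injectivity of
    \<open>Lam (t *\<^sub>R x)\<close> on \<open>V\<close> then removes \<open>Lam\<close>
    altogether.\<close>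
  have "Lam (t *\<^sub>R x) a + Lam (t *\<^sub>R x) (br x (A t)) + t *\<^sub>R DL (t *\<^sub>R x) u x =
      DL (t *\<^sub>R x) x (A t) + Lam (t *\<^sub>R x) a" unfolding 2[symmetric] by simp
  also have "\<dots> = Lam (t *\<^sub>R x) u + t *\<^sub>R DL (t *\<^sub>R x) u x"
    using 1 Lam_line_diff[OF assms, of t] by (simp add: add.commute)
  finally have "Lam (t *\<^sub>R x) (a + br x (A t)) = Lam (t *\<^sub>R x) u"
    unfolding linear_add[OF linear_Lam] by simp
  then have "a + br x (A t) = u"
    using om_Lam[OF tx] V_closed(4)[OF aV br_V[OF assms(1) AV]] assms(2) by metis
  then have "a = u - br x (A t)" by (simp add: eq_diff_eq)
  then show ?thesis using a by (simp add: A_def[abs_def])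
qed

text \<open>Descending induction on \<open>m\<close>. At \<open>m = Suc \<nu>\<close> nilpotency
  kills everything; one step lower, the derivative of \<open>(br x ^^ m) (e t)\<close> is minus the
  case \<open>Suc m\<close> and hence 0, so this curve is constant with initial value 0.\<close>

lemma ode_unique:
  assumes x: "x \<in> V" and e: "\<And>t. e t \<in> V" "e 0 = 0" "\<And>t. (e has_vector_derivative - br x (e t)) (at t)"
  shows "e t = 0"
proof -
  have lin: "linear (br x ^^ k)" for k
  proof (induction k)
    case 0 show ?case using linear_id by (simp add: id_def)
  next
    case (Suc k) then show ?case unfolding funpow.simps by (rule linear_compose[OF _ lin_br(1)])
  qed
  have "\<forall>t. (br x ^^ m) (e t) = 0" if "m \<le> Suc \<nu>" for m
    using that
  proof (induction m rule: inc_induct)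
    case base
    then show ?case using ad_nilpotent[OF x e(1)] by simp
  next
    case (step m)
    have "((\<lambda>s. (br x ^^ m) (e s)) has_vector_derivative 0) (at t)" for t
    proof -
      have "((\<lambda>s. (br x ^^ m) (e s)) has_vector_derivative (br x ^^ m) (- br x (e t))) (at t)"
        using has_vector_derivative_compose_UNIV[OF smooth_on_linear[OF lin] e(3)]
        by (simp only: differential_linear[OF lin tangent_UNIV])
      moreover have "(br x ^^ m) (- br x (e t)) = 0"
        using step.IH by (simp add: linear_neg[OF lin] funpow_swap1)
      ultimately show ?thesis by simp
    qed
    then obtain c where "\<And>s. (br x ^^ m) (e s) = c"
      using has_derivative_zero_constant[of UNIV "\<lambda>s. (br x ^^ m) (e s)"]
      by (auto simp: has_vector_derivative_def)
    moreover have "(br x ^^ m) (e 0) = 0" using e(2) linear_0[OF lin] by simp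
    ultimately show ?case by simp
  qed
  from this[of 0] show ?thesis by simp
qed

text \<open>As \<open>br x z = 0\<close>, the line \<open>t *\<^sub>R z\<close> solves the same
  equation as \<open>t *\<^sub>R om (t *\<^sub>R x) z\<close>, with the same initial value; the
  claim is their equality at \<open>t = 1\<close>.\<close>

lemma om_central: assumes "central z" "x \<in> V" shows "om x z = z"
proof -
  define e where "e t = t *\<^sub>R om (t *\<^sub>R x) z - t *\<^sub>R z" for t
  have z: "z \<in> V" using assms(1) central_V by blast
  have "e 1 = 0"
  proof (rule ode_unique[OF assms(2)])
    show "e t \<in> V" for t using om_V V_closed z by (simp add: e_def)
    show "e 0 = 0" by (simp add: e_def)
    fix t
    have "((\<lambda>t. t *\<^sub>R z) has_vector_derivative z) (at t)" by (auto intro!: derivative_eq_intros)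
    from has_vector_derivative_diff[OF om_ode[OF assms(2) z] this]
    have "(e has_vector_derivative - br x (t *\<^sub>R om (t *\<^sub>R x) z)) (at t)" by (simp add: e_def[abs_def])
    moreover have "br x (e t) = br x (t *\<^sub>R om (t *\<^sub>R x) z)"
      using central_br(2)[OF assms] lin_br(1)[of x] by (simp add: e_def linear_diff linear_scale)
    ultimately show "(e has_vector_derivative - br x (e t)) (at t)" by simp
  qed
  then show ?thesis by (simp add: e_def)
qed

lemma Lam_central: "central z \<Longrightarrow> x \<in> V \<Longrightarrow> Lam x z = z"
  using Lam_om[of x z] om_central[of z x] central_V by simp

text \<open>When the second bracket vanishes, the equation for \<open>om\<close> is solved by a
  quadratic polynomial in \<open>t\<close>, whence the coefficient 1/2; inverting the result gives
  \<open>Lam\<close>. The formula makes the isomorphism with the quadric explicit.\<close>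

lemma Lam_two_step:
  assumes "x \<in> V" "u \<in> V" "br x (br x u) = 0"
  shows "Lam x u = u + (1/2) *\<^sub>R br x u"
proof -
  have om2: "om x v = v - (1/2) *\<^sub>R br x v" if "v \<in> V" "br x (br x v) = 0" for v
  proof -
    define e where "e t = t *\<^sub>R om (t *\<^sub>R x) v - (t *\<^sub>R v - (t\<^sup>2/2) *\<^sub>R br x v)" for t
    have "e 1 = 0"
    proof (rule ode_unique[OF assms(1)])
      show "e t \<in> V" for t using om_V V_closed that br_V[OF assms(1) that(1)] by (simp add: e_def)
      show "e 0 = 0" by (simp add: e_def)
      fix t
      have "((\<lambda>t. t *\<^sub>R v - (t\<^sup>2/2) *\<^sub>R br x v) has_vector_derivative v - t *\<^sub>R br x v) (at t)"
        by (auto intro!: derivative_eq_intros)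
      from has_vector_derivative_diff[OF om_ode[OF assms(1) that(1)] this]
      have "(e has_vector_derivative t *\<^sub>R br x v - br x (t *\<^sub>R om (t *\<^sub>R x) v)) (at t)"
        by (simp add: e_def[abs_def])
      moreover have "br x (e t) = br x (t *\<^sub>R om (t *\<^sub>R x) v) - t *\<^sub>R br x v"
        using that(2) lin_br(1)[of x] by (simp add: e_def linear_diff linear_scale)
      ultimately show "(e has_vector_derivative - br x (e t)) (at t)" by simp
    qed
    then show ?thesis by (simp add: e_def algebra_simps)
  qed
  let ?v = "u + (1/2) *\<^sub>R br x u"
  have v: "?v \<in> V" by (rule V_closed(4)[OF assms(2) V_closed(2)[OF br_V[OF assms(1,2)]]])
  have "br x ?v = br x u" using assms(3) lin_br(1)[of x] by (simp add: linear_add linear_scale)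
  then have "om x ?v = u" using om2[OF v] assms(3) by simp
  then show ?thesis using Lam_om[OF assms(1) v] by simp
qed

text \<open>The curve \<open>mul x (s *\<^sub>R z)\<close> moves with constant velocity
  \<open>z\<close>, because \<open>Lam\<close> fixes \<open>z\<close> at every point.\<close>

lemma mul_central: assumes "central z" "x \<in> V" shows "mul x z = x + z"
proof -
  have z: "z \<in> V" using assms(1) central_V by blast
  have "((\<lambda>s. mul x (s *\<^sub>R z) - s *\<^sub>R z) has_vector_derivative 0) (at t)" for t
  proof -
    have "((\<lambda>t. t *\<^sub>R z) has_vector_derivative z) (at t)" by (auto intro!: derivative_eq_intros)
    from has_vector_derivative_diff[OF mul_deriv[OF assms(2) z] this]
    show ?thesis using Lam_central[OF assms(1)] mul_V[OF assms(2)] z V_closed by simp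
  qed
  then obtain c where c: "\<And>s. mul x (s *\<^sub>R z) - s *\<^sub>R z = c"
    using has_derivative_zero_constant[of UNIV "\<lambda>s. mul x (s *\<^sub>R z) - s *\<^sub>R z"]
    by (auto simp: has_vector_derivative_def)
  from c[of 0] c[of 1] show ?thesis using assms(2) by (simp add: mul_0 algebra_simps)
qed

text \<open>Squaring \<open>y + z\<close> in two ways shows that \<open>y\<close> and \<open>z\<close> commute.\<close>

lemma mul_central_left: assumes "central z" "y \<in> V" shows "mul z y = y + z"
proof -
  have z: "z \<in> V" using assms(1) central_V by blast
  have yz: "mul y z \<in> V" "mul z y \<in> V" using mul_V z assms(2) by auto
  have "mul (mul y z) (mul y z) = 2 *\<^sub>R (y + z)"
    using mul_line[of "y + z" 1 1] V_closed(4)[OF assms(2) z] mul_central[OF assms] by simp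
  also have "\<dots> = mul (2 *\<^sub>R y) (2 *\<^sub>R z)"
    using mul_central[OF central_scale[OF assms(1)], of "2 *\<^sub>R y" 2] assms(2) V_closed
    by (simp add: scaleR_add_right)
  also have "\<dots> = mul (mul y y) (mul z z)"
    using mul_line[of y 1 1] mul_line[of z 1 1] assms(2) z by simp
  finally have "mul y (mul z (mul y z)) = mul y (mul y (mul z z))"
    using mul_assoc assms(2) z yz mul_V by simp
  then have "mul z (mul y z) = mul y (mul z z)"
    using mul_cancel_left(1) assms(2) z yz mul_V by metis
  then have "mul (mul z y) z = mul (mul y z) z" using mul_assoc assms(2) z by simp
  then have "mul z y = mul y z" using mul_cancel_right yz z by metis
  then show ?thesis using mul_central[OF assms] by simp
qed

lemma mul_add_central:
  assumes "central z" "x \<in> V" "y \<in> V"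
  shows "mul (x + z) y = mul x y + z" "mul x (y + z) = mul x y + z"
proof -
  have z: "z \<in> V" using assms(1) central_V by blast
  show "mul (x + z) y = mul x y + z"
    using mul_central_left[OF assms(1,2)] mul_central_left[OF assms(1) mul_V[OF assms(2,3)]]
      mul_assoc[OF z assms(2,3)] by simp
  show "mul x (y + z) = mul x y + z"
    using mul_central[OF assms(1,3)] mul_central[OF assms(1) mul_V[OF assms(2,3)]]
      mul_assoc[OF assms(2,3) z] by simp
qed

text \<open>Left translation by \<open>x + z\<close> is left translation by \<open>x\<close>
  followed by a translation of the vector space, so the differentials coincide. This becomes the
  invariance of the connection under the structure group.\<close>

lemma Lam_add_central:
  assumes "central z" "x \<in> V" "u \<in> V" shows "Lam (x + z) u = Lam x u"
proof -
  have "((\<lambda>s. mul x (s *\<^sub>R u) + z) has_vector_derivative Lam x u) (at 0)"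
    using Lam_deriv0[OF assms(2,3)] by (auto intro!: derivative_eq_intros)
  moreover have "(\<lambda>s. mul (x + z) (s *\<^sub>R u)) = (\<lambda>s. mul x (s *\<^sub>R u) + z)"
    using mul_add_central(1)[OF assms(1,2)] assms(3) V_closed by simp
  ultimately show ?thesis
    using Lam_deriv0[OF V_closed(4)[OF assms(2) central_V[OF assms(1)]] assms(3)]
      vector_derivative_unique_at by metis
qed

lemma Lam_inj: "x \<in> V \<Longrightarrow> inj_on (Lam x) V"
  by (rule inj_on_inverseI[of _ "om x"]) (rule om_Lam)

lemma Lam_onto: "x \<in> V \<Longrightarrow> Lam x ` V = V"
proof
  show "V \<subseteq> Lam x ` V" if "x \<in> V"
  proof
    fix v assume "v \<in> V"
    from Lam_om[OF that this] show "v \<in> Lam x ` V" using om_V[of x v] by (metis imageI)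
  qed
qed (use Lam_V in blast)

section \<open>Left-invariant distributions\<close>

text \<open>Sections of a left-invariant distribution have variable coefficients. Besides the
  algebraic bracket, only derivatives of the coefficients occur, and these stay in any subspace that
  contains the coefficients; this is why the flag and the symbol can be read off from the
  algebra.\<close>

lemma Lam_lie_bracket:
  assumes U: "open_in V U" "x \<in> U" and a: "smooth_on U a" "\<And>y. y \<in> U \<Longrightarrow> a y \<in> V"
    and b: "smooth_on U b" "\<And>y. y \<in> U \<Longrightarrow> b y \<in> V"
  shows "lie_bracket V (\<lambda>y. Lam y (a y)) (\<lambda>y. Lam y (b y)) x =
    Lam x (br (a x) (b x) + differential V b x (Lam x (a x)) - differential V a x (Lam x (b x)))"
proof -
  have x: "x \<in> V" using U openin_imp_subset by blast
  have d: "differential V (\<lambda>y. Lam y (c y)) x h = DL x h (c x) + Lam x (differential V c x h)"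
    if "smooth_on U c" "h \<in> V" for c h
  proof (rule differential_eqI)
    show "((\<lambda>y. Lam y (c y)) has_derivative (\<lambda>h. DL x h (c x) + Lam x (differential V c x h))) (at x within V)"
      by (rule has_derivative_family[OF linear_Lam open_UNIV UNIV_I DL has_derivative_ident
            has_derivative_differential[OF that(1) U] x])
    show "h \<in> tangent_space V x" using tangent_space_subspace[OF subV x] that(2) by simp
  qed
  show ?thesis
    unfolding lie_bracket_def d[OF a(1) Lam_V] d[OF b(1) Lam_V]
    using Lam_bracket_rel[OF a(2)[OF U(2)] b(2)[OF U(2)] x]
    by (simp add: linear_add[OF linear_Lam] linear_diff[OF linear_Lam] algebra_simps)
qed

text \<open>The Maurer-Cartan form recovers the coefficient, and its smooth dependence on the point
  makes the coefficient smooth.\<close>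

lemma section_coeff:
  assumes "A \<in> sections U (\<lambda>x. Lam x ` W)" "U \<subseteq> V" "W \<subseteq> V"
  obtains a where "smooth_on U a" "\<And>x. x \<in> U \<Longrightarrow> a x \<in> W" "\<And>x. x \<in> U \<Longrightarrow> A x = Lam x (a x)"
proof (rule that[of "\<lambda>x. om x (A x)"])
  show "smooth_on U (\<lambda>x. om x (A x))"
    by (rule smooth_on_family[OF linear_om smooth_om]) (use assms(1) in \<open>simp add: sections_def\<close>)
  fix x assume x: "x \<in> U"
  then obtain w where w: "w \<in> W" "A x = Lam x w" using assms(1) by (auto simp: sections_def)
  moreover have "om x (Lam x w) = w" using om_Lam w(1) assms(2,3) x by blast
  ultimately show "om x (A x) \<in> W" "A x = Lam x (om x (A x))" by auto
qed

lemma section_coeffI: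
  assumes "smooth_on U a" "\<And>x. x \<in> U \<Longrightarrow> a x \<in> W"
  shows "(\<lambda>x. Lam x (a x)) \<in> sections U (\<lambda>x. Lam x ` W)"
  using assms smooth_on_family[OF linear_Lam smooth_Lam assms(1)] by (auto simp: sections_def)

end

section \<open>Standard models\<close>

lemma embedded_submanifold_subspace: "subspace V \<Longrightarrow> embedded_submanifold (dim V) V"
  unfolding embedded_submanifold_def
  by (intro ballI exI[of _ UNIV] exI[of _ V] exI[of _ "\<lambda>x. x"]) (auto simp: smooth_on_id)

locale std_model = exp_model gr br \<nu> mul
  for gr :: "nat \<Rightarrow> 'a::euclidean_space set" and br \<nu> mul +
  fixes J :: "'a \<Rightarrow> 'a" and X :: "'a cr"
  assumes generated: "generated_in_degree_one gr br" and dim_gr1: "dim (gr 1) = 2"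
    and J: "complex_structure_on (gr 1) J" and points_X: "points X = V"
    and distr_X: "\<And>x. x \<in> V \<Longrightarrow> distr X x = (\<lambda>u. left_inv_field mul u x) ` gr 1"
    and cplx_X: "\<And>x u. x \<in> V \<Longrightarrow> u \<in> gr 1 \<Longrightarrow>
      cplx X x (left_inv_field mul u x) = left_inv_field mul (J u) x"

lemma standard_modelE:
  assumes "standard_model gr br J X" "gnla_depth gr \<nu>"
  obtains mul where "std_model gr br \<nu> mul J X"
proof -
  from assms(1)[unfolded standard_model_def] obtain mul where
    m: "gnla gr br" "generated_in_degree_one gr br" "dim (gr 1) = 2" "complex_structure_on (gr 1) J"
    "points X = gnla_carrier gr" "exp_group gr br mul"
    "\<forall>x\<in>points X. distr X x = (\<lambda>u. left_inv_field mul u x) ` gr 1"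
    "\<forall>x\<in>points X. \<forall>u\<in>gr 1. cplx X x (left_inv_field mul u x) = left_inv_field mul (J u) x"
    by (elim conjE exE)
  have "std_model gr br \<nu> mul J X"
    by unfold_locales (use assms(2) m in auto)
  then show ?thesis by (rule that)
qed

lemma (in std_model) standard_model: "standard_model gr br J X"
  unfolding standard_model_def
  using gnla generated dim_gr1 J points_X exp distr_X cplx_X
  by (intro conjI exI[of _ mul] ballI) simp_all

context std_model
begin

lemma gr1_V: "u \<in> gr 1 \<Longrightarrow> u \<in> V" using grV by blast

lemma J_gr1: "u \<in> gr 1 \<Longrightarrow> J u \<in> gr 1" and J_J: "u \<in> gr 1 \<Longrightarrow> J (J u) = - u" and linear_J: "linear J"
  using J by (auto simp: complex_structure_on_def)

lemma distr_Lam: "x \<in> V \<Longrightarrow> distr X x = Lam x ` gr 1"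
  using distr_X left_inv_field_eq gr1_V by (simp cong: image_cong)

lemma cplx_Lam: "x \<in> V \<Longrightarrow> u \<in> gr 1 \<Longrightarrow> cplx X x (Lam x u) = Lam x (J u)"
  using cplx_X left_inv_field_eq gr1_V J_gr1 by metis

lemma depth_pos: "\<nu> \<ge> 1"
proof (rule ccontr)
  assume "\<not> \<nu> \<ge> 1"
  then have "gr 1 = {0}" using gr_top[of 1] by simp
  then show False using dim_gr1 by simp
qed

lemma tangent_V: "x \<in> V \<Longrightarrow> tangent_space V x = V" by (rule tangent_space_subspace[OF subV])

lemma sub_Lam: "subspace W \<Longrightarrow> subspace (Lam x ` W)"
  by (rule linear_subspace_image[OF linear_Lam])

lemma smooth_cplx:
  assumes "open_in V U" "A \<in> sections U (distr X)" shows "smooth_on U (\<lambda>x. cplx X x (A x))"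
proof -
  have U: "U \<subseteq> V" using assms(1) openin_imp_subset by blast
  have "A \<in> sections U (\<lambda>x. Lam x ` gr 1)"
    by (rule sections_subset[OF assms(2) order_refl]) (use distr_Lam U in blast)
  then obtain a where a: "smooth_on U a" "\<And>x. x \<in> U \<Longrightarrow> a x \<in> gr 1" "\<And>x. x \<in> U \<Longrightarrow> A x = Lam x (a x)"
    using section_coeff[OF _ U grV] by blast
  have "smooth_on U (\<lambda>x. Lam x (J (a x)))"
    by (rule smooth_on_family[OF linear_Lam smooth_Lam smooth_on_linear_compose[OF linear_J a(1)]])
  then show ?thesis by (rule smooth_on_cong) (use a(2,3) cplx_Lam U in auto)
qed

lemma regular: "cr_regular X"
  unfolding cr_regular_def points_X
proof (intro conjI ballI allI impI)
  show "tangent_closed V" by (rule tangent_closed_subspace[OF subV])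
  fix x assume x: "x \<in> V"
  show "subspace (distr X x)" unfolding distr_Lam[OF x] by (rule sub_Lam[OF sub_gr])
  show "distr X x \<subseteq> tangent_space V x" unfolding distr_Lam[OF x] tangent_V[OF x] using Lam_V by blast
  show "cplx X x v \<in> distr X x" if "v \<in> distr X x" for v
    using that cplx_Lam[OF x] J_gr1 unfolding distr_Lam[OF x] by force
next
  show "smooth_on U (\<lambda>x. cplx X x (A x))" if "open_in V U \<and> A \<in> sections U (distr X)" for U A
    using smooth_cplx that by blast
qed

lemma const_coeff_bracket:
  assumes "x \<in> V" "u \<in> V" "v \<in> V"
  shows "lie_bracket V (\<lambda>y. Lam y u) (\<lambda>y. Lam y v) x = Lam x (br u v)"
proof -
  have "differential V (\<lambda>y. w) x h = 0" if "h \<in> V" for w h :: 'a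
    by (rule differential_eqI[OF has_derivative_const]) (use that tangent_V[OF assms(1)] in simp)
  then show ?thesis
    using Lam_lie_bracket[where a="\<lambda>_. u" and b="\<lambda>_. v",
        OF openin_subtopology_self assms(1) smooth_on_const assms(2) smooth_on_const assms(3)]
    by (simp add: Lam_V)
qed

lemma section_const_Lam: "u \<in> W \<Longrightarrow> (\<lambda>y. Lam y u) \<in> sections U (\<lambda>y. Lam y ` W)"
  by (rule section_coeffI[OF smooth_on_const]) simp

text \<open>For the upper bound, the bracket formula raises the filtration by at most one step. For
  the lower bound, constant coefficients already realise all brackets of \<open>gr 1\<close> with
  \<open>gr k\<close>, and these span \<open>gr (Suc k)\<close>.\<close>

lemma weak_flag_Lam: "x \<in> V \<Longrightarrow> weak_flag X k x = Lam x ` Fil k"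
proof (induction k arbitrary: x)
  case 0
  then show ?case by (simp add: Fil_0 linear_0[OF linear_Lam])
next
  case (Suc k)
  show ?case
  proof (cases k)
    case 0
    then show ?thesis using Fil_1 distr_Lam[OF Suc.prems] by simp
  next
    case (Suc j)
    note x = Suc.prems
    let ?B = "{lie_bracket (points X) A B x | A B U. open_in (points X) U \<and> x \<in> U \<and>
      A \<in> sections U (distr X) \<and> B \<in> sections U (weak_flag X k)}"
    have wf: "weak_flag X (Suc k) x = span (weak_flag X k x \<union> ?B)" by (simp add: Suc)
    have brk: "lie_bracket V A B x \<in> Lam x ` Fil (Suc k)"
      if U: "open_in V U" "x \<in> U" and A: "A \<in> sections U (distr X)" and B: "B \<in> sections U (weak_flag X k)" for A B U
    proof -
      have UV: "U \<subseteq> V" using U(1) openin_imp_subset by blast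
      have "A \<in> sections U (\<lambda>x. Lam x ` gr 1)"
        by (rule sections_subset[OF A order_refl]) (use distr_Lam UV in blast)
      from section_coeff[OF this UV grV] obtain a where
        a: "smooth_on U a" "\<And>x. x \<in> U \<Longrightarrow> a x \<in> gr 1" "\<And>x. x \<in> U \<Longrightarrow> A x = Lam x (a x)" by blast
      have "B \<in> sections U (\<lambda>x. Lam x ` Fil k)"
        by (rule sections_subset[OF B order_refl]) (use Suc.IH UV in blast)
      from section_coeff[OF this UV Fil_V] obtain b where
        b: "smooth_on U b" "\<And>x. x \<in> U \<Longrightarrow> b x \<in> Fil k" "\<And>x. x \<in> U \<Longrightarrow> B x = Lam x (b x)" by blast
      have t: "Lam x w \<in> tangent_space V x" for w using tangent_V[OF x] Lam_V by simp
      have "differential V b x (Lam x (a x)) \<in> Fil (Suc k)"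
        using differential_in_subspace[OF b(1) U sub_Fil b(2) t] Fil_mono[of k "Suc k"] by auto
      moreover have "differential V a x (Lam x (b x)) \<in> Fil (Suc k)"
        using differential_in_subspace[OF a(1) U sub_gr a(2) t] gr_Fil[of 1 "Suc k"] by auto
      moreover have "br (a x) (b x) \<in> Fil (Suc k)"
        using br_Fil[of "a x" 1 "b x" k] a(2) b(2) U(2) Fil_1 by auto
      ultimately have "br (a x) (b x) + differential V b x (Lam x (a x)) - differential V a x (Lam x (b x)) \<in> Fil (Suc k)"
        using sub_Fil by (intro subspace_add subspace_diff)
      moreover have "lie_bracket V A B x = lie_bracket V (\<lambda>y. Lam y (a y)) (\<lambda>y. Lam y (b y)) x"
        by (rule lie_bracket_cong[OF U]) (use a(3) b(3) in auto)
      moreover have "a y \<in> V" "b y \<in> V" if "y \<in> U" for y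
        using a(2)[OF that] b(2)[OF that] grV Fil_V by blast+
      ultimately show ?thesis using Lam_lie_bracket[OF U a(1) _ b(1)] by simp
    qed
    have "?B \<subseteq> Lam x ` Fil (Suc k)"
      by (intro subsetI) (elim CollectE exE conjE, simp only: brk points_X)
    moreover have "weak_flag X k x \<subseteq> Lam x ` Fil (Suc k)"
      unfolding Suc.IH[OF x] using Fil_mono[of k "Suc k"] by (intro image_mono) simp
    ultimately have 1: "weak_flag X (Suc k) x \<subseteq> Lam x ` Fil (Suc k)"
      unfolding wf by (intro span_minimal sub_Lam sub_Fil Un_least)
    have gen: "Lam x (br u v) \<in> weak_flag X (Suc k) x" if "u \<in> gr 1" "v \<in> gr k" for u v
    proof -
      have "(\<lambda>y. Lam y u) \<in> sections V (distr X)"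
        by (rule sections_subset[OF section_const_Lam[of u "gr 1"] order_refl])
          (use that distr_Lam in auto)
      moreover have "(\<lambda>y. Lam y v) \<in> sections V (weak_flag X k)"
        by (rule sections_subset[OF section_const_Lam[of v "Fil k"] order_refl])
          (use that Suc.IH gr_Fil[of k k] in auto)
      moreover have "Lam x (br u v) = lie_bracket (points X) (\<lambda>y. Lam y u) (\<lambda>y. Lam y v) x"
        using const_coeff_bracket[OF x subsetD[OF grV that(1)] subsetD[OF grV that(2)]] points_X by simp
      ultimately have "Lam x (br u v) \<in> ?B"
        using x points_X by (intro CollectI exI[of _ "\<lambda>y. Lam y u"] exI[of _ "\<lambda>y. Lam y v"] exI[of _ V]) simp
      then show ?thesis unfolding wf by (intro span_base) simp
    qed
    have sub: "subspace {w. Lam x w \<in> weak_flag X (Suc k) x}"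
      using linear_subspace_vimage[OF linear_Lam, of "weak_flag X (Suc k) x" x] subspace_span
      unfolding vimage_def wf by simp
    have "gr j \<subseteq> {w. Lam x w \<in> weak_flag X (Suc k) x}" if "j \<le> Suc k" for j
    proof (cases "j \<le> k")
      case True
      then have "Lam x ` gr j \<subseteq> weak_flag X k x" unfolding Suc.IH[OF x] using gr_Fil by blast
      then show ?thesis unfolding wf using span_superset by blast
    next
      case False
      then have "j = Suc k" using that by simp
      then have "gr j = span {br u v | u v. u \<in> gr 1 \<and> v \<in> gr k}"
        using generated_step[OF generated, of k] Suc by simp
      also have "\<dots> \<subseteq> {w. Lam x w \<in> weak_flag X (Suc k) x}"
        by (rule span_minimal[OF _ sub]) (use gen in blast)
      finally show ?thesis .
    qed
    then have "Fil (Suc k) \<subseteq> {w. Lam x w \<in> weak_flag X (Suc k) x}"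
      unfolding Fil_def by (intro span_minimal sub) blast
    with 1 show ?thesis by blast
  qed
qed

lemma dim_Lam: "x \<in> V \<Longrightarrow> subspace W \<Longrightarrow> W \<subseteq> V \<Longrightarrow> dim (Lam x ` W) = dim W"
  using dim_image_eq[OF linear_Lam] inj_on_subset[OF Lam_inj] by (metis span_eq_iff)

lemma growth:
  assumes "x \<in> V" shows "dim (weak_flag X (Suc k) x) - dim (weak_flag X k x) = dim (gr (Suc k))"
  using dim_Lam[OF assms sub_Fil Fil_V] dim_Fil[of k] by (simp add: weak_flag_Lam[OF assms])

lemma smooth_distribution_Lam:
  assumes "subspace W" "\<And>x. x \<in> V \<Longrightarrow> E x = Lam x ` W" shows "smooth_distribution V E"
  unfolding smooth_distribution_def
proof (intro conjI ballI)
  fix x assume x: "x \<in> V"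
  show "subspace (E x)" unfolding assms(2)[OF x] by (rule sub_Lam[OF assms(1)])
  show "E x \<subseteq> tangent_space V x" unfolding assms(2)[OF x] tangent_V[OF x] using Lam_V by blast
  fix v assume "v \<in> E x"
  then obtain u where u: "u \<in> W" "v = Lam x u" using assms(2)[OF x] by blast
  have "(\<lambda>y. Lam y u) \<in> sections V E"
    by (rule sections_subset[OF section_const_Lam[OF u(1)] order_refl]) (use assms(2) in simp)
  then show "\<exists>U A. open_in V U \<and> x \<in> U \<and> A \<in> sections U E \<and> A x = v"
    using x u(2) by (intro exI[of _ V] exI[of _ "\<lambda>y. Lam y u"]) simp
qed

lemma cr_manifold: "cr_manifold X"
  unfolding cr_manifold_def points_X
proof (intro conjI)
  show "\<exists>d. embedded_submanifold d V" using embedded_submanifold_subspace[OF subV] by (rule exI)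
  show "smooth_distribution V (distr X)" by (rule smooth_distribution_Lam[OF sub_gr distr_Lam])
  show "\<forall>x\<in>V. dim (distr X x) = 2"
    using dim_Lam[OF _ sub_gr grV] dim_gr1 distr_Lam by (intro ballI) metis
  show "\<forall>x\<in>V. \<forall>v\<in>distr X x. cplx X x v \<in> distr X x \<and> cplx X x (cplx X x v) = - v"
  proof (intro ballI)
    fix x v assume x: "x \<in> V" and "v \<in> distr X x"
    then obtain u where u: "u \<in> gr 1" "v = Lam x u" using distr_Lam[OF x] by blast
    show "cplx X x v \<in> distr X x \<and> cplx X x (cplx X x v) = - v"
      using u(1) J_gr1[OF u(1)] J_J[OF u(1)]
      by (simp add: u(2) distr_Lam[OF x] cplx_Lam[OF x] linear_neg[OF linear_Lam])
  qed
  show "\<forall>x\<in>V. \<forall>v\<in>distr X x. \<forall>w\<in>distr X x. \<forall>a b.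
      cplx X x (a *\<^sub>R v + b *\<^sub>R w) = a *\<^sub>R cplx X x v + b *\<^sub>R cplx X x w"
  proof (intro ballI allI)
    fix x v w a b assume x: "x \<in> V" and "v \<in> distr X x" "w \<in> distr X x"
    then obtain u u' where u: "u \<in> gr 1" "v = Lam x u" "u' \<in> gr 1" "w = Lam x u'"
      using distr_Lam[OF x] by blast
    have "a *\<^sub>R v + b *\<^sub>R w = Lam x (a *\<^sub>R u + b *\<^sub>R u')"
      by (simp add: u(2,4) linear_add[OF linear_Lam] linear_scale[OF linear_Lam])
    moreover have "a *\<^sub>R u + b *\<^sub>R u' \<in> gr 1" using u sub_gr by (intro subspace_add subspace_scale)
    ultimately have "cplx X x (a *\<^sub>R v + b *\<^sub>R w) = Lam x (J (a *\<^sub>R u + b *\<^sub>R u'))"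
      using cplx_Lam[OF x] by metis
    then show "cplx X x (a *\<^sub>R v + b *\<^sub>R w) = a *\<^sub>R cplx X x v + b *\<^sub>R cplx X x w"
      unfolding u(2,4) cplx_Lam[OF x u(1)] cplx_Lam[OF x u(3)]
      by (simp add: linear_add[OF linear_Lam] linear_scale[OF linear_Lam]
          linear_add[OF linear_J] linear_scale[OF linear_J])
  qed
  show "\<forall>U A. open_in V U \<and> A \<in> sections U (distr X) \<longrightarrow> smooth_on U (\<lambda>x. cplx X x (A x))"
    using smooth_cplx by (intro allI impI) (elim conjE)
  show "\<forall>k. \<forall>x\<in>V. \<forall>y\<in>V. dim (weak_flag X k x) = dim (weak_flag X k y)"
    using dim_Lam[OF _ sub_Fil Fil_V] weak_flag_Lam by (intro allI ballI) metis
qed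

lemma bracket_generating: "bracket_generating X"
  unfolding bracket_generating_def points_X
  by (intro exI[of _ \<nu>]) (simp add: weak_flag_Lam Fil_top Lam_onto tangent_V)

text \<open>The left trivialisation identifies the flag quotients with the components of the
  algebra: a vector at \<open>x\<close> is moved to the identity by \<open>om x\<close> and its
  degree \<open>k\<close> part is taken.\<close>

lemma is_symbol: assumes x: "x \<in> V" shows "is_symbol X x gr br"
proof -
  define \<sigma> where "\<sigma> k v = pr k (om x (P v))" for k v
  have \<sigma>: "\<sigma> k (Lam x w) = pr k w" if "w \<in> V" for k w
    using om_Lam[OF x that] P(3)[OF Lam_V] by (simp add: \<sigma>_def)
  have 1: "linear (\<sigma> k)" for k
    using linear_compose[OF linear_compose[OF P(1) linear_om] linear_pr] unfolding \<sigma>_def[abs_def] o_def .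
  have 2: "\<sigma> (Suc k) ` weak_flag X (Suc k) x = gr (Suc k)" for k
  proof -
    have "(\<lambda>w. \<sigma> (Suc k) (Lam x w)) ` Fil (Suc k) = pr (Suc k) ` Fil (Suc k)"
      by (rule image_cong[OF refl \<sigma>]) (use Fil_V in blast)
    then show ?thesis unfolding weak_flag_Lam[OF x] image_image pr_Fil_image .
  qed
  have 3: "{v \<in> weak_flag X (Suc k) x. \<sigma> (Suc k) v = 0} = weak_flag X k x" for k
  proof -
    have "{v \<in> Lam x ` Fil (Suc k). \<sigma> (Suc k) v = 0} = Lam x ` {w \<in> Fil (Suc k). pr (Suc k) w = 0}"
      using \<sigma> Fil_V[of "Suc k"] by (auto simp: subset_iff)
    then show ?thesis unfolding weak_flag_Lam[OF x] Fil_kernel .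
  qed
  have 4: "lie_bracket V A B x \<in> weak_flag X (i + j) x \<and>
      \<sigma> (i + j) (lie_bracket V A B x) = br (\<sigma> i (A x)) (\<sigma> j (B x))"
    if ij: "i \<ge> 1" "j \<ge> 1" and U: "open_in V U" "x \<in> U"
      and A: "A \<in> sections U (weak_flag X i)" and B: "B \<in> sections U (weak_flag X j)" for i j U A B
  proof -
    have UV: "U \<subseteq> V" using U(1) openin_imp_subset by blast
    have "A \<in> sections U (\<lambda>x. Lam x ` Fil i)"
      by (rule sections_subset[OF A order_refl]) (use weak_flag_Lam UV in blast)
    from section_coeff[OF this UV Fil_V] obtain a where
      a: "smooth_on U a" "\<And>x. x \<in> U \<Longrightarrow> a x \<in> Fil i" "\<And>x. x \<in> U \<Longrightarrow> A x = Lam x (a x)" by blast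
    have "B \<in> sections U (\<lambda>x. Lam x ` Fil j)"
      by (rule sections_subset[OF B order_refl]) (use weak_flag_Lam UV in blast)
    from section_coeff[OF this UV Fil_V] obtain b where
      b: "smooth_on U b" "\<And>x. x \<in> U \<Longrightarrow> b x \<in> Fil j" "\<And>x. x \<in> U \<Longrightarrow> B x = Lam x (b x)" by blast
    have ab: "a y \<in> V" "b y \<in> V" if "y \<in> U" for y
      using a(2)[OF that] b(2)[OF that] Fil_V by blast+
    have t: "Lam x w \<in> tangent_space V x" for w using tangent_V[OF x] Lam_V by simp
    let ?d = "differential V b x (Lam x (a x))" and ?e = "differential V a x (Lam x (b x))"
    let ?c = "br (a x) (b x) + ?d - ?e"
    have d: "?d \<in> Fil j" and e: "?e \<in> Fil i"
      using differential_in_subspace[OF b(1) U sub_Fil b(2) t] differential_in_subspace[OF a(1) U sub_Fil a(2) t] by auto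
    have c: "?c \<in> Fil (i + j)"
      using d e br_Fil[OF a(2)[OF U(2)] b(2)[OF U(2)]] Fil_mono[of i "i + j"] Fil_mono[of j "i + j"] sub_Fil[of "i + j"]
      by (intro subspace_add subspace_diff) auto
    have lb: "lie_bracket V A B x = Lam x ?c"
    proof -
      have "lie_bracket V A B x = lie_bracket V (\<lambda>y. Lam y (a y)) (\<lambda>y. Lam y (b y)) x"
        by (rule lie_bracket_cong[OF U]) (use a(3) b(3) in auto)
      then show ?thesis using Lam_lie_bracket[OF U a(1) ab(1) b(1) ab(2)] by simp
    qed
    \<comment> \<open>The derivative terms lie in degrees at most \<open>j\<close> and
      \<open>i\<close>; as both indices are positive, these are below \<open>i + j\<close> and
      vanish under the projection.\<close>
    have "pr (i + j) ?d = 0" "pr (i + j) ?e = 0"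
      using pr_Fil[OF d, of "i + j"] pr_Fil[OF e, of "i + j"] ij by auto
    then have "pr (i + j) ?c = br (pr i (a x)) (pr j (b x))"
      using pr_br[OF a(2)[OF U(2)] b(2)[OF U(2)]]
      by (simp add: linear_add[OF linear_pr] linear_diff[OF linear_pr])
    moreover have "?c \<in> V" using c Fil_V by blast
    ultimately have "\<sigma> (i + j) (lie_bracket V A B x) = br (\<sigma> i (A x)) (\<sigma> j (B x))"
      unfolding lb a(3)[OF U(2)] b(3)[OF U(2)] using \<sigma> ab[OF U(2)] by simp
    moreover have "lie_bracket V A B x \<in> weak_flag X (i + j) x"
      unfolding lb weak_flag_Lam[OF x] using c by blast
    ultimately show ?thesis by blast
  qed
  show ?thesis unfolding is_symbol_def points_X
  proof (intro conjI exI[of _ \<sigma>])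
    show "gnla gr br" by (rule gnla)
    show "\<forall>k. linear (\<sigma> k)" using 1 by (rule allI)
    show "\<forall>k. \<sigma> (Suc k) ` weak_flag X (Suc k) x = gr (Suc k)" using 2 by (rule allI)
    show "\<forall>k. {v \<in> weak_flag X (Suc k) x. \<sigma> (Suc k) v = 0} = weak_flag X k x" using 3 by (rule allI)
    show "\<forall>i\<ge>1. \<forall>j\<ge>1. \<forall>U A B. open_in V U \<and> x \<in> U \<and> A \<in> sections U (weak_flag X i) \<and> B \<in> sections U (weak_flag X j) \<longrightarrow>
      lie_bracket V A B x \<in> weak_flag X (i + j) x \<and>
      \<sigma> (i + j) (lie_bracket V A B x) = br (\<sigma> i (A x)) (\<sigma> j (B x))"
    proof (intro allI impI)
      fix i j U A B
      assume "1 \<le> i" "1 \<le> j" and "open_in V U \<and> x \<in> U \<and> A \<in> sections U (weak_flag X i) \<and> B \<in> sections U (weak_flag X j)"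
      then show "lie_bracket V A B x \<in> weak_flag X (i + j) x \<and>
          \<sigma> (i + j) (lie_bracket V A B x) = br (\<sigma> i (A x)) (\<sigma> j (B x))"
        by (elim conjE) (rule 4)
    qed
  qed
qed

lemma has_depth: "has_depth X \<nu>"
  unfolding has_depth_def points_X
  by (intro ballI exI[of _ gr] exI[of _ br] conjI is_symbol depth)

end

section \<open>Quotients of standard models by their top component\<close>

text \<open>With \<open>i = \<nu>\<close> this covers isomorphisms, with \<open>\<nu> = Suc i\<close> the quotient by the central
  component \<open>gr \<nu>\<close>; \<open>\<psi>\<close> is the section of \<open>\<phi>\<close> with values in the components of degree at most \<open>i\<close>.\<close>

locale truncation = std_model gr br \<nu> mul J X
  for gr :: "nat \<Rightarrow> 'a::euclidean_space set" and br \<nu> mul J X +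
  fixes \<phi> :: "'a \<Rightarrow> 'b::euclidean_space" and \<psi> :: "'b \<Rightarrow> 'a" and i :: nat
  assumes lin_phi: "linear \<phi>" and lin_psi: "linear \<psi>"
    and psi_phi_Fil: "\<And>x. x \<in> Fil i \<Longrightarrow> \<psi> (\<phi> x) = x" and psi_Fil: "\<And>y. \<psi> y \<in> Fil i"
    and kill: "\<And>k x. k > i \<Longrightarrow> x \<in> gr k \<Longrightarrow> \<phi> x = 0"
    and i: "1 \<le> i" "i \<le> \<nu>" "\<nu> \<le> Suc i"
begin

definition gr' where "gr' k = \<phi> ` gr k"
definition br' where "br' x y = \<phi> (br (\<psi> x) (\<psi> y))"
definition mul' where "mul' x y = \<phi> (mul (\<psi> x) (\<psi> y))"
definition J' where "J' x = \<phi> (J (\<psi> x))"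

lemma psi_V: "\<psi> y \<in> V" using psi_Fil Fil_V by blast

text \<open>The residue is the degree \<nu> part of \<open>x\<close>, or 0 when
  \<open>i = \<nu>\<close>. Being central, it drops out of brackets and splits off additively from
  products, which is what makes \<open>\<phi>\<close> compatible with \<open>br'\<close> and
  \<open>mul'\<close>.\<close>

lemma residue: assumes "x \<in> V"
  shows "central (x - \<psi> (\<phi> x))" "\<phi> (x - \<psi> (\<phi> x)) = 0" "\<phi> x = 0 \<Longrightarrow> i < \<nu> \<Longrightarrow> x \<in> gr \<nu>"
proof -
  have "central (x - \<psi> (\<phi> x)) \<and> \<phi> (x - \<psi> (\<phi> x)) = 0 \<and> (\<phi> x = 0 \<longrightarrow> i < \<nu> \<longrightarrow> x \<in> gr \<nu>)"
  proof (cases "i = \<nu>")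
    case True
    then have "\<psi> (\<phi> x) = x" using psi_phi_Fil Fil_top assms by blast
    then show ?thesis using V_closed(1) linear_0[OF lin_phi] True by (simp add: central_def br_0)
  next
    case False
    then have n: "\<nu> = Suc i" using i by simp
    have "x - pr \<nu> x \<in> Fil i" using Fil_split[of x i] assms Fil_top[of "Suc i"] n by simp
    moreover have k: "\<phi> (pr \<nu> x) = 0" using kill[OF _ pr_in] n by simp
    ultimately have "\<psi> (\<phi> x) = x - pr \<nu> x"
      using psi_phi_Fil[of "x - pr \<nu> x"] by (simp add: linear_diff[OF lin_phi])
    then have r: "x - \<psi> (\<phi> x) = pr \<nu> x" by simp
    then have "\<phi> x = 0 \<Longrightarrow> x = pr \<nu> x" using linear_0[OF lin_psi] by simp
    then show ?thesis unfolding r using central_top[OF pr_in] k pr_in by metis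
  qed
  then show "central (x - \<psi> (\<phi> x))" "\<phi> (x - \<psi> (\<phi> x)) = 0" "\<phi> x = 0 \<Longrightarrow> i < \<nu> \<Longrightarrow> x \<in> gr \<nu>" by auto
qed

lemma phi_psi_phi: "x \<in> V \<Longrightarrow> \<phi> (\<psi> (\<phi> x)) = \<phi> x"
  using residue(2)[of x] by (simp add: linear_diff[OF lin_phi])

lemma phi_br: assumes "x \<in> V" "y \<in> V" shows "\<phi> (br x y) = br' (\<phi> x) (\<phi> y)"
proof -
  have "br x y = br (\<psi> (\<phi> x) + (x - \<psi> (\<phi> x))) (\<psi> (\<phi> y) + (y - \<psi> (\<phi> y)))" by simp
  also have "\<dots> = br (\<psi> (\<phi> x)) (\<psi> (\<phi> y))"
    using central_br[OF residue(1)[OF assms(1)]] central_br[OF residue(1)[OF assms(2)]] psi_V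
      central_V[OF residue(1)[OF assms(2)]]
    by (simp only: bilinear_ladd[OF bil] bilinear_radd[OF bil]) simp
  finally show ?thesis by (simp add: br'_def)
qed

lemma phi_mul: assumes "x \<in> V" "y \<in> V" shows "\<phi> (mul x y) = mul' (\<phi> x) (\<phi> y)"
proof -
  let ?r = "x - \<psi> (\<phi> x)" and ?s = "y - \<psi> (\<phi> y)"
  have "mul x y = mul (\<psi> (\<phi> x) + ?r) (\<psi> (\<phi> y) + ?s)" by simp
  also have "\<dots> = mul (\<psi> (\<phi> x)) (\<psi> (\<phi> y) + ?s) + ?r"
    by (rule mul_add_central(1)[OF residue(1)[OF assms(1)] psi_V]) (use assms(2) in simp)
  also have "\<dots> = mul (\<psi> (\<phi> x)) (\<psi> (\<phi> y)) + ?s + ?r"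
    by (simp only: mul_add_central(2)[OF residue(1)[OF assms(2)] psi_V[of "\<phi> x"] psi_V[of "\<phi> y"]])
  finally show ?thesis
    using residue(2)[OF assms(1)] residue(2)[OF assms(2)] by (simp add: mul'_def linear_add[OF lin_phi])
qed

lemma carrier': "gnla_carrier gr' = \<phi> ` V"
  unfolding gnla_carrier_def gr'_def by (simp add: linear_span_image[OF lin_phi] image_UN[symmetric])

lemma phi_inj: "x \<in> Fil i \<Longrightarrow> \<phi> x = 0 \<Longrightarrow> x = 0"
  using psi_phi_Fil[of x] linear_0[OF lin_psi] by simp

text \<open>Independence is lifted to \<open>gr\<close>: components of degree above \<open>i\<close>
  are replaced by 0, and on the span of the remaining ones \<open>\<phi>\<close> is
  injective.\<close>

lemma gr'_indep:
  assumes "\<And>k. f k \<in> gr' k" "(\<Sum>k\<le>n. f k) = 0" "k \<le> n" shows "f k = 0"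
proof -
  have "\<exists>g. \<forall>k. g k \<in> gr k \<and> f k = \<phi> (g k)"
    using assms(1) by (intro choice) (auto simp: gr'_def)
  then obtain g where g: "\<And>k. g k \<in> gr k" "\<And>k. f k = \<phi> (g k)" by blast
  define h where "h k = (if k \<le> i then g k else 0)" for k
  have h: "h k \<in> gr k" "f k = \<phi> (h k)" for k
    using g kill[of k "g k"] subspace_0[OF sub_gr] linear_0[OF lin_phi] by (auto simp: h_def)
  have "h k \<in> Fil i" for k
    using h(1)[of k] gr_Fil[of k i] subspace_0[OF sub_Fil] by (auto simp: h_def)
  then have "(\<Sum>k\<le>n. h k) \<in> Fil i" by (intro subspace_sum sub_Fil)
  moreover have "\<phi> (\<Sum>k\<le>n. h k) = 0" using assms(2) by (simp add: linear_sum[OF lin_phi] h(2))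
  ultimately have "(\<Sum>k\<le>n. h k) = 0" by (rule phi_inj)
  then show ?thesis using gr_indep[OF h(1) _ assms(3)] h(2) linear_0[OF lin_phi] by simp
qed

lemma gnla': "gnla gr' br'"
  unfolding gnla_def
proof (intro conjI)
  show "\<forall>k. subspace (gr' k)" using linear_subspace_image[OF lin_phi sub_gr] by (simp add: gr'_def)
  show "gr' 0 = {0}" using gr0 linear_0[OF lin_phi] by (simp add: gr'_def)
  show "\<forall>f n. (\<forall>k. f k \<in> gr' k) \<and> (\<Sum>k\<le>n. f k) = 0 \<longrightarrow> (\<forall>k\<le>n. f k = 0)"
    using gr'_indep by (intro allI impI) (elim conjE, simp)
  have "linear (\<lambda>y. \<phi> (br (\<psi> x) (\<psi> y)))" "linear (\<lambda>x. \<phi> (br (\<psi> x) (\<psi> y)))" for x y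
    using linear_compose[OF linear_compose[OF lin_psi lin_br(1)] lin_phi]
      linear_compose[OF linear_compose[OF lin_psi lin_br(2)] lin_phi] by (simp_all add: o_def)
  then show "bilinear br'" by (simp add: bilinear_def br'_def[abs_def])
  show "\<forall>i j. \<forall>x\<in>gr' i. \<forall>y\<in>gr' j. br' x y \<in> gr' (i + j)"
  proof (intro allI ballI)
    fix a b x y assume "x \<in> gr' a" "y \<in> gr' b"
    then obtain u v where u: "u \<in> gr a" "x = \<phi> u" "v \<in> gr b" "y = \<phi> v" by (auto simp: gr'_def)
    have "br' x y = \<phi> (br u v)" using phi_br[OF subsetD[OF grV u(1)] subsetD[OF grV u(3)]] u by simp
    then show "br' x y \<in> gr' (a + b)" using br_gr[OF u(1,3)] by (simp add: gr'_def)
  qed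
  show "\<forall>x\<in>gnla_carrier gr'. br' x x = 0"
    unfolding carrier' using phi_br[symmetric] br_self linear_0[OF lin_phi] by auto
  show "\<forall>x\<in>gnla_carrier gr'. \<forall>y\<in>gnla_carrier gr'. \<forall>z\<in>gnla_carrier gr'.
      br' x (br' y z) + br' y (br' z x) + br' z (br' x y) = 0"
    unfolding carrier'
  proof (intro ballI, elim imageE)
    fix x' y' z' x y z assume h: "x \<in> V" "y \<in> V" "z \<in> V" "x' = \<phi> x" "y' = \<phi> y" "z' = \<phi> z"
    have "br' x' (br' y' z') + br' y' (br' z' x') + br' z' (br' x' y') =
        \<phi> (br x (br y z) + br y (br z x) + br z (br x y))"
      using h(1-3) br_V by (simp add: h(4-6) phi_br linear_add[OF lin_phi])
    then show "br' x' (br' y' z') + br' y' (br' z' x') + br' z' (br' x' y') = 0"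
      using jacobi[OF h(1-3)] linear_0[OF lin_phi] by simp
  qed
qed

lemma subspace_phi_V: "subspace (\<phi> ` V)" by (rule linear_subspace_image[OF lin_phi subV])

lemma left_inv_field':
  assumes "x \<in> V" "u \<in> V" shows "left_inv_field mul' (\<phi> u) (\<phi> x) = \<phi> (Lam x u)"
proof -
  have "((\<lambda>t. \<phi> (mul x (t *\<^sub>R u))) has_vector_derivative \<phi> (Lam x u)) (at 0)"
    using has_vector_derivative_compose_UNIV[OF smooth_on_linear[OF lin_phi] Lam_deriv0[OF assms]]
    by (simp only: differential_linear[OF lin_phi tangent_UNIV])
  moreover have "(\<lambda>t. \<phi> (mul x (t *\<^sub>R u))) = (\<lambda>t. mul' (\<phi> x) (t *\<^sub>R \<phi> u))"
    using assms V_closed by (simp add: phi_mul linear_scale[OF lin_phi])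
  ultimately show ?thesis unfolding left_inv_field_def by (metis vector_derivative_at)
qed

text \<open>The map \<open>\<phi>\<close> need not be injective, so fields cannot simply be pushed
  forward; the left-invariant fields upstairs and downstairs are instead shown to be
  \<open>\<phi>\<close>-related.\<close>

lemma bracket':
  assumes "u \<in> V" "v \<in> V" "x \<in> V"
  shows "lie_bracket (\<phi> ` V) (left_inv_field mul' (\<phi> u)) (left_inv_field mul' (\<phi> v)) (\<phi> x) =
    left_inv_field mul' (br' (\<phi> u) (\<phi> v)) (\<phi> x)"
proof -
  let ?w = "\<lambda>i::bool. if i then v else u"
  have w: "?w i \<in> V" for i using assms by simp
  have lb: "lie_bracket V (\<lambda>y. Lam y (?w False)) (\<lambda>y. Lam y (?w True)) x = Lam x (br u v)"
    using const_coeff_bracket[OF assms(3,1,2)] by simp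
  have "lie_bracket (\<phi> ` V) (left_inv_field mul' (\<phi> (?w False))) (left_inv_field mul' (\<phi> (?w True))) (\<phi> x) =
      differential V \<phi> x (lie_bracket V (\<lambda>y. Lam y (?w False)) (\<lambda>y. Lam y (?w True)) x)"
  proof (rule lie_bracket_related[where A="\<lambda>i y. Lam y (?w i)" and B="\<lambda>i. left_inv_field mul' (\<phi> (?w i))"])
    show "smooth_on V \<phi>" by (rule smooth_on_linear[OF lin_phi])
    show "open_in V V" "x \<in> V" "\<phi> ` V \<subseteq> \<phi> ` V" "open_in (\<phi> ` V) (\<phi> ` V)" using assms by auto
    show "smooth_on V (\<lambda>y. Lam y (?w i))" for i by (rule smooth_Lam)
    show t: "Lam y (?w i) \<in> tangent_space V y" if "y \<in> V" for i y using tangent_V[OF that] Lam_V by simp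
    \<comment> \<open>The section \<open>\<psi>\<close> lifts points of the quotient linearly and so
      provides a smooth formula for the field downstairs.\<close>
    show "smooth_on (\<phi> ` V) (left_inv_field mul' (\<phi> (?w i)))" for i
    proof (rule smooth_on_cong)
      show "smooth_on (\<phi> ` V) (\<lambda>y. \<phi> (Lam (\<psi> y) (?w i)))"
        by (intro smooth_on_linear_compose[OF lin_phi]
            smooth_on_compose[OF smooth_on_linear[OF lin_psi] smooth_Lam subset_UNIV])
      fix y assume "y \<in> \<phi> ` V"
      then have "\<phi> (\<psi> y) = y" using phi_psi_phi by auto
      then show "\<phi> (Lam (\<psi> y) (?w i)) = left_inv_field mul' (\<phi> (?w i)) y"
        using left_inv_field'[OF psi_V[of y] w[of i]] by simp
    qed
    show "left_inv_field mul' (\<phi> (?w i)) (\<phi> y) = differential V \<phi> y (Lam y (?w i))" if "y \<in> V" for i y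
      using left_inv_field'[OF that w] differential_linear[OF lin_phi t[OF that]] by simp
    show "lie_bracket V (\<lambda>y. Lam y (?w False)) (\<lambda>y. Lam y (?w True)) x \<in> tangent_space V x"
      unfolding lb using tangent_V[OF assms(3)] Lam_V by simp
  qed
  also have "\<dots> = \<phi> (Lam x (br u v))"
    unfolding lb by (rule differential_linear[OF lin_phi]) (use tangent_V[OF assms(3)] Lam_V in simp)
  finally show ?thesis
    using left_inv_field'[OF assms(3) br_V[OF assms(1,2)]] phi_br[OF assms(1,2)] by simp
qed

lemma exp_group': "exp_group gr' br' mul'"
  unfolding exp_group_def Let_def carrier'
proof (intro conjI)
  show "\<forall>x\<in>\<phi> ` V. \<forall>y\<in>\<phi> ` V. mul' x y \<in> \<phi> ` V"
    using mul_V psi_V by (auto simp: mul'_def)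
  show "\<forall>x\<in>\<phi> ` V. \<forall>y\<in>\<phi> ` V. \<forall>z\<in>\<phi> ` V. mul' (mul' x y) z = mul' x (mul' y z)"
    using mul_V by (auto simp: phi_mul[symmetric] mul_assoc)
  show "\<forall>x\<in>\<phi> ` V. mul' 0 x = x \<and> mul' x 0 = x"
    using phi_mul[of 0] phi_mul[of _ 0] V_closed(1) mul_0 linear_0[OF lin_phi] by auto
  show "\<forall>x\<in>\<phi> ` V. \<forall>s t. mul' (s *\<^sub>R x) (t *\<^sub>R x) = (s + t) *\<^sub>R x"
    using V_closed(2) mul_line by (auto simp: linear_scale[OF lin_phi, symmetric] phi_mul[symmetric])
  have "linear (\<lambda>p. (\<psi> (fst p), \<psi> (snd p)))"
    by (rule linearI) (simp_all add: linear_add[OF lin_psi] linear_scale[OF lin_psi])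
  from smooth_on_compose[OF smooth_on_linear[OF this] mul_smooth, of "\<phi> ` V \<times> \<phi> ` V"]
  have "smooth_on (\<phi> ` V \<times> \<phi> ` V) (\<lambda>p. \<phi> (mul (\<psi> (fst p)) (\<psi> (snd p))))"
    using psi_V by (intro smooth_on_linear_compose[OF lin_phi]) auto
  then show "smooth_on (\<phi> ` V \<times> \<phi> ` V) (\<lambda>(x, y). mul' x y)"
    by (simp add: mul'_def case_prod_unfold)
  show "\<forall>u\<in>\<phi> ` V. \<forall>v\<in>\<phi> ` V. \<forall>x\<in>\<phi> ` V.
      lie_bracket (\<phi> ` V) (left_inv_field mul' u) (left_inv_field mul' v) x = left_inv_field mul' (br' u v) x"
    using bracket' by blast
qed

lemma depth': "gnla_depth gr' i"
  unfolding gnla_depth_def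
proof
  obtain x where x: "x \<in> gr i" "x \<noteq> 0"
    using gr_nonzero[OF generated i(1,2)] subspace_0[OF sub_gr] by blast
  then have "\<phi> x \<noteq> 0" using phi_inj gr_Fil[of i i] by blast
  then show "gr' i \<noteq> {0}" using x(1) by (auto simp: gr'_def)
  show "\<forall>k>i. gr' k = {0}" using kill subspace_0[OF sub_gr] by (auto simp: gr'_def image_iff)
qed

sublocale t: exp_model gr' br' i mul'
  by unfold_locales (rule gnla' depth' exp_group')+

lemma t_Lam: "x \<in> V \<Longrightarrow> u \<in> V \<Longrightarrow> t.Lam (\<phi> x) (\<phi> u) = \<phi> (Lam x u)"
  using left_inv_field' t.left_inv_field_eq carrier' by simp

text \<open>The complex structure must be a function of the tangent vector; the Maurer-Cartan form
  \<open>t.om\<close> recovers the Lie algebra element to which \<open>J'\<close> is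
  applied.\<close>

definition X' :: "'b cr" where
  "X' = \<lparr>points = gnla_carrier gr', distr = (\<lambda>x. (\<lambda>u. left_inv_field mul' u x) ` gr' 1),
    cplx = (\<lambda>x v. left_inv_field mul' (J' (t.om x v)) x)\<rparr>"

lemma gr1_Fil: "gr 1 \<subseteq> Fil i" using gr_Fil[OF i(1)] .

lemma J'_phi: "u \<in> gr 1 \<Longrightarrow> J' (\<phi> u) = \<phi> (J u)"
  using psi_phi_Fil gr1_Fil by (auto simp: J'_def)

sublocale t: std_model gr' br' i mul' J' X'
proof
  show "generated_in_degree_one gr' br'"
    unfolding generated_in_degree_one_def
  proof (intro allI impI, elim conjE)
    fix W assume W: "subspace W" "gr' 1 \<subseteq> W" "\<forall>x\<in>W. \<forall>y\<in>W. br' x y \<in> W"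
    let ?W = "V \<inter> \<phi> -` W"
    have "subspace ?W" by (rule subspace_inter[OF subV linear_subspace_vimage[OF lin_phi W(1)]])
    moreover have "gr 1 \<subseteq> ?W" using W(2) grV by (auto simp: gr'_def)
    moreover have "\<forall>x\<in>?W. \<forall>y\<in>?W. br x y \<in> ?W" using W(3) br_V phi_br by auto
    ultimately have "V \<subseteq> ?W" using generated unfolding generated_in_degree_one_def by blast
    then show "gnla_carrier gr' \<subseteq> W" unfolding carrier' by blast
  qed
  have "inj_on \<phi> (span (gr 1))"
    using gr1_Fil psi_phi_Fil sub_gr[of 1] by (intro inj_on_inverseI[of _ \<psi>]) (auto simp: span_eq_iff[THEN iffD2])
  then show "dim (gr' 1) = 2" using dim_image_eq[OF lin_phi] dim_gr1 by (simp add: gr'_def)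
  have "linear J'" using linear_compose[OF linear_compose[OF lin_psi linear_J] lin_phi]
    by (simp add: J'_def[abs_def] o_def)
  then show "complex_structure_on (gr' 1) J'"
    using J'_phi J_gr1 J_J linear_neg[OF lin_phi] unfolding complex_structure_on_def gr'_def by auto
  show "points X' = gnla_carrier gr'" by (simp add: X'_def)
  show "distr X' x = (\<lambda>u. left_inv_field mul' u x) ` gr' 1" for x by (simp add: X'_def)
  show "cplx X' x (left_inv_field mul' u x) = left_inv_field mul' (J' u) x"
    if "x \<in> gnla_carrier gr'" "u \<in> gr' 1" for x u
  proof -
    have "u \<in> gnla_carrier gr'" using that(2) t.grV by blast
    then show ?thesis using t.om_Lam[OF that(1)] t.left_inv_field_eq[OF that(1)] by (simp add: X'_def)
  qed
qed

lemma distr': "x \<in> V \<Longrightarrow> distr X' (\<phi> x) = \<phi> ` distr X x"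
proof -
  assume x: "x \<in> V"
  have "distr X' (\<phi> x) = t.Lam (\<phi> x) ` \<phi> ` gr 1" using t.distr_Lam x carrier' by (simp add: gr'_def)
  also have "\<dots> = \<phi> ` Lam x ` gr 1" unfolding image_image
    by (rule image_cong[OF refl t_Lam[OF x gr1_V]])
  finally show ?thesis using distr_Lam[OF x] by simp
qed

lemma cplx': "x \<in> V \<Longrightarrow> v \<in> distr X x \<Longrightarrow> cplx X' (\<phi> x) (\<phi> v) = \<phi> (cplx X x v)"
proof -
  assume x: "x \<in> V" and "v \<in> distr X x"
  then obtain u where u: "u \<in> gr 1" "v = Lam x u" using distr_Lam[OF x] by blast
  have "cplx X' (\<phi> x) (t.Lam (\<phi> x) (\<phi> u)) = t.Lam (\<phi> x) (J' (\<phi> u))"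
    using u(1) x carrier' by (intro t.cplx_Lam) (auto simp: gr'_def)
  then show ?thesis
    using t_Lam[OF x gr1_V] u J_gr1 J'_phi by (simp add: cplx_Lam[OF x])
qed

lemma iso: assumes "i = \<nu>" shows "cr_iso X X' V (gnla_carrier gr') \<phi> \<psi>"
proof
  show "open_in (points X) V" "open_in (points X') (gnla_carrier gr')" by (simp_all add: points_X t.points_X)
  show "\<phi> ` V = gnla_carrier gr'" using carrier' ..
  show "\<psi> (\<phi> x) = x" if "x \<in> V" for x using psi_phi_Fil Fil_top assms that by blast
  show "smooth_on V \<phi>" "smooth_on (gnla_carrier gr') \<psi>" by (rule smooth_on_linear lin_phi lin_psi)+
  show "cr_regular X" "cr_regular X'" by (rule regular t.regular)+
  fix x assume x: "x \<in> V"
  have d: "differential (points X) \<phi> x v = \<phi> v" if "v \<in> distr X x" for v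
    using that cr_regular_distr[OF regular, of x] x by (intro differential_linear[OF lin_phi]) (auto simp: points_X)
  show "differential (points X) \<phi> x ` distr X x = distr X' (\<phi> x)"
    using d distr'[OF x] by (simp cong: image_cong)
  fix v assume v: "v \<in> distr X x"
  then have "cplx X x v \<in> distr X x" using regular x by (simp add: cr_regular_def points_X)
  then show "differential (points X) \<phi> x (cplx X x v) = cplx X' (\<phi> x) (differential (points X) \<phi> x v)"
    using d v cplx'[OF x v] by simp
qed

end

section \<open>Symmetry reductions and integrable extensions of standard models\<close>

lemma infinitesimal_symmetryI:
  assumes "\<xi> \<in> sections U (tangent_space (points X))"
    "\<And>U' A x. open_in (points X) U' \<Longrightarrow> U' \<subseteq> U \<Longrightarrow> A \<in> sections U' (distr X) \<Longrightarrow> x \<in> U' \<Longrightarrow>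
      lie_bracket (points X) \<xi> A x \<in> distr X x \<and>
      lie_bracket (points X) \<xi> (\<lambda>y. cplx X y (A y)) x = cplx X x (lie_bracket (points X) \<xi> A x)"
  shows "infinitesimal_symmetry X U \<xi>"
  unfolding infinitesimal_symmetry_def
  by (intro conjI assms(1) allI impI ballI; elim conjE) (use assms(2) in blast)+

lemma infinitesimal_symmetryD:
  assumes "infinitesimal_symmetry X U \<xi>"
    "open_in (points X) U'" "U' \<subseteq> U" "A \<in> sections U' (distr X)" "x \<in> U'"
  shows "lie_bracket (points X) \<xi> A x \<in> distr X x"
    "lie_bracket (points X) \<xi> (\<lambda>y. cplx X y (A y)) x = cplx X x (lie_bracket (points X) \<xi> A x)"
proof -
  have "\<forall>U' A. open_in (points X) U' \<and> U' \<subseteq> U \<and> A \<in> sections U' (distr X) \<longrightarrow>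
      (\<forall>x\<in>U'. lie_bracket (points X) \<xi> A x \<in> distr X x \<and>
        lie_bracket (points X) \<xi> (\<lambda>y. cplx X y (A y)) x = cplx X x (lie_bracket (points X) \<xi> A x))"
    using assms(1) unfolding infinitesimal_symmetry_def by (elim conjE)
  from this[rule_format, of U' A x] assms(2-5)
  show "lie_bracket (points X) \<xi> A x \<in> distr X x"
    "lie_bracket (points X) \<xi> (\<lambda>y. cplx X y (A y)) x = cplx X x (lie_bracket (points X) \<xi> A x)"
    by simp_all
qed

lemma infinitesimal_symmetry_cong:
  assumes "infinitesimal_symmetry X U \<xi>" "\<And>x. x \<in> U \<Longrightarrow> \<xi> x = \<eta> x"
  shows "infinitesimal_symmetry X U \<eta>"
proof (rule infinitesimal_symmetryI)
  show "\<eta> \<in> sections U (tangent_space (points X))"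
    using assms(1) unfolding infinitesimal_symmetry_def by (elim conjE) (rule sections_cong[OF _ assms(2)])
  fix U' A x assume U': "open_in (points X) U'" "U' \<subseteq> U" "A \<in> sections U' (distr X)" "x \<in> U'"
  have "lie_bracket (points X) \<eta> B x = lie_bracket (points X) \<xi> B x" for B
    by (rule lie_bracket_cong[OF U'(1,4)]) (use assms(2) U'(2) in auto)
  then show "lie_bracket (points X) \<eta> A x \<in> distr X x \<and>
      lie_bracket (points X) \<eta> (\<lambda>y. cplx X y (A y)) x = cplx X x (lie_bracket (points X) \<eta> A x)"
    using infinitesimal_symmetryD[OF assms(1) U'] by simp
qed

text \<open>Test sections on \<open>Y\<close> are pulled back to \<open>X\<close>, where the
  symmetry condition holds, and the resulting brackets are pushed forward again.\<close>

lemma (in cr_iso) infinitesimal_symmetry_push: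
  assumes A: "infinitesimal_symmetry X U A" shows "infinitesimal_symmetry Y V (push A)"
proof (rule infinitesimal_symmetryI)
  interpret s: cr_iso Y X V U g f by (rule cr_sym)
  have At: "A \<in> sections U (tangent_space (points X))"
    using A unfolding infinitesimal_symmetry_def by (elim conjE)
  have "push A \<in> sections (f ` U) (tangent_space (points Y))"
    by (rule push_sections[OF At openU order_refl order_refl]) (use df_tangent in blast)
  then show "push A \<in> sections V (tangent_space (points Y))" unfolding image .
  fix Q C y assume Q: "open_in (points Y) Q" "Q \<subseteq> V" and C: "C \<in> sections Q (distr Y)" and y: "y \<in> Q"
  let ?Q = "g ` Q" and ?C = "s.push C"
  have Q': "open_in (points X) ?Q" "?Q \<subseteq> U" "g y \<in> ?Q" "f (g y) = y"
    using s.openin_sub[OF Q] Q(2) s.image y s.inv by auto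
  have C': "?C \<in> sections ?Q (distr X)"
    by (rule s.push_sections[OF C Q]) (use s.distr s.distr_tangent Q(2) in auto)
  have dX: "distr X x \<subseteq> tangent_space (points X) x" if "x \<in> ?Q" for x
    using distr_tangent that Q'(2) by blast
  have JC: "(\<lambda>x. cplx X x (?C x)) \<in> sections ?Q (distr X)"
  proof -
    have "smooth_on ?Q (\<lambda>x. cplx X x (?C x))" using regX Q'(1) C' by (simp add: cr_regular_def)
    then show ?thesis using C' cplx_distr Q'(2) by (auto simp: sections_def subset_iff)
  qed
  have CT: "C z \<in> tangent_space (points Y) z" if "z \<in> Q" for z
    using C s.distr_tangent that Q(2) by (auto simp: sections_def)
  have pp: "push ?C z = C z" if "z \<in> Q" for z
    using push_push[of z C] that Q(2) CT by blast
  have pJ: "push (\<lambda>x. cplx X x (?C x)) z = cplx Y z (C z)" if z: "z \<in> Q" for z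
  proof -
    have gz: "g z \<in> U" "g z \<in> ?Q" "f (g z) = z" using z Q' s.inv Q(2) by auto
    have "push (\<lambda>x. cplx X x (?C x)) z = differential (points X) f (g z) (cplx X (g z) (?C (g z)))"
      by (simp add: push_def)
    also have "\<dots> = cplx Y z (differential (points X) f (g z) (?C (g z)))"
    proof -
      have "?C (g z) \<in> distr X (g z)" using C' gz(2) unfolding sections_def by blast
      from cplx[OF gz(1) this] show ?thesis unfolding gz(3) .
    qed
    also have "\<dots> = cplx Y z (C z)" using pp[OF z] by (simp add: push_def)
    finally show ?thesis .
  qed
  have brk: "lie_bracket (points Y) (push A) (push B) y = differential (points X) f (g y) (lie_bracket (points X) A B (g y))"
    if "B \<in> sections ?Q (distr X)" for B
    using bracket_push[OF cr_regular_closed[OF regX] sections_subset[OF At Q'(2) order_refl]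
        sections_subset[OF that order_refl dX] Q'(1-3)] Q'(4) by simp
  have 1: "lie_bracket (points Y) (push A) C y = differential (points X) f (g y) (lie_bracket (points X) A ?C (g y))"
    unfolding brk[OF C', symmetric] by (rule lie_bracket_cong[OF Q(1) y]) (use pp in auto)
  have 2: "lie_bracket (points Y) (push A) (\<lambda>z. cplx Y z (C z)) y =
      differential (points X) f (g y) (lie_bracket (points X) A (\<lambda>x. cplx X x (?C x)) (g y))"
    unfolding brk[OF JC, symmetric] by (rule lie_bracket_cong[OF Q(1) y]) (use pJ in auto)
  have gy: "g y \<in> U" using Q'(2,3) by blast
  note D = infinitesimal_symmetryD[OF A Q'(1,2) C' Q'(3)]
  show "lie_bracket (points Y) (push A) C y \<in> distr Y y \<and>
      lie_bracket (points Y) (push A) (\<lambda>z. cplx Y z (C z)) y = cplx Y y (lie_bracket (points Y) (push A) C y)"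
    unfolding 1 2 D(2) using distr[OF gy] D(1) cplx[OF gy D(1)] Q'(4) by auto
qed

lemma (in std_model) differential_const:
  fixes w :: 'a shows "x \<in> V \<Longrightarrow> h \<in> V \<Longrightarrow> differential V (\<lambda>y. w) x h = 0"
  by (rule differential_eqI[OF has_derivative_const]) (simp add: tangent_V)

text \<open>A constant central field is also the left-invariant field of \<open>z\<close>. Its
  bracket with \<open>Lam y (a y)\<close> is \<open>Lam\<close> of the derivative of the coefficient
  \<open>a\<close> along \<open>z\<close>; this derivative remains in \<open>gr 1\<close> and
  commutes with the linear map \<open>J\<close>.\<close>

lemma (in std_model) central_symmetry:
  assumes z: "central z" and U: "open_in V U" shows "infinitesimal_symmetry X U (\<lambda>_. z)"
proof (rule infinitesimal_symmetryI)
  have "U \<subseteq> V" using U openin_imp_subset by blast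
  then show "(\<lambda>_. z) \<in> sections U (tangent_space (points X))"
    using central_V[OF z] tangent_V points_X by (auto simp: sections_def smooth_on_const)
  fix Q A x assume Q: "open_in (points X) Q" "Q \<subseteq> U" and A: "A \<in> sections Q (distr X)" and x: "x \<in> Q"
  have QV: "open_in V Q" "Q \<subseteq> V" "x \<in> V" using Q x \<open>U \<subseteq> V\<close> points_X by auto
  have "A \<in> sections Q (\<lambda>x. Lam x ` gr 1)"
    by (rule sections_subset[OF A order_refl]) (use distr_Lam QV in blast)
  from section_coeff[OF this QV(2) grV] obtain a where
    a: "smooth_on Q a" "\<And>x. x \<in> Q \<Longrightarrow> a x \<in> gr 1" "\<And>x. x \<in> Q \<Longrightarrow> A x = Lam x (a x)" by blast
  have brk: "lie_bracket V (\<lambda>_. z) (\<lambda>y. Lam y (b y)) x = Lam x (differential V b x z)"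
    if b: "smooth_on Q b" "\<And>x. x \<in> Q \<Longrightarrow> b x \<in> gr 1" for b
  proof -
    have "lie_bracket V (\<lambda>_. z) (\<lambda>y. Lam y (b y)) x = lie_bracket V (\<lambda>y. Lam y z) (\<lambda>y. Lam y (b y)) x"
      by (rule lie_bracket_cong[OF QV(1) x]) (use Lam_central[OF z] QV(2) in auto)
    also have "\<dots> = Lam x (br z (b x) + differential V b x (Lam x z) - differential V (\<lambda>_. z) x (Lam x (b x)))"
      by (rule Lam_lie_bracket[OF QV(1) x smooth_on_const central_V[OF z] b(1) gr1_V[OF b(2)]])
    finally show ?thesis
      using central_br(1)[OF z gr1_V[OF b(2)[OF x]]] differential_const[OF QV(3) Lam_V]
        Lam_central[OF z QV(3)] by simp
  qed
  have zt: "z \<in> tangent_space V x" using tangent_V[OF QV(3)] central_V[OF z] by simp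
  have da: "differential V a x z \<in> gr 1"
    by (rule differential_in_subspace[OF a(1) QV(1) x sub_gr a(2) zt])
  have "differential V (\<lambda>y. J (a y)) x z = J (differential V a x z)"
    by (rule differential_eqI[OF has_derivative_compose[OF has_derivative_differential[OF a(1) QV(1) x]
            linear_imp_has_derivative[OF linear_J]] zt])
  moreover have "lie_bracket V (\<lambda>_. z) (\<lambda>y. cplx X y (A y)) x = lie_bracket V (\<lambda>_. z) (\<lambda>y. Lam y (J (a y))) x"
    by (rule lie_bracket_cong[OF QV(1) x]) (use a(2,3) cplx_Lam QV(2) in auto)
  ultimately have 2: "lie_bracket V (\<lambda>_. z) (\<lambda>y. cplx X y (A y)) x = Lam x (J (differential V a x z))"
    using brk[OF smooth_on_linear_compose[OF linear_J a(1)] J_gr1[OF a(2)]] by simp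
  have "lie_bracket V (\<lambda>_. z) A x = lie_bracket V (\<lambda>_. z) (\<lambda>y. Lam y (a y)) x"
    by (rule lie_bracket_cong[OF QV(1) x]) (use a(3) in auto)
  then have 1: "lie_bracket V (\<lambda>_. z) A x = Lam x (differential V a x z)" using brk[OF a(1,2)] by simp
  show "lie_bracket (points X) (\<lambda>_. z) A x \<in> distr X x \<and>
      lie_bracket (points X) (\<lambda>_. z) (\<lambda>y. cplx X y (A y)) x = cplx X x (lie_bracket (points X) (\<lambda>_. z) A x)"
    unfolding points_X 1 2 using da distr_Lam[OF QV(3)] cplx_Lam[OF QV(3) da] by simp
qed

locale reduction = truncation +
  assumes nu: "\<nu> = Suc i"
begin

lemma phi_top: "z \<in> gr \<nu> \<Longrightarrow> \<phi> z = 0" using kill[of \<nu> z] nu by simp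

lemma Fil_top_disjoint: "z \<in> Fil i \<Longrightarrow> z \<in> gr \<nu> \<Longrightarrow> z = 0"
  using phi_inj phi_top by blast

lemma phi_kernel: "x \<in> V \<Longrightarrow> \<phi> x = 0 \<Longrightarrow> x \<in> gr \<nu>" using residue(3) nu by simp

text \<open>Horizontal and vertical part: the left-invariant distribution of \<open>Fil i\<close>,
  and \<open>gr \<nu>\<close>, on which \<open>Lam y\<close> is the identity.\<close>

lemma Lam_split:
  assumes "y \<in> V" "w \<in> V"
  obtains u z where "u \<in> Fil i" "z \<in> gr \<nu>" "w = Lam y u + z"
proof
  let ?w = "om y w"
  have "?w \<in> Fil (Suc i)" using om_V Fil_top nu by blast
  from Fil_split[OF this] show "?w - pr \<nu> ?w \<in> Fil i" by (simp add: nu)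
  show "pr \<nu> ?w \<in> gr \<nu>" by (rule pr_in)
  have "Lam y (?w - pr \<nu> ?w) + pr \<nu> ?w = Lam y ?w"
    using Lam_central[OF central_top[OF pr_in] assms(1)] by (simp add: linear_diff[OF linear_Lam])
  then show "w = Lam y (?w - pr \<nu> ?w) + pr \<nu> ?w" using Lam_om[OF assms] by simp
qed

lemma Lam_Fil_top: "y \<in> V \<Longrightarrow> z \<in> gr \<nu> \<Longrightarrow> z \<in> Lam y ` Fil i \<Longrightarrow> z = 0"
proof -
  assume y: "y \<in> V" and z: "z \<in> gr \<nu>" and "z \<in> Lam y ` Fil i"
  then obtain w where w: "w \<in> Fil i" "z = Lam y w" by blast
  have "om y (Lam y w) = w" using om_Lam[OF y] w(1) Fil_V by blast
  then have "w = z" using w(2) om_central[OF central_top[OF z] y] by simp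
  then show "z = 0" using Fil_top_disjoint w(1) z by simp
qed

text \<open>Images of relative balls are open because \<open>\<phi>\<close> has a continuous section
  through each point \<open>b\<close>, namely the translate
  \<open>y' \<mapsto> b + \<psi> (y' - y)\<close> of \<open>\<psi>\<close>.\<close>

lemma open_phi: "open_in (\<phi> ` V) (\<phi> ` (V \<inter> ball n r))"
proof (subst openin_subopen, intro ballI)
  fix y assume "y \<in> \<phi> ` (V \<inter> ball n r)"
  then obtain b where b: "b \<in> V" "b \<in> ball n r" "y = \<phi> b" by blast
  let ?k = "\<lambda>y'. b + \<psi> (y' - y)"
  have "?k = (\<lambda>y'. (b - \<psi> y) + \<psi> y')" by (auto simp: linear_diff[OF lin_psi])
  then have "smooth_on UNIV ?k"
    using smooth_on_add[OF smooth_on_const smooth_on_linear[OF lin_psi]] by simp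
  then have "continuous_on UNIV ?k" by (rule smooth_on_continuous)
  then have o: "open (?k -` ball n r)" by (rule open_vimage[OF open_ball])
  have "y' \<in> \<phi> ` (V \<inter> ball n r)" if "y' \<in> \<phi> ` V" "y' \<in> ?k -` ball n r" for y'
  proof -
    have "\<phi> (?k y') = y'"
      using phi_psi_phi b(1,3) that(1)
      by (auto simp: linear_add[OF lin_phi] linear_diff[OF lin_psi] linear_diff[OF lin_phi])
    moreover have "?k y' \<in> V" using b(1) psi_V V_closed by simp
    ultimately show ?thesis using that(2) by (metis IntI imageI vimageD)
  qed
  moreover have "y \<in> ?k -` ball n r" using b linear_0[OF lin_psi] by simp
  ultimately show "\<exists>T. open_in (\<phi> ` V) T \<and> y \<in> T \<and> T \<subseteq> \<phi> ` (V \<inter> ball n r)"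
    by (intro exI[of _ "\<phi> ` V \<inter> ?k -` ball n r"] conjI openin_open_Int[OF o]) (use b in auto)
qed

text \<open>The neighbourhood is the preimage of a ball, so that the fibres of the projection are
  homeomorphic to convex sets.\<close>

lemma symmetry_reduction_at:
  fixes W :: "'c::euclidean_space cr"
  assumes W: "cr_regular W" and eq: "cr_equivalence_at W X p n"
  shows "symmetry_reduction_at i W X' p (\<phi> n)"
proof -
  obtain U0 V0 f g where i0: "cr_iso W X U0 V0 f g" "p \<in> U0" "f p = n"
    using cr_equivalence_atE[OF eq W regular] .
  interpret a: cr_iso W X U0 V0 f g by (rule i0(1))
  interpret as: cr_iso X W V0 U0 g f by (rule a.cr_sym)
  have nV: "n \<in> V" "n \<in> V0" using a.fV[OF i0(2)] i0(3) a.VT points_X by auto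
  obtain Q where Q: "open Q" "V0 = V \<inter> Q" using a.openV points_X by (auto simp: openin_open)
  then obtain r where r: "r > 0" "ball n r \<subseteq> Q" using nV openE by blast
  define B where "B = V \<inter> ball n r"
  have B: "open_in (points X) B" "B \<subseteq> V0" "B \<subseteq> V" "n \<in> B" "convex B"
    using r Q(2) nV points_X subspace_imp_convex[OF subV]
    by (auto simp: B_def intro: openin_open_Int convex_Int convex_ball)
  define U where "U = g ` B"
  interpret c: cr_iso X W B U g f unfolding U_def by (rule as.cr_sub[OF B(1,2)])
  interpret e: cr_iso W X U B f g by (rule c.cr_sym)
  have pU: "p \<in> U" unfolding U_def using B(4) a.inv[OF i0(2)] i0(3) by (metis imageI)
  let ?dg = "\<lambda>y. differential V g y" and ?df = "\<lambda>x. differential (points W) f x"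
  have tV: "tangent_space (points X) y = V" if "y \<in> B" for y using tangent_V that B(3) points_X by auto
  have fB: "f x \<in> B" "f x \<in> V" "g (f x) = x" if "x \<in> U" for x using e.fV[OF that] B(3) e.inv[OF that] by auto
  have linG: "linear (?dg (f x))" if "x \<in> U" for x using c.linear_df[OF fB(1)[OF that]] points_X by simp
  have dT: "tangent_space (points W) x = ?dg (f x) ` V" if "x \<in> U" for x
    using c.df_onto[OF fB(1)[OF that]] tV[OF fB(1)[OF that]] fB(3)[OF that] points_X by simp
  have dfdg: "?df x (?dg (f x) z) = z" if "x \<in> U" "z \<in> V" for x z
    using c.dgdf[OF fB(1)[OF that(1)], of z] tV[OF fB(1)[OF that(1)]] that fB(3)[OF that(1)] points_X by simp
  have dgdf: "?dg (f x) (?df x v) = v" if "x \<in> U" "v \<in> tangent_space (points W) x" for x v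
    using e.dgdf[OF that] points_X by simp
  have dfV: "?df x v \<in> V" if "x \<in> U" "v \<in> tangent_space (points W) x" for x v
    using e.df_tangent[OF that] tV[OF fB(1)[OF that(1)]] by simp
  have flag: "weak_flag W i x = ?dg (f x) ` Lam (f x) ` Fil i" if "x \<in> U" for x
    using c.weak_flag_image[OF fB(1)[OF that], of i] weak_flag_Lam[OF fB(2)[OF that]] fB(3)[OF that] points_X by simp
  \<comment> \<open>Outside \<open>U\<close> the value is fixed to 0, so that \<open>\<xi>\<close>
    depends linearly on \<open>z\<close> as a function on the whole space: closure of
    \<open>h\<close> under linear combinations is an equality of functions.\<close>
  define \<xi> where "\<xi> z x = (if x \<in> U then ?dg (f x) z else 0)" for z x
  define h where "h = \<xi> ` gr \<nu>"
  have push: "c.push (\<lambda>_. z) x = \<xi> z x" if "x \<in> U" for z x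
    unfolding c.push_def \<xi>_def using that points_X by simp
  have grt: "z \<in> V" "central z" if "z \<in> gr \<nu>" for z using that grV central_top by auto
  have gU: "U \<subseteq> points W" using e.US .
  have h0: "(\<lambda>x. 0) \<in> h"
  proof -
    have "\<xi> 0 = (\<lambda>x. 0)" using linear_0[OF linG] by (auto simp: \<xi>_def)
    then show ?thesis unfolding h_def using subspace_0[OF sub_gr] by (metis imageI)
  qed
  have hlin: "(\<lambda>x. k *\<^sub>R \<xi>' x + l *\<^sub>R \<eta> x) \<in> h" if hh: "\<xi>' \<in> h" "\<eta> \<in> h" for \<xi>' \<eta> k l
  proof -
    obtain z w where z: "z \<in> gr \<nu>" "\<xi>' = \<xi> z" "w \<in> gr \<nu>" "\<eta> = \<xi> w"
      using hh unfolding h_def by blast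
    have "(\<lambda>x. k *\<^sub>R \<xi>' x + l *\<^sub>R \<eta> x) = \<xi> (k *\<^sub>R z + l *\<^sub>R w)"
      using linG by (auto simp: z(2,4) \<xi>_def linear_add linear_scale)
    moreover have "k *\<^sub>R z + l *\<^sub>R w \<in> gr \<nu>" using z sub_gr by (intro subspace_add subspace_scale)
    ultimately show ?thesis by (simp add: h_def)
  qed
  have hsym: "infinitesimal_symmetry W U \<xi>'" if hh: "\<xi>' \<in> h" for \<xi>'
  proof -
    obtain z where z: "z \<in> gr \<nu>" "\<xi>' = \<xi> z" using hh unfolding h_def by blast
    have "infinitesimal_symmetry X B (\<lambda>_. z)"
      using central_symmetry[OF grt(2)[OF z(1)]] B(1) points_X by simp
    from infinitesimal_symmetry_cong[OF c.infinitesimal_symmetry_push[OF this] push]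
    show ?thesis by (simp add: z(2))
  qed
  have habel: "lie_bracket (points W) \<xi>' \<eta> x = 0" if \<xi>h: "\<xi>' \<in> h" "\<eta> \<in> h" and x: "x \<in> U" for \<xi>' \<eta> x
  proof -
    obtain z w where z: "z \<in> gr \<nu>" "\<xi>' = \<xi> z" "w \<in> gr \<nu>" "\<eta> = \<xi> w"
      using \<xi>h unfolding h_def by blast
    have sec: "(\<lambda>_. u) \<in> sections B (tangent_space (points X))" if "u \<in> gr \<nu>" for u
      using grt(1)[OF that] tV by (simp add: sections_def smooth_on_const)
    have "lie_bracket (points W) \<xi>' \<eta> x = lie_bracket (points W) (c.push (\<lambda>_. z)) (c.push (\<lambda>_. w)) (g (f x))"
      unfolding z(2,4) fB(3)[OF x]
      by (rule lie_bracket_cong[OF e.openU x]) (simp_all add: push)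
    also have "\<dots> = differential (points X) g (f x) (lie_bracket (points X) (\<lambda>_. z) (\<lambda>_. w) (f x))"
      by (rule c.bracket_push[OF cr_regular_closed[OF regular] sec[OF z(1)] sec[OF z(3)] B(1) order_refl fB(1)[OF x]])
    also have "lie_bracket (points X) (\<lambda>_. z) (\<lambda>_. w) (f x) = 0"
      using differential_const[OF fB(2)[OF x]] grt(1) z by (simp add: lie_bracket_def points_X)
    finally show ?thesis using linear_0[OF linG[OF x]] points_X by simp
  qed
  have htan: "tangent_space (points W) x = {v + \<eta> x | v \<eta>. v \<in> weak_flag W i x \<and> \<eta> \<in> h}" if x: "x \<in> U" for x
  proof
    show "tangent_space (points W) x \<subseteq> {v + \<eta> x | v \<eta>. v \<in> weak_flag W i x \<and> \<eta> \<in> h}"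
    proof
      fix v assume "v \<in> tangent_space (points W) x"
      then obtain w where w: "w \<in> V" "v = ?dg (f x) w" using dT[OF x] by blast
      obtain u z where u: "u \<in> Fil i" "z \<in> gr \<nu>" "w = Lam (f x) u + z"
        using Lam_split[OF fB(2)[OF x] w(1)] .
      have "v = ?dg (f x) (Lam (f x) u) + \<xi> z x"
        using x by (simp add: w(2) u(3) \<xi>_def linear_add[OF linG])
      then show "v \<in> {v + \<eta> x | v \<eta>. v \<in> weak_flag W i x \<and> \<eta> \<in> h}"
        unfolding flag[OF x] h_def using u(1,2) by blast
    qed
    show "{v + \<eta> x | v \<eta>. v \<in> weak_flag W i x \<and> \<eta> \<in> h} \<subseteq> tangent_space (points W) x"
    proof
      fix v assume "v \<in> {v + \<eta> x | v \<eta>. v \<in> weak_flag W i x \<and> \<eta> \<in> h}"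
      then obtain u z where u: "z \<in> gr \<nu>" "v = ?dg (f x) (Lam (f x) u) + \<xi> z x"
        unfolding flag[OF x] h_def by blast
      then have "v = ?dg (f x) (Lam (f x) u + z)" using x by (simp add: \<xi>_def linear_add[OF linG])
      moreover have "Lam (f x) u + z \<in> V" using Lam_V grt(1)[OF u(1)] V_closed by blast
      ultimately show "v \<in> tangent_space (points W) x" unfolding dT[OF x] by blast
    qed
  qed
  have htrans: "\<eta> y = 0" if x: "x \<in> U" and \<eta>: "\<eta> \<in> h" "\<eta> x \<in> weak_flag W i x" and "y \<in> U" for x \<eta> y
  proof -
    obtain z where z: "z \<in> gr \<nu>" "\<eta> = \<xi> z" using \<eta> by (auto simp: h_def)
    have "?dg (f x) z \<in> ?dg (f x) ` Lam (f x) ` Fil i" using \<eta>(2) x flag[OF x] by (simp add: z(2) \<xi>_def)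
    then obtain w where w: "w \<in> Fil i" "?dg (f x) z = ?dg (f x) (Lam (f x) w)" by blast
    then have "z = Lam (f x) w" using dfdg[OF x] grt(1)[OF z(1)] Lam_V by metis
    then have "z = 0" using Lam_Fil_top[OF fB(2)[OF x] z(1)] w(1) by blast
    then show ?thesis using that linear_0[OF linG] by (simp add: z(2) \<xi>_def)
  qed
  let ?\<pi> = "\<lambda>x. \<phi> (f x)"
  have d\<pi>: "differential (points W) ?\<pi> x v = \<phi> (?df x v)" if "x \<in> U" "v \<in> tangent_space (points W) x" for x v
    by (rule differential_eqI[OF has_derivative_compose[OF has_derivative_differential[OF e.smf e.openU that(1)]
            linear_imp_has_derivative[OF lin_phi]] that(2)])
  have dWT: "distr W x \<subseteq> tangent_space (points W) x" if "x \<in> U" for x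
    using e.distr_tangent[OF that] by blast
  show ?thesis
    unfolding symmetry_reduction_at_def
  proof (intro exI[of _ U] exI[of _ "\<phi> ` B"] exI[of _ h] exI[of _ ?\<pi>] conjI ballI allI impI)
    show "open_in (points W) U" by (rule e.openU)
    show "p \<in> U" by (rule pU)
    show "open_in (points X') (\<phi> ` B)" unfolding t.points_X carrier' B_def by (rule open_phi)
    show "\<phi> n \<in> \<phi> ` B" using B(4) by blast
    show "smooth_on U ?\<pi>" by (rule smooth_on_linear_compose[OF lin_phi e.smf])
    show "?\<pi> ` U = \<phi> ` B" unfolding e.image[symmetric] image_image ..
    show "?\<pi> p = \<phi> n" using i0(3) by simp
    show "connected {x \<in> U. ?\<pi> x = y}" for y
    proof -
      have "{x \<in> U. ?\<pi> x = y} = g ` {b \<in> B. \<phi> b = y}"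
        using fB c.inv c.image by (auto simp: image_iff)
      moreover have "convex {b \<in> B. \<phi> b = y}"
        using B(5) unfolding convex_def
        by (simp add: linear_add[OF lin_phi] linear_scale[OF lin_phi] scaleR_left_distrib[symmetric])
      then have "connected (g ` {b \<in> B. \<phi> b = y})"
        by (intro connected_continuous_image convex_connected
            continuous_on_subset[OF smooth_on_continuous[OF c.smf]]) auto
      ultimately show ?thesis by simp
    qed
    fix x assume x: "x \<in> U"
    have fx: "\<phi> (f x) \<in> \<phi> ` V" using fB(2)[OF x] by blast
    have "differential (points W) ?\<pi> x ` tangent_space (points W) x = \<phi> ` ?df x ` tangent_space (points W) x"
      unfolding image_image by (rule image_cong[OF refl d\<pi>[OF x]])
    also have "?df x ` tangent_space (points W) x = V" using e.df_onto[OF x] tV[OF fB(1)[OF x]] by simp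
    finally show "differential (points W) ?\<pi> x ` tangent_space (points W) x = tangent_space (points X') (?\<pi> x)"
      using tangent_space_subspace[OF subspace_phi_V fx] by (simp add: t.points_X carrier')
    show "{v \<in> tangent_space (points W) x. differential (points W) ?\<pi> x v = 0} = {\<eta> x | \<eta>. \<eta> \<in> h}"
    proof
      show "{v \<in> tangent_space (points W) x. differential (points W) ?\<pi> x v = 0} \<subseteq> {\<eta> x | \<eta>. \<eta> \<in> h}"
      proof
        fix v assume v: "v \<in> {v \<in> tangent_space (points W) x. differential (points W) ?\<pi> x v = 0}"
        then have vt: "v \<in> tangent_space (points W) x" and "\<phi> (?df x v) = 0" using d\<pi>[OF x] by auto
        then have "?df x v \<in> gr \<nu>" using phi_kernel[OF dfV[OF x]] by blast
        moreover have "v = \<xi> (?df x v) x" using dgdf[OF x vt] x by (simp add: \<xi>_def)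
        ultimately show "v \<in> {\<eta> x | \<eta>. \<eta> \<in> h}" unfolding h_def by blast
      qed
      show "{\<eta> x | \<eta>. \<eta> \<in> h} \<subseteq> {v \<in> tangent_space (points W) x. differential (points W) ?\<pi> x v = 0}"
      proof
        fix v assume "v \<in> {\<eta> x | \<eta>. \<eta> \<in> h}"
        then obtain z where z: "z \<in> gr \<nu>" "v = ?dg (f x) z" using x by (auto simp: h_def \<xi>_def)
        have vt: "v \<in> tangent_space (points W) x" using dT[OF x] z grt(1) by blast
        then show "v \<in> {v \<in> tangent_space (points W) x. differential (points W) ?\<pi> x v = 0}"
          using d\<pi>[OF x vt] dfdg[OF x grt(1)[OF z(1)]] phi_top[OF z(1)] z(2) by simp
      qed
    qed
    have "differential (points W) ?\<pi> x ` distr W x = \<phi> ` ?df x ` distr W x"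
      unfolding image_image by (rule image_cong[OF refl d\<pi>[OF x]]) (use dWT[OF x] in blast)
    then show "differential (points W) ?\<pi> x ` distr W x = distr X' (?\<pi> x)"
      using e.distr[OF x] distr'[OF fB(2)[OF x]] by simp
    fix v assume v: "v \<in> distr W x"
    have "?df x v \<in> distr X (f x)" using e.distr[OF x] v by blast
    then show "differential (points W) ?\<pi> x (cplx W x v) = cplx X' (?\<pi> x) (differential (points W) ?\<pi> x v)"
      using d\<pi>[OF x] dWT[OF x] v e.cplx_distr[OF x v] e.cplx[OF x v] cplx'[OF fB(2)[OF x]]
      by (simp add: subset_iff)
  qed (use h0 hlin hsym habel htan htrans in blast)+
qed

text \<open>The manifold \<open>W\<close> is allowed to be merely locally equivalent to the model,
  because at the top of the tower it is the given manifold itself.\<close>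

lemma symmetry_reduction:
  fixes W :: "'c::euclidean_space cr"
  assumes W: "cr_manifold W" "has_depth W \<nu>" and eq: "locally_cr_equivalent W X"
  shows "symmetry_reduction W X'"
  unfolding symmetry_reduction_def
proof (intro conjI exI[of _ i])
  have r: "cr_regular W"
    by (rule cr_regularI[OF W(1) tangent_closed_locally_cr_equivalent[OF cr_regular_closed[OF regular] eq]])
  show "cr_manifold W" "cr_manifold X'" by (rule W(1) t.cr_manifold)+
  show "has_depth W (Suc i)" using W(2) nu by simp
  show "rel_set (symmetry_reduction_at i W X') (points W) (points X')"
    unfolding rel_set_def
  proof (intro conjI ballI)
    fix p assume "p \<in> points W"
    then obtain n where "n \<in> points X" "cr_equivalence_at W X p n" using locally_cr_equivalentD(1)[OF eq] by blast
    then show "\<exists>q\<in>points X'. symmetry_reduction_at i W X' p q"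
      using symmetry_reduction_at[OF r] carrier' t.points_X points_X by blast
  next
    fix q assume "q \<in> points X'"
    then obtain n where n: "n \<in> points X" "q = \<phi> n" using carrier' t.points_X points_X by blast
    then obtain p where "p \<in> points W" "cr_equivalence_at W X p n" using locally_cr_equivalentD(2)[OF eq] by blast
    then show "\<exists>p\<in>points W. symmetry_reduction_at i W X' p q"
      using symmetry_reduction_at[OF r] n(2) by blast
  qed
qed

lemma graded_central_extension: "graded_central_extension (Suc i) gr br gr' br'"
  unfolding graded_central_extension_def
proof (intro exI[of _ \<phi>] conjI)
  show "linear \<phi>" by (rule lin_phi)
  show "\<forall>i. \<phi> ` gr i = gr' i" by (simp add: gr'_def)
  show "\<forall>x\<in>V. \<forall>y\<in>V. \<phi> (br x y) = br' (\<phi> x) (\<phi> y)" using phi_br by blast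
  show "{x \<in> V. \<phi> x = 0} = gr (Suc i)" using phi_kernel phi_top grV nu by auto
  show "\<forall>x\<in>gr (Suc i). \<forall>y\<in>V. br x y = 0" using central_top central_br(1) nu by blast
qed

text \<open>The structure group is \<open>gr \<nu>\<close> acting by addition, which is the group
  product because \<open>gr \<nu>\<close> is central. Everything else follows from the splitting
  into \<open>Fil i\<close> and \<open>gr \<nu>\<close>.\<close>

lemma horizontal_lift: "horizontal_lift X' X"
  unfolding horizontal_lift_def
proof (intro conjI exI[of _ i] exI[of _ \<phi>] exI[of _ "gr \<nu>"] exI[of _ "\<lambda>a z. z + a"]
    exI[of _ "\<lambda>z. Lam z ` Fil i"])
  have d\<phi>: "differential (points X) \<phi> z v = \<phi> v" if "z \<in> points X" "v \<in> V" for z v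
    using differential_linear[OF lin_phi] tangent_V that points_X by simp
  have LF: "Lam z ` Fil i \<subseteq> V" for z using Lam_V by blast
  have top_V: "a \<in> V" if "a \<in> gr \<nu>" for a using that grV by blast
  show "cr_manifold X'" "cr_manifold X" by (rule t.cr_manifold cr_manifold)+
  show "has_depth X' i" by (rule t.has_depth)
  show "smooth_on (points X) \<phi>" by (rule smooth_on_linear[OF lin_phi])
  show "\<phi> ` points X = points X'" by (simp add: points_X t.points_X carrier')
  have tX': "tangent_space (points X') (\<phi> z) = \<phi> ` V" if "z \<in> points X" for z
    using tangent_space_subspace[OF subspace_phi_V, of "\<phi> z"] that by (simp add: t.points_X carrier' points_X)
  show "\<forall>z\<in>points X. differential (points X) \<phi> z ` tangent_space (points X) z = tangent_space (points X') (\<phi> z)"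
    using tX' d\<phi> tangent_V points_X by (simp cong: image_cong)
  show "subspace (gr \<nu>)" by (rule sub_gr)
  have "linear (\<lambda>p::'a \<times> 'a. snd p + fst p)" by (rule linearI) (simp_all add: algebra_simps)
  from smooth_on_linear[OF this] show "smooth_on (gr \<nu> \<times> points X) (\<lambda>(a, z). z + a)"
    by (simp add: case_prod_unfold)
  show "\<forall>z\<in>points X. z + 0 = z" by simp
  show "\<forall>a\<in>gr \<nu>. \<forall>b\<in>gr \<nu>. \<forall>z\<in>points X. z + (a + b) = z + b + a" by (simp add: algebra_simps)
  show "\<forall>a\<in>gr \<nu>. \<forall>z\<in>points X. z + a \<in> points X \<and> (z + a = z \<longrightarrow> a = 0)"
    using V_closed(4) top_V points_X by simp
  show "\<forall>z\<in>points X. \<forall>z'\<in>points X. (\<phi> z = \<phi> z') = (\<exists>a\<in>gr \<nu>. z' = z + a)"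
  proof (intro ballI iffI)
    fix z z' assume z: "z \<in> points X" "z' \<in> points X" and "\<phi> z = \<phi> z'"
    then have "z' - z \<in> gr \<nu>"
      using phi_kernel[of "z' - z"] V_closed(5) points_X by (simp add: linear_diff[OF lin_phi])
    then show "\<exists>a\<in>gr \<nu>. z' = z + a" by (intro bexI[of _ "z' - z"]) auto
  qed (use phi_top linear_add[OF lin_phi] in auto)
  show "smooth_distribution (points X) (\<lambda>z. Lam z ` Fil i)"
    unfolding points_X by (rule smooth_distribution_Lam[OF sub_Fil refl])
  show "\<forall>z\<in>points X. bij_betw (differential (points X) \<phi> z) (Lam z ` Fil i) (tangent_space (points X') (\<phi> z))"
  proof
    fix z assume z: "z \<in> points X"
    then have zV: "z \<in> V" using points_X by simp
    have "inj_on \<phi> (Lam z ` Fil i)"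
      unfolding linear_inj_on_iff_eq_0[OF lin_phi sub_Lam[OF sub_Fil]]
      using Lam_Fil_top[OF zV] phi_kernel LF by blast
    moreover have "\<phi> ` Lam z ` Fil i = \<phi> ` V"
    proof
      show "\<phi> ` V \<subseteq> \<phi> ` Lam z ` Fil i"
      proof (rule image_subsetI)
        fix w assume "w \<in> V"
        from Lam_split[OF zV this] obtain u y where u: "u \<in> Fil i" "y \<in> gr \<nu>" "w = Lam z u + y" .
        then have "\<phi> w = \<phi> (Lam z u)" using phi_top by (simp add: linear_add[OF lin_phi])
        then show "\<phi> w \<in> \<phi> ` Lam z ` Fil i" using u(1) by blast
      qed
    qed (use LF in blast)
    ultimately have "bij_betw \<phi> (Lam z ` Fil i) (\<phi> ` V)" by (simp add: bij_betw_def)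
    moreover have "differential (points X) \<phi> z v = \<phi> v" if "v \<in> Lam z ` Fil i" for v
      using d\<phi>[OF z] that LF by blast
    ultimately show "bij_betw (differential (points X) \<phi> z) (Lam z ` Fil i) (tangent_space (points X') (\<phi> z))"
      unfolding tX'[OF z] using bij_betw_cong by blast
  qed
  show "\<forall>a\<in>gr \<nu>. \<forall>z\<in>points X. differential (points X) (\<lambda>z. z + a) z ` Lam z ` Fil i = Lam (z + a) ` Fil i"
  proof (intro ballI)
    fix a z assume a: "a \<in> gr \<nu>" and z: "z \<in> points X"
    have "differential (points X) (\<lambda>z. z + a) z v = v" if "v \<in> V" for v
      by (rule differential_eqI[where D="\<lambda>v. v"])
        (use that z tangent_V points_X in \<open>auto intro!: derivative_eq_intros\<close>)
    then have "differential (points X) (\<lambda>z. z + a) z ` Lam z ` Fil i = Lam z ` Fil i"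
      using LF by (auto simp: image_image Lam_V)
    also have "\<dots> = Lam (z + a) ` Fil i"
      by (rule image_cong[OF refl Lam_add_central[symmetric, OF central_top[OF a]]])
        (use z points_X Fil_V in auto)
    finally show "differential (points X) (\<lambda>z. z + a) z ` Lam z ` Fil i = Lam (z + a) ` Fil i" .
  qed
  show "\<forall>z\<in>points X. distr X z = {v \<in> Lam z ` Fil i. differential (points X) \<phi> z v \<in> distr X' (\<phi> z)}"
  proof
    fix z assume z: "z \<in> points X"
    then have zV: "z \<in> V" using points_X by simp
    \<comment> \<open>If a horizontal \<open>v\<close> and a vector of the distribution have the
      same projection, their difference is horizontal and vertical at once, hence 0.\<close>
    have "v \<in> distr X z \<longleftrightarrow> \<phi> v \<in> distr X' (\<phi> z)" if vF: "v \<in> Lam z ` Fil i" for v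
    proof
      assume "\<phi> v \<in> distr X' (\<phi> z)"
      then have "\<phi> v \<in> \<phi> ` Lam z ` gr 1" unfolding distr'[OF zV] distr_Lam[OF zV] .
      then obtain u where u: "u \<in> gr 1" "\<phi> v = \<phi> (Lam z u)" by blast
      obtain w where w: "w \<in> Fil i" "v = Lam z w" using vF by blast
      have uF: "u \<in> Fil i" using u(1) gr1_Fil by blast
      have "v - Lam z u = Lam z (w - u)" using w(2) by (simp add: linear_diff[OF linear_Lam])
      moreover have "w - u \<in> Fil i" using w(1) uF sub_Fil subspace_diff by blast
      ultimately have "v - Lam z u \<in> Lam z ` Fil i" by blast
      moreover have "v - Lam z u \<in> gr \<nu>"
        using phi_kernel[of "v - Lam z u"] u(2) w(2) Lam_V V_closed(5) by (simp add: linear_diff[OF lin_phi])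
      ultimately have "v = Lam z u" using Lam_Fil_top[OF zV] by fastforce
      then show "v \<in> distr X z" using u(1) distr_Lam[OF zV] by blast
    qed (use distr'[OF zV] in blast)
    moreover have "distr X z \<subseteq> Lam z ` Fil i" using distr_Lam[OF zV] gr1_Fil by blast
    moreover have "differential (points X) \<phi> z v = \<phi> v" if "v \<in> Lam z ` Fil i" for v
      using d\<phi>[OF z] that LF by blast
    ultimately show "distr X z = {v \<in> Lam z ` Fil i. differential (points X) \<phi> z v \<in> distr X' (\<phi> z)}"
      by auto
  qed
  show "\<forall>z\<in>points X. \<forall>v\<in>distr X z. differential (points X) \<phi> z (cplx X z v) =
      cplx X' (\<phi> z) (differential (points X) \<phi> z v)"
  proof (intro ballI)
    fix z v assume z: "z \<in> points X" and v: "v \<in> distr X z"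
    then have zV: "z \<in> V" using points_X by simp
    have dV: "w \<in> V" if "w \<in> distr X z" for w using that distr_Lam[OF zV] Lam_V by auto
    have "cplx X z v \<in> distr X z" using regular z v by (simp add: cr_regular_def)
    then show "differential (points X) \<phi> z (cplx X z v) = cplx X' (\<phi> z) (differential (points X) \<phi> z v)"
      using d\<phi>[OF z dV] v cplx'[OF zV v] by simp
  qed
  show "\<forall>z\<in>points X. \<exists>(gr'' :: nat \<Rightarrow> 'a set) br'' (gr3 :: nat \<Rightarrow> 'b set) br3.
      is_symbol X z gr'' br'' \<and> is_symbol X' (\<phi> z) gr3 br3 \<and>
      gnla_depth gr'' (Suc i) \<and> dim (gr'' (Suc i)) = dim (gr \<nu>) \<and>
      graded_central_extension (Suc i) gr'' br'' gr3 br3"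
  proof
    fix z assume "z \<in> points X"
    then have "z \<in> V" "\<phi> z \<in> gnla_carrier gr'" using points_X carrier' by auto
    then show "\<exists>(gr'' :: nat \<Rightarrow> 'a set) br'' (gr3 :: nat \<Rightarrow> 'b set) br3.
      is_symbol X z gr'' br'' \<and> is_symbol X' (\<phi> z) gr3 br3 \<and>
      gnla_depth gr'' (Suc i) \<and> dim (gr'' (Suc i)) = dim (gr \<nu>) \<and>
      graded_central_extension (Suc i) gr'' br'' gr3 br3"
      using is_symbol t.is_symbol depth nu graded_central_extension
      by (intro exI[of _ gr] exI[of _ br] exI[of _ gr'] exI[of _ br'] conjI) auto
  qed
qed

lemma integrable_extension:
  fixes W :: "'a cr"
  assumes "locally_cr_equivalent W X" shows "integrable_extension X' W"
  unfolding integrable_extension_def using horizontal_lift assms by blast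

end

section \<open>Replacing the base by an isomorphic CR manifold\<close>

text \<open>The symmetries and the neighbourhood upstairs stay the same; the projection is composed
  with \<open>f\<close>. This lets the last quotient be the quadric itself instead of a standard
  model.\<close>

lemma symmetry_reduction_at_post:
  assumes iso: "cr_iso Y Z (points Y) (points Z) f g"
    and dX: "\<And>x. x \<in> points X \<Longrightarrow> distr X x \<subseteq> tangent_space (points X) x"
    and jX: "\<And>x v. x \<in> points X \<Longrightarrow> v \<in> distr X x \<Longrightarrow> cplx X x v \<in> distr X x"
    and red: "symmetry_reduction_at k X Y p q"
  shows "symmetry_reduction_at k X Z p (f q)"
proof -
  interpret cr_iso Y Z "points Y" "points Z" f g by (rule iso)
  from red[unfolded symmetry_reduction_at_def] obtain U V h \<pi> where
    U: "open_in (points X) U" "p \<in> U" "open_in (points Y) V" "q \<in> V" and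
    h: "(\<lambda>x. 0) \<in> h" "\<forall>\<xi>\<in>h. \<forall>\<eta>\<in>h. \<forall>a b. (\<lambda>x. a *\<^sub>R \<xi> x + b *\<^sub>R \<eta> x) \<in> h"
      "\<forall>\<xi>\<in>h. infinitesimal_symmetry X U \<xi>"
      "\<forall>\<xi>\<in>h. \<forall>\<eta>\<in>h. \<forall>x\<in>U. lie_bracket (points X) \<xi> \<eta> x = 0"
      "\<forall>x\<in>U. tangent_space (points X) x = {v + \<xi> x | v \<xi>. v \<in> weak_flag X k x \<and> \<xi> \<in> h}"
      "\<forall>x\<in>U. \<forall>\<xi>\<in>h. \<xi> x \<in> weak_flag X k x \<longrightarrow> (\<forall>y\<in>U. \<xi> y = 0)" and
    \<pi>: "smooth_on U \<pi>" "\<pi> ` U = V" "\<pi> p = q" "\<forall>y\<in>V. connected {x \<in> U. \<pi> x = y}"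
      "\<forall>x\<in>U. differential (points X) \<pi> x ` tangent_space (points X) x = tangent_space (points Y) (\<pi> x)"
      "\<forall>x\<in>U. {v \<in> tangent_space (points X) x. differential (points X) \<pi> x v = 0} = {\<xi> x | \<xi>. \<xi> \<in> h}"
      "\<forall>x\<in>U. differential (points X) \<pi> x ` distr X x = distr Y (\<pi> x)"
      "\<forall>x\<in>U. \<forall>v\<in>distr X x. differential (points X) \<pi> x (cplx X x v) =
            cplx Y (\<pi> x) (differential (points X) \<pi> x v)"
    by (elim exE conjE)
  have finj: "inj_on f (points Y)" by (rule inj_on_inverseI[of _ g]) (rule inv)
  have UX: "U \<subseteq> points X" and VY: "V \<subseteq> points Y" using U openin_imp_subset by blast+
  have \<pi>Y: "\<pi> x \<in> points Y" if "x \<in> U" for x using that \<pi>(2) VY by blast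
  let ?\<rho> = "\<lambda>x. f (\<pi> x)"
  let ?d = "\<lambda>x. differential (points X) \<pi> x" and ?e = "\<lambda>x. differential (points Y) f (\<pi> x)"
  have d: "differential (points X) ?\<rho> x v = ?e x (?d x v)" if "x \<in> U" "v \<in> tangent_space (points X) x" for x v
    by (rule differential_compose[OF \<pi>(1) U(1) that(1) _ smf openU that(2)]) (use \<pi>(2) VY in blast)
  have dt: "?d x v \<in> tangent_space (points Y) (\<pi> x)" if "x \<in> U" "v \<in> tangent_space (points X) x" for x v
    using that \<pi>(5) by blast
  have img: "differential (points X) ?\<rho> x ` W = ?e x ` ?d x ` W"
    if "x \<in> U" "W \<subseteq> tangent_space (points X) x" for x W
    unfolding image_image by (rule image_cong[OF refl d[OF that(1)]]) (use that(2) in blast)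
  show ?thesis
    unfolding symmetry_reduction_at_def
  proof (intro exI[of _ U] exI[of _ "f ` V"] exI[of _ h] exI[of _ ?\<rho>] conjI)
    show "open_in (points Z) (f ` V)" by (rule openin_sub[OF U(3) VY])
    show "f q \<in> f ` V" using U(4) by blast
    show "smooth_on U ?\<rho>" by (rule smooth_on_compose[OF \<pi>(1) smf]) (use \<pi>(2) VY in blast)
    show "?\<rho> ` U = f ` V" unfolding \<pi>(2)[symmetric] image_image ..
    show "?\<rho> p = f q" using \<pi>(3) by simp
    show "\<forall>z\<in>f ` V. connected {x \<in> U. ?\<rho> x = z}"
    proof
      fix z assume "z \<in> f ` V"
      then obtain y where y: "y \<in> V" "z = f y" by blast
      have "?\<rho> x = z \<longleftrightarrow> \<pi> x = y" if "x \<in> U" for x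
        unfolding y(2) by (rule inj_on_eq_iff[OF finj \<pi>Y[OF that]]) (use y(1) VY in blast)
      then have "{x \<in> U. ?\<rho> x = z} = {x \<in> U. \<pi> x = y}" by blast
      then show "connected {x \<in> U. ?\<rho> x = z}" using \<pi>(4) y(1) by simp
    qed
    show "\<forall>x\<in>U. differential (points X) ?\<rho> x ` tangent_space (points X) x = tangent_space (points Z) (?\<rho> x)"
      using img[OF _ order_refl] \<pi>(5) df_onto \<pi>Y by simp
    show "\<forall>x\<in>U. {v \<in> tangent_space (points X) x. differential (points X) ?\<rho> x v = 0} = {\<xi> x | \<xi>. \<xi> \<in> h}"
    proof
      fix x assume x: "x \<in> U"
      have "differential (points X) ?\<rho> x v = 0 \<longleftrightarrow> ?d x v = 0" if "v \<in> tangent_space (points X) x" for v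
        unfolding d[OF x that]
        using dgdf[OF \<pi>Y[OF x] dt[OF x that]] linear_0[OF linear_df[OF \<pi>Y[OF x]]]
          linear_0[OF linear_differential[OF smg openV, of "f (\<pi> x)"]] fV[OF \<pi>Y[OF x]] by auto
      then have "{v \<in> tangent_space (points X) x. differential (points X) ?\<rho> x v = 0} =
          {v \<in> tangent_space (points X) x. ?d x v = 0}" by blast
      then show "{v \<in> tangent_space (points X) x. differential (points X) ?\<rho> x v = 0} = {\<xi> x | \<xi>. \<xi> \<in> h}"
        using \<pi>(6) x by simp
    qed
    show "\<forall>x\<in>U. differential (points X) ?\<rho> x ` distr X x = distr Z (?\<rho> x)"
    proof
      fix x assume x: "x \<in> U"
      then have "distr X x \<subseteq> tangent_space (points X) x" using dX UX by blast
      from img[OF x this] show "differential (points X) ?\<rho> x ` distr X x = distr Z (?\<rho> x)"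
        using \<pi>(7) distr[OF \<pi>Y[OF x]] x by simp
    qed
    show "\<forall>x\<in>U. \<forall>v\<in>distr X x. differential (points X) ?\<rho> x (cplx X x v) =
            cplx Z (?\<rho> x) (differential (points X) ?\<rho> x v)"
    proof (intro ballI)
      fix x v assume x: "x \<in> U" and v: "v \<in> distr X x"
      have t: "w \<in> tangent_space (points X) x" if "w \<in> distr X x" for w using that dX UX x by blast
      have dv: "?d x v \<in> distr Y (\<pi> x)" using \<pi>(7) x v by blast
      have jv: "cplx X x v \<in> distr X x" using jX UX x v by blast
      show "differential (points X) ?\<rho> x (cplx X x v) = cplx Z (?\<rho> x) (differential (points X) ?\<rho> x v)"
        unfolding d[OF x t[OF v]] d[OF x t[OF jv]] using \<pi>(8) x v cplx[OF \<pi>Y[OF x] dv] by simp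
    qed
  qed (use U h in blast)+
qed

lemma symmetry_reduction_post:
  assumes iso: "cr_iso Y Z (points Y) (points Z) f g" and Z: "cr_manifold Z"
    and red: "symmetry_reduction X Y"
  shows "symmetry_reduction X Z"
proof -
  interpret cr_iso Y Z "points Y" "points Z" f g by (rule iso)
  have X: "cr_manifold X" using red unfolding symmetry_reduction_def by (elim conjE)
  have dX: "distr X x \<subseteq> tangent_space (points X) x" if "x \<in> points X" for x
    using X that unfolding cr_manifold_def smooth_distribution_def by (elim conjE) simp
  have jX: "cplx X x v \<in> distr X x" if "x \<in> points X" "v \<in> distr X x" for x v
    using X that unfolding cr_manifold_def by (elim conjE) blast
  obtain k where k: "has_depth X (Suc k)" "rel_set (symmetry_reduction_at k X Y) (points X) (points Y)"
    using red unfolding symmetry_reduction_def by (elim conjE exE)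
  have post: "symmetry_reduction_at k X Z p (f q)" if "symmetry_reduction_at k X Y p q" for p q
    by (rule symmetry_reduction_at_post[OF iso _ _ that]) (erule dX, erule (1) jX)
  have "rel_set (symmetry_reduction_at k X Z) (points X) (points Z)"
    unfolding rel_set_def
  proof (intro conjI ballI)
    fix p assume "p \<in> points X"
    then obtain q where q: "q \<in> points Y" "symmetry_reduction_at k X Y p q"
      using k(2) unfolding rel_set_def by blast
    show "\<exists>r\<in>points Z. symmetry_reduction_at k X Z p r"
      using post[OF q(2)] fV[OF q(1)] by blast
  next
    fix r assume "r \<in> points Z"
    then obtain q where q: "q \<in> points Y" "r = f q" using image by blast
    then obtain p where p: "p \<in> points X" "symmetry_reduction_at k X Y p q"
      using k(2) unfolding rel_set_def by blast
    show "\<exists>p\<in>points X. symmetry_reduction_at k X Z p r"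
      unfolding q(2) using post[OF p(2)] p(1) by blast
  qed
  then show ?thesis using X Z k(1) unfolding symmetry_reduction_def by blast
qed

text \<open>As for reductions, but the symbol of the new base has to be supplied too.
  \<open>has_depth\<close> and the extension of symbols refer to GNLAs inside the ambient space of
  the base, so \<open>Y\<close> and \<open>Z\<close> share their type.\<close>

lemma horizontal_lift_post:
  fixes Y Z :: "'b::euclidean_space cr" and W :: "'a::euclidean_space cr"
  assumes iso: "cr_iso Y Z (points Y) (points Z) f g" and Z: "cr_manifold Z"
    and lift: "horizontal_lift Y W"
  shows "horizontal_lift Z W"
proof -
  interpret cr_iso Y Z "points Y" "points Z" f g by (rule iso)
  from lift[unfolded horizontal_lift_def] obtain k \<pi> and A :: "'a set" and act H where
    W: "cr_manifold W" "has_depth Y k" and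
    \<pi>: "smooth_on (points W) \<pi>" "\<pi> ` points W = points Y"
      "\<forall>z\<in>points W. differential (points W) \<pi> z ` tangent_space (points W) z = tangent_space (points Y) (\<pi> z)" and
    A: "subspace A" "smooth_on (A \<times> points W) (\<lambda>(a, z). act a z)" "\<forall>z\<in>points W. act 0 z = z"
      "\<forall>a\<in>A. \<forall>b\<in>A. \<forall>z\<in>points W. act (a + b) z = act a (act b z)"
      "\<forall>a\<in>A. \<forall>z\<in>points W. act a z \<in> points W \<and> (act a z = z \<longrightarrow> a = 0)"
      "\<forall>z\<in>points W. \<forall>z'\<in>points W. \<pi> z = \<pi> z' \<longleftrightarrow> (\<exists>a\<in>A. z' = act a z)" and
    H: "smooth_distribution (points W) H"
      "\<forall>z\<in>points W. bij_betw (differential (points W) \<pi> z) (H z) (tangent_space (points Y) (\<pi> z))"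
      "\<forall>a\<in>A. \<forall>z\<in>points W. differential (points W) (act a) z ` H z = H (act a z)" and
    D: "\<forall>z\<in>points W. distr W z = {v \<in> H z. differential (points W) \<pi> z v \<in> distr Y (\<pi> z)}"
      "\<forall>z\<in>points W. \<forall>v\<in>distr W z. differential (points W) \<pi> z (cplx W z v) =
          cplx Y (\<pi> z) (differential (points W) \<pi> z v)" and
    S: "\<forall>z\<in>points W. \<exists>(gr :: nat \<Rightarrow> 'a set) br (gr' :: nat \<Rightarrow> 'b set) br'.
          is_symbol W z gr br \<and> is_symbol Y (\<pi> z) gr' br' \<and>
          gnla_depth gr (Suc k) \<and> dim (gr (Suc k)) = dim A \<and> graded_central_extension (Suc k) gr br gr' br'"
    by (elim exE conjE)
  have \<pi>Y: "\<pi> z \<in> points Y" if "z \<in> points W" for z using that \<pi>(2) by blast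
  let ?\<rho> = "\<lambda>x. f (\<pi> x)"
  let ?d = "\<lambda>z. differential (points W) \<pi> z" and ?e = "\<lambda>z. differential (points Y) f (\<pi> z)"
  have d: "differential (points W) ?\<rho> x v = ?e x (?d x v)" if "x \<in> points W" "v \<in> tangent_space (points W) x" for x v
    by (rule differential_compose[OF \<pi>(1) openin_subtopology_self that(1) _ smf openU that(2)]) (use \<pi>(2) in blast)
  have dt: "?d x v \<in> tangent_space (points Y) (\<pi> x)" if "x \<in> points W" "v \<in> tangent_space (points W) x" for x v
    using that \<pi>(3) by blast
  have HT: "H z \<subseteq> tangent_space (points W) z" if "z \<in> points W" for z
    using H(1) that unfolding smooth_distribution_def by (elim conjE) simp
  have DH: "distr W z \<subseteq> H z" if "z \<in> points W" for z using D(1) that by auto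
  have jW: "cplx W x v \<in> distr W x" if "x \<in> points W" "v \<in> distr W x" for x v
    using W(1) that unfolding cr_manifold_def by (elim conjE) blast
  have e_iff: "?e z w \<in> distr Z (f (\<pi> z)) \<longleftrightarrow> w \<in> distr Y (\<pi> z)"
    if zw: "z \<in> points W" "w \<in> tangent_space (points Y) (\<pi> z)" for z w
  proof
    assume "?e z w \<in> distr Z (f (\<pi> z))"
    then obtain w' where w': "w' \<in> distr Y (\<pi> z)" "?e z w = ?e z w'" using distr[OF \<pi>Y[OF zw(1)]] by blast
    then have "w = w'"
      using inj_onD[OF df_inj[OF \<pi>Y[OF zw(1)]] w'(2) zw(2)] distr_tangent[OF \<pi>Y[OF zw(1)]] by blast
    then show "w \<in> distr Y (\<pi> z)" using w'(1) by simp
  qed (use distr[OF \<pi>Y[OF zw(1)]] in blast)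
  show ?thesis
    unfolding horizontal_lift_def
  proof (intro conjI exI[of _ k] exI[of _ ?\<rho>] exI[of _ A] exI[of _ act] exI[of _ H])
    show "cr_manifold Z" "cr_manifold W" by (rule Z W(1))+
    show "has_depth Z k"
      unfolding has_depth_def
    proof
      fix z assume "z \<in> points Z"
      then obtain y where y: "y \<in> points Y" "z = f y" using image by blast
      then have "\<exists>(gr :: nat \<Rightarrow> 'b set) br. is_symbol Y y gr br \<and> gnla_depth gr k"
        using W(2) unfolding has_depth_def by simp
      then obtain gr :: "nat \<Rightarrow> 'b set" and br where s: "is_symbol Y y gr br" "gnla_depth gr k"
        by (elim exE conjE)
      show "\<exists>(gr :: nat \<Rightarrow> 'b set) br. is_symbol Z z gr br \<and> gnla_depth gr k"
        unfolding y(2) using is_symbol_transport[OF y(1) s(1)] s(2) by (intro exI conjI)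
    qed
    show "smooth_on (points W) ?\<rho>" by (rule smooth_on_compose[OF \<pi>(1) smf]) (use \<pi>(2) in blast)
    show "?\<rho> ` points W = points Z" unfolding image[symmetric] \<pi>(2)[symmetric] image_image ..
    show "\<forall>z\<in>points W. differential (points W) ?\<rho> z ` tangent_space (points W) z = tangent_space (points Z) (?\<rho> z)"
    proof
      fix z assume z: "z \<in> points W"
      have "differential (points W) ?\<rho> z ` tangent_space (points W) z = ?e z ` ?d z ` tangent_space (points W) z"
        unfolding image_image by (rule image_cong[OF refl d[OF z]])
      then show "differential (points W) ?\<rho> z ` tangent_space (points W) z = tangent_space (points Z) (?\<rho> z)"
        using \<pi>(3) z df_onto[OF \<pi>Y[OF z]] by simp
    qed
    show "\<forall>z\<in>points W. \<forall>z'\<in>points W. ?\<rho> z = ?\<rho> z' \<longleftrightarrow> (\<exists>a\<in>A. z' = act a z)"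
    proof (intro ballI)
      fix z z' assume z: "z \<in> points W" "z' \<in> points W"
      have "?\<rho> z = ?\<rho> z' \<longleftrightarrow> \<pi> z = \<pi> z'" 
        by (rule inj_on_eq_iff[OF inj_on_inverseI[of _ g, OF inv] \<pi>Y[OF z(1)] \<pi>Y[OF z(2)]])
      then show "?\<rho> z = ?\<rho> z' \<longleftrightarrow> (\<exists>a\<in>A. z' = act a z)" using A(6) z by simp
    qed
    show "\<forall>z\<in>points W. bij_betw (differential (points W) ?\<rho> z) (H z) (tangent_space (points Z) (?\<rho> z))"
    proof
      fix z assume z: "z \<in> points W"
      have "bij_betw (?e z) (tangent_space (points Y) (\<pi> z)) (tangent_space (points Z) (?\<rho> z))"
        using df_inj[OF \<pi>Y[OF z]] df_onto[OF \<pi>Y[OF z]] by (simp add: bij_betw_def)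
      from bij_betw_trans[OF _ this] H(2) z
      have b: "bij_betw (?e z \<circ> ?d z) (H z) (tangent_space (points Z) (?\<rho> z))" by blast
      have eq: "(?e z \<circ> ?d z) v = differential (points W) ?\<rho> z v" if "v \<in> H z" for v
        using d[OF z] HT[OF z] that by (simp add: subset_iff)
      show "bij_betw (differential (points W) ?\<rho> z) (H z) (tangent_space (points Z) (?\<rho> z))"
        by (rule iffD1[OF bij_betw_cong[of "H z" "?e z \<circ> ?d z" "differential (points W) ?\<rho> z"] b]) (rule eq)
    qed
    show "\<forall>z\<in>points W. distr W z = {v \<in> H z. differential (points W) ?\<rho> z v \<in> distr Z (?\<rho> z)}"
    proof
      fix z assume z: "z \<in> points W"
      have "?d z v \<in> distr Y (\<pi> z) \<longleftrightarrow> differential (points W) ?\<rho> z v \<in> distr Z (?\<rho> z)" if "v \<in> H z" for v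
      proof -
        have v: "v \<in> tangent_space (points W) z" using HT[OF z] that by blast
        show ?thesis unfolding d[OF z v] using e_iff[OF z dt[OF z v]] by simp
      qed
      then show "distr W z = {v \<in> H z. differential (points W) ?\<rho> z v \<in> distr Z (?\<rho> z)}"
        using D(1) z by auto
    qed
    show "\<forall>z\<in>points W. \<forall>v\<in>distr W z. differential (points W) ?\<rho> z (cplx W z v) =
          cplx Z (?\<rho> z) (differential (points W) ?\<rho> z v)"
    proof (intro ballI)
      fix z v assume z: "z \<in> points W" and v: "v \<in> distr W z"
      have t: "w \<in> tangent_space (points W) z" if "w \<in> distr W z" for w using that DH[OF z] HT[OF z] by blast
      have dv: "?d z v \<in> distr Y (\<pi> z)" using D(1) z v by blast
      show "differential (points W) ?\<rho> z (cplx W z v) = cplx Z (?\<rho> z) (differential (points W) ?\<rho> z v)"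
        unfolding d[OF z t[OF v]] d[OF z t[OF jW[OF z v]]] using D(2) z v cplx[OF \<pi>Y[OF z] dv] by simp
    qed
    show "\<forall>z\<in>points W. \<exists>(gr :: nat \<Rightarrow> 'a set) br (gr' :: nat \<Rightarrow> 'b set) br'.
          is_symbol W z gr br \<and> is_symbol Z (?\<rho> z) gr' br' \<and>
          gnla_depth gr (Suc k) \<and> dim (gr (Suc k)) = dim A \<and> graded_central_extension (Suc k) gr br gr' br'"
    proof
      fix z assume z: "z \<in> points W"
      from bspec[OF S z] obtain gr :: "nat \<Rightarrow> 'a set" and br and gr' :: "nat \<Rightarrow> 'b set" and br' where
        s: "is_symbol W z gr br" "is_symbol Y (\<pi> z) gr' br'" "gnla_depth gr (Suc k)"
        "dim (gr (Suc k)) = dim A" "graded_central_extension (Suc k) gr br gr' br'" by (elim exE conjE)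
      show "\<exists>(gr :: nat \<Rightarrow> 'a set) br (gr' :: nat \<Rightarrow> 'b set) br'.
          is_symbol W z gr br \<and> is_symbol Z (?\<rho> z) gr' br' \<and>
          gnla_depth gr (Suc k) \<and> dim (gr (Suc k)) = dim A \<and> graded_central_extension (Suc k) gr br gr' br'"
        using s is_symbol_transport[OF \<pi>Y[OF z] s(2)]
        by (intro exI[of _ gr] exI[of _ br] exI[of _ gr'] exI[of _ br'] conjI)
    qed
  qed (rule A(1) A(2) A(3) A(4) A(5) H(1) H(3))+
qed

section \<open>The standard model of depth two and the quadric\<close>

lemma independent_pair:
  fixes a b :: "'a::euclidean_space"
  assumes "\<And>s t. s *\<^sub>R a + t *\<^sub>R b = 0 \<Longrightarrow> s = 0 \<and> t = 0"
  shows "independent {a, b}" "card {a, b} = 2"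
proof -
  have "a \<noteq> b" using assms[of 1 "-1"] by auto
  then show "card {a, b} = 2" by simp
  show "independent {a, b}"
  proof (rule independent_insertI)
    show "a \<notin> span {b}"
    proof
      assume "a \<in> span {b}"
      then obtain k where "a = k *\<^sub>R b" by (auto simp: span_singleton)
      then show False using assms[of 1 "- k"] by simp
    qed
    show "independent {b}" using assms[of 0 1] by auto
  qed
qed

lemma indep_pair_span:
  fixes S :: "'a::euclidean_space set"
  assumes "subspace S" "dim S = 2" "a \<in> S" "b \<in> S"
    and ind: "\<And>s t. s *\<^sub>R a + t *\<^sub>R b = 0 \<Longrightarrow> s = 0 \<and> t = 0"
  shows "S = span {a, b}"
proof
  show "S \<subseteq> span {a, b}"
    using assms(2-4) independent_pair[of a b, OF ind] by (intro card_ge_dim_independent) auto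
  show "span {a, b} \<subseteq> S" by (rule span_minimal) (use assms in auto)
qed

lemma linear_left_inverse_on_range:
  fixes \<psi> :: "'b::euclidean_space \<Rightarrow> 'a::euclidean_space"
  assumes "linear \<psi>" "\<And>y. \<psi> y = 0 \<Longrightarrow> y = 0"
  obtains \<phi> where "linear \<phi>" "\<forall>y. \<phi> (\<psi> y) = y"
proof -
  have "inj \<psi>" using assms linear_injective_0 by blast
  from linear_injective_left_inverse[OF assms(1) this] show ?thesis
    using that by (metis comp_apply id_apply)
qed

context std_model
begin

lemma gr2_span:
  assumes "gr 1 = span {a, b}" shows "gr 2 = span {br a b}"
proof -
  have ab: "a \<in> V" "b \<in> V" "a \<in> gr 1" "b \<in> gr 1" using assms gr1_V by (auto simp: span_base)
  have "{br x y | x y. x \<in> gr 1 \<and> y \<in> gr 1} \<subseteq> span {br a b}"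
  proof
    fix z assume "z \<in> {br x y | x y. x \<in> gr 1 \<and> y \<in> gr 1}"
    then obtain x y where z: "z = br x y" "x \<in> span {a, b}" "y \<in> span {a, b}" using assms by blast
    have "br x y \<in> span {br a b}"
    proof (rule bilinear_span_mem[OF bil subspace_span _ z(2,3)])
      fix x y assume "x \<in> {a, b}" "y \<in> {a, b}"
      then show "br x y \<in> span {br a b}"
        using br_self[OF ab(1)] br_self[OF ab(2)] br_anti[OF ab(2,1)]
        by (auto simp: span_base span_zero span_neg)
    qed
    then show "z \<in> span {br a b}" using z(1) by simp
  qed
  then have "span {br x y | x y. x \<in> gr 1 \<and> y \<in> gr 1} \<subseteq> span {br a b}"
    by (rule span_minimal) simp
  moreover have "br a b \<in> span {br x y | x y. x \<in> gr 1 \<and> y \<in> gr 1}" using ab by (intro span_base) blast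
  then have "span {br a b} \<subseteq> span {br x y | x y. x \<in> gr 1 \<and> y \<in> gr 1}" by (intro span_minimal) auto
  moreover have "gr 2 = span {br x y | x y. x \<in> gr 1 \<and> y \<in> gr 1}"
    using generated_step[OF generated, of 1] by (simp add: numeral_2_eq_2)
  ultimately show ?thesis by blast
qed

end

lemma cmod_sq: "(cmod z)\<^sup>2 = Re z * Re z + Im z * Im z"
  by (subst cmod_power2) (simp add: power2_eq_square)

abbreviation quadric :: "(complex ^ 2) set" where
  "quadric \<equiv> {p. Im (p $ 2) = (cmod (p $ 1))\<^sup>2}"

lemma points_quadric: "points cr_quadric = quadric" by (simp add: cr_quadric_def induced_cr_def)

lemma cplx_quadric: "cplx cr_quadric x v = \<i> *s v" by (simp add: cr_quadric_def induced_cr_def)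

lemma distr_quadric: "distr cr_quadric x = {v \<in> tangent_space quadric x. \<i> *s v \<in> tangent_space quadric x}"
  by (simp add: cr_quadric_def induced_cr_def)

lemma linear_ivec: "linear (\<lambda>v::complex ^ 2. \<i> *s v)"
  by (rule linearI) (auto simp: vec_eq_iff algebra_simps)

lemma linear_component: "linear (\<lambda>p::complex ^ 2. Re (p $ j))" "linear (\<lambda>p::complex ^ 2. Im (p $ j))"
  by (rule linearI; simp)+

text \<open>For \<open>c = -1\<close> and \<open>c = 1\<close> these shears are mutually inverse,
  and the first straightens the quadric to the real hyperplane where the second coordinate is
  real.\<close>

lemma smooth_quadric_shear: "smooth_on S (\<lambda>p::complex ^ 2. p + (c * (cmod (p $ 1))\<^sup>2) *\<^sub>R axis 2 \<i>)"
proof -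
  have s: "smooth_on S (\<lambda>p::complex ^ 2. (Re (p $ 1) * Re (p $ 1) + Im (p $ 1) * Im (p $ 1)))"
    by (intro smooth_on_add smooth_on_bilinear[OF bounded_bilinear_mult] smooth_on_linear linear_component)
  have "smooth_on S (\<lambda>p::complex ^ 2. p + (c * (Re (p $ 1) * Re (p $ 1) + Im (p $ 1) * Im (p $ 1))) *\<^sub>R axis 2 \<i>)"
    by (intro smooth_on_add smooth_on_id smooth_on_bilinear[OF bounded_bilinear_scaleR] smooth_on_const
        smooth_on_bilinear[OF bounded_bilinear_mult] s)
  then show ?thesis by (simp only: cmod_sq)
qed

lemma embedded_submanifold_quadric: "embedded_submanifold (dim {p::complex ^ 2. Im (p $ 2) = 0}) quadric"
proof -
  let ?L = "{p::complex ^ 2. Im (p $ 2) = 0}"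
  let ?\<Phi> = "\<lambda>p::complex ^ 2. p + ((-1) * (cmod (p $ 1))\<^sup>2) *\<^sub>R axis 2 \<i>"
  let ?\<Psi> = "\<lambda>p::complex ^ 2. p + (1 * (cmod (p $ 1))\<^sup>2) *\<^sub>R axis 2 \<i>"
  have 1: "?\<Phi> (?\<Psi> p) = p" "?\<Psi> (?\<Phi> p) = p" for p by (simp_all add: axis_def)
  have "?\<Phi> ` quadric = ?L"
  proof
    show "?L \<subseteq> ?\<Phi> ` quadric"
    proof
      fix p assume "p \<in> ?L"
      then have "?\<Psi> p \<in> quadric" by (simp add: axis_def)
      then show "p \<in> ?\<Phi> ` quadric"
        by (rule image_eqI[where f="?\<Phi>" and x="?\<Psi> p", rotated]) (rule 1(1)[symmetric])
    qed
  qed (auto simp: axis_def)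
  moreover have "p \<in> ?\<Phi> ` UNIV" for p
    by (rule image_eqI[where f="?\<Phi>" and x="?\<Psi> p"]) (rule 1(1)[symmetric], simp)
  then have "?\<Phi> ` UNIV = UNIV" by blast
  moreover have "subspace ?L" by (intro subspaceI) auto
  ultimately show ?thesis
    unfolding embedded_submanifold_def
    by (intro ballI exI[of _ UNIV] exI[of _ "UNIV :: (complex ^ 2) set"] exI[of _ ?L] exI[of _ ?\<Phi>] exI[of _ ?\<Psi>] conjI
        open_UNIV UNIV_I smooth_quadric_shear 1(2) refl) simp_all
qed

text \<open>Differentiation of the defining equation along a curve. Applied to both \<open>v\<close>
  and \<open>\<i> *s v\<close>, it determines the second component of a vector of the distribution
  from the first.\<close>

lemma quadric_tangent:
  assumes "v \<in> tangent_space quadric p"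
  shows "Im (v $ 2) = 2 * (Re (p $ 1) * Re (v $ 1) + Im (p $ 1) * Im (v $ 1))"
proof -
  obtain \<gamma> where \<gamma>: "\<gamma> 0 = p" "\<forall>t. \<gamma> t \<in> quadric" "(\<gamma> has_vector_derivative v) (at 0)"
    using assms unfolding tangent_space_def by blast
  let ?\<rho> = "\<lambda>p::complex ^ 2. Im (p $ 2) - (Re (p $ 1) * Re (p $ 1) + Im (p $ 1) * Im (p $ 1))"
  let ?D = "\<lambda>v::complex ^ 2. Im (v $ 2) - ((Re (p $ 1) * Re (v $ 1) + Re (v $ 1) * Re (p $ 1)) +
      (Im (p $ 1) * Im (v $ 1) + Im (v $ 1) * Im (p $ 1)))"
  have "(?\<rho> has_derivative ?D) (at p within quadric)"
    by (intro has_derivative_diff has_derivative_add has_derivative_mult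
        linear_imp_has_derivative linear_component)
  from curve_derivative[OF this \<gamma>] have a: "((\<lambda>t. ?\<rho> (\<gamma> t)) has_vector_derivative ?D v) (at 0)" .
  have eq: "(\<lambda>t. ?\<rho> (\<gamma> t)) = (\<lambda>t. 0)" using \<gamma>(2) by (auto simp: cmod_sq)
  have "((\<lambda>t. 0::real) has_vector_derivative 0) (at 0)" by simp
  from vector_derivative_unique_at[OF a[unfolded eq] this] have "?D v = 0" .
  then show ?thesis by (simp add: algebra_simps)
qed

lemma cr_regular_quadric: "tangent_closed quadric \<Longrightarrow> cr_regular cr_quadric"
  unfolding cr_regular_def points_quadric
proof (intro conjI ballI allI impI)
  assume T: "tangent_closed quadric"
  then show "tangent_closed quadric" .
  fix x assume "x \<in> quadric"
  then have s: "subspace (tangent_space quadric x)" using T by (simp add: tangent_closed_def)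
  have "distr cr_quadric x = tangent_space quadric x \<inter> (\<lambda>v. \<i> *s v) -` tangent_space quadric x"
    by (auto simp: distr_quadric)
  then show "subspace (distr cr_quadric x)"
    using subspace_inter[OF s linear_subspace_vimage[OF linear_ivec s]] by simp
  show "distr cr_quadric x \<subseteq> tangent_space quadric x" by (auto simp: distr_quadric)
  fix v assume v: "v \<in> distr cr_quadric x"
  have "\<i> *s (\<i> *s v) = - v" by (simp add: vec_eq_iff)
  then show "cplx cr_quadric x v \<in> distr cr_quadric x"
    using v s by (simp add: distr_quadric cplx_quadric subspace_neg)
next
  fix U A assume "open_in quadric U \<and> A \<in> sections U (distr cr_quadric)"
  then show "smooth_on U (\<lambda>x. cplx cr_quadric x (A x))"
    unfolding cplx_quadric by (intro smooth_on_linear_compose[OF linear_ivec]) (simp add: sections_def)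
qed

lemma (in std_model) gr1_basis:
  obtains e where "e \<in> gr 1" "\<And>s t. s *\<^sub>R e + t *\<^sub>R J e = 0 \<Longrightarrow> s = 0 \<and> t = 0"
proof -
  obtain e where e: "e \<in> gr 1" "e \<noteq> 0"
  proof -
    have "gr 1 \<noteq> {0}"
    proof
      assume "gr 1 = {0}"
      then show False using dim_gr1 by simp
    qed
    then show ?thesis using that subspace_0[OF sub_gr[of 1]] by blast
  qed
  have ind: "s = 0 \<and> t = 0" if "s *\<^sub>R e + t *\<^sub>R J e = 0" for s t
  proof -
    \<comment> \<open>Applying \<open>J\<close> gives a second relation; combining the two with
      weights \<open>s\<close> and \<open>- t\<close> isolates \<open>e\<close> with coefficient
      \<open>s * s + t * t\<close>.\<close>
    have "J (s *\<^sub>R e + t *\<^sub>R J e) = 0" using that linear_0[OF linear_J] by simp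
    then have J0: "s *\<^sub>R J e - t *\<^sub>R e = 0"
      using J_J[OF e(1)] by (simp add: linear_add[OF linear_J] linear_scale[OF linear_J])
    have "s *\<^sub>R (s *\<^sub>R e + t *\<^sub>R J e) - t *\<^sub>R (s *\<^sub>R J e - t *\<^sub>R e) = (s * s + t * t) *\<^sub>R e"
      by (simp add: algebra_simps)
    then have "(s * s + t * t) *\<^sub>R e = 0" using that J0 by simp
    then have "s * s + t * t = 0" using e(2) by simp
    then show ?thesis by (simp add: sum_squares_eq_zero_iff)
  qed
  with e(1) that show ?thesis by blast
qed

lemma (in std_model) quadric_iso:
  assumes two: "\<nu> = 2"
  obtains f g where "cr_iso X cr_quadric V quadric f g"
proof -
  obtain e where e: "e \<in> gr 1" and ind: "\<And>s t. s *\<^sub>R e + t *\<^sub>R J e = 0 \<Longrightarrow> s = 0 \<and> t = 0"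
    using gr1_basis by blast
  have je: "J e \<in> gr 1" by (rule J_gr1[OF e])
  define e2 where "e2 = br e (J e)"
  have gr1: "gr 1 = span {e, J e}" by (rule indep_pair_span[OF sub_gr dim_gr1 e je ind])
  have gr2: "gr 2 = span {e2}" unfolding e2_def by (rule gr2_span[OF gr1])
  have e2: "e2 \<noteq> 0"
  proof
    assume "e2 = 0"
    then show False using gr_nu gr2 unfolding two by simp
  qed
  have e2c: "central e2" using central_top[of e2] gr2 two by (simp add: span_base)
  define \<psi> where "\<psi> y = fst y *\<^sub>R e + fst (snd y) *\<^sub>R J e + snd (snd y) *\<^sub>R e2" for y :: "real \<times> real \<times> real"
  have lin: "linear \<psi>" by (rule linearI) (simp_all add: \<psi>_def algebra_simps)
  have pr1: "pr 1 (\<psi> y) = fst y *\<^sub>R e + fst (snd y) *\<^sub>R J e" and pr2: "pr 2 (\<psi> y) = snd (snd y) *\<^sub>R e2" for y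
    using pr_gr[OF e] pr_gr[OF je] pr_gr[of e2 2] gr2
    by (simp_all add: \<psi>_def linear_add[OF linear_pr] linear_scale[OF linear_pr] span_base)
  have inj: "y = 0" if "\<psi> y = 0" for y
    using pr1[of y] pr2[of y] ind[of "fst y" "fst (snd y)"] e2 that
    by (simp add: linear_0[OF linear_pr] prod_eq_iff)
  obtain \<kappa> where lin\<kappa>: "linear \<kappa>" and "\<forall>y. \<kappa> (\<psi> y) = y"
    by (rule linear_left_inverse_on_range[OF lin inj])
  then have \<kappa>: "linear \<kappa>" "\<kappa> (\<psi> y) = y" for y by blast+
  have V_range: "V = range \<psi>"
  proof
    have "subspace (range \<psi>)" by (rule linear_subspace_image[OF lin subspace_UNIV])
    moreover have "gr k \<subseteq> range \<psi>" for k
    proof -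
      have "e = \<psi> (1, 0, 0)" "J e = \<psi> (0, 1, 0)" "e2 = \<psi> (0, 0, 1)" by (simp_all add: \<psi>_def)
      then have h: "{e, J e} \<subseteq> range \<psi>" "{e2} \<subseteq> range \<psi>" by blast+
      have "span {e, J e} \<subseteq> range \<psi>" "span {e2} \<subseteq> range \<psi>"
        by (rule span_minimal[OF h(1) \<open>subspace (range \<psi>)\<close>] span_minimal[OF h(2) \<open>subspace (range \<psi>)\<close>])+
      moreover have "{0} \<subseteq> range \<psi>" using subspace_0[OF \<open>subspace (range \<psi>)\<close>] by blast
      ultimately show ?thesis using gr0 gr1 gr2 gr_top[of k] two
        by (cases "k = 0"; cases "k = 1"; cases "k = 2") auto
    qed
    ultimately show "V \<subseteq> range \<psi>" unfolding gnla_carrier_def by (intro span_minimal) blast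
    have "e \<in> V" "J e \<in> V" "e2 \<in> V" using gr1_V[OF e] gr1_V[OF je] central_V[OF e2c] by auto
    then show "range \<psi> \<subseteq> V" using V_closed by (auto simp: \<psi>_def)
  qed
  define c1 where "c1 x = fst (\<kappa> x)" for x
  define c2 where "c2 x = fst (snd (\<kappa> x))" for x
  define c3 where "c3 x = snd (snd (\<kappa> x))" for x
  have linc: "linear c1" "linear c2" "linear c3"
    using \<kappa>(1) by (auto intro!: linearI simp: c1_def c2_def c3_def linear_add linear_scale)
  have rep: "x = c1 x *\<^sub>R e + c2 x *\<^sub>R J e + c3 x *\<^sub>R e2" if "x \<in> V" for x
    using that \<kappa>(2) unfolding V_range by (auto simp: c1_def c2_def c3_def \<psi>_def)
  have c\<psi>: "c1 (\<psi> y) = fst y" "c2 (\<psi> y) = fst (snd y)" "c3 (\<psi> y) = snd (snd y)" for y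
    by (simp_all add: \<kappa>(2) c1_def c2_def c3_def)
  have ce: "c1 (a *\<^sub>R e + b *\<^sub>R J e + c *\<^sub>R e2) = a" "c2 (a *\<^sub>R e + b *\<^sub>R J e + c *\<^sub>R e2) = b"
    "c3 (a *\<^sub>R e + b *\<^sub>R J e + c *\<^sub>R e2) = c" for a b c
    using c\<psi>[of "(a, b, c)"] by (simp_all add: \<psi>_def)
  have c_gr1: "u = c1 u *\<^sub>R e + c2 u *\<^sub>R J e" "c3 u = 0" if u: "u \<in> gr 1" for u
  proof -
    have "u \<in> span {e, J e}" using u gr1 by simp
    then obtain a b where "u = a *\<^sub>R e + b *\<^sub>R J e" by (auto simp: span_insert span_singleton algebra_simps)
    then show "u = c1 u *\<^sub>R e + c2 u *\<^sub>R J e" "c3 u = 0" using ce[of a b 0] by simp_all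
  qed
  have cJ: "c1 (J u) = - c2 u" "c2 (J u) = c1 u" if "u \<in> gr 1" for u
  proof -
    have "J u = J (c1 u *\<^sub>R e + c2 u *\<^sub>R J e)" using c_gr1(1)[OF that] by simp
    also have "\<dots> = (- c2 u) *\<^sub>R e + c1 u *\<^sub>R J e + 0 *\<^sub>R e2"
      using J_J[OF e] by (simp add: linear_add[OF linear_J] linear_scale[OF linear_J])
    finally show "c1 (J u) = - c2 u" "c2 (J u) = c1 u" using ce[of "- c2 u" "c1 u" 0] by simp_all
  qed
  have br_e: "br x u = (c1 x * c2 u - c2 x * c1 u) *\<^sub>R e2" if "x \<in> V" "u \<in> gr 1" for x u
  proof -
    have eV: "e \<in> V" "J e \<in> V" using gr1_V[OF e] gr1_V[OF je] .
    have "br x u = br (c1 x *\<^sub>R e + c2 x *\<^sub>R J e + c3 x *\<^sub>R e2) (c1 u *\<^sub>R e + c2 u *\<^sub>R J e)"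
      using rep[OF that(1)] c_gr1(1)[OF that(2)] by simp
    also have "\<dots> = (c1 x * c2 u - c2 x * c1 u) *\<^sub>R e2"
      using br_self[OF eV(1)] br_self[OF eV(2)] br_anti[OF eV(2,1)] central_br(1)[OF e2c eV(1)] central_br(1)[OF e2c eV(2)]
      by (simp add: bilinear_ladd[OF bil] bilinear_radd[OF bil] bilinear_lmul[OF bil] bilinear_rmul[OF bil]
          e2_def algebra_simps)
    finally show ?thesis .
  qed
  have Lam_e: "Lam x u = u + ((c1 x * c2 u - c2 x * c1 u) / 2) *\<^sub>R e2" if "x \<in> V" "u \<in> gr 1" for x u
  proof -
    have "br x (br x u) = 0"
      unfolding br_e[OF that] using central_br(2)[OF central_scale[OF e2c] that(1)] .
    from Lam_two_step[OF that(1) gr1_V[OF that(2)] this] show ?thesis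
      unfolding br_e[OF that] by simp
  qed
  \<comment> \<open>By \<open>Lam_e\<close> the \<open>e2\<close> part of \<open>Lam x u\<close>
    carries 1/2, so the factor -4 contributes -2 times the alternating form of \<open>x\<close> and
    \<open>u\<close> to the real part of the second component. With the derivative of the squared
    modulus as imaginary part this is 2i times the conjugate of \<open>?z x\<close> times
    \<open>?z u\<close>, complex linear in \<open>u\<close>.\<close>
  define \<L> :: "'a \<Rightarrow> complex ^ 2" where
    "\<L> x = c1 x *\<^sub>R axis 1 1 + c2 x *\<^sub>R axis 1 \<i> + (- 4 * c3 x) *\<^sub>R axis 2 1" for x
  have linL: "linear \<L>"
    by (rule linearI) (simp_all add: \<L>_def linear_add[OF linc(1)] linear_add[OF linc(2)] linear_add[OF linc(3)]
        linear_scale[OF linc(1)] linear_scale[OF linc(2)] linear_scale[OF linc(3)] algebra_simps)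
  define f where "f x = \<L> x + (c1 x * c1 x + c2 x * c2 x) *\<^sub>R axis 2 \<i>" for x
  define g where "g p = \<psi> (Re (p $ 1), Im (p $ 1), - Re (p $ 2) / 4)" for p :: "complex ^ 2"
  have f12: "f x $ 1 = Complex (c1 x) (c2 x)" "f x $ 2 = Complex (- 4 * c3 x) (c1 x * c1 x + c2 x * c2 x)" for x
    by (simp_all add: f_def \<L>_def axis_def complex_eq_iff)
  have fQ: "f x \<in> quadric" for x by (simp add: f12 cmod_sq)
  have gf: "g (f x) = x" if "x \<in> V" for x
  proof -
    have "g (f x) = \<psi> (c1 x, c2 x, c3 x)" by (simp add: g_def f12)
    then show ?thesis using rep[OF that] by (simp add: \<psi>_def)
  qed
  have fg: "f (g p) = p" if "p \<in> quadric" for p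
  proof -
    have p2: "Im (p $ 2) = Re (p $ 1) * Re (p $ 1) + Im (p $ 1) * Im (p $ 1)"
      using that by (simp add: cmod_sq)
    have "f (g p) $ 1 = p $ 1" "f (g p) $ 2 = p $ 2"
      by (simp_all add: f12 g_def c\<psi> p2 complex_eq_iff)
    then show ?thesis by (simp add: vec_eq_iff forall_2)
  qed
  have img: "f ` V = quadric"
  proof
    show "quadric \<subseteq> f ` V"
    proof
      fix p assume "p \<in> quadric"
      from fg[OF this] show "p \<in> f ` V" unfolding V_range g_def by (metis rangeI imageI)
    qed
  qed (use fQ in blast)
  have smf: "smooth_on V f"
    unfolding f_def by (intro smooth_on_add smooth_on_linear linL linc smooth_on_const
        smooth_on_bilinear[OF bounded_bilinear_scaleR] smooth_on_bilinear[OF bounded_bilinear_mult])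
  have "linear g" unfolding g_def[abs_def]
  proof (rule linearI)
    show "\<psi> (Re ((p + q) $ 1), Im ((p + q) $ 1), - Re ((p + q) $ 2) / 4) =
        \<psi> (Re (p $ 1), Im (p $ 1), - Re (p $ 2) / 4) + \<psi> (Re (q $ 1), Im (q $ 1), - Re (q $ 2) / 4)" for p q
      by (simp add: \<psi>_def algebra_simps diff_divide_distrib add_divide_distrib)
    show "\<psi> (Re ((k *\<^sub>R p) $ 1), Im ((k *\<^sub>R p) $ 1), - Re ((k *\<^sub>R p) $ 2) / 4) =
        k *\<^sub>R \<psi> (Re (p $ 1), Im (p $ 1), - Re (p $ 2) / 4)" for k p
      by (simp add: \<psi>_def algebra_simps)
  qed
  then have smg: "smooth_on quadric g" by (rule smooth_on_linear)
  interpret d: local_diffeo V quadric V quadric f g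
    by unfold_locales (auto simp: img gf smf smg)
  have Tq: "tangent_closed quadric"
    by (rule tangent_closed_transport[OF tangent_closed_subspace[OF subV]]) (use d.sym in blast)
  have df: "differential V f x v = \<L> v + (2 * (c1 x * c1 v + c2 x * c2 v)) *\<^sub>R axis 2 \<i>"
    if "x \<in> V" "v \<in> V" for x v
  proof -
    have "(f has_derivative (\<lambda>v. \<L> v + ((c1 x * c1 v + c1 v * c1 x) + (c2 x * c2 v + c2 v * c2 x)) *\<^sub>R axis 2 \<i>)) (at x within V)"
      unfolding f_def[abs_def]
      by (intro has_derivative_add has_derivative_scaleR_left has_derivative_mult linear_imp_has_derivative linL linc)
    from differential_eqI[OF this] show ?thesis using that tangent_V by (simp add: algebra_simps)
  qed
  let ?z = "\<lambda>x. Complex (c1 x) (c2 x)"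
  have dfL: "differential V f x (Lam x u) $ 1 = ?z u" "differential V f x (Lam x u) $ 2 = 2 * \<i> * cnj (?z x) * ?z u"
    if "x \<in> V" "u \<in> gr 1" for x u
  proof -
    have "Lam x u = c1 u *\<^sub>R e + c2 u *\<^sub>R J e + ((c1 x * c2 u - c2 x * c1 u) / 2) *\<^sub>R e2"
      using Lam_e[OF that] c_gr1(1)[OF that(2)] by simp
    then have "c1 (Lam x u) = c1 u" "c2 (Lam x u) = c2 u" "c3 (Lam x u) = (c1 x * c2 u - c2 x * c1 u) / 2"
      using ce by simp_all
    then show "differential V f x (Lam x u) $ 1 = ?z u" "differential V f x (Lam x u) $ 2 = 2 * \<i> * cnj (?z x) * ?z u"
      unfolding df[OF that(1) Lam_V] by (simp_all add: \<L>_def axis_def complex_eq_iff algebra_simps)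
  qed
  have dfJ: "differential V f x (Lam x (J u)) = \<i> *s differential V f x (Lam x u)" if "x \<in> V" "u \<in> gr 1" for x u
  proof -
    have "?z (J u) = \<i> * ?z u" using cJ[OF that(2)] by (simp add: complex_eq_iff)
    then show ?thesis using dfL[OF that] dfL[OF that(1) J_gr1[OF that(2)]]
      by (simp add: vec_eq_iff forall_2 algebra_simps)
  qed
  have dt: "differential V f x (Lam x u) \<in> tangent_space quadric (f x)" if "x \<in> V" for x u
    using d.df_tangent[OF that] tangent_V[OF that] Lam_V by simp
  have "cr_iso X cr_quadric V quadric f g"
  proof (rule cr_iso.intro)
    show "local_diffeo (points X) (points cr_quadric) V quadric f g"
      unfolding points_X points_quadric by (rule d.local_diffeo_axioms)
    show "cr_iso_axioms X cr_quadric V f"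
    proof
      show "cr_regular X" "cr_regular cr_quadric" by (rule regular cr_regular_quadric[OF Tq])+
      fix x assume x: "x \<in> V"
      show "differential (points X) f x ` distr X x = distr cr_quadric (f x)"
        unfolding points_X distr_Lam[OF x]
      proof
        show "differential V f x ` Lam x ` gr 1 \<subseteq> distr cr_quadric (f x)"
          using dt[OF x] dfJ[OF x] by (auto simp: distr_quadric dfJ[OF x, symmetric])
        show "distr cr_quadric (f x) \<subseteq> differential V f x ` Lam x ` gr 1"
        proof
          fix v assume "v \<in> distr cr_quadric (f x)"
          then have v: "v \<in> tangent_space quadric (f x)" "\<i> *s v \<in> tangent_space quadric (f x)"
            by (auto simp: distr_quadric)
          \<comment> \<open>The candidate is read off from the first component; tangency of
            \<open>v\<close> and of \<open>\<i> *s v\<close> then forces the second components to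
            agree.\<close>
          define u where "u = Re (v $ 1) *\<^sub>R e + Im (v $ 1) *\<^sub>R J e"
          have u: "u \<in> gr 1" unfolding u_def using e je sub_gr by (intro subspace_add subspace_scale)
          have zu: "?z u = v $ 1" using ce[of "Re (v $ 1)" "Im (v $ 1)" 0] by (simp add: u_def complex_eq_iff)
          have "differential V f x (Lam x u) $ 2 = v $ 2"
            unfolding dfL(2)[OF x u] zu
            using quadric_tangent[OF v(1)] quadric_tangent[OF v(2)] f12(1)[of x]
            by (simp add: complex_eq_iff algebra_simps)
          then have "differential V f x (Lam x u) = v"
            using dfL(1)[OF x u] zu by (simp add: vec_eq_iff forall_2)
          then show "v \<in> differential V f x ` Lam x ` gr 1" using u by blast
        qed
      qed
      fix v assume "v \<in> distr X x"
      then obtain u where u: "u \<in> gr 1" "v = Lam x u" using distr_Lam[OF x] by blast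
      show "differential (points X) f x (cplx X x v) = cplx cr_quadric (f x) (differential (points X) f x v)"
        unfolding points_X u(2) cplx_Lam[OF x u(1)] cplx_quadric by (rule dfJ[OF x u(1)])
    qed
  qed
  then show ?thesis by (rule that)
qed

text \<open>Constancy of ranks and smooth frames are not computed on the quadric; they are inherited
  from a standard model of depth two through \<open>quadric_iso\<close>.\<close>

lemma (in std_model) cr_manifold_quadric:
  assumes "\<nu> = 2" shows "cr_manifold cr_quadric"
proof -
  obtain f g where i: "cr_iso X cr_quadric V quadric f g" using quadric_iso[OF assms] .
  interpret cr_iso X cr_quadric V quadric f g by (rule i)
  show ?thesis
  proof (rule cr_manifold_transport[OF cr_manifold regY])
    show "embedded_submanifold (dim {p::complex ^ 2. Im (p $ 2) = 0}) (points cr_quadric)"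
      unfolding points_quadric by (rule embedded_submanifold_quadric)
    show "cplx cr_quadric x (cplx cr_quadric x v) = - v" for x v
      by (simp add: cplx_quadric vec_eq_iff)
    show "cplx cr_quadric x (a *\<^sub>R v + b *\<^sub>R w) = a *\<^sub>R cplx cr_quadric x v + b *\<^sub>R cplx cr_quadric x w" for x v w a b
      unfolding cplx_quadric by (simp add: linear_add[OF linear_ivec] linear_scale[OF linear_ivec])
    show "\<exists>p U V f g. cr_iso X cr_quadric U V f g \<and> p \<in> U \<and> f p = q" if "q \<in> points cr_quadric" for q
    proof -
      have "q \<in> f ` V" using that unfolding points_quadric image .
      then obtain p where "p \<in> V" "f p = q" by (elim imageE) simp
      then show ?thesis
        using i by (intro exI[of _ p] exI[of _ V] exI[of _ quadric] exI[of _ f] exI[of _ g] conjI)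
    qed
  qed
qed

section \<open>Standard models of depth three\<close>

lemma (in cr_iso) locally_cr_equivalent:
  assumes "U = points X" "V = points Y" shows "locally_cr_equivalent X Y"
proof (rule locally_cr_equivalentI)
  show "\<exists>q\<in>points Y. cr_equivalence_at X Y p q" if "p \<in> points X" for p
    using cr_equivalence_at[of p] fV[of p] that assms by blast
  show "\<exists>p\<in>points X. cr_equivalence_at X Y p q" if "q \<in> points Y" for q
  proof -
    have "q \<in> f ` U" using that assms image by simp
    then obtain p where "p \<in> U" "q = f p" by (elim imageE)
    then show ?thesis using cr_equivalence_at assms(1) by blast
  qed
qed

section \<open>Realising models and their quotients in a prescribed Euclidean space\<close>

lemma subspace_embedding:
  fixes S :: "'a::euclidean_space set"
  assumes "subspace S" "dim S \<le> DIM('b::euclidean_space)"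
  obtains f :: "'a \<Rightarrow> 'b::euclidean_space" and g where "linear f" "linear g" "\<forall>x\<in>S. g (f x) = x" "\<forall>y. g y \<in> S"
proof -
  obtain T :: "'b set" where T: "subspace T" "dim T = dim S"
    using choose_subspace_of_subspace[of "dim S" "UNIV :: 'b set"] assms(2) by auto
  obtain f :: "'a \<Rightarrow> 'b" and g where fg: "linear f" "linear g" "f ` S = T" "g ` T = S" "\<And>x. x \<in> S \<Longrightarrow> g (f x) = x"
    using isometries_subspaces[OF assms(1) T(1) T(2)[symmetric]] by metis
  obtain Q :: "'b \<Rightarrow> 'b" where Q: "linear Q" "\<And>y. Q y \<in> T" "\<And>y. y \<in> T \<Longrightarrow> Q y = y"
    using linear_projection[OF T(1)] by blast
  show ?thesis
  proof (rule that[of f "g \<circ> Q"])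
    show "linear f" "linear (g \<circ> Q)" using fg(1) linear_compose[OF Q(1) fg(2)] .
    show "\<forall>x\<in>S. (g \<circ> Q) (f x) = x" using Q(3) fg(3,5) by auto
    show "\<forall>y. (g \<circ> Q) y \<in> S" using Q(2) fg(4) by auto
  qed
qed

context std_model
begin

text \<open>A truncation with \<open>i = \<nu>\<close> is an isomorphic copy of the model, here
  inside another Euclidean space of sufficient dimension.\<close>

lemma embedding_exists:
  assumes "dim V \<le> DIM('b::euclidean_space)"
  shows "\<exists>(\<phi> :: 'a \<Rightarrow> 'b::euclidean_space) \<psi>. truncation gr br \<nu> mul J X \<phi> \<psi> \<nu>"
proof -
  obtain \<phi> :: "'a \<Rightarrow> 'b" and \<psi> where h: "linear \<phi>" "linear \<psi>" "\<forall>x\<in>V. \<psi> (\<phi> x) = x" "\<forall>y. \<psi> y \<in> V"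
    using subspace_embedding[OF subV assms] by blast
  have "truncation gr br \<nu> mul J X \<phi> \<psi> \<nu>"
  proof (intro truncation.intro truncation_axioms.intro)
    show "std_model gr br \<nu> mul J X" by (rule std_model_axioms)
    show "linear \<phi>" "linear \<psi>" by (rule h)+
    show "\<psi> (\<phi> x) = x" if "x \<in> Fil \<nu>" for x using h(3) that Fil_V by blast
    show "\<psi> y \<in> Fil \<nu>" for y using h(4) Fil_top[of \<nu>] by simp
    show "\<phi> x = 0" if "\<nu> < k" "x \<in> gr k" for k x using gr_top[OF that(1)] that(2) linear_0[OF h(1)] by simp
  qed (use depth_pos in auto)
  then show ?thesis by blast
qed

text \<open>The map first removes the degree \<nu> part and then embeds \<open>Fil i\<close>
  linearly, so the target needs room for \<open>Fil i\<close> only and not for the whole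
  algebra.\<close>

lemma reduction_exists:
  assumes "\<nu> = Suc i" "1 \<le> i" "dim (Fil i) \<le> DIM('b::euclidean_space)"
  shows "\<exists>(\<phi> :: 'a \<Rightarrow> 'b::euclidean_space) \<psi>. reduction gr br \<nu> mul J X \<phi> \<psi> i"
proof -
  obtain f :: "'a \<Rightarrow> 'b" and \<psi> where h: "linear f" "linear \<psi>" "\<forall>x\<in>Fil i. \<psi> (f x) = x" "\<forall>y. \<psi> y \<in> Fil i"
    using subspace_embedding[OF sub_Fil assms(3)] by blast
  define \<phi> where "\<phi> x = f (P x - pr \<nu> (P x))" for x
  have "linear (\<lambda>x. P x - pr \<nu> (P x))"
    using linear_compose_sub[OF P(1) linear_compose[OF P(1) linear_pr]] by (simp add: o_def)
  then have lin: "linear \<phi>" using linear_compose[OF _ h(1)] by (simp add: \<phi>_def[abs_def] o_def)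
  have "reduction gr br \<nu> mul J X \<phi> \<psi> i"
  proof (intro reduction.intro truncation.intro truncation_axioms.intro reduction_axioms.intro)
    show "std_model gr br \<nu> mul J X" by (rule std_model_axioms)
    show "linear \<phi>" "linear \<psi>" by (rule lin h(2))+
    show "\<psi> (\<phi> x) = x" if "x \<in> Fil i" for x
    proof -
      have "P x = x" using that Fil_V P(3) by blast
      moreover have "pr \<nu> x = 0" using pr_Fil[OF that] assms(1) by simp
      ultimately show ?thesis using h(3) that by (simp add: \<phi>_def)
    qed
    show "\<psi> y \<in> Fil i" for y using h(4) by blast
    show "\<phi> x = 0" if "i < k" "x \<in> gr k" for k x
    proof (cases "k = \<nu>")
      case True
      then have "P x = x" "pr \<nu> x = x" using that(2) grV P(3) pr_gr[OF that(2)] by auto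
      then show ?thesis using linear_0[OF h(1)] by (simp add: \<phi>_def)
    next
      case False
      then have "x = 0" using gr_top[of k] that assms(1) by simp
      then show ?thesis using linear_0[OF lin] by simp
    qed
  qed (use assms in auto)
  then show ?thesis by blast
qed

text \<open>Moves the model to a prescribed algebra. Here \<open>\<psi>\<close> identifies
  \<open>gr2\<close> with \<open>gr\<close>, and the truncation with \<open>i = \<nu>\<close> along
  a left inverse of \<open>\<psi>\<close> returns exactly \<open>gr2\<close> and \<open>br2\<close>;
  the complex structure \<open>J2\<close> is whatever corresponds to \<open>J\<close>.\<close>

lemma isomorphic_model:
  fixes gr2 :: "nat \<Rightarrow> 'b::euclidean_space set"
  assumes lin: "linear \<psi>" and inj: "\<And>y. \<psi> y = 0 \<Longrightarrow> y = 0" and im: "\<And>y. \<psi> y \<in> V"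
    and gr2: "\<And>k. gr k = \<psi> ` gr2 k" and br2: "\<And>x y. br (\<psi> x) (\<psi> y) = \<psi> (br2 x y)"
  shows "\<exists>J2 E. standard_model gr2 br2 J2 E \<and> locally_cr_equivalent X E"
proof -
  obtain \<phi> where lin\<phi>: "linear \<phi>" and \<phi>: "\<forall>y. \<phi> (\<psi> y) = y"
    by (rule linear_left_inverse_on_range[OF lin inj])
  have "(\<Union>k. gr k) \<subseteq> range \<psi>" using gr2 by blast
  then have V: "V \<subseteq> range \<psi>"
    unfolding gnla_carrier_def by (rule span_minimal) (rule linear_subspace_image[OF lin subspace_UNIV])
  interpret truncation gr br \<nu> mul J X \<phi> \<psi> \<nu>
  proof (intro truncation.intro truncation_axioms.intro)
    show "std_model gr br \<nu> mul J X" by (rule std_model_axioms)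
    show "linear \<phi>" "linear \<psi>" by (rule lin\<phi> lin)+
    show "\<psi> (\<phi> x) = x" if "x \<in> Fil \<nu>" for x
    proof -
      have "x \<in> range \<psi>" using that Fil_V V by blast
      then show ?thesis using \<phi> by auto
    qed
    show "\<psi> y \<in> Fil \<nu>" for y using im Fil_top[of \<nu>] by simp
    show "\<phi> x = 0" if "\<nu> < k" "x \<in> gr k" for k x using gr_top[OF that(1)] that(2) linear_0[OF lin\<phi>] by simp
  qed (use depth_pos in auto)
  have "gr' = gr2" unfolding gr'_def[abs_def] gr2 image_image using \<phi> by simp
  moreover have "br' = br2" unfolding br'_def[abs_def] br2 using \<phi> by simp
  moreover have "locally_cr_equivalent X X'"
    by (rule cr_iso.locally_cr_equivalent[OF iso[OF refl]]) (simp_all add: points_X t.points_X)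
  ultimately show ?thesis using t.standard_model by metis
qed

lemma gr3_span:
  assumes "gr 1 = span {a, b}" "gr 2 = span {e}" shows "gr 3 = span {br a e, br b e}"
proof -
  have ab: "a \<in> gr 1" "b \<in> gr 1" "e \<in> gr 2" using assms by (auto simp: span_base)
  have "{br x y | x y. x \<in> gr 1 \<and> y \<in> gr 2} \<subseteq> span {br a e, br b e}"
  proof
    fix z assume "z \<in> {br x y | x y. x \<in> gr 1 \<and> y \<in> gr 2}"
    then obtain x y where z: "z = br x y" "x \<in> span {a, b}" "y \<in> span {e}" using assms by blast
    have "br x y \<in> span {br a e, br b e}"
      by (rule bilinear_span_mem[OF bil subspace_span _ z(2,3)]) (auto intro: span_base)
    then show "z \<in> span {br a e, br b e}" using z(1) by simp
  qed
  then have "span {br x y | x y. x \<in> gr 1 \<and> y \<in> gr 2} \<subseteq> span {br a e, br b e}"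
    by (rule span_minimal) simp
  moreover have "{br a e, br b e} \<subseteq> span {br x y | x y. x \<in> gr 1 \<and> y \<in> gr 2}"
    using ab by (auto intro!: span_base)
  then have "span {br a e, br b e} \<subseteq> span {br x y | x y. x \<in> gr 1 \<and> y \<in> gr 2}" by (rule span_minimal) simp
  moreover have "gr 3 = span {br x y | x y. x \<in> gr 1 \<and> y \<in> gr 2}"
    using generated_step[OF generated, of 2] by (simp add: numeral_3_eq_3 numeral_2_eq_2)
  ultimately show ?thesis by blast
qed

lemma br_eq_0: "x \<in> gr i \<Longrightarrow> y \<in> gr j \<Longrightarrow> i + j > \<nu> \<Longrightarrow> br x y = 0"
  using br_gr[of x i y j] gr_top[of "i + j"] by simp

lemma br_anti_gr: "x \<in> gr i \<Longrightarrow> y \<in> gr j \<Longrightarrow> br x y = - br y x"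
  using br_anti grV by blast

end

lemma dim_span_singleton: "a \<noteq> 0 \<Longrightarrow> dim (span {a}) = 1" for a :: "'a::euclidean_space"
  using dim_eq_card_independent[of "{a}"] by simp

lemma dim_indep_pair:
  fixes a b :: "'a::euclidean_space"
  assumes "\<And>s t. s *\<^sub>R a + t *\<^sub>R b = 0 \<Longrightarrow> s = 0 \<and> t = 0"
  shows "dim (span {a, b}) = 2"
  using dim_eq_card_independent[OF independent_pair(1)[of a b, OF assms]] independent_pair(2)[of a b, OF assms] by simp

lemma image_span_pair: "linear \<psi> \<Longrightarrow> \<psi> ` span {a, b} = span {\<psi> a, \<psi> b}"
  by (simp add: linear_span_image[symmetric])

lemma image_span_single: "linear \<psi> \<Longrightarrow> \<psi> ` span {a} = span {\<psi> a}"
  by (simp add: linear_span_image[symmetric])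

lemma exhaust_5: fixes i :: 5 shows "i \<in> {1, 2, 3, 4, 5}"
proof (induct i)
  case (of_int z)
  then have "0 \<le> z" "z < 5" by simp_all
  then have "z = 0 \<or> z = 1 \<or> z = 2 \<or> z = 3 \<or> z = 4" by arith
  then show ?case by auto
qed

lemma (in std_model) hilbert_cartan_case:
  assumes nu: "\<nu> = 3" and gr1: "gr 1 = span {a, b}" and gr2: "gr 2 = span {e}" and e: "e = br a b" "e \<noteq> 0"
    and ind1: "\<And>s t. s *\<^sub>R a + t *\<^sub>R b = 0 \<Longrightarrow> s = 0 \<and> t = 0"
    and ind3: "\<And>s t. s *\<^sub>R br a e + t *\<^sub>R br b e = 0 \<Longrightarrow> s = 0 \<and> t = 0"
  shows "\<exists>H. hilbert_cartan_cr H \<and> locally_cr_equivalent X H"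
proof -
  let ?f = "br a e" and ?g = "br b e"
  have gr3: "gr 3 = span {?f, ?g}" by (rule gr3_span[OF gr1 gr2])
  have m: "a \<in> gr 1" "b \<in> gr 1" "e \<in> gr 2" "?f \<in> gr 3" "?g \<in> gr 3"
    using gr1 gr2 gr3 by (auto simp: span_base)
  have mV: "a \<in> V" "b \<in> V" "e \<in> V" "?f \<in> V" "?g \<in> V" using m grV by blast+
  define \<psi> where "\<psi> y = y $ 1 *\<^sub>R a + y $ 2 *\<^sub>R b + y $ 3 *\<^sub>R e + y $ 4 *\<^sub>R ?f + y $ 5 *\<^sub>R ?g" for y :: "real ^ 5"
  have lin: "linear \<psi>" by (rule linearI) (simp_all add: \<psi>_def algebra_simps)
  have "\<exists>J2 E. standard_model hilbert_cartan_grading hilbert_cartan_bracket J2 E \<and> locally_cr_equivalent X E"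
  proof (rule isomorphic_model[OF lin])
    show "y = 0" if y: "\<psi> y = 0" for y
    proof -
      note pra = pr_gr[OF m(1)] pr_gr[OF m(2)] pr_gr[OF m(3)] pr_gr[OF m(4)] pr_gr[OF m(5)]
      have "pr 1 (\<psi> y) = y $ 1 *\<^sub>R a + y $ 2 *\<^sub>R b" "pr 2 (\<psi> y) = y $ 3 *\<^sub>R e"
        "pr 3 (\<psi> y) = y $ 4 *\<^sub>R ?f + y $ 5 *\<^sub>R ?g"
        unfolding \<psi>_def linear_add[OF linear_pr] linear_scale[OF linear_pr] pra by simp_all
      then have "y $ 1 = 0 \<and> y $ 2 = 0" "y $ 3 = 0" "y $ 4 = 0 \<and> y $ 5 = 0"
        using ind1[of "y $ 1" "y $ 2"] ind3[of "y $ 4" "y $ 5"] e(2) y linear_0[OF linear_pr] by auto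
      then have "y $ i = 0" for i using exhaust_5[of i] by auto
      then show ?thesis by (simp add: vec_eq_iff)
    qed
    show "\<psi> y \<in> V" for y using mV V_closed by (simp add: \<psi>_def)
    have ax: "\<psi> (axis 1 1) = a" "\<psi> (axis 2 1) = b" "\<psi> (axis 3 1) = e" "\<psi> (axis 4 1) = ?f" "\<psi> (axis 5 1) = ?g"
      by (simp_all add: \<psi>_def axis_def)
    show "gr k = \<psi> ` hilbert_cartan_grading k" for k
    proof -
      consider "k = 0" | "k = 1" | "k = 2" | "k = 3" | "k > 3" by linarith
      then show ?thesis
        using gr1 gr2 gr3 gr0 gr_top[of k] nu linear_0[OF lin]
        by cases (simp_all add: hilbert_cartan_grading_def image_span_pair[OF lin] image_span_single[OF lin] ax)
    qed
    \<comment> \<open>Brackets of total degree above 3 vanish; \<open>t\<close> below treats the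
      remaining ones.\<close>
    note z = br_eq_0[OF m(1) m(4)] br_eq_0[OF m(1) m(5)] br_eq_0[OF m(2) m(4)] br_eq_0[OF m(2) m(5)]
      br_eq_0[OF m(3) m(3)] br_eq_0[OF m(3) m(4)] br_eq_0[OF m(3) m(5)] br_eq_0[OF m(4) m(1)] br_eq_0[OF m(4) m(2)]
      br_eq_0[OF m(4) m(3)] br_eq_0[OF m(4) m(4)] br_eq_0[OF m(4) m(5)] br_eq_0[OF m(5) m(1)] br_eq_0[OF m(5) m(2)]
      br_eq_0[OF m(5) m(3)] br_eq_0[OF m(5) m(4)] br_eq_0[OF m(5) m(5)]
    have t: "br a a = 0" "br b b = 0" "br a b = e" "br b a = - e" "br e a = - ?f" "br e b = - ?g"
      using br_self mV e(1) br_anti_gr[OF m(2,1)] br_anti_gr[OF m(3,1)] br_anti_gr[OF m(3,2)] by auto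
    show "br (\<psi> x) (\<psi> y) = \<psi> (hilbert_cartan_bracket x y)" for x y
    proof -
      have "\<psi> (hilbert_cartan_bracket x y) = (x $ 1 * y $ 2 - x $ 2 * y $ 1) *\<^sub>R e +
        (x $ 1 * y $ 3 - x $ 3 * y $ 1) *\<^sub>R ?f + (x $ 2 * y $ 3 - x $ 3 * y $ 2) *\<^sub>R ?g"
        unfolding hilbert_cartan_bracket_def linear_add[OF lin] linear_scale[OF lin] ax ..
      moreover have "br (\<psi> x) (\<psi> y) = (x $ 1 * y $ 2 - x $ 2 * y $ 1) *\<^sub>R e +
        (x $ 1 * y $ 3 - x $ 3 * y $ 1) *\<^sub>R ?f + (x $ 2 * y $ 3 - x $ 3 * y $ 2) *\<^sub>R ?g"
        unfolding \<psi>_def bilinear_ladd[OF bil] bilinear_radd[OF bil] bilinear_lmul[OF bil] bilinear_rmul[OF bil]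
        using z nu by (simp add: t algebra_simps)
      ultimately show ?thesis by simp
    qed
  qed
  then show ?thesis unfolding hilbert_cartan_cr_def by blast
qed

text \<open>The vector \<open>b\<close> spans the kernel of the bracket of \<open>gr 1\<close> with
  \<open>e\<close>, matching the second basis vector of the Engel algebra.\<close>

lemma (in std_model) engel_case:
  assumes nu: "\<nu> = 3" and gr1: "gr 1 = span {a, b}" and gr2: "gr 2 = span {e}" and e: "e = br a b" "e \<noteq> 0"
    and ind1: "\<And>s t. s *\<^sub>R a + t *\<^sub>R b = 0 \<Longrightarrow> s = 0 \<and> t = 0"
    and be: "br b e = 0" and f: "br a e \<noteq> 0"
  shows "\<exists>E. engel_cr E \<and> locally_cr_equivalent X E"
proof -
  let ?f = "br a e"
  have gr3: "gr 3 = span {?f}"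
    using gr3_span[OF gr1 gr2] be span_insert_0[of "{?f}"] by (simp add: insert_commute)
  have m: "a \<in> gr 1" "b \<in> gr 1" "e \<in> gr 2" "?f \<in> gr 3"
    using gr1 gr2 gr3 by (auto simp: span_base)
  have mV: "a \<in> V" "b \<in> V" "e \<in> V" "?f \<in> V" using m grV by blast+
  define \<psi> where "\<psi> y = y $ 1 *\<^sub>R a + y $ 2 *\<^sub>R b + y $ 3 *\<^sub>R e + y $ 4 *\<^sub>R ?f" for y :: "real ^ 4"
  have lin: "linear \<psi>" by (rule linearI) (simp_all add: \<psi>_def algebra_simps)
  have "\<exists>J2 E. standard_model engel_grading engel_bracket J2 E \<and> locally_cr_equivalent X E"
  proof (rule isomorphic_model[OF lin])
    show "y = 0" if y: "\<psi> y = 0" for y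
    proof -
      note pra = pr_gr[OF m(1)] pr_gr[OF m(2)] pr_gr[OF m(3)] pr_gr[OF m(4)]
      have "pr 1 (\<psi> y) = y $ 1 *\<^sub>R a + y $ 2 *\<^sub>R b" "pr 2 (\<psi> y) = y $ 3 *\<^sub>R e"
        "pr 3 (\<psi> y) = y $ 4 *\<^sub>R ?f"
        unfolding \<psi>_def linear_add[OF linear_pr] linear_scale[OF linear_pr] pra by simp_all
      then have "y $ 1 = 0 \<and> y $ 2 = 0" "y $ 3 = 0" "y $ 4 = 0"
        using ind1[of "y $ 1" "y $ 2"] f e(2) y linear_0[OF linear_pr] by auto
      then show ?thesis by (simp add: vec_eq_iff forall_4)
    qed
    show "\<psi> y \<in> V" for y using mV V_closed by (simp add: \<psi>_def)
    have ax: "\<psi> (axis 1 1) = a" "\<psi> (axis 2 1) = b" "\<psi> (axis 3 1) = e" "\<psi> (axis 4 1) = ?f"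
      by (simp_all add: \<psi>_def axis_def)
    show "gr k = \<psi> ` engel_grading k" for k
    proof -
      consider "k = 0" | "k = 1" | "k = 2" | "k = 3" | "k > 3" by linarith
      then show ?thesis
        using gr1 gr2 gr3 gr0 gr_top[of k] nu linear_0[OF lin]
        by cases (simp_all add: engel_grading_def image_span_pair[OF lin] image_span_single[OF lin] ax)
    qed
    note z = br_eq_0[OF m(1) m(4)] br_eq_0[OF m(2) m(4)]
      br_eq_0[OF m(3) m(3)] br_eq_0[OF m(3) m(4)] br_eq_0[OF m(4) m(1)] br_eq_0[OF m(4) m(2)]
      br_eq_0[OF m(4) m(3)] br_eq_0[OF m(4) m(4)]
    have t: "br a a = 0" "br b b = 0" "br a b = e" "br b a = - e" "br e a = - ?f" "br e b = 0"
      using br_self mV e(1) br_anti_gr[OF m(2,1)] br_anti_gr[OF m(3,1)] br_anti_gr[OF m(3,2)] be by auto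
    show "br (\<psi> x) (\<psi> y) = \<psi> (engel_bracket x y)" for x y
    proof -
      have "\<psi> (engel_bracket x y) = (x $ 1 * y $ 2 - x $ 2 * y $ 1) *\<^sub>R e +
        (x $ 1 * y $ 3 - x $ 3 * y $ 1) *\<^sub>R ?f"
        unfolding engel_bracket_def linear_add[OF lin] linear_scale[OF lin] ax ..
      moreover have "br (\<psi> x) (\<psi> y) = (x $ 1 * y $ 2 - x $ 2 * y $ 1) *\<^sub>R e +
        (x $ 1 * y $ 3 - x $ 3 * y $ 1) *\<^sub>R ?f"
        unfolding \<psi>_def bilinear_ladd[OF bil] bilinear_radd[OF bil] bilinear_lmul[OF bil] bilinear_rmul[OF bil]
        using z nu by (simp add: t be algebra_simps)
      ultimately show ?thesis by simp
    qed
  qed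
  then show ?thesis unfolding engel_cr_def by blast
qed

lemma (in std_model) reduced_growthI:
  assumes "dim (gr 2) = 1" "dim (gr 3) = d" "\<nu> = 3" shows "has_reduced_growth X [2, 1, d]"
  unfolding has_reduced_growth_def points_X
proof (intro ballI allI)
  fix x and k :: nat assume "x \<in> V"
  consider "k = 0" | "k = 1" | "k = 2" | "k > 2" by linarith
  then have "dim (gr (Suc k)) = (if k < length [2, 1, d] then [2, 1, d] ! k else 0)"
    using dim_gr1 assms gr_top[of "Suc k"]
    by cases (simp_all add: numeral_2_eq_2 numeral_3_eq_3)
  then show "dim (weak_flag X (Suc k) x) - dim (weak_flag X k x) =
      (if k < length [2, 1, d] then [2, 1, d] ! k else 0)"
    unfolding growth[OF \<open>x \<in> V\<close>] .
qed

lemma (in std_model) gr12_basis: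
  assumes "\<nu> \<ge> 2"
  obtains a b where "a \<in> gr 1" "b \<in> gr 1" "\<forall>s t. s *\<^sub>R a + t *\<^sub>R b = 0 \<longrightarrow> s = 0 \<and> t = 0"
    "gr 1 = span {a, b}" "gr 2 = span {br a b}" "br a b \<noteq> 0"
proof -
  obtain a where a: "a \<in> gr 1" and ind: "\<And>s t. s *\<^sub>R a + t *\<^sub>R J a = 0 \<Longrightarrow> s = 0 \<and> t = 0"
    using gr1_basis by blast
  have g1: "gr 1 = span {a, J a}" by (rule indep_pair_span[OF sub_gr dim_gr1 a J_gr1[OF a] ind])
  have g2: "gr 2 = span {br a (J a)}" by (rule gr2_span[OF g1])
  have "gr 2 \<noteq> {0}" by (rule gr_nonzero[OF generated]) (use assms in auto)
  then have "br a (J a) \<noteq> 0" unfolding g2 using span_insert_0[of "{}"] by force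
  then show ?thesis using ind by (intro that[OF a J_gr1[OF a] _ g1 g2]) blast
qed

lemma (in std_model) depth_three:
  assumes nu: "\<nu> = 3"
  shows "((\<exists>E. engel_cr E \<and> locally_cr_equivalent X E) \<and> has_reduced_growth X [2, 1, 1]) \<or>
    ((\<exists>H. hilbert_cartan_cr H \<and> locally_cr_equivalent X H) \<and> has_reduced_growth X [2, 1, 2])"
proof -
  have two: "2 \<le> \<nu>" using nu by simp
  obtain a b where ab: "a \<in> gr 1" "b \<in> gr 1" and ind0: "\<forall>s t. s *\<^sub>R a + t *\<^sub>R b = 0 \<longrightarrow> s = 0 \<and> t = 0"
    and g1: "gr 1 = span {a, b}" and g2: "gr 2 = span {br a b}" and e: "br a b \<noteq> 0"
    by (rule gr12_basis[OF two])
  have ind: "s = 0 \<and> t = 0" if "s *\<^sub>R a + t *\<^sub>R b = 0" for s t using ind0 that by blast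
  let ?e = "br a b" and ?f = "br a (br a b)" and ?g = "br b (br a b)"
  have d2: "dim (gr 2) = 1" unfolding g2 by (rule dim_span_singleton[OF e])
  show ?thesis
  proof (cases "\<forall>s t. s *\<^sub>R ?f + t *\<^sub>R ?g = 0 \<longrightarrow> s = 0 \<and> t = 0")
    case True
    then have ind3: "s = 0 \<and> t = 0" if "s *\<^sub>R ?f + t *\<^sub>R ?g = 0" for s t using that by blast
    have "dim (gr 3) = 2" unfolding gr3_span[OF g1 g2] by (rule dim_indep_pair[OF ind3])
    then show ?thesis
      using hilbert_cartan_case[OF nu g1 g2 refl e ind ind3] reduced_growthI[OF d2 _ nu] by blast
  next
    case False
    then obtain s t where st: "s *\<^sub>R ?f + t *\<^sub>R ?g = 0" "s \<noteq> 0 \<or> t \<noteq> 0" by blast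
    \<comment> \<open>The relation \<open>st\<close> says that \<open>y2\<close>, with coefficients
      \<open>s\<close> and \<open>t\<close>, annihilates the bracket of \<open>a\<close> and
      \<open>b\<close>. The vector \<open>y1\<close>, with coefficients \<open>t\<close> and
      \<open>- s\<close>, completes it to a basis; \<open>c\<close> is the determinant of the change
      of basis.\<close>
    define c where "c = t * t + s * s"
    have c: "c \<noteq> 0" using st(2) using sum_squares_eq_zero_iff[of t s] by (auto simp: c_def)
    define y1 where "y1 = t *\<^sub>R a - s *\<^sub>R b"
    define y2 where "y2 = s *\<^sub>R a + t *\<^sub>R b"
    have y: "y1 \<in> gr 1" "y2 \<in> gr 1"
      unfolding y1_def y2_def using ab sub_gr by (auto intro!: subspace_add subspace_diff subspace_scale)
    have ind': "p = 0 \<and> q = 0" if "p *\<^sub>R y1 + q *\<^sub>R y2 = 0" for p q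
    proof -
      have "(p * t + q * s) *\<^sub>R a + (q * t - p * s) *\<^sub>R b = 0"
        using that by (simp add: y1_def y2_def algebra_simps)
      then have h: "p * t + q * s = 0" "q * t - p * s = 0" using ind by blast+
      have pc: "p * c = t * (p * t + q * s) - s * (q * t - p * s)" "q * c = s * (p * t + q * s) + t * (q * t - p * s)"
        by (simp_all add: c_def algebra_simps)
      have "p * c = 0" "q * c = 0" unfolding pc h by simp_all
      then show ?thesis using c by simp
    qed
    have h1: "gr 1 = span {y1, y2}" by (rule indep_pair_span[OF sub_gr dim_gr1 y ind'])
    have e': "br y1 y2 = c *\<^sub>R ?e"
      unfolding y1_def y2_def bilinear_ladd[OF bil] bilinear_radd[OF bil] bilinear_lmul[OF bil]
        bilinear_rmul[OF bil] bilinear_lsub[OF bil]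
      using br_self[OF gr1_V[OF ab(1)]] br_self[OF gr1_V[OF ab(2)]] br_anti_gr[OF ab(2,1)]
      by (simp add: c_def algebra_simps)
    have h2: "gr 2 = span {br y1 y2}" by (rule gr2_span[OF h1])
    have ne: "br y1 y2 \<noteq> 0" using e e' c by simp
    have "br y2 (c *\<^sub>R ?e) = c *\<^sub>R (s *\<^sub>R ?f + t *\<^sub>R ?g)"
      unfolding y2_def bilinear_ladd[OF bil] bilinear_lmul[OF bil] bilinear_rmul[OF bil]
      by (simp add: algebra_simps)
    then have b0: "br y2 (br y1 y2) = 0" unfolding e' using st(1) by simp
    have h3: "gr 3 = span {br y1 (br y1 y2)}"
      using gr3_span[OF h1 h2] b0 span_insert_0[of "{br y1 (br y1 y2)}"] by (simp add: insert_commute)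
    have f0: "br y1 (br y1 y2) \<noteq> 0"
    proof
      assume "br y1 (br y1 y2) = 0"
      then have "gr 3 = {0}" unfolding h3 by simp
      then show False using gr_nu unfolding nu by simp
    qed
    have "dim (gr 3) = 1" unfolding h3 by (rule dim_span_singleton[OF f0])
    moreover have "\<exists>E. engel_cr E \<and> locally_cr_equivalent X E"
      by (rule engel_case[OF nu h1 h2 refl ne ind' b0 f0])
    ultimately show ?thesis using reduced_growthI[OF d2 _ nu] by blast
  qed
qed

text \<open>The quotient of depth two is a standard model; the isomorphism
  \<open>quadric_iso\<close> then replaces it by the quadric, whatever the complex structure on
  \<open>gr 1\<close> is.\<close>

lemma (in std_model) reduction_to_quadric:
  assumes nu: "\<nu> = 3"
  shows "symmetry_reduction X cr_quadric \<and> integrable_extension cr_quadric X"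
proof -
  have two: "2 \<le> \<nu>" using nu by simp
  obtain a b where g2: "gr 2 = span {br a b}" and e: "br a b \<noteq> 0"
    by (rule gr12_basis[OF two], rule that)
  have "dim (Fil 2) = 3"
    using dim_Fil[of 0] dim_Fil[of 1] dim_gr1 dim_span_singleton[OF e] g2
    by (simp add: Fil_0 numeral_2_eq_2)
  \<comment> \<open>The three-dimensional quotient is realised in the real four-dimensional space of
    the quadric, so that both have one type as \<open>horizontal_lift_post\<close> demands.\<close>
  then have "dim (Fil 2) \<le> DIM(complex ^ 2)" by simp
  from reduction_exists[OF _ _ this] nu obtain \<phi> :: "'a \<Rightarrow> complex ^ 2" and \<psi> where
    "reduction gr br \<nu> mul J X \<phi> \<psi> 2" by auto
  then interpret reduction gr br \<nu> mul J X \<phi> \<psi> 2 .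
  obtain f g where "cr_iso X' cr_quadric (gnla_carrier gr') quadric f g" by (rule t.quadric_iso[OF refl])
  then have q: "cr_iso X' cr_quadric (points X') (points cr_quadric) f g"
    by (simp add: t.points_X points_quadric)
  note Q = t.cr_manifold_quadric[OF refl]
  note r = locally_cr_equivalent_refl[OF regular]
  show ?thesis
    using symmetry_reduction_post[OF q Q symmetry_reduction[OF cr_manifold has_depth r]]
      horizontal_lift_post[OF q Q horizontal_lift] r
    unfolding integrable_extension_def by blast
qed

section \<open>The tower of symmetry reductions\<close>

text \<open>The quotient is realised in the same space as the model. The quantification over
  \<open>W\<close> allows the upper level of the step to be any CR manifold locally equivalent to
  the model.\<close>

lemma (in std_model) tower_step:
  assumes nu: "\<nu> = Suc i" and i: "1 \<le> i"
  obtains gr' :: "nat \<Rightarrow> 'a set" and br' J' Y where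
    "standard_model gr' br' J' Y" "gnla_depth gr' i"
    "\<forall>W :: 'a cr. cr_manifold W \<and> has_depth W (Suc i) \<and> locally_cr_equivalent W X \<longrightarrow>
      symmetry_reduction W Y \<and> integrable_extension Y W"
proof -
  have "\<exists>(\<phi> :: 'a \<Rightarrow> 'a) \<psi>. reduction gr br \<nu> mul J X \<phi> \<psi> i"
    by (rule reduction_exists[OF nu i dim_subset_UNIV])
  then obtain \<phi> :: "'a \<Rightarrow> 'a" and \<psi> where r: "reduction gr br \<nu> mul J X \<phi> \<psi> i" by blast
  interpret reduction gr br \<nu> mul J X \<phi> \<psi> i by (rule r)
  show ?thesis
  proof (rule that[OF t.standard_model t.depth])
    show "\<forall>W :: 'a cr. cr_manifold W \<and> has_depth W (Suc i) \<and> locally_cr_equivalent W X \<longrightarrow>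
      symmetry_reduction W X' \<and> integrable_extension X' W"
      using symmetry_reduction integrable_extension nu by blast
  qed
qed

text \<open>Induction on the depth, starting from 3: one step is split off at the top and the tower
  of its quotient is extended. As the steps are stated for all \<open>W\<close>, the top level can
  later be replaced by the given manifold.\<close>

lemma tower:
  fixes Z :: "'a::euclidean_space cr"
  assumes "\<nu> \<ge> 3" "standard_model gr br J Z" "gnla_depth gr \<nu>"
  shows "\<exists>T :: nat \<Rightarrow> 'a cr. T \<nu> = Z \<and>
    (\<forall>i\<in>{3..\<nu>}. \<exists>(gr :: nat \<Rightarrow> 'a set) br J. standard_model gr br J (T i) \<and> gnla_depth gr i) \<and>
    (\<forall>i\<in>{3..<\<nu>}. \<forall>W :: 'a cr. cr_manifold W \<and> has_depth W (Suc i) \<and> locally_cr_equivalent W (T (Suc i)) \<longrightarrow>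
      symmetry_reduction W (T i) \<and> integrable_extension (T i) W)"
  using assms
proof (induction \<nu> arbitrary: gr br J Z rule: dec_induct)
  case base
  then have "\<exists>(gr :: nat \<Rightarrow> 'a set) br J. standard_model gr br J Z \<and> gnla_depth gr 3" by blast
  then show ?case by (intro exI[of _ "\<lambda>_. Z"]) simp
next
  case (step n)
  obtain mul where "std_model gr br (Suc n) mul J Z"
    using standard_modelE[OF step.prems] .
  then interpret std_model gr br "Suc n" mul J Z .
  obtain gr' :: "nat \<Rightarrow> 'a set" and br' J' Y where Y: "standard_model gr' br' J' Y" "gnla_depth gr' n"
    and red: "\<forall>W :: 'a cr. cr_manifold W \<and> has_depth W (Suc n) \<and> locally_cr_equivalent W Z \<longrightarrow>
      symmetry_reduction W Y \<and> integrable_extension Y W"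
    by (rule tower_step[OF refl]) (use step.hyps in auto)
  from step.IH[OF Y] obtain T :: "nat \<Rightarrow> 'a cr" where T: "T n = Y"
    "\<forall>i\<in>{3..n}. \<exists>(gr :: nat \<Rightarrow> 'a set) br J. standard_model gr br J (T i) \<and> gnla_depth gr i"
    "\<forall>i\<in>{3..<n}. \<forall>W :: 'a cr. cr_manifold W \<and> has_depth W (Suc i) \<and> locally_cr_equivalent W (T (Suc i)) \<longrightarrow>
      symmetry_reduction W (T i) \<and> integrable_extension (T i) W" by (elim exE conjE)
  have top: "\<exists>(gr :: nat \<Rightarrow> 'a set) br J. standard_model gr br J Z \<and> gnla_depth gr (Suc n)"
    using step.prems by blast
  show ?case
  proof (intro exI[of _ "T(Suc n := Z)"] conjI ballI)
    show "(T(Suc n := Z)) (Suc n) = Z" by simp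
    show "\<exists>(gr :: nat \<Rightarrow> 'a set) br J. standard_model gr br J ((T(Suc n := Z)) i) \<and> gnla_depth gr i"
      if "i \<in> {3..Suc n}" for i
      using T(2) top that by (cases "i = Suc n") auto
    show "\<forall>W :: 'a cr. cr_manifold W \<and> has_depth W (Suc i) \<and> locally_cr_equivalent W ((T(Suc n := Z)) (Suc i)) \<longrightarrow>
      symmetry_reduction W ((T(Suc n := Z)) i) \<and> integrable_extension ((T(Suc n := Z)) i) W"
      if i: "i \<in> {3..<Suc n}" for i
    proof (cases "i = n")
      case True
      then show ?thesis using red T(1) by simp
    next
      case False
      then have "i \<in> {3..<n}" "Suc i \<noteq> Suc n" "i \<noteq> Suc n" using i by auto
      then show ?thesis using bspec[OF T(3)] by simp
    qed
  qed
qed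

text \<open>The algebra \<open>gr\<close> may be given in any Euclidean space. A local equivalence
  has an injective differential on the tangent space, which for a subspace is
  \<open>points X\<close> itself; this bounds its dimension by that of the space containing
  \<open>W\<close>.\<close>

lemma dim_le_of_cr_equivalence:
  fixes W :: "'b::euclidean_space cr"
  assumes "cr_regular W" "cr_regular X" "subspace (points X)" "x \<in> points X" "cr_equivalence_at W X p x"
  shows "dim (points X) \<le> DIM('b)"
proof -
  obtain U V f g where i: "cr_iso W X U V f g" "p \<in> U" "f p = x"
    using cr_equivalence_atE[OF assms(5,1,2)] .
  interpret s: cr_iso X W V U g f by (rule cr_iso.cr_sym[OF i(1)])
  have x: "x \<in> V" using i s.image s.inv cr_iso.cr_sym[OF i(1)] s.sym local_diffeo.fV by blast
  have T: "tangent_space (points X) x = points X" by (rule tangent_space_subspace[OF assms(3,4)])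
  have "inj_on (differential (points X) g x) (span (points X))"
    using s.df_inj[OF x] T assms(3) by (metis span_eq_iff)
  from dim_image_eq[OF s.linear_df[OF x] this] show ?thesis
    using dim_subset_UNIV[of "differential (points X) g x ` points X"] by simp
qed

text \<open>The symbol of \<open>Z\<close> is reused for \<open>W\<close>; as
  \<open>has_depth\<close> looks for it inside the ambient space, both manifolds have the same
  type.\<close>

lemma has_depth_transport:
  fixes W Z :: "'b::euclidean_space cr"
  assumes "cr_regular W" "cr_regular Z" "locally_cr_equivalent W Z" "has_depth Z k"
  shows "has_depth W k"
  unfolding has_depth_def
proof
  fix p assume "p \<in> points W"
  then obtain q where q: "q \<in> points Z" "cr_equivalence_at W Z p q"
    using locally_cr_equivalentD(1)[OF assms(3)] by blast
  obtain gr :: "nat \<Rightarrow> 'b set" and br where s: "is_symbol Z q gr br" "gnla_depth gr k"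
    using bspec[OF assms(4)[unfolded has_depth_def] q(1)] by (elim exE conjE)
  obtain U V f g where i: "cr_iso Z W U V f g" "q \<in> U" "f q = p"
    using cr_equivalence_atE[OF cr_equivalence_at_sym[OF assms(1,2) q(2)] assms(2,1)] .
  have "is_symbol W p gr br" using cr_iso.is_symbol_transport[OF i(1,2) s(1)] i(3) by simp
  then show "\<exists>(gr :: nat \<Rightarrow> 'b set) br. is_symbol W p gr br \<and> gnla_depth gr k" using s(2) by blast
qed

lemma has_reduced_growth_transport:
  assumes "cr_regular W" "cr_regular Z" "locally_cr_equivalent W Z" "has_reduced_growth Z rs"
  shows "has_reduced_growth W rs"
  unfolding has_reduced_growth_def
proof (intro ballI allI)
  fix p k assume "p \<in> points W"
  then obtain q where q: "q \<in> points Z" "cr_equivalence_at W Z p q"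
    using locally_cr_equivalentD(1)[OF assms(3)] by blast
  obtain U V f g where i: "cr_iso W Z U V f g" "p \<in> U" "f p = q"
    using cr_equivalence_atE[OF q(2) assms(1,2)] .
  have "dim (weak_flag W k p) = dim (weak_flag Z k q)" for k
    using cr_iso.dim_weak_flag[OF i(1,2), of k] i(3) by simp
  then show "dim (weak_flag W (Suc k) p) - dim (weak_flag W k p) = (if k < length rs then rs ! k else 0)"
    using assms(4) q(1) by (simp add: has_reduced_growth_def)
qed

lemma engel_depth: "gnla_depth engel_grading 3"
proof -
  have "axis 4 1 \<noteq> (0 :: real ^ 4)" by (simp add: axis_eq_0_iff)
  moreover have "axis 4 1 \<in> span {axis 4 1 :: real ^ 4}" by (rule span_base) simp
  ultimately have "span {axis 4 1 :: real ^ 4} \<noteq> {0}" by (metis singletonD)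
  then show ?thesis by (simp add: gnla_depth_def engel_grading_def)
qed

lemma hilbert_cartan_depth: "gnla_depth hilbert_cartan_grading 3"
proof -
  have "axis 4 1 \<noteq> (0 :: real ^ 5)" by (simp add: axis_eq_0_iff)
  moreover have "axis 4 1 \<in> span {axis 4 1, axis 5 1 :: real ^ 5}" by (rule span_base) simp
  ultimately have "span {axis 4 1, axis 5 1 :: real ^ 5} \<noteq> {0}" by (metis singletonD)
  then show ?thesis by (simp add: gnla_depth_def hilbert_cartan_grading_def)
qed

lemma standard_model_regular:
  assumes "standard_model gr br J X" "gnla_depth gr k" shows "cr_regular X"
proof -
  obtain mul where "std_model gr br k mul J X" using standard_modelE[OF assms] .
  then show ?thesis by (rule std_model.regular)
qed

lemma engel_regular: "engel_cr E \<Longrightarrow> cr_regular E"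
  unfolding engel_cr_def using standard_model_regular engel_depth by blast

lemma hilbert_cartan_regular: "hilbert_cartan_cr H \<Longrightarrow> cr_regular H"
  unfolding hilbert_cartan_cr_def using standard_model_regular hilbert_cartan_depth by blast

text \<open>The dichotomy holds for the model and passes to \<open>W\<close> by transitivity of
  local equivalence, for which the Engel and Hilbert-Cartan models have to be regular.\<close>

lemma depth_three_transport:
  fixes W Z :: "'b::euclidean_space cr"
  assumes W: "cr_regular W" "locally_cr_equivalent W Z" and Z: "standard_model gr br J Z" "gnla_depth gr 3"
  shows "((\<exists>E. engel_cr E \<and> locally_cr_equivalent W E) \<and> has_reduced_growth W [2, 1, 1]) \<or>
    ((\<exists>H. hilbert_cartan_cr H \<and> locally_cr_equivalent W H) \<and> has_reduced_growth W [2, 1, 2])"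
proof -
  obtain mul where "std_model gr br 3 mul J Z" using standard_modelE[OF Z] .
  then interpret std_model gr br 3 mul J Z .
  note G = has_reduced_growth_transport[OF W(1) regular W(2)]
  note tr = locally_cr_equivalent_trans[OF W(1) regular _ W(2)]
  from depth_three[OF refl] show ?thesis
  proof (elim disjE conjE exE)
    fix E assume E: "engel_cr E" "locally_cr_equivalent Z E" and g: "has_reduced_growth Z [2, 1, 1]"
    from tr[OF engel_regular[OF E(1)] E(2)] E(1) G[OF g] show ?thesis by blast
  next
    fix H assume H: "hilbert_cartan_cr H" "locally_cr_equivalent Z H" and g: "has_reduced_growth Z [2, 1, 2]"
    from tr[OF hilbert_cartan_regular[OF H(1)] H(2)] H(1) G[OF g] show ?thesis by blast
  qed
qed

theorem theorem3:
  fixes M :: "(complex ^ 'n) set"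
    and gr :: "nat \<Rightarrow> 'a::euclidean_space set" and br :: "'a \<Rightarrow> 'a \<Rightarrow> 'a" and J :: "'a \<Rightarrow> 'a"
    and m n \<nu> :: nat
  assumes "n = CARD('n)" and "m = n + 1"
    and "embedded_submanifold m M"
    and "cr_manifold (induced_cr M)"
    and "bracket_generating (induced_cr M)"
    and "homogeneous_cr_model M gr br J"
    and "\<forall>x\<in>M. is_symbol (induced_cr M) x gr br"
    and "gnla_depth gr \<nu>" and "\<nu> \<ge> 3"
  shows "(\<exists>X :: nat \<Rightarrow> (complex ^ 'n) cr.
        X \<nu> = induced_cr M \<and>
        (\<forall>i\<in>{3..\<nu>}. cr_manifold (X i) \<and> bracket_generating (X i) \<and> has_depth (X i) i) \<and>
        (\<forall>i\<in>{3..<\<nu>}. symmetry_reduction (X (Suc i)) (X i)) \<and>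
        (((\<exists>E. engel_cr E \<and> locally_cr_equivalent (X 3) E) \<and> has_reduced_growth (X 3) [2, 1, 1]) \<or>
         ((\<exists>H. hilbert_cartan_cr H \<and> locally_cr_equivalent (X 3) H) \<and>
            has_reduced_growth (X 3) [2, 1, 2])) \<and>
        (\<forall>i\<in>{3..<\<nu>}. integrable_extension (X i) (X (Suc i)))) \<and>
      (\<forall>E. engel_cr E \<longrightarrow>
         symmetry_reduction E cr_quadric \<and> integrable_extension cr_quadric E) \<and>
      (\<forall>H. hilbert_cartan_cr H \<longrightarrow>
         symmetry_reduction H cr_quadric \<and> integrable_extension cr_quadric H)"
proof (intro conjI allI impI)
  let ?M = "induced_cr M"
  obtain N where N: "standard_model gr br J N" "locally_cr_equivalent ?M N"
    using assms(6) unfolding homogeneous_cr_model_def by (elim conjE exE)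
  obtain mul where "std_model gr br \<nu> mul J N" using standard_modelE[OF N(1) assms(8)] .
  then interpret std_model gr br \<nu> mul J N .
  \<comment> \<open>Involutivity of the tangent spaces of \<open>M\<close> is inherited from the
    model through the local equivalence.\<close>
  have regM: "cr_regular ?M"
    by (rule cr_regularI[OF assms(4) tangent_closed_locally_cr_equivalent[OF cr_regular_closed[OF regular] N(2)]])
  have "0 \<in> points N" using V_closed(1) points_X by simp
  then obtain p where "cr_equivalence_at ?M N p 0" using locally_cr_equivalentD(2)[OF N(2)] by blast
  from dim_le_of_cr_equivalence[OF regM regular _ \<open>0 \<in> points N\<close> this] subV
  have "dim V \<le> DIM(complex ^ 'n)" by (simp add: points_X)
  then have "\<exists>(\<phi> :: 'a \<Rightarrow> complex ^ 'n) \<psi>. truncation gr br \<nu> mul J N \<phi> \<psi> \<nu>"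
    by (rule embedding_exists)
  then obtain \<phi> :: "'a \<Rightarrow> complex ^ 'n" and \<psi> where tr: "truncation gr br \<nu> mul J N \<phi> \<psi> \<nu>" by blast
  \<comment> \<open>The given model lives in the space of \<open>gr\<close>; its copy
    \<open>X'\<close> lives in \<open>complex ^ 'n\<close> like \<open>M\<close>, so that all levels
    of the tower have one type.\<close>
  interpret truncation gr br \<nu> mul J N \<phi> \<psi> \<nu> by (rule tr)
  have "locally_cr_equivalent N X'"
    by (rule cr_iso.locally_cr_equivalent[OF iso[OF refl]]) (simp_all add: points_X t.points_X)
  then have MZ: "locally_cr_equivalent ?M X'"
    by (rule locally_cr_equivalent_trans[OF regM regular t.regular N(2)])
  have depthM: "has_depth ?M \<nu>" by (rule has_depth_transport[OF regM t.regular MZ t.has_depth])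
  obtain T :: "nat \<Rightarrow> (complex ^ 'n) cr" where T: "T \<nu> = X'"
    "\<forall>i\<in>{3..\<nu>}. \<exists>(gr :: nat \<Rightarrow> (complex ^ 'n) set) br J. standard_model gr br J (T i) \<and> gnla_depth gr i"
    "\<forall>i\<in>{3..<\<nu>}. \<forall>W :: (complex ^ 'n) cr. cr_manifold W \<and> has_depth W (Suc i) \<and>
      locally_cr_equivalent W (T (Suc i)) \<longrightarrow> symmetry_reduction W (T i) \<and> integrable_extension (T i) W"
    using tower[OF assms(9) t.standard_model t.depth] by (elim exE conjE)
  \<comment> \<open>The top level is \<open>M\<close> itself, as the claim demands equality there;
    all lower levels are standard models.\<close>
  define X where "X = T(\<nu> := ?M)"
  have model: "cr_manifold (T i) \<and> bracket_generating (T i) \<and> has_depth (T i) i \<and> cr_regular (T i)"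
    if i: "i \<in> {3..\<nu>}" for i
  proof -
    obtain gr0 :: "nat \<Rightarrow> (complex ^ 'n) set" and br0 J0 where s: "standard_model gr0 br0 J0 (T i)" "gnla_depth gr0 i"
      using bspec[OF T(2) i] by (elim exE conjE)
    obtain mul0 where "std_model gr0 br0 i mul0 J0 (T i)" using standard_modelE[OF s] .
    then interpret s: std_model gr0 br0 i mul0 J0 "T i" .
    show ?thesis using s.cr_manifold s.bracket_generating s.has_depth s.regular by blast
  qed
  have X: "cr_manifold (X i) \<and> bracket_generating (X i) \<and> has_depth (X i) i \<and> cr_regular (X i) \<and>
      locally_cr_equivalent (X i) (T i)" if i: "i \<in> {3..\<nu>}" for i
  proof (cases "i = \<nu>")
    case True
    then show ?thesis using assms(4,5) depthM regM MZ T(1) by (simp add: X_def)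
  next
    case False
    then show ?thesis using model[OF i] locally_cr_equivalent_refl[of "T i"] by (simp add: X_def)
  qed
  have red: "symmetry_reduction (X (Suc i)) (X i) \<and> integrable_extension (X i) (X (Suc i))"
    if i: "i \<in> {3..<\<nu>}" for i
  proof -
    have "Suc i \<in> {3..\<nu>}" "X i = T i" using i by (auto simp: X_def)
    with bspec[OF T(3) i] X[of "Suc i"] show ?thesis by simp
  qed
  have three: "3 \<in> {3..\<nu>}" using assms(9) by simp
  obtain gr3 :: "nat \<Rightarrow> (complex ^ 'n) set" and br3 J3 where s3: "standard_model gr3 br3 J3 (T 3)" "gnla_depth gr3 3"
    using bspec[OF T(2) three] by (elim exE conjE)
  have X3: "cr_regular (X 3)" "locally_cr_equivalent (X 3) (T 3)" using X[OF three] by auto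
  show "\<exists>X :: nat \<Rightarrow> (complex ^ 'n) cr.
        X \<nu> = induced_cr M \<and>
        (\<forall>i\<in>{3..\<nu>}. cr_manifold (X i) \<and> bracket_generating (X i) \<and> has_depth (X i) i) \<and>
        (\<forall>i\<in>{3..<\<nu>}. symmetry_reduction (X (Suc i)) (X i)) \<and>
        (((\<exists>E. engel_cr E \<and> locally_cr_equivalent (X 3) E) \<and> has_reduced_growth (X 3) [2, 1, 1]) \<or>
         ((\<exists>H. hilbert_cartan_cr H \<and> locally_cr_equivalent (X 3) H) \<and>
            has_reduced_growth (X 3) [2, 1, 2])) \<and>
        (\<forall>i\<in>{3..<\<nu>}. integrable_extension (X i) (X (Suc i)))"
  proof (intro exI[of _ X] conjI)
    show "X \<nu> = induced_cr M" by (simp add: X_def)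
    show "\<forall>i\<in>{3..\<nu>}. cr_manifold (X i) \<and> bracket_generating (X i) \<and> has_depth (X i) i" using X by blast
    show "\<forall>i\<in>{3..<\<nu>}. symmetry_reduction (X (Suc i)) (X i)"
      "\<forall>i\<in>{3..<\<nu>}. integrable_extension (X i) (X (Suc i))" using red by blast+
  qed (rule depth_three_transport[OF X3 s3])
next
  fix E assume "engel_cr E"
  then obtain J' where "standard_model engel_grading engel_bracket J' E" unfolding engel_cr_def by blast
  from standard_modelE[OF this engel_depth] obtain mul where
    "std_model engel_grading engel_bracket 3 mul J' E" .
  from std_model.reduction_to_quadric[OF this refl]
  show "symmetry_reduction E cr_quadric" "integrable_extension cr_quadric E" by auto
next
  fix H assume "hilbert_cartan_cr H"
  then obtain J' where "standard_model hilbert_cartan_grading hilbert_cartan_bracket J' H"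
    unfolding hilbert_cartan_cr_def by blast
  from standard_modelE[OF this hilbert_cartan_depth] obtain mul where
    "std_model hilbert_cartan_grading hilbert_cartan_bracket 3 mul J' H" .
  from std_model.reduction_to_quadric[OF this refl]
  show "symmetry_reduction H cr_quadric" "integrable_extension cr_quadric H" by auto
qed

end
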